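(* Let $\mathbb{K}$ be an algebraically closed field of characteristic zero, and let $X$ be a normal variety over $\mathbb{K}$ with finitely generated Cox ring $\mathcal{R}(X)$. Then, for any finitely generated subgroup $K \subseteq \mathrm{WDiv}(X)$ of the group of Weil divisors of $X$ and any open subset $U \subseteq X$, the algebra of sections $\Gamma(U,\mathcal{S})$ of the sheaf of divisorial algebras $\mathcal{S} = \bigoplus_{D\in K}\mathcal{O}_X(D)$ associated to $K$ is a finitely generated $\mathbb{K}$-algebra.
   Context: Conventions: $\mathbb{K}$ is an algebraically closed field of characteristic zero; varieties are irreducible varieties over $\mathbb{K}$. Sheaf of divisorial algebras: for a finitely generated subgroup $K\subseteq \mathrm{WDiv}(X)$, the associated sheaf of divisorial algebras is the sheaf of $K$-graded $\mathcal{O}_X$-algebras $\mathcal{S} := \bigoplus_{D\in K}\mathcal{S}_D$, $\mathcal{S}_D := \mathcal{O}_X(D)$, where for open $W \subseteq X$ the sections $\Gamma(W,\mathcal{O}_X(D))$ are $0$ and the nonzero rational functions $f$ with $(\mathrm{div}(f)+D)|_W \ge 0$, and multiplication of homogeneous sections is multiplication in $\mathbb{K}(X)$. Cox ring: let $X$ be a normal variety with finitely generated divisor class group $\mathrm{Cl}(X)$ and only constant invertible global functions, $\Gamma(X,\mathcal{O})^*=\mathbb{K}^*$. Choose a finitely generated subgroup $L \subseteq \mathrm{WDiv}(X)$ such that the projection $c\colon L \to \mathrm{Cl}(X)$ is surjective, let $L^0 = \ker(c)$, and let $\mathcal{S}^L$ be the sheaf of divisorial algebras associated to $L$. Fix a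 homomorphism $\chi\colon L^0 \to \mathbb{K}(X)^*$ with $\mathrm{div}(\chi(E)) = E$ for all $E \in L^0$, and let $\mathcal{I}\subseteq\mathcal{S}^L$ be the sheaf of ideals locally generated by the sections $1-\chi(E)$, $E\in L^0$, where $\chi(E)$ is regarded as homogeneous of degree $-E$. The Cox sheaf is $\mathcal{R} := \mathcal{S}^L/\mathcal{I}$ with projection $p\colon\mathcal{S}^L\to\mathcal{R}$, graded by $\mathrm{Cl}(X)$ via $\mathcal{R}_{[D]} := p\big(\bigoplus_{D'\in c^{-1}([D])}\mathcal{S}^L_{D'}\big)$. The Cox ring is $\mathcal{R}(X) := \Gamma(X,\mathcal{R})$; up to isomorphism it does not depend on the choices of $L$ and $\chi$. A normal variety "has finitely generated Cox ring" if its divisor class group is finitely generated, its invertible global functions are constant (so that the Cox ring is defined), and its Cox ring is finitely generated as a $\mathbb{K}$-algebra. *)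

theory Defs
  imports
    "HOL-Analysis.Abstract_Topology"
    "HOL-Computational_Algebra.Polynomial"
    "HOL-Algebra.Algebra"
begin

section \<open>Varieties as spaces with functions\<close>

text \<open>
  Varieties over an algebraically closed field are modelled classically: a space of (closed) points
  carrying a sheaf of field-valued functions, locally isomorphic to affine algebraic sets.
  A section over an open set is a function that is \<^const>\<open>undefined\<close> outside that set, so that
  sections over a fixed open set really form a ring.
\<close>

record ('a, 'k) function_space =
  top_of :: "'a topology"
  regular :: "'a set \<Rightarrow> ('a \<Rightarrow> 'k) set"

abbreviation points :: "('a, 'k) function_space \<Rightarrow> 'a set"
  where "points \<V> \<equiv> topspace (top_of \<V>)"

definition open_subspace :: "('a, 'k) function_space \<Rightarrow> 'a set \<Rightarrow> ('a, 'k) function_space"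
  where "open_subspace \<V> U = \<lparr>top_of = subtopology (top_of \<V>) U, regular = regular \<V>\<rparr>"

definition morphism ::
    "('a, 'k) function_space \<Rightarrow> ('b, 'k) function_space \<Rightarrow> ('a \<Rightarrow> 'b) \<Rightarrow> bool"
  where "morphism \<V> Y h \<longleftrightarrow> continuous_map (top_of \<V>) (top_of Y) h \<and>
    (\<forall>W f. openin (top_of Y) W \<longrightarrow> f \<in> regular Y W \<longrightarrow>
       restrict (f \<circ> h) {x \<in> points \<V>. h x \<in> W} \<in> regular \<V> {x \<in> points \<V>. h x \<in> W})"

definition isomorphic :: "('a, 'k) function_space \<Rightarrow> ('b, 'k) function_space \<Rightarrow> bool"
  where "isomorphic \<V> Y \<longleftrightarrow> (\<exists>h g. morphism \<V> Y h \<and> morphism Y \<V> g \<and>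
    (\<forall>x \<in> points \<V>. g (h x) = x) \<and> (\<forall>y \<in> points Y. h (g y) = y))"

subsection \<open>Affine algebraic sets\<close>

text \<open>Polynomial functions in the coordinates \<open>x\<^sub>0, \<dots>, x\<^sub>n\<^sub>-\<^sub>1\<close>.\<close>

inductive_set poly_fun :: "nat \<Rightarrow> ((nat \<Rightarrow> 'k::comm_ring_1) \<Rightarrow> 'k) set" for n :: nat
  where
    const: "(\<lambda>_. c) \<in> poly_fun n"
  | var: "i < n \<Longrightarrow> (\<lambda>x. x i) \<in> poly_fun n"
  | add: "p \<in> poly_fun n \<Longrightarrow> q \<in> poly_fun n \<Longrightarrow> (\<lambda>x. p x + q x) \<in> poly_fun n"
  | mult: "p \<in> poly_fun n \<Longrightarrow> q \<in> poly_fun n \<Longrightarrow> (\<lambda>x. p x * q x) \<in> poly_fun n"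

definition algebraic_set :: "nat \<Rightarrow> (nat \<Rightarrow> 'k::field) set \<Rightarrow> bool"
  where "algebraic_set n V \<longleftrightarrow>
    (\<exists>S \<subseteq> poly_fun n. V = {x \<in> {..<n} \<rightarrow>\<^sub>E UNIV. \<forall>p \<in> S. p x = 0})"

definition zariski_topology :: "nat \<Rightarrow> (nat \<Rightarrow> 'k::field) set \<Rightarrow> (nat \<Rightarrow> 'k) topology"
  where "zariski_topology n V = topology_generated_by {{x \<in> V. p x \<noteq> 0} | p. p \<in> poly_fun n}"

definition affine_regular ::
    "nat \<Rightarrow> (nat \<Rightarrow> 'k::field) set \<Rightarrow> (nat \<Rightarrow> 'k) set \<Rightarrow> ((nat \<Rightarrow> 'k) \<Rightarrow> 'k) set"
  where "affine_regular n V U = {f \<in> extensional U. \<forall>x \<in> U. \<exists>W p q.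
    openin (zariski_topology n V) W \<and> x \<in> W \<and> W \<subseteq> U \<and> p \<in> poly_fun n \<and> q \<in> poly_fun n \<and>
    (\<forall>y \<in> W. q y \<noteq> 0 \<and> f y = p y / q y)}"

definition affine_model :: "nat \<Rightarrow> (nat \<Rightarrow> 'k::field) set \<Rightarrow> (nat \<Rightarrow> 'k, 'k) function_space"
  where "affine_model n V = \<lparr>top_of = zariski_topology n V, regular = affine_regular n V\<rparr>"

definition affine :: "('a, 'k::field) function_space \<Rightarrow> bool"
  where "affine \<V> \<longleftrightarrow> (\<exists>n V. algebraic_set n V \<and> isomorphic \<V> (affine_model n V))"

subsection \<open>Varieties\<close>

definition irreducible_in :: "'a topology \<Rightarrow> 'a set \<Rightarrow> bool"
  where "irreducible_in T S \<longleftrightarrow> S \<subseteq> topspace T \<and> S \<noteq> {} \<and>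
    (\<forall>A B. closedin T A \<longrightarrow> closedin T B \<longrightarrow> S \<subseteq> A \<union> B \<longrightarrow> S \<subseteq> A \<or> S \<subseteq> B)"

text \<open>
  The topology of the product \<open>\<V> \<times> \<V>\<close> in the category of prevarieties (finer than the product
  topology): it is generated by the non-vanishing loci of the functions
  \<open>(x, y) \<mapsto> \<Sum>\<^sub>i f\<^sub>i(x) g\<^sub>i(y)\<close>, with \<open>f\<^sub>i\<close> regular on \<open>U\<close> and \<open>g\<^sub>i\<close> regular on \<open>V\<close>.
\<close>

definition square_topology :: "('a, 'k::field) function_space \<Rightarrow> ('a \<times> 'a) topology"
  where "square_topology \<V> = topology_generated_by
    {{(x, y). x \<in> U \<and> y \<in> V \<and> (\<Sum>i<m. f i x * g i y) \<noteq> 0} | U V (m :: nat) f g.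
      openin (top_of \<V>) U \<and> openin (top_of \<V>) V \<and>
      (\<forall>i<m. f i \<in> regular \<V> U) \<and> (\<forall>i<m. g i \<in> regular \<V> V)}"

locale function_sheaf =
  fixes \<V> :: "('a, 'k::{alg_closed_field, field_char_0}) function_space"
  assumes regular_extensional: "openin (top_of \<V>) U \<Longrightarrow> f \<in> regular \<V> U \<Longrightarrow> f \<in> extensional U"
    and regular_const: "openin (top_of \<V>) U \<Longrightarrow> (\<lambda>x\<in>U. c) \<in> regular \<V> U"
    and regular_add: "openin (top_of \<V>) U \<Longrightarrow> f \<in> regular \<V> U \<Longrightarrow> g \<in> regular \<V> U \<Longrightarrow>
      (\<lambda>x\<in>U. f x + g x) \<in> regular \<V> U"
    and regular_mult: "openin (top_of \<V>) U \<Longrightarrow> f \<in> regular \<V> U \<Longrightarrow> g \<in> regular \<V> U \<Longrightarrow>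
      (\<lambda>x\<in>U. f x * g x) \<in> regular \<V> U"
    and regular_restrict: "openin (top_of \<V>) U \<Longrightarrow> openin (top_of \<V>) V \<Longrightarrow> V \<subseteq> U \<Longrightarrow>
      f \<in> regular \<V> U \<Longrightarrow> restrict f V \<in> regular \<V> V"
    and regular_glue: "openin (top_of \<V>) U \<Longrightarrow> f \<in> extensional U \<Longrightarrow>
      (\<And>x. x \<in> U \<Longrightarrow> \<exists>W. openin (top_of \<V>) W \<and> x \<in> W \<and> W \<subseteq> U \<and> restrict f W \<in> regular \<V> W) \<Longrightarrow>
      f \<in> regular \<V> U"

locale variety = function_sheaf +
  assumes irreducible_points: "irreducible_in (top_of \<V>) (points \<V>)"
    and finite_affine_cover: "\<exists>\<U>. finite \<U> \<and> \<Union>\<U> = points \<V> \<and>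
      (\<forall>U \<in> \<U>. openin (top_of \<V>) U \<and> affine (open_subspace \<V> U))"
    and separated: "closedin (square_topology \<V>) {(x, x) | x. x \<in> points \<V>}"

section \<open>Rational functions and divisors\<close>

text \<open>
  The class of a regular function \<open>f\<close> on a nonempty open set \<open>U\<close> under
  \<open>(U, f) \<sim> (V, g) \<longleftrightarrow> f = g\<close> on \<open>U \<inter> V\<close>; only the values of \<open>f\<close> on \<open>U\<close> matter.
\<close>

type_synonym ('a, 'k) rational = "('a set \<times> ('a \<Rightarrow> 'k)) set"

definition rational_class ::
    "('a, 'k) function_space \<Rightarrow> 'a set \<Rightarrow> ('a \<Rightarrow> 'k) \<Rightarrow> ('a, 'k) rational"
  where "rational_class \<V> U f =
    {(V, g). openin (top_of \<V>) V \<and> V \<noteq> {} \<and> g \<in> regular \<V> V \<and> (\<forall>x \<in> U \<inter> V. f x = g x)}"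

definition function_field :: "('a, 'k::field) function_space \<Rightarrow> ('a, 'k) rational ring"
  where "function_field \<V> =
    \<lparr>carrier = {rational_class \<V> U f | U f. openin (top_of \<V>) U \<and> U \<noteq> {} \<and> f \<in> regular \<V> U},
     monoid.mult = (\<lambda>A B. \<Union>(U, f) \<in> A. \<Union>(V, g) \<in> B. rational_class \<V> (U \<inter> V) (\<lambda>x. f x * g x)),
     monoid.one = rational_class \<V> (points \<V>) (\<lambda>_. 1),
     ring.zero = rational_class \<V> (points \<V>) (\<lambda>_. 0),
     ring.add = (\<lambda>A B. \<Union>(U, f) \<in> A. \<Union>(V, g) \<in> B. rational_class \<V> (U \<inter> V) (\<lambda>x. f x + g x))\<rparr>"

definition const_rational :: "('a, 'k::field) function_space \<Rightarrow> 'k \<Rightarrow> ('a, 'k) rational"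
  where "const_rational \<V> c = rational_class \<V> (points \<V>) (\<lambda>_. c)"

text \<open>
  The local ring of \<open>\<V>\<close> along an irreducible subset \<open>Y\<close>, as a subring of the function field: the
  rational functions that are regular on some open set meeting \<open>Y\<close>.  For \<open>Y = {x}\<close> this is the
  stalk of the structure sheaf at \<open>x\<close>.
\<close>

definition local_ring_at ::
    "('a, 'k::field) function_space \<Rightarrow> 'a set \<Rightarrow> ('a, 'k) rational ring"
  where "local_ring_at \<V> Y = (function_field \<V>)
    \<lparr>carrier := {\<phi> \<in> carrier (function_field \<V>). \<exists>(U, f) \<in> \<phi>. U \<inter> Y \<noteq> {}}\<rparr>"

definition integrally_closed_in :: "('r, 'm) ring_scheme \<Rightarrow> 'r set \<Rightarrow> bool"
  where "integrally_closed_in F A \<longleftrightarrow> (\<forall>\<phi> \<in> carrier F.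
    (\<exists>p. polynomial\<^bsub>F\<^esub> A p \<and> p \<noteq> [] \<and> lead_coeff p = \<one>\<^bsub>F\<^esub> \<and> ring.eval F p \<phi> = \<zero>\<^bsub>F\<^esub>) \<longrightarrow> \<phi> \<in> A)"

locale normal_variety = variety +
  assumes normal: "x \<in> points \<V> \<Longrightarrow>
    integrally_closed_in (function_field \<V>) (carrier (local_ring_at \<V> {x}))"

subsection \<open>Weil divisors and the divisor class group\<close>

text \<open>
  Prime divisors are the closed irreducible subsets of codimension one; as \<open>\<V>\<close> itself is
  irreducible, codimension one means: proper, with no closed irreducible set strictly in between.
\<close>

definition prime_divisors :: "('a, 'k) function_space \<Rightarrow> 'a set set"
  where "prime_divisors \<V> =
    {P. closedin (top_of \<V>) P \<and> irreducible_in (top_of \<V>) P \<and> P \<subset> points \<V> \<and>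
      \<not> (\<exists>Z. closedin (top_of \<V>) Z \<and> irreducible_in (top_of \<V>) Z \<and> P \<subset> Z \<and> Z \<subset> points \<V>)}"

type_synonym 'a divisor = "'a set \<Rightarrow>\<^sub>0 int"

definition WDiv :: "('a, 'k) function_space \<Rightarrow> 'a divisor monoid"
  where "WDiv \<V> = free_Abelian_group (prime_divisors \<V>)"

text \<open>
  Order of a nonzero rational function along a prime divisor \<open>P\<close> of a normal variety: the local ring
  along \<open>P\<close> is a discrete valuation ring, and every nonzero rational function is
  \<open>u t\<^sup>n\<close> with \<open>u\<close> a unit and \<open>t\<close> a generator of the maximal ideal (the set of non-units).
\<close>

definition ord_along :: "('a, 'k::field) function_space \<Rightarrow> 'a set \<Rightarrow> ('a, 'k) rational \<Rightarrow> int"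
  where "ord_along \<V> P \<phi> = (let F = function_field \<V>; A = local_ring_at \<V> P in
    THE n. \<exists>u t. u \<in> Units A \<and> t \<in> carrier A \<and> PIdl\<^bsub>A\<^esub> t = carrier A - Units A \<and>
      \<phi> = u \<otimes>\<^bsub>F\<^esub> (t [^]\<^bsub>F\<^esub> (n :: int)))"

definition div_of :: "('a, 'k::field) function_space \<Rightarrow> ('a, 'k) rational \<Rightarrow> 'a set \<Rightarrow> int"
  where "div_of \<V> \<phi> P = (if P \<in> prime_divisors \<V> then ord_along \<V> P \<phi> else 0)"

definition PDiv :: "('a, 'k::field) function_space \<Rightarrow> 'a divisor set"
  where "PDiv \<V> = {E \<in> carrier (WDiv \<V>). \<exists>\<phi> \<in> carrier (function_field \<V>) - {\<zero>\<^bsub>function_field \<V>\<^esub>}.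
    div_of \<V> \<phi> = Poly_Mapping.lookup E}"

definition Cl :: "('a, 'k::field) function_space \<Rightarrow> 'a divisor set monoid"
  where "Cl \<V> = WDiv \<V> Mod PDiv \<V>"

definition divisor_class :: "('a, 'k::field) function_space \<Rightarrow> 'a divisor \<Rightarrow> 'a divisor set"
  where "divisor_class \<V> E = PDiv \<V> #>\<^bsub>WDiv \<V>\<^esub> E"

definition fin_gen_subgroup :: "('g, 'm) monoid_scheme \<Rightarrow> 'g set \<Rightarrow> bool"
  where "fin_gen_subgroup G H \<longleftrightarrow> (\<exists>A. finite A \<and> A \<subseteq> carrier G \<and> H = generate G A)"

section \<open>Sheaves of divisorial algebras\<close>

text \<open>
  Sections of \<open>O\<^sub>\<V>(D)\<close> over an open set; a sheaf has only the zero section over the empty set.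
\<close>

definition divisor_sections ::
    "('a, 'k::field) function_space \<Rightarrow> 'a divisor \<Rightarrow> 'a set \<Rightarrow> ('a, 'k) rational set"
  where "divisor_sections \<V> D W = insert \<zero>\<^bsub>function_field \<V>\<^esub>
    {\<phi> \<in> carrier (function_field \<V>) - {\<zero>\<^bsub>function_field \<V>\<^esub>}. W \<noteq> {} \<and>
      (\<forall>P \<in> prime_divisors \<V>. P \<inter> W \<noteq> {} \<longrightarrow> div_of \<V> \<phi> P + Poly_Mapping.lookup D P \<ge> 0)}"

definition homogeneous ::
    "('a, 'k::field) function_space \<Rightarrow> 'a divisor set \<Rightarrow> 'a divisor \<Rightarrow> ('a, 'k) rational \<Rightarrow>
      ('a divisor \<Rightarrow> ('a, 'k) rational)"
  where "homogeneous \<V> K D \<phi> = (\<lambda>E\<in>K. if E = D then \<phi> else \<zero>\<^bsub>function_field \<V>\<^esub>)"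

text \<open>
  The ring \<open>\<Gamma>(U, S) = \<Oplus>\<^bsub>D \<in> K\<^esub> \<Gamma>(U, O\<^sub>\<V>(D))\<close> (sections commute with the direct sum because \<open>\<V>\<close> is
  noetherian).  An element is the family of its homogeneous components; it is the zero ring if \<open>U\<close>
  is empty, whence the distinction in the unit element.
\<close>

definition divisorial_algebra ::
    "('a, 'k::field) function_space \<Rightarrow> 'a divisor set \<Rightarrow> 'a set \<Rightarrow>
      ('a divisor \<Rightarrow> ('a, 'k) rational) ring"
  where "divisorial_algebra \<V> K U = (let F = function_field \<V> in
    \<lparr>carrier = {s \<in> \<Pi>\<^sub>E D\<in>K. divisor_sections \<V> D U. finite {D \<in> K. s D \<noteq> \<zero>\<^bsub>F\<^esub>}},
     monoid.mult = (\<lambda>s t. \<lambda>D\<in>K. \<Oplus>\<^bsub>F\<^esub>E\<in>{E \<in> K. s E \<noteq> \<zero>\<^bsub>F\<^esub>}. s E \<otimes>\<^bsub>F\<^esub> t (D - E)),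
     monoid.one = homogeneous \<V> K 0 (if U = {} then \<zero>\<^bsub>F\<^esub> else \<one>\<^bsub>F\<^esub>),
     ring.zero = homogeneous \<V> K 0 \<zero>\<^bsub>F\<^esub>,
     ring.add = (\<lambda>s t. \<lambda>D\<in>K. s D \<oplus>\<^bsub>F\<^esub> t D)\<rparr>)"

definition divisorial_const ::
    "('a, 'k::field) function_space \<Rightarrow> 'a divisor set \<Rightarrow> 'a set \<Rightarrow> 'k \<Rightarrow>
      ('a divisor \<Rightarrow> ('a, 'k) rational)"
  where "divisorial_const \<V> K U c =
    homogeneous \<V> K 0 (if U = {} then \<zero>\<^bsub>function_field \<V>\<^esub> else const_rational \<V> c)"

text \<open>All restriction maps between nonempty open sets are inclusions, so stalks are unions.\<close>

definition divisorial_stalk ::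
    "('a, 'k::field) function_space \<Rightarrow> 'a divisor set \<Rightarrow> 'a \<Rightarrow>
      ('a divisor \<Rightarrow> ('a, 'k) rational) ring"
  where "divisorial_stalk \<V> K x = (divisorial_algebra \<V> K (points \<V>))
    \<lparr>carrier := \<Union>{carrier (divisorial_algebra \<V> K W) | W. openin (top_of \<V>) W \<and> x \<in> W}\<rparr>"

text \<open>The structure map \<open>\<iota>\<close> makes the ring \<open>R\<close> an algebra over the field \<open>'k\<close>.\<close>

definition fin_gen_algebra :: "('r, 'm) ring_scheme \<Rightarrow> ('k \<Rightarrow> 'r) \<Rightarrow> bool"
  where "fin_gen_algebra R \<iota> \<longleftrightarrow>
    (\<exists>A. finite A \<and> A \<subseteq> carrier R \<and> generate_ring R (range \<iota> \<union> A) = carrier R)"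

section \<open>Cox sheaf and Cox ring\<close>

text \<open>The kernel \<open>L\<^sup>0\<close> of the projection from \<open>L\<close> to the class group.\<close>

definition principal_part :: "('a, 'k::field) function_space \<Rightarrow> 'a divisor set \<Rightarrow> 'a divisor set"
  where "principal_part \<V> L = kernel ((WDiv \<V>)\<lparr>carrier := L\<rparr>) (Cl \<V>) (divisor_class \<V>)"

definition cox_data ::
    "('a, 'k::field) function_space \<Rightarrow> 'a divisor set \<Rightarrow> ('a divisor \<Rightarrow> ('a, 'k) rational) \<Rightarrow> bool"
  where "cox_data \<V> L \<chi> \<longleftrightarrow>
    subgroup L (WDiv \<V>) \<and> fin_gen_subgroup (WDiv \<V>) L \<and>
    divisor_class \<V> ` L = carrier (Cl \<V>) \<and>
    \<chi> \<in> hom ((WDiv \<V>)\<lparr>carrier := principal_part \<V> L\<rparr>) (units_of (function_field \<V>)) \<and>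
    (\<forall>E \<in> principal_part \<V> L. div_of \<V> (\<chi> E) = Poly_Mapping.lookup E)"

definition cox_ideal_stalk ::
    "('a, 'k::field) function_space \<Rightarrow> 'a divisor set \<Rightarrow> ('a divisor \<Rightarrow> ('a, 'k) rational) \<Rightarrow>
      'a \<Rightarrow> ('a divisor \<Rightarrow> ('a, 'k) rational) set"
  where "cox_ideal_stalk \<V> L \<chi> x = (let S = divisorial_stalk \<V> L x in
    Idl\<^bsub>S\<^esub> {\<one>\<^bsub>S\<^esub> \<ominus>\<^bsub>S\<^esub> homogeneous \<V> L (- E) (\<chi> E) | E. E \<in> principal_part \<V> L})"

definition cox_stalk ::
    "('a, 'k::field) function_space \<Rightarrow> 'a divisor set \<Rightarrow> ('a divisor \<Rightarrow> ('a, 'k) rational) \<Rightarrow>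
      'a \<Rightarrow> ('a divisor \<Rightarrow> ('a, 'k) rational) set ring"
  where "cox_stalk \<V> L \<chi> x = divisorial_stalk \<V> L x Quot cox_ideal_stalk \<V> L \<chi> x"

text \<open>The germ at \<open>x\<close> of the image in the Cox sheaf of a section \<open>s\<close> of the divisorial algebra.\<close>

definition cox_germ ::
    "('a, 'k::field) function_space \<Rightarrow> 'a divisor set \<Rightarrow> ('a divisor \<Rightarrow> ('a, 'k) rational) \<Rightarrow>
      ('a divisor \<Rightarrow> ('a, 'k) rational) \<Rightarrow> 'a \<Rightarrow> ('a divisor \<Rightarrow> ('a, 'k) rational) set"
  where "cox_germ \<V> L \<chi> s x = cox_ideal_stalk \<V> L \<chi> x +>\<^bsub>divisorial_stalk \<V> L x\<^esub> s"

text \<open>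
  Sections over \<open>U\<close> of the quotient sheaf \<open>S\<^sup>L/I\<close>: families of germs in the quotient stalks that are
  locally induced by sections of \<open>S\<^sup>L\<close> (sheafification of the presheaf quotient).
\<close>

definition cox_sections ::
    "('a, 'k::field) function_space \<Rightarrow> 'a divisor set \<Rightarrow> ('a divisor \<Rightarrow> ('a, 'k) rational) \<Rightarrow>
      'a set \<Rightarrow> ('a \<Rightarrow> ('a divisor \<Rightarrow> ('a, 'k) rational) set) ring"
  where "cox_sections \<V> L \<chi> U =
    \<lparr>carrier = {\<sigma> \<in> \<Pi>\<^sub>E x\<in>U. carrier (cox_stalk \<V> L \<chi> x).
       \<forall>x \<in> U. \<exists>W s. openin (top_of \<V>) W \<and> x \<in> W \<and> W \<subseteq> U \<and>
         s \<in> carrier (divisorial_algebra \<V> L W) \<and> (\<forall>y \<in> W. \<sigma> y = cox_germ \<V> L \<chi> s y)},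
     monoid.mult = (\<lambda>\<sigma> \<tau>. \<lambda>x\<in>U. \<sigma> x \<otimes>\<^bsub>cox_stalk \<V> L \<chi> x\<^esub> \<tau> x),
     monoid.one = (\<lambda>x\<in>U. \<one>\<^bsub>cox_stalk \<V> L \<chi> x\<^esub>),
     ring.zero = (\<lambda>x\<in>U. \<zero>\<^bsub>cox_stalk \<V> L \<chi> x\<^esub>),
     ring.add = (\<lambda>\<sigma> \<tau>. \<lambda>x\<in>U. \<sigma> x \<oplus>\<^bsub>cox_stalk \<V> L \<chi> x\<^esub> \<tau> x)\<rparr>"

definition cox_ring ::
    "('a, 'k::field) function_space \<Rightarrow> 'a divisor set \<Rightarrow> ('a divisor \<Rightarrow> ('a, 'k) rational) \<Rightarrow>
      ('a \<Rightarrow> ('a divisor \<Rightarrow> ('a, 'k) rational) set) ring"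
  where "cox_ring \<V> L \<chi> = cox_sections \<V> L \<chi> (points \<V>)"

definition cox_const ::
    "('a, 'k::field) function_space \<Rightarrow> 'a divisor set \<Rightarrow> ('a divisor \<Rightarrow> ('a, 'k) rational) \<Rightarrow>
      'k \<Rightarrow> ('a \<Rightarrow> ('a divisor \<Rightarrow> ('a, 'k) rational) set)"
  where "cox_const \<V> L \<chi> c =
    (\<lambda>x\<in>points \<V>. cox_germ \<V> L \<chi> (divisorial_const \<V> L (points \<V>) c) x)"

definition only_constant_units :: "('a, 'k::field) function_space \<Rightarrow> bool"
  where "only_constant_units \<V> \<longleftrightarrow>
    (\<forall>f \<in> regular \<V> (points \<V>). (\<exists>g \<in> regular \<V> (points \<V>). \<forall>x \<in> points \<V>. f x * g x = 1) \<longrightarrow>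
      (\<exists>c. \<forall>x \<in> points \<V>. f x = c))"

text \<open>
  The Cox ring is independent of \<open>L\<close> and \<open>\<chi>\<close> up to isomorphism of algebras, so it is harmless to
  ask for finite generation for some admissible choice.
\<close>

definition has_fin_gen_cox_ring :: "('a, 'k::field) function_space \<Rightarrow> bool"
  where "has_fin_gen_cox_ring \<V> \<longleftrightarrow>
    fin_gen_subgroup (Cl \<V>) (carrier (Cl \<V>)) \<and> only_constant_units \<V> \<and>
    (\<exists>L \<chi>. cox_data \<V> L \<chi> \<and> fin_gen_algebra (cox_ring \<V> L \<chi>) (cox_const \<V> L \<chi>))"

end

theory Submission
  imports Defs "HOL-Library.Function_Algebras" "HOL-Library.Multiset"
begin

text \<open>
  Components of generators of the Cox ring, lifted to the divisorial algebra of \<open>L\<close>, are finitely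
  many homogeneous global sections whose monomials, up to factors \<open>\<chi> E\<close>, span \<open>\<Gamma>(X, O(D))\<close> for
  every \<open>D \<in> L\<close>. Any divisor is linearly equivalent to one in \<open>L\<close>, so generators of \<open>K\<close> and the
  finitely many prime divisors outside \<open>U\<close> yield finitely many rational functions, invertible on
  \<open>U\<close> up to a twist, and multiplication by a monomial in them carries a section of \<open>O(D)\<close> over \<open>U\<close>,
  \<open>D \<in> K\<close>, to a global section of a divisor in \<open>L\<close>. Thus \<open>\<Gamma>(U, S)\<close> is spanned by monomials whose
  exponent vectors form the preimage of a subgroup, a finitely generated monoid by
  Dickson's lemma, and its generators generate the algebra. Normality, the Nullstellensatz and
  Hilbert's basis theorem enter through the fact that the local ring along a prime divisor is a
  discrete valuation ring, so that orders are additive.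
\<close>

section \<open>Rings of polynomial functions\<close>

text \<open>Elements of the Cox ring are families of germs in quotient stalks, so they need not come
  from global sections of the divisorial algebra. The bridge is a map that is constant on these
  germs: \<open>collapse\<close> assigns to a section of the algebra of \<open>L\<close> one
  rational function for each degree, and the Cox ideal lies in its kernel. Its values live in the
  function field, which is the same at every point, so they can be compared on overlaps and computed
  at a single point. For the same reason all section rings and stalks are realised inside one group
  algebra over the function field.

  At the end each monomial carries a degree in \<open>L\<close> and a degree in \<open>K\<close>,
  kept apart. Only monomials with principal \<open>L\<close>-degree count, for there a factor
  \<open>\<chi> E\<close> removes that degree. Differences preserve this condition, and that lets
  the finite set of minimal exponents generate the monoid.

  The order along a prime divisor is a definite description over all generators of a maximal ideal.
  It can be evaluated only where such a generator exists and the exponent is independent of it; this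
  is why so much commutative algebra precedes the divisors.\<close>

definition subring_set :: "'b::comm_ring_1 set \<Rightarrow> bool"
  where "subring_set A \<longleftrightarrow> 1 \<in> A \<and> (\<forall>a\<in>A. \<forall>b\<in>A. a - b \<in> A \<and> a * b \<in> A)"

lemma subring_set_one: "subring_set A \<Longrightarrow> 1 \<in> A"
  and subring_set_diff: "subring_set A \<Longrightarrow> a \<in> A \<Longrightarrow> b \<in> A \<Longrightarrow> a - b \<in> A"
  and subring_set_mult: "subring_set A \<Longrightarrow> a \<in> A \<Longrightarrow> b \<in> A \<Longrightarrow> a * b \<in> A"
  by (auto simp: subring_set_def)

lemma subring_set_zero: "subring_set A \<Longrightarrow> 0 \<in> A"
  using subring_set_diff[of A 1 1] subring_set_one by auto

lemma subring_set_minus: "subring_set A \<Longrightarrow> a \<in> A \<Longrightarrow> - a \<in> A"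
  using subring_set_diff[of A 0 a] subring_set_zero by auto

lemma subring_set_add: "subring_set A \<Longrightarrow> a \<in> A \<Longrightarrow> b \<in> A \<Longrightarrow> a + b \<in> A"
  using subring_set_diff[of A a "- b"] subring_set_minus[of A b] by auto

lemma subring_set_sum: "subring_set A \<Longrightarrow> (\<And>i. i \<in> I \<Longrightarrow> f i \<in> A) \<Longrightarrow> sum f I \<in> A"
  by (induction I rule: infinite_finite_induct) (auto simp: subring_set_zero subring_set_add)

lemma subring_set_power: "subring_set A \<Longrightarrow> a \<in> A \<Longrightarrow> a ^ n \<in> A"
  by (induction n) (auto simp: subring_set_one subring_set_mult)

lemmas subring_set_closed = subring_set_one subring_set_zero subring_set_diff subring_set_mult
  subring_set_minus subring_set_add subring_set_sum subring_set_power

section \<open>Ideals generated inside a subring\<close>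

inductive_set ideal_span :: "'b::comm_ring_1 set \<Rightarrow> 'b set \<Rightarrow> 'b set" for A Y
  where
    zero: "0 \<in> ideal_span A Y"
  | step: "z \<in> ideal_span A Y \<Longrightarrow> a \<in> A \<Longrightarrow> y \<in> Y \<Longrightarrow> a * y + z \<in> ideal_span A Y"

lemma ideal_span_add:
  assumes "u \<in> ideal_span A Y" "v \<in> ideal_span A Y"
  shows "u + v \<in> ideal_span A Y"
  using assms(1)
  by (induction) (auto simp: assms(2) add.assoc intro: ideal_span.intros)

lemma ideal_span_mult:
  assumes "subring_set A" "u \<in> ideal_span A Y" "a \<in> A"
  shows "a * u \<in> ideal_span A Y"
  using assms(2)
proof induction
  case (step z b y)
  have "(a * b) * y + a * z \<in> ideal_span A Y"
    by (rule ideal_span.step) (use step assms in \<open>auto intro: subring_set_closed\<close>)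
  then show ?case by (simp add: algebra_simps)
qed (auto intro: ideal_span.intros)

lemma ideal_span_minus:
  assumes "subring_set A" "u \<in> ideal_span A Y"
  shows "- u \<in> ideal_span A Y"
  using ideal_span_mult[OF assms, of "- 1"] assms by (auto intro: subring_set_closed)

lemma ideal_span_diff:
  assumes "subring_set A" "u \<in> ideal_span A Y" "v \<in> ideal_span A Y"
  shows "u - v \<in> ideal_span A Y"
  using ideal_span_add[OF assms(2) ideal_span_minus[OF assms(1,3)]] by simp

lemma ideal_span_incl:
  assumes "subring_set A" "y \<in> Y"
  shows "y \<in> ideal_span A Y"
  using ideal_span.step[OF ideal_span.zero subring_set_one[OF assms(1)] assms(2)] by simp

lemma ideal_span_least:
  assumes "u \<in> ideal_span A Z" "0 \<in> J"
    and "\<And>u v. u \<in> J \<Longrightarrow> v \<in> J \<Longrightarrow> u + v \<in> J"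
    and "\<And>a u. a \<in> A \<Longrightarrow> u \<in> Z \<Longrightarrow> a * u \<in> J"
  shows "u \<in> J"
  using assms(1) by (induction) (auto intro: assms)

lemma ideal_span_trans:
  assumes "subring_set A" "u \<in> ideal_span A Z" "Z \<subseteq> ideal_span A Y"
  shows "u \<in> ideal_span A Y"
  using assms(2)
  by (rule ideal_span_least) (use assms in \<open>auto intro: ideal_span.zero ideal_span_add ideal_span_mult\<close>)

lemma ideal_span_mono: "u \<in> ideal_span A Z \<Longrightarrow> Z \<subseteq> Y \<Longrightarrow> u \<in> ideal_span A Y"
  by (induction rule: ideal_span.induct) (auto intro: ideal_span.intros)

lemma ideal_span_in:
  assumes "subring_set A" "u \<in> ideal_span A Y" "Y \<subseteq> A"
  shows "u \<in> A"
  using assms(2) by (rule ideal_span_least) (use assms in \<open>auto intro: subring_set_closed\<close>)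

lemma ideal_span_finite:
  assumes "u \<in> ideal_span A Y"
  obtains Y0 where "Y0 \<subseteq> Y" "finite Y0" "u \<in> ideal_span A Y0"
proof -
  have "\<exists>Y0\<subseteq>Y. finite Y0 \<and> u \<in> ideal_span A Y0"
    using assms
  proof induction
    case zero
    show ?case by (rule exI[of _ "{}"]) (auto intro: ideal_span.zero)
  next
    case (step z a y)
    then obtain Y0 where Y0: "Y0 \<subseteq> Y" "finite Y0" "z \<in> ideal_span A Y0" by auto
    show ?case
      by (rule exI[of _ "insert y Y0"]) (use Y0 step in \<open>auto intro!: ideal_span.step intro: ideal_span_mono[OF Y0(3)]\<close>)
  qed
  then show ?thesis using that by auto
qed

text \<open>The finite generating set is drawn from \<open>Y\<close> itself. Later choices of
  \<open>Y\<close> are leading coefficients, the union of a chain of ideals, or numerators of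
  fractions, and the finitely many generators have to be of the same kind.\<close>

definition noetherian_set :: "'b::comm_ring_1 set \<Rightarrow> bool"
  where "noetherian_set A \<longleftrightarrow> (\<forall>Y\<subseteq>A. \<exists>Y0\<subseteq>Y. finite Y0 \<and> Y \<subseteq> ideal_span A Y0)"

text \<open>If the ideal of \<open>Y\<close> were not generated by finitely many of its elements,
  one could choose greedily a sequence whose k-th term has least measure \<open>m\<close> among the
  elements that its predecessors do not generate. Excluding such sequences gives finite generation;
  the measure will be the degree.\<close>

lemma noetherian_setI_sequence:
  assumes A: "subring_set A"
    and seq: "\<And>Y (f :: nat \<Rightarrow> _). Y \<subseteq> A \<Longrightarrow> (\<And>k. f k \<in> ideal_span A Y - ideal_span A (f ` {..<k})) \<Longrightarrow>
      (\<And>k g. g \<in> ideal_span A Y - ideal_span A (f ` {..<k}) \<Longrightarrow> m (f k) \<le> (m g :: nat)) \<Longrightarrow> False"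
  shows "noetherian_set A"
  unfolding noetherian_set_def
proof (intro allI impI)
  fix Y assume Y: "Y \<subseteq> A"
  have ex: "\<exists>k f. ideal_span A Y \<subseteq> ideal_span A (f ` {..<k::nat}) \<and> (\<forall>i<k. f i \<in> ideal_span A Y)"
  proof (rule ccontr)
    assume neg: "\<not> ?thesis"
    define P where "P f k r \<longleftrightarrow> r \<in> ideal_span A Y - ideal_span A (f ` {..<k}) \<and>
      (\<forall>g \<in> ideal_span A Y - ideal_span A (f ` {..<k}). m r \<le> m g)" for f and k :: nat and r
    \<comment> \<open>The condition on \<open>f k\<close> involves all earlier values, so the choice
      goes by well-founded recursion; \<open>P f k\<close> reads \<open>f\<close> only below
      \<open>k\<close>.\<close>
    have "\<exists>f. \<forall>k. P f k (f k)"
    proof (rule dependent_wf_choice[of less_than])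
      fix f g :: "nat \<Rightarrow> 'a" and k r
      assume "\<And>z. (z, k) \<in> less_than \<Longrightarrow> f z = g z"
      then have "f ` {..<k} = g ` {..<k}" by (intro image_cong) auto
      then show "P f k r = P g k r" by (simp add: P_def)
    next
      fix k f assume "\<And>j. (j, k) \<in> less_than \<Longrightarrow> P f j (f j)"
      then have "\<forall>i<k. f i \<in> ideal_span A Y" by (auto simp: P_def)
      with neg have "\<not> ideal_span A Y \<subseteq> ideal_span A (f ` {..<k})" by blast
      then obtain g0 where g0: "g0 \<in> ideal_span A Y - ideal_span A (f ` {..<k})" by blast
      from arg_min_natI[of "\<lambda>g. g \<in> ideal_span A Y - ideal_span A (f ` {..<k})" g0 m, OF g0]
        arg_min_nat_le[of "\<lambda>g. g \<in> ideal_span A Y - ideal_span A (f ` {..<k})" _ m]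
      show "\<exists>r. P f k r" unfolding P_def by blast
    qed auto
    then obtain f where "\<And>k. P f k (f k)" by auto
    then show False using seq[OF Y, of f] by (auto simp: P_def)
  qed
  then obtain k f where kf: "ideal_span A Y \<subseteq> ideal_span A (f ` {..<k::nat})" "\<forall>i<k. f i \<in> ideal_span A Y"
    by auto
  \<comment> \<open>The \<open>f i\<close> lie in the span of \<open>Y\<close>, not in
    \<open>Y\<close>. Each is a combination of finitely many elements of \<open>Y\<close>, and these
    together generate as well.\<close>
  have "\<forall>i\<in>{..<k}. \<exists>Z. Z \<subseteq> Y \<and> finite Z \<and> f i \<in> ideal_span A Z"
    using kf(2) by (metis ideal_span_finite lessThan_iff)
  then obtain Z where Z: "\<And>i. i < k \<Longrightarrow> Z i \<subseteq> Y \<and> finite (Z i) \<and> f i \<in> ideal_span A (Z i)"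
    by (metis lessThan_iff)
  let ?Z = "\<Union>i<k. Z i"
  have "f ` {..<k} \<subseteq> ideal_span A ?Z"
  proof
    fix u assume "u \<in> f ` {..<k}"
    then obtain i where "i < k" "u = f i" by auto
    then show "u \<in> ideal_span A ?Z" using Z[of i] by (auto intro: ideal_span_mono)
  qed
  then have "Y \<subseteq> ideal_span A ?Z"
    using kf(1) ideal_span_incl[OF A] ideal_span_trans[OF A] by blast
  then show "\<exists>Y0\<subseteq>Y. finite Y0 \<and> Y \<subseteq> ideal_span A Y0"
    using Z by (intro exI[of _ ?Z]) auto
qed

section \<open>Hilbert's basis theorem\<close>

definition polys_over :: "'b::comm_ring_1 set \<Rightarrow> 'b poly set"
  where "polys_over A = {Q. \<forall>i. Polynomial.coeff Q i \<in> A}"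

lemma polys_overI: "(\<And>i. Polynomial.coeff Q i \<in> A) \<Longrightarrow> Q \<in> polys_over A"
  by (simp add: polys_over_def)

lemma polys_overD: "Q \<in> polys_over A \<Longrightarrow> Polynomial.coeff Q i \<in> A"
  by (simp add: polys_over_def)

lemma subring_set_polys_over:
  assumes "subring_set A"
  shows "subring_set (polys_over A)"
  unfolding subring_set_def
proof (intro conjI ballI)
  show "1 \<in> polys_over A"
    using assms by (auto intro!: polys_overI simp: coeff_1 subring_set_closed)
  fix P Q assume "P \<in> polys_over A" "Q \<in> polys_over A"
  then show "P - Q \<in> polys_over A" "P * Q \<in> polys_over A"
    using assms by (auto intro!: polys_overI subring_set_closed simp: coeff_mult dest: polys_overD)
qed

lemma polys_over_monom: "subring_set A \<Longrightarrow> a \<in> A \<Longrightarrow> Polynomial.monom a n \<in> polys_over A"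
  by (auto intro!: polys_overI subring_set_closed)

lemma degree_diff_less_lead:
  fixes f g :: "'b::comm_ring_1 poly"
  assumes "Polynomial.degree g \<le> Polynomial.degree f" "Polynomial.coeff g (Polynomial.degree f) = Polynomial.coeff f (Polynomial.degree f)"
  shows "f - g = 0 \<or> Polynomial.degree (f - g) < Polynomial.degree f"
proof (cases "f - g = 0")
  case False
  have "Polynomial.degree (f - g) \<le> Polynomial.degree f" using assms(1) by (simp add: degree_diff_le)
  moreover have "Polynomial.degree (f - g) \<noteq> Polynomial.degree f"
    using False assms(2) by (metis coeff_diff diff_self leading_coeff_0_iff)
  ultimately show ?thesis by simp
qed simp

text \<open>Hilbert's basis theorem. The leading coefficients along the greedy sequence span a
  finitely generated ideal of \<open>A\<close>, so the leading coefficient of some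
  \<open>f m\<close> is a combination of earlier ones. The same combination of the polynomials,
  shifted to a common degree, cancels the leading term of \<open>f m\<close>; what remains has
  smaller degree and is still outside the span, against minimality.\<close>

lemma noetherian_polys_over:
  fixes A :: "'b::comm_ring_1 set"
  assumes A: "subring_set A" and N: "noetherian_set A"
  shows "noetherian_set (polys_over A)"
proof (rule noetherian_setI_sequence[where m = Polynomial.degree])
  let ?P = "polys_over A"
  show P: "subring_set ?P" using subring_set_polys_over[OF A] .
  fix Y and f :: "nat \<Rightarrow> 'b poly"
  assume Y: "Y \<subseteq> ?P" and f: "\<And>k. f k \<in> ideal_span ?P Y - ideal_span ?P (f ` {..<k})"
    and min: "\<And>k g. g \<in> ideal_span ?P Y - ideal_span ?P (f ` {..<k}) \<Longrightarrow> Polynomial.degree (f k) \<le> Polynomial.degree g"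
  have fP: "f k \<in> ?P" for k using f ideal_span_in[OF P _ Y] by blast
  let ?l = "\<lambda>k. Polynomial.lead_coeff (f k)"
  have "range ?l \<subseteq> A" using fP by (auto intro: polys_overD)
  then obtain L0 where L0: "L0 \<subseteq> range ?l" "finite L0" "range ?l \<subseteq> ideal_span A L0"
    using N unfolding noetherian_set_def by blast
  obtain I where I: "finite I" "L0 = ?l ` I"
    using finite_subset_image[OF L0(2,1)] by blast
  \<comment> \<open>An index beyond all those in \<open>I\<close>; the \<open>0\<close> covers an
    empty \<open>I\<close>.\<close>
  define m where "m = Suc (Max (insert 0 I))"
  have Im: "I \<subseteq> {..<m}" unfolding m_def using I(1) by (auto simp: less_Suc_eq_le)
  \<comment> \<open>Degrees do not decrease along the sequence: \<open>f m\<close> was already a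
    candidate when \<open>f i\<close> was chosen as minimal.\<close>
  have dm: "Polynomial.degree (f i) \<le> Polynomial.degree (f m)" if "i < m" for i
  proof (rule min)
    have "f ` {..<i} \<subseteq> f ` {..<m}" using that by auto
    then show "f m \<in> ideal_span ?P Y - ideal_span ?P (f ` {..<i})"
      using f[of m] ideal_span_mono by blast
  qed
  \<comment> \<open>A combination of leading coefficients is lifted to one of the
    \<open>f i\<close>, each summand raised by a monomial to the degree of
    \<open>f m\<close>.\<close>
  have "u \<in> ideal_span A (?l ` I) \<Longrightarrow>
    \<exists>g \<in> ideal_span ?P (f ` {..<m}). Polynomial.degree g \<le> Polynomial.degree (f m) \<and> Polynomial.coeff g (Polynomial.degree (f m)) = u" for u
  proof (induction rule: ideal_span.induct)
    case zero
    show ?case by (rule bexI[of _ 0]) (auto intro: ideal_span.zero)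
  next
    case (step z a y)
    then obtain g where g: "g \<in> ideal_span ?P (f ` {..<m})" "Polynomial.degree g \<le> Polynomial.degree (f m)"
      "Polynomial.coeff g (Polynomial.degree (f m)) = z" by auto
    from step obtain i where i: "i \<in> I" "y = ?l i" by auto
    then have im: "i < m" using Im by auto
    let ?e = "Polynomial.degree (f m) - Polynomial.degree (f i)"
    let ?g = "Polynomial.monom a ?e * f i + g"
    have "Polynomial.degree (Polynomial.monom a ?e * f i) \<le> ?e + Polynomial.degree (f i)"
      using degree_mult_le[of "Polynomial.monom a ?e" "f i"] degree_monom_le[of a ?e] by linarith
    then have 1: "Polynomial.degree ?g \<le> Polynomial.degree (f m)"
      using g(2) dm[OF im] by (intro degree_add_le) auto
    have 2: "Polynomial.coeff ?g (Polynomial.degree (f m)) = a * y + z"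
      using g(3) dm[OF im] i(2) by (simp add: coeff_monom_mult)
    have 3: "?g \<in> ideal_span ?P (f ` {..<m})"
      using g(1) step(2) im by (intro ideal_span.step) (auto intro: polys_over_monom[OF A])
    show ?case using 1 2 3 by blast
  qed
  moreover have "?l m \<in> ideal_span A (?l ` I)" using L0 I by auto
  ultimately obtain g where g: "g \<in> ideal_span ?P (f ` {..<m})" "Polynomial.degree g \<le> Polynomial.degree (f m)"
      "Polynomial.coeff g (Polynomial.degree (f m)) = ?l m" by blast
  have gY: "g \<in> ideal_span ?P Y"
    using g(1) by (rule ideal_span_trans[OF P]) (use f in auto)
  have nin: "f m - g \<notin> ideal_span ?P (f ` {..<m})"
    using ideal_span_add[OF _ g(1), of "f m - g"] f[of m] by auto
  have "f m - g \<in> ideal_span ?P Y"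
    using f[of m] gY ideal_span_diff[OF P] by blast
  then have "Polynomial.degree (f m) \<le> Polynomial.degree (f m - g)" using nin min by blast
  moreover have "f m - g \<noteq> 0" using nin ideal_span.zero by metis
  ultimately show False using degree_diff_less_lead[OF g(2,3)] by auto
qed

lemma ideal_span_image:
  assumes "u \<in> ideal_span A Y" "subring_set A" "Y \<subseteq> A"
    and "\<And>a b. a \<in> A \<Longrightarrow> b \<in> A \<Longrightarrow> h (a + b) = h a + h b"
    and "\<And>a b. a \<in> A \<Longrightarrow> b \<in> A \<Longrightarrow> h (a * b) = h a * h b"
  shows "h u \<in> ideal_span (h ` A) (h ` Y)"
  using assms(1)
proof induction
  case zero
  have "h 0 = 0" using assms(4)[of 0 0] subring_set_zero[OF assms(2)] by simp
  then show ?case by (simp add: ideal_span.zero)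
next
  case (step z a y)
  have "z \<in> A" "y \<in> A" using step ideal_span_in[OF assms(2) _ assms(3)] assms(3) by auto
  then have "h (a * y + z) = h a * h y + h z"
    using assms step by (simp add: subring_set_mult)
  then show ?case using step by (auto intro: ideal_span.step)
qed

lemma noetherian_set_image:
  assumes A: "subring_set A" and N: "noetherian_set A"
    and h: "\<And>a b. a \<in> A \<Longrightarrow> b \<in> A \<Longrightarrow> h (a + b) = h a + h b"
      "\<And>a b. a \<in> A \<Longrightarrow> b \<in> A \<Longrightarrow> h (a * b) = h a * h b"
  shows "noetherian_set (h ` A)"
  unfolding noetherian_set_def
proof (intro allI impI)
  fix Y assume "Y \<subseteq> h ` A"
  then obtain Z where Z: "Z \<subseteq> A" "Y = h ` Z" by (meson subset_imageE)
  then obtain Z0 where Z0: "Z0 \<subseteq> Z" "finite Z0" "Z \<subseteq> ideal_span A Z0"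
    using N unfolding noetherian_set_def by blast
  have "Y \<subseteq> ideal_span (h ` A) (h ` Z0)"
    using Z Z0 ideal_span_image[of _ A Z0 h, OF _ A _ h] by blast
  then show "\<exists>Y0\<subseteq>Y. finite Y0 \<and> Y \<subseteq> ideal_span (h ` A) Y0"
    using Z Z0 by (intro exI[of _ "h ` Z0"]) auto
qed

section \<open>Polynomial functions in one more coordinate\<close>

lemma poly_fun_add: "p \<in> poly_fun n \<Longrightarrow> q \<in> poly_fun n \<Longrightarrow> p + q \<in> poly_fun n"
  using poly_fun.add[of p n q] by (simp add: plus_fun_def)

lemma poly_fun_mult: "p \<in> poly_fun n \<Longrightarrow> q \<in> poly_fun n \<Longrightarrow> p * q \<in> poly_fun n"
  using poly_fun.mult[of p n q] by (simp add: times_fun_def)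

lemma subring_set_poly_fun: "subring_set (poly_fun n)"
proof -
  have "(- 1 :: (nat \<Rightarrow> 'a) \<Rightarrow> 'a) \<in> poly_fun n"
    using poly_fun.const[of "- 1 :: 'a" n] by (simp add: fun_Compl_def one_fun_def)
  then have "- b \<in> poly_fun n" if "b \<in> poly_fun n" for b :: "(nat \<Rightarrow> 'a) \<Rightarrow> 'a"
    using poly_fun_mult[of "- 1" n b] that by simp
  then have "a - b \<in> poly_fun n" if "a \<in> poly_fun n" "b \<in> poly_fun n" for a b :: "(nat \<Rightarrow> 'a) \<Rightarrow> 'a"
    using poly_fun_add[of a n "- b"] that by simp
  then show ?thesis
    unfolding subring_set_def using poly_fun.const[of "1 :: 'a" n] poly_fun_mult
    by (auto simp: one_fun_def)
qed

lemma poly_fun_mono: "p \<in> poly_fun n \<Longrightarrow> n \<le> m \<Longrightarrow> p \<in> poly_fun m"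
  by (induction rule: poly_fun.induct) (auto intro: poly_fun.intros)

lemma poly_fun_cong: "p \<in> poly_fun n \<Longrightarrow> (\<And>i. i < n \<Longrightarrow> x i = y i) \<Longrightarrow> p x = p y"
  by (induction rule: poly_fun.induct) auto

text \<open>All numbers of variables share one function type, so the induction on \<open>n\<close>
  passes through formal polynomials over \<open>poly_fun n\<close> and returns by evaluation at the
  last coordinate. Surjectivity of the evaluation suffices: Noetherianity passes to images, and
  prime ideals are pulled back.\<close>

lemma poly_fun_Suc:
  "poly_fun (Suc n) = (\<lambda>Q. poly Q (\<lambda>x. x n)) ` polys_over (poly_fun n :: ((nat \<Rightarrow> 'k::comm_ring_1) \<Rightarrow> 'k) set)"
  (is "_ = ?ev ` _")
proof (intro equalityI subsetI)
  note S = subring_set_polys_over[OF subring_set_poly_fun]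
  fix p :: "(nat \<Rightarrow> 'k) \<Rightarrow> 'k" assume "p \<in> poly_fun (Suc n)"
  then show "p \<in> ?ev ` polys_over (poly_fun n)"
  proof induction
    case (const c)
    show ?case
      by (rule image_eqI[of _ _ "[:(\<lambda>_. c):]"])
        (auto simp: coeff_pCons subring_set_zero[OF subring_set_poly_fun] split: nat.splits
          intro!: polys_overI poly_fun.const)
  next
    case (var i)
    show ?case
    proof (cases "i = n")
      case True
      show ?thesis
        by (rule image_eqI[of _ _ "Polynomial.monom 1 1"])
          (auto simp: True poly_monom intro!: polys_over_monom subring_set_poly_fun subring_set_one)
    next
      case False
      then show ?thesis using var
        by (intro image_eqI[of _ _ "[:(\<lambda>x. x i):]"])
          (auto simp: coeff_pCons subring_set_zero[OF subring_set_poly_fun] split: nat.splits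
            intro!: polys_overI poly_fun.var)
    qed
  next
    case (add p q)
    then obtain P Q where PQ: "P \<in> polys_over (poly_fun n)" "Q \<in> polys_over (poly_fun n)"
      "p = ?ev P" "q = ?ev Q" by auto
    then show ?case
      by (intro image_eqI[of _ _ "P + Q"]) (auto simp: plus_fun_def intro: subring_set_add[OF S])
  next
    case (mult p q)
    then obtain P Q where PQ: "P \<in> polys_over (poly_fun n)" "Q \<in> polys_over (poly_fun n)"
      "p = ?ev P" "q = ?ev Q" by auto
    then show ?case
      by (intro image_eqI[of _ _ "P * Q"]) (auto simp: times_fun_def intro: subring_set_mult[OF S])
  qed
next
  fix p assume "p \<in> ?ev ` polys_over (poly_fun n)"
  then obtain Q where Q: "Q \<in> polys_over (poly_fun n)" "p = ?ev Q" by auto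
  have "(\<lambda>x. x n) \<in> poly_fun (Suc n)" by (auto intro: poly_fun.var)
  moreover have "Polynomial.coeff Q i \<in> poly_fun (Suc n)" for i
    using polys_overD[OF Q(1)] poly_fun_mono le_SucI by blast
  ultimately show "p \<in> poly_fun (Suc n)"
    unfolding Q(2) poly_altdef by (intro subring_set_closed subring_set_poly_fun) auto
qed

lemma noetherian_poly_fun: "noetherian_set (poly_fun n :: ((nat \<Rightarrow> 'k::field) \<Rightarrow> 'k) set)"
proof (induction n)
  case 0
  have const: "\<exists>c. p = (\<lambda>_. c)" if "p \<in> poly_fun 0" for p :: "(nat \<Rightarrow> 'k) \<Rightarrow> 'k"
    using that by induction auto
  show ?case
    unfolding noetherian_set_def
  proof (intro allI impI)
    fix Y :: "((nat \<Rightarrow> 'k) \<Rightarrow> 'k) set" assume Y: "Y \<subseteq> poly_fun 0"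
    show "\<exists>Y0\<subseteq>Y. finite Y0 \<and> Y \<subseteq> ideal_span (poly_fun 0) Y0"
    proof (cases "Y \<subseteq> {0}")
      case True
      then show ?thesis by (intro exI[of _ "{}"]) (auto intro: ideal_span.zero)
    next
      case False
      then obtain y where y: "y \<in> Y" "y \<noteq> 0" by auto
      then obtain c where c: "y = (\<lambda>_. c)" using const Y by blast
      with y have c0: "c \<noteq> 0" by (auto simp: zero_fun_def)
      have "z \<in> ideal_span (poly_fun 0) {y}" if zY: "z \<in> Y" for z
      proof -
        obtain d where d: "z = (\<lambda>_. d)" using const Y zY by blast
        have "(\<lambda>_. d / c) * y + 0 \<in> ideal_span (poly_fun 0) {y}"
          by (intro ideal_span.intros poly_fun.const) auto
        then show ?thesis using c c0 d by (simp add: times_fun_def)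
      qed
      then show ?thesis using y by (intro exI[of _ "{y}"]) auto
    qed
  qed
next
  case (Suc n)
  show ?case
    unfolding poly_fun_Suc
    by (rule noetherian_set_image[OF subring_set_polys_over noetherian_polys_over])
      (auto simp: Suc subring_set_poly_fun)
qed

section \<open>Prime ideals and the Nullstellensatz\<close>

definition prime_in :: "'b::comm_ring_1 set \<Rightarrow> 'b set \<Rightarrow> bool"
  where "prime_in A Q \<longleftrightarrow> Q \<subseteq> A \<and> 0 \<in> Q \<and> 1 \<notin> Q \<and> (\<forall>u\<in>Q. \<forall>v\<in>Q. u + v \<in> Q) \<and>
    (\<forall>a\<in>A. \<forall>u\<in>Q. a * u \<in> Q) \<and> (\<forall>a\<in>A. \<forall>b\<in>A. a * b \<in> Q \<longrightarrow> a \<in> Q \<or> b \<in> Q)"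

lemma prime_inD:
  assumes "prime_in A Q"
  shows "u \<in> Q \<Longrightarrow> u \<in> A" "0 \<in> Q" "1 \<notin> Q" "u \<in> Q \<Longrightarrow> v \<in> Q \<Longrightarrow> u + v \<in> Q"
    "a \<in> A \<Longrightarrow> u \<in> Q \<Longrightarrow> a * u \<in> Q" "a \<in> A \<Longrightarrow> b \<in> A \<Longrightarrow> a * b \<in> Q \<Longrightarrow> a \<in> Q \<or> b \<in> Q"
  using assms unfolding prime_in_def by blast+

lemma prime_in_mult2: "prime_in A Q \<Longrightarrow> a \<in> A \<Longrightarrow> u \<in> Q \<Longrightarrow> u * a \<in> Q"
  using prime_inD(5)[of A Q a u] by (simp add: mult.commute)

lemma prime_in_minus: "prime_in A Q \<Longrightarrow> subring_set A \<Longrightarrow> u \<in> Q \<Longrightarrow> - u \<in> Q"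
  using prime_inD(5)[of A Q "- 1" u] by (simp add: subring_set_closed)

lemma prime_in_diff: "prime_in A Q \<Longrightarrow> subring_set A \<Longrightarrow> u \<in> Q \<Longrightarrow> v \<in> Q \<Longrightarrow> u - v \<in> Q"
  using prime_inD(4)[of A Q u "- v"] prime_in_minus[of A Q v] by simp

lemma prime_in_sum: "prime_in A Q \<Longrightarrow> (\<And>i. i \<in> I \<Longrightarrow> f i \<in> Q) \<Longrightarrow> sum f I \<in> Q"
  by (induction I rule: infinite_finite_induct) (auto intro: prime_inD)

lemma prime_in_power:
  "prime_in A Q \<Longrightarrow> subring_set A \<Longrightarrow> a \<in> A \<Longrightarrow> a \<notin> Q \<Longrightarrow> a ^ n \<notin> Q"
  by (induction n) (auto dest: prime_inD subring_set_power)

text \<open>Zorn's lemma: an ideal that is maximal among those containing \<open>S\<close> and no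
  power of \<open>g\<close> is prime.\<close>

lemma exists_prime_avoiding_powers:
  assumes A: "subring_set A" and S: "S \<subseteq> A" and g: "g \<in> A" and gS: "\<And>N. g ^ N \<notin> ideal_span A S"
  obtains Q where "prime_in A Q" "S \<subseteq> Q" "g \<notin> Q"
proof -
  define C where "C = {I. I \<subseteq> A \<and> S \<subseteq> I \<and> 0 \<in> I \<and> (\<forall>u\<in>I. \<forall>v\<in>I. u + v \<in> I) \<and>
    (\<forall>a\<in>A. \<forall>u\<in>I. a * u \<in> I) \<and> (\<forall>N. g ^ N \<notin> I)}"
  have "ideal_span A S \<in> C"
    unfolding C_def using gS
    by (auto intro: ideal_span_in[OF A _ S] ideal_span_incl[OF A] ideal_span.zero ideal_span_add
        ideal_span_mult[OF A])
  moreover have "\<Union>K \<in> C" if "K \<noteq> {}" "subset.chain C K" for K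
  proof -
    have K: "K \<subseteq> C" and ch: "\<And>I J. I \<in> K \<Longrightarrow> J \<in> K \<Longrightarrow> I \<subseteq> J \<or> J \<subseteq> I"
      using that(2) by (auto simp: subset_chain_def)
    have "u + v \<in> \<Union>K" if uv: "u \<in> \<Union>K" "v \<in> \<Union>K" for u v
    proof -
      obtain I J where IJ: "I \<in> K" "J \<in> K" "u \<in> I" "v \<in> J" using uv by auto
      then have "(u \<in> J \<and> v \<in> J) \<or> (u \<in> I \<and> v \<in> I)" using ch[of I J] by blast
      then show ?thesis using IJ K unfolding C_def by blast
    qed
    moreover have "0 \<in> \<Union>K" "S \<subseteq> \<Union>K" using that(1) K unfolding C_def by blast+
    moreover have "\<Union>K \<subseteq> A" "\<forall>a\<in>A. \<forall>u\<in>\<Union>K. a * u \<in> \<Union>K" "\<forall>N. g ^ N \<notin> \<Union>K"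
      using K unfolding C_def by blast+
    ultimately show ?thesis unfolding C_def mem_Collect_eq by blast
  qed
  ultimately obtain M where M: "M \<in> C" and max: "\<And>I. I \<in> C \<Longrightarrow> M \<subseteq> I \<Longrightarrow> I = M"
    using subset_Zorn_nonempty[of C] by blast
  \<comment> \<open>Enlarging \<open>M\<close> by \<open>a\<close> gives a strictly larger ideal,
    which by maximality contains a power of \<open>g\<close>.\<close>
  have big: "\<exists>N m c. m \<in> M \<and> c \<in> A \<and> g ^ N = m + c * a" if a: "a \<in> A" "a \<notin> M" for a
  proof (rule ccontr)
    assume neg: "\<not> ?thesis"
    let ?I = "{m + c * a |m c. m \<in> M \<and> c \<in> A}"
    have m: "m \<in> ?I" if "m \<in> M" for m
      using that subring_set_zero[OF A] by (intro CollectI exI[of _ m] exI[of _ 0]) auto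
    have "a \<in> ?I"
      using M subring_set_one[OF A] by (intro CollectI exI[of _ 0] exI[of _ 1]) (auto simp: C_def)
    have "?I \<in> C"
      unfolding C_def
    proof (rule CollectI, intro conjI ballI allI)
      show "?I \<subseteq> A" using M a A by (auto simp: C_def intro!: subring_set_closed)
      have "S \<subseteq> M" "0 \<in> M" using M by (auto simp: C_def)
      then show "S \<subseteq> ?I" "0 \<in> ?I" using m by blast+
      show "g ^ N \<notin> ?I" for N using neg by blast
      fix u v assume "u \<in> ?I" "v \<in> ?I"
      then obtain m c m' c' where "u = m + c * a" "v = m' + c' * a" "m \<in> M" "m' \<in> M" "c \<in> A" "c' \<in> A"
        by auto
      then show "u + v \<in> ?I"
        using M A by (intro CollectI exI[of _ "m + m'"] exI[of _ "c + c'"])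
          (auto simp: C_def algebra_simps intro: subring_set_closed)
    next
      fix b u assume b: "b \<in> A" and "u \<in> ?I"
      then obtain m c where "u = m + c * a" "m \<in> M" "c \<in> A" by auto
      then show "b * u \<in> ?I"
        using M A b by (intro CollectI exI[of _ "b * m"] exI[of _ "b * c"])
          (auto simp: C_def algebra_simps intro: subring_set_closed)
    qed
    then have "?I = M" using m max[of ?I] by blast
    then show False using \<open>a \<in> ?I\<close> a by simp
  qed
  have "prime_in A M"
    unfolding prime_in_def
  proof (intro conjI ballI impI)
    show "1 \<notin> M" using M unfolding C_def by (metis (mono_tags, lifting) mem_Collect_eq power_0)
    fix a b assume ab: "a \<in> A" "b \<in> A" "a * b \<in> M"
    show "a \<in> M \<or> b \<in> M"
    proof (rule ccontr)
      assume "\<not> (a \<in> M \<or> b \<in> M)"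
      then obtain N m c N' m' c' where 1: "m \<in> M" "c \<in> A" "g ^ N = m + c * a"
        "m' \<in> M" "c' \<in> A" "g ^ N' = m' + c' * b" using big ab by metis
      have M4: "u + v \<in> M" if "u \<in> M" "v \<in> M" for u v using M that by (auto simp: C_def)
      have M5: "u * v \<in> M" if "u \<in> A" "v \<in> M" for u v using M that by (auto simp: C_def)
      have MA: "M \<subseteq> A" using M by (auto simp: C_def)
      \<comment> \<open>As \<open>a * b\<close> is in \<open>M\<close>, the product of the two
        powers of \<open>g\<close> is in \<open>M\<close>, which contains none.\<close>
      have "g ^ (N + N') = (m' + c' * b) * m + (c * a) * m' + (c * c') * (a * b)"
        by (simp add: power_add 1 algebra_simps)
      also have "\<dots> \<in> M"
        by (intro M4 M5 1 ab subring_set_mult[OF A] subring_set_add[OF A] subsetD[OF MA])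
      finally show False using M by (auto simp: C_def)
    qed
  qed (use M in \<open>auto simp: C_def\<close>)
  moreover have "S \<subseteq> M" "g \<notin> M" using M unfolding C_def by (auto dest: spec[of _ 1])
  ultimately show ?thesis using that by blast
qed

text \<open>Division with remainder over a ring in which the leading coefficient of \<open>g\<close>
  need not be invertible: scaling \<open>f\<close> by a power of it makes each cancellation
  possible.\<close>

lemma pseudo_division_over:
  fixes A :: "'b::comm_ring_1 set"
  assumes A: "subring_set A" and g: "g \<in> polys_over A" and f: "f \<in> polys_over A"
  shows "\<exists>N s r. s \<in> polys_over A \<and> r \<in> polys_over A \<and>
    Polynomial.smult (Polynomial.lead_coeff g ^ N) f = g * s + r \<and>
    Polynomial.degree s \<le> Polynomial.degree f - Polynomial.degree g \<and>
    (r = 0 \<or> Polynomial.degree r < Polynomial.degree g)"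
  using f
proof (induction "Polynomial.degree f" arbitrary: f rule: less_induct)
  case less
  note P = subring_set_polys_over[OF A]
  let ?d = "Polynomial.degree f - Polynomial.degree g" and ?c = "Polynomial.lead_coeff g"
  show ?case
  proof (cases "f = 0 \<or> Polynomial.degree f < Polynomial.degree g")
    case True
    then show ?thesis
      by (intro exI[of _ 0] exI[of _ f]) (use less P in \<open>auto intro: subring_set_closed\<close>)
  next
    case False
    let ?m = "Polynomial.monom (Polynomial.lead_coeff f) ?d"
    define h where "h = Polynomial.smult ?c f - ?m * g"
    have mP: "?m \<in> polys_over A" using less(2) A by (auto intro: polys_over_monom polys_overD)
    have cP: "[:?c:] \<in> polys_over A" using polys_over_monom[OF A, of ?c 0] g
      by (simp add: monom_0 polys_overD)
    have sm: "Polynomial.smult c q = [:c:] * q" for c and q :: "'b poly" by simp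
    have hP: "h \<in> polys_over A"
      unfolding h_def sm using P mP cP g less(2) by (intro subring_set_closed)
    \<comment> \<open>\<open>A\<close> may have zero divisors, so scaling \<open>f\<close> can
      itself lower the degree. Then the coefficient of \<open>?m * g\<close> in the degree of
      \<open>f\<close> vanishes too, and \<open>h\<close> still has smaller degree.\<close>
    have "h = 0 \<or> Polynomial.degree h < Polynomial.degree f"
    proof (cases "Polynomial.smult ?c f = 0 \<or> Polynomial.degree (Polynomial.smult ?c f) < Polynomial.degree f")
      case 1: True
      have "Polynomial.degree (?m * g) \<le> Polynomial.degree f"
        using degree_mult_le[of ?m g] degree_monom_le[of "Polynomial.lead_coeff f" ?d] False by linarith
      moreover have "Polynomial.coeff (?m * g) (Polynomial.degree f) = Polynomial.coeff (Polynomial.smult ?c f) (Polynomial.degree f)"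
        using False mult.commute[of "Polynomial.lead_coeff f" ?c] by (simp add: coeff_monom_mult)
      moreover have "Polynomial.coeff (Polynomial.smult ?c f) (Polynomial.degree f) = 0"
        using 1 coeff_eq_0[of "Polynomial.smult ?c f" "Polynomial.degree f"]
        by (auto simp del: coeff_smult)
      moreover have "Polynomial.degree (Polynomial.smult ?c f) \<le> Polynomial.degree f" by (rule degree_smult_le)
      ultimately show ?thesis
        unfolding h_def
        by (metis (no_types, lifting) coeff_diff degree_diff_le diff_self le_neq_implies_less leading_coeff_0_iff)
    next
      case 2: False
      then have eq: "Polynomial.degree (Polynomial.smult ?c f) = Polynomial.degree f"
        using degree_smult_le[of ?c f] by linarith
      have "Polynomial.degree (?m * g) \<le> Polynomial.degree f"
        using degree_mult_le[of ?m g] degree_monom_le[of "Polynomial.lead_coeff f" ?d] False by linarith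
      moreover have "Polynomial.coeff (?m * g) (Polynomial.degree f) = Polynomial.coeff (Polynomial.smult ?c f) (Polynomial.degree f)"
        using False mult.commute[of "Polynomial.lead_coeff f" ?c] by (simp add: coeff_monom_mult)
      ultimately show ?thesis unfolding h_def using degree_diff_less_lead[of "?m * g" "Polynomial.smult ?c f"] eq by simp
    qed
    then consider "h = 0" | "Polynomial.degree h < Polynomial.degree f" by blast
    then obtain N s r where IH: "s \<in> polys_over A" "r \<in> polys_over A" "Polynomial.smult (?c ^ N) h = g * s + r"
      "Polynomial.degree s \<le> ?d" "r = 0 \<or> Polynomial.degree r < Polynomial.degree g"
    proof cases
      case 1
      then show ?thesis using that[of 0 0 0] subring_set_zero[OF P] by auto
    next
      case 2
      with less(1)[OF 2 hP] obtain N s r where "s \<in> polys_over A" "r \<in> polys_over A" "Polynomial.smult (?c ^ N) h = g * s + r"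
      "Polynomial.degree s \<le> Polynomial.degree h - Polynomial.degree g" "r = 0 \<or> Polynomial.degree r < Polynomial.degree g"
        by blast
      then show ?thesis using that[of s r N] 2 by auto
    qed
    let ?s = "s + Polynomial.smult (?c ^ N) ?m"
    have "Polynomial.smult (?c ^ Suc N) f = Polynomial.smult (?c ^ N) (h + ?m * g)"
      by (simp add: h_def mult.commute)
    also have "\<dots> = g * ?s + r" by (simp add: smult_add_right IH(3) algebra_simps)
    finally have 1: "Polynomial.smult (?c ^ Suc N) f = g * ?s + r" .
    have cNP: "[:?c ^ N:] \<in> polys_over A" using polys_over_monom[OF A, of "?c ^ N" 0] g A
      by (simp add: monom_0 polys_overD subring_set_power)
    have 2: "?s \<in> polys_over A"
      unfolding sm using P IH(1) mP cNP by (intro subring_set_closed)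
    have 3: "Polynomial.degree ?s \<le> ?d"
      using IH(4) degree_smult_le[of "?c ^ N" ?m] degree_monom_le[of "Polynomial.lead_coeff f" ?d]
      by (intro degree_add_le) auto
    show ?thesis using 1 2 3 IH(2,5) by blast
  qed
qed

section \<open>A prime ideal of A[T] and its contraction to A\<close>

context
  fixes A :: "'b::comm_ring_1 set" and Q :: "'b poly set" and p :: "'b set"
  assumes A: "subring_set A" and Q: "prime_in (polys_over A) Q"
  defines "p \<equiv> {a \<in> A. [:a:] \<in> Q}"
begin

lemma const_polys_over: "a \<in> A \<Longrightarrow> [:a:] \<in> polys_over A"
  using polys_over_monom[OF A, of a 0] by (simp add: monom_0)

lemma prime_in_consts: "prime_in A p"
  unfolding prime_in_def
proof (intro conjI ballI impI)
  show "0 \<in> p" "1 \<notin> p" using prime_inD(2,3)[OF Q] A by (auto simp: p_def subring_set_zero one_pCons)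
  show "u + v \<in> p" if "u \<in> p" "v \<in> p" for u v
    using that prime_inD(4)[OF Q, of "[:u:]" "[:v:]"] A by (auto simp: p_def intro: subring_set_closed)
  show "a * u \<in> p" if "a \<in> A" "u \<in> p" for a u
    using that prime_inD(5)[OF Q, of "[:a:]" "[:u:]"] A const_polys_over
    by (auto simp: p_def mult.commute intro: subring_set_closed)
  show "a \<in> p \<or> b \<in> p" if "a \<in> A" "b \<in> A" "a * b \<in> p" for a b
    using that prime_inD(6)[OF Q, of "[:a:]" "[:b:]"] const_polys_over
    by (auto simp: p_def mult.commute)
qed (auto simp: p_def)

lemma polys_over_consts_in:
  assumes "f \<in> polys_over p"
  shows "f \<in> Q"
proof -
  have "f = (\<Sum>i\<le>Polynomial.degree f. Polynomial.monom 1 i * [:Polynomial.coeff f i:])"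
    by (simp add: poly_as_sum_of_monoms smult_monom mult.commute)
  also have "\<dots> \<in> Q"
    using assms subring_set_one[OF A]
    by (intro prime_in_sum[OF Q] prime_inD(5)[OF Q] polys_over_monom[OF A])
      (auto simp: p_def dest: polys_overD)
  finally show ?thesis .
qed

lemma polys_over_consts_add: "f \<in> polys_over p \<Longrightarrow> g \<in> polys_over p \<Longrightarrow> (f + g) \<in> polys_over p"
  by (auto intro!: polys_overI prime_inD(4)[OF prime_in_consts] dest: polys_overD)

lemma polys_over_consts_mult:
  assumes "f \<in> polys_over p" "g \<in> polys_over A"
  shows "(g * f) \<in> polys_over p"
  using assms by (auto simp: coeff_mult dest: polys_overD
      intro!: polys_overI prime_in_sum[OF prime_in_consts] prime_inD(5)[OF prime_in_consts])

text \<open>Works with degrees modulo \<open>p\<close> without forming a quotient ring: leading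
  terms with coefficient in \<open>p\<close> are removed until a leading coefficient outside
  \<open>p\<close> appears, which happens because not all coefficients of \<open>f\<close> are in
  \<open>p\<close>.\<close>

lemma lead_coeff_outside:
  assumes "f \<in> polys_over A" "f \<notin> polys_over p"
  shows "\<exists>f' \<in> polys_over A. Polynomial.lead_coeff f' \<notin> p \<and>
    Polynomial.degree f' \<le> Polynomial.degree f \<and> (f - f') \<in> polys_over p"
  using assms
proof (induction "Polynomial.degree f" arbitrary: f rule: less_induct)
  case less
  show ?case
  proof (cases "Polynomial.lead_coeff f \<in> p")
    case False
    then show ?thesis using less(2) prime_inD(2)[OF prime_in_consts]
      by (intro bexI[of _ f]) (auto intro: polys_overI)
  next
    case True
    let ?m = "Polynomial.monom (Polynomial.lead_coeff f) (Polynomial.degree f)"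
    let ?g = "f - ?m"
    have tm: "?m \<in> polys_over p" using True prime_inD(2)[OF prime_in_consts] by (auto intro!: polys_overI)
    have nt: "?g \<notin> polys_over p" using polys_over_consts_add[OF _ tm, of ?g] less(3) by auto
    then have "?g \<noteq> 0" using prime_inD(2)[OF prime_in_consts] by (metis coeff_0 polys_overI)
    then have "Polynomial.degree ?g < Polynomial.degree f"
      using degree_diff_less_lead[of ?m f] by (auto simp: degree_monom_le)
    moreover have "?g \<in> polys_over A"
      using subring_set_polys_over[OF A] less(2) A
      by (intro subring_set_closed polys_over_monom) (auto intro: polys_overD)
    ultimately obtain f' where f': "f' \<in> polys_over A" "Polynomial.lead_coeff f' \<notin> p"
      "Polynomial.degree f' \<le> Polynomial.degree ?g" "(?g - f') \<in> polys_over p" using less(1)[of ?g] nt by auto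
    have "f - f' = (?g - f') + ?m" by simp
    then have "(f - f') \<in> polys_over p" using polys_over_consts_add[OF f'(4) tm] by metis
    then show ?thesis using f' \<open>Polynomial.degree ?g < Polynomial.degree f\<close> by (intro bexI[of _ f']) auto
  qed
qed

text \<open>
  In the second case \<open>h\<close> is an element of \<open>Q\<close> of least degree with leading coefficient outside
  \<open>p = Q \<inter> A\<close>; it generates the image of \<open>Q\<close> over the fraction field of \<open>A/p\<close>.
\<close>

lemma prime_over_polys_cases:
  obtains (transcendental) "Q \<subseteq> polys_over p"
  | (algebraic) h where "h \<in> Q" "Polynomial.lead_coeff h \<notin> p" "Polynomial.degree h > 0"
    "\<And>f. f \<in> Q \<Longrightarrow> \<exists>N s r. s \<in> polys_over A \<and> r \<in> polys_over p \<and> Polynomial.smult (Polynomial.lead_coeff h ^ N) f = h * s + r"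
    "\<And>b. b \<in> polys_over A \<Longrightarrow> b \<notin> Q \<Longrightarrow>
      \<exists>b' q a. b' \<in> polys_over A \<and> q \<in> Q \<and> a \<in> A \<and> a \<notin> p \<and> [:a:] = b * b' + q"
proof (cases "Q \<subseteq> polys_over p")
  case True
  then show ?thesis using transcendental by blast
next
  case False
  note P = subring_set_polys_over[OF A] and pp = prime_in_consts
  let ?S = "\<lambda>f. f \<in> Q \<and> Polynomial.lead_coeff f \<notin> p"
  have lead_coeff_outsideQ: "\<exists>f'. ?S f' \<and> Polynomial.degree f' \<le> Polynomial.degree f" if fQ: "f \<in> Q" "f \<notin> polys_over p" for f
  proof -
    obtain f' where f': "f' \<in> polys_over A" "Polynomial.lead_coeff f' \<notin> p"
    "Polynomial.degree f' \<le> Polynomial.degree f" "(f - f') \<in> polys_over p" using lead_coeff_outside fQ prime_inD(1)[OF Q] by blast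
    have "f - (f - f') \<in> Q" using prime_in_diff[OF Q P fQ(1) polys_over_consts_in[OF f'(4)]] .
    then show ?thesis using f' by auto
  qed
  with False obtain f0 where "?S f0" by blast
  then obtain h where h: "?S h" and hmin: "\<And>f. ?S f \<Longrightarrow> Polynomial.degree h \<le> Polynomial.degree f"
    using arg_min_natI[of ?S f0 Polynomial.degree] arg_min_nat_le[of ?S _ Polynomial.degree] by blast
  let ?d = "Polynomial.degree h" and ?c = "Polynomial.lead_coeff h"
  have hP: "h \<in> polys_over A" using h prime_inD(1)[OF Q] by blast
  have cA: "?c \<in> A" using hP by (auto intro: polys_overD)
  \<comment> \<open>Below the degree of \<open>h\<close>, an element of \<open>Q\<close> has all its
    coefficients in \<open>p\<close>; otherwise removing leading terms would give a smaller
    candidate for \<open>h\<close>.\<close>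
  have small: "r \<in> polys_over p" if "r \<in> Q" "r = 0 \<or> Polynomial.degree r < ?d" for r
  proof (rule ccontr)
    assume nt: "r \<notin> polys_over p"
    then have "r \<noteq> 0" using prime_inD(2)[OF pp] by (auto intro: polys_overI)
    then show False using lead_coeff_outsideQ[OF that(1) nt] hmin that(2) by fastforce
  qed
  have d0: "?d > 0"
  proof (rule ccontr)
    assume "\<not> ?d > 0"
    then obtain a where "h = [:a:]" by (metis degree_eq_zeroE gr0I)
    then show False using h hP polys_overD[of h A 0] by (auto simp: p_def)
  qed
  have sm: "Polynomial.smult c q = [:c:] * q" for c and q :: "'b poly" by simp
  have smP: "Polynomial.smult c q \<in> polys_over A" if "c \<in> A" "q \<in> polys_over A" for c q
    unfolding sm using that P const_polys_over by (intro subring_set_closed) auto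
  have smQ: "Polynomial.smult c q \<in> Q" if "c \<in> A" "q \<in> Q" for c q
    unfolding sm using that prime_inD(5)[OF Q] const_polys_over by blast
  have 1: "\<exists>N s r. s \<in> polys_over A \<and> r \<in> polys_over p \<and> Polynomial.smult (?c ^ N) f = h * s + r" if f: "f \<in> Q" for f
  proof -
    obtain N s r where *: "s \<in> polys_over A" "r \<in> polys_over A" "Polynomial.smult (?c ^ N) f = h * s + r"
      "r = 0 \<or> Polynomial.degree r < ?d"
      using pseudo_division_over[OF A hP, of f] f prime_inD(1)[OF Q] by blast
    have "r = Polynomial.smult (?c ^ N) f - s * h" using *(3) by (simp add: mult.commute)
    also have "\<dots> \<in> Q"
      using f h *(1) cA A by (intro prime_in_diff[OF Q P] smQ prime_inD(5)[OF Q] subring_set_closed) auto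
    finally show ?thesis using * small by blast
  qed
  \<comment> \<open>Over the fraction field of \<open>A/p\<close> the residue ring of
    \<open>Q\<close> is a field, so \<open>b\<close> outside \<open>Q\<close> is invertible there;
    clearing denominators gives the identity. The proof takes an element of least degree, with
    leading coefficient outside \<open>p\<close>, in the ideal of \<open>b\<close> and
    \<open>Q\<close>.\<close>
  have 2: "\<exists>b' q a. b' \<in> polys_over A \<and> q \<in> Q \<and> a \<in> A \<and> a \<notin> p \<and> [:a:] = b * b' + q"
    if b: "b \<in> polys_over A" "b \<notin> Q" for b
  proof -
    let ?J = "\<lambda>e. \<exists>b' q. b' \<in> polys_over A \<and> q \<in> Q \<and> e = b * b' + q"
    let ?E = "\<lambda>e. e \<in> polys_over A \<and> Polynomial.lead_coeff e \<notin> p \<and> ?J e"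
    have lead_coeff_outsideE: "\<exists>e'. ?E e' \<and> Polynomial.degree e' \<le> Polynomial.degree e"
      if e: "e \<in> polys_over A" "e \<notin> polys_over p" "?J e" for e
    proof -
      obtain e' where e': "e' \<in> polys_over A" "Polynomial.lead_coeff e' \<notin> p"
        "Polynomial.degree e' \<le> Polynomial.degree e" "(e - e') \<in> polys_over p" using lead_coeff_outside e by blast
      obtain b' q where bq: "b' \<in> polys_over A" "q \<in> Q" "e = b * b' + q" using e(3) by blast
      have "e' = b * b' + (q - (e - e'))" using bq by simp
      moreover have "q - (e - e') \<in> Q" using prime_in_diff[OF Q P bq(2) polys_over_consts_in[OF e'(4)]] .
      ultimately show ?thesis using e' bq(1) by blast
    qed
    obtain N s r where *: "s \<in> polys_over A" "r \<in> polys_over A" "Polynomial.smult (?c ^ N) b = h * s + r"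
      "r = 0 \<or> Polynomial.degree r < ?d"
      using pseudo_division_over[OF A hP b(1)] by blast
    have "Polynomial.smult (?c ^ N) b \<notin> Q"
    proof
      assume "Polynomial.smult (?c ^ N) b \<in> Q"
      then have "[:?c ^ N:] \<in> Q"
        using b prime_inD(6)[OF Q const_polys_over b(1), of "?c ^ N"] cA A by (auto simp: subring_set_power)
      then have "?c ^ N \<in> p" using cA A by (auto simp: p_def intro: subring_set_closed)
      then show False using prime_in_power[OF pp A cA] h by blast
    qed
    moreover have "h * s \<in> Q" using prime_in_mult2[OF Q *(1)] h by blast
    ultimately have rQ: "r \<notin> Q" using *(3) prime_inD(4)[OF Q] by metis
    then have ntr: "r \<notin> polys_over p" using polys_over_consts_in by blast
    \<comment> \<open>The remainder of \<open>b\<close> modulo \<open>h\<close> lies in the ideal of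
      \<open>b\<close> and \<open>Q\<close> and pushes the least degree there below that of
      \<open>h\<close>.\<close>
    have "r = b * [:?c ^ N:] + (- (s * h))" using *(3) by (simp add: algebra_simps)
    moreover have "- (s * h) \<in> Q" using h *(1) by (intro prime_in_minus[OF Q P] prime_inD(5)[OF Q]) auto
    moreover have "[:?c ^ N:] \<in> polys_over A" using cA A const_polys_over subring_set_power by blast
    ultimately have "?J r" by blast
    from lead_coeff_outsideE[OF *(2) ntr this] obtain e1 where e1: "?E e1" "Polynomial.degree e1 \<le> Polynomial.degree r" by blast
    have "r \<noteq> 0" using rQ prime_inD(2)[OF Q] by auto
    with e1 *(4) have e1d: "Polynomial.degree e1 < ?d" by auto
    obtain e where e: "?E e" and emin: "\<And>f. ?E f \<Longrightarrow> Polynomial.degree e \<le> Polynomial.degree f"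
      using e1(1) arg_min_natI[of ?E e1 Polynomial.degree] arg_min_nat_le[of ?E _ Polynomial.degree] by blast
    let ?k = "Polynomial.lead_coeff e"
    have ed: "Polynomial.degree e < ?d" using emin[OF e1(1)] e1d by simp
    \<comment> \<open>For positive degree, dividing \<open>h\<close> by \<open>e\<close> leaves a
      remainder with coefficients in \<open>p\<close>, by minimality of \<open>e\<close>, so
      \<open>e * s\<close> is in \<open>Q\<close>. By primality \<open>e\<close> or \<open>s\<close>
      is in \<open>Q\<close>: the first contradicts the choice of \<open>h\<close>, the second
      forces a power of the leading coefficient of \<open>e\<close>, or the leading coefficient of
      \<open>h\<close>, into \<open>p\<close>.\<close>
    have "Polynomial.degree e = 0"
    proof (rule ccontr)
      assume de: "Polynomial.degree e \<noteq> 0"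
      obtain N s r where **: "s \<in> polys_over A" "r \<in> polys_over A" "Polynomial.smult (?k ^ N) h = e * s + r"
        "Polynomial.degree s \<le> ?d - Polynomial.degree e"
        "r = 0 \<or> Polynomial.degree r < Polynomial.degree e"
        using pseudo_division_over[OF A _ hP, of e] e by blast
      obtain b' q where bq: "b' \<in> polys_over A" "q \<in> Q" "e = b * b' + q" using e by blast
      have kA: "?k ^ N \<in> A" using e A by (auto intro: subring_set_closed polys_overD)
      have "r = Polynomial.smult (?k ^ N) h - e * s" using **(3) by simp
      also have "\<dots> = b * (- (b' * s)) + (Polynomial.smult (?k ^ N) h - q * s)"
        by (simp add: bq(3) algebra_simps)
      finally have "r = b * (- (b' * s)) + (Polynomial.smult (?k ^ N) h - q * s)" .
      moreover have "Polynomial.smult (?k ^ N) h - q * s \<in> Q"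
        using h bq **(1) kA by (intro prime_in_diff[OF Q P] smQ prime_in_mult2[OF Q]) auto
      moreover have "- (b' * s) \<in> polys_over A" using P bq **(1) by (intro subring_set_closed)
      ultimately have Jr: "?J r" by blast
      have tr: "r \<in> polys_over p"
      proof (rule ccontr)
        assume nt: "r \<notin> polys_over p"
        then have "r \<noteq> 0" using prime_inD(2)[OF pp] by (auto intro: polys_overI)
        with lead_coeff_outsideE[OF **(2) nt Jr] emin **(5) show False by fastforce
      qed
      have "e * s = Polynomial.smult (?k ^ N) h - r" using **(3) by simp
      also have "\<dots> \<in> Q" using h kA polys_over_consts_in[OF tr] by (intro prime_in_diff[OF Q P] smQ) auto
      finally have "e \<in> Q \<or> s \<in> Q" using prime_inD(6)[OF Q _ **(1)] e by blast
      then show False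
      proof
        assume "e \<in> Q"
        then show False using hmin[of e] e ed by auto
      next
        assume "s \<in> Q"
        moreover have "Polynomial.degree s < ?d" using **(4) de d0 by linarith
        ultimately have ts: "s \<in> polys_over p" using small by blast
        have "(e * s + r) \<in> polys_over p" using polys_over_consts_add[OF polys_over_consts_mult[OF ts] tr] e by blast
        then have "(Polynomial.smult (?k ^ N) h) \<in> polys_over p" using **(3) by simp
        then have "?k ^ N * ?c \<in> p" using polys_overD by fastforce
        then have "?k ^ N \<in> p \<or> ?c \<in> p" using prime_inD(6)[OF pp kA cA] by blast
        then show False using h prime_in_power[OF pp A, of ?k N] e by (auto intro: polys_overD)
      qed
    qed
    then obtain a where a: "e = [:a:]" by (metis degree_eq_zeroE)
    then have "a \<in> A" "a \<notin> p" using e polys_overD[of e A 0] by auto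
    moreover obtain b' q where "b' \<in> polys_over A" "q \<in> Q" "e = b * b' + q" using e by blast
    ultimately show ?thesis using a by (intro exI[of _ b'] exI[of _ q] exI[of _ a]) simp
  qed
  show ?thesis using algebraic[of h] h d0 1 2 by blast
qed

end

lemma poly_fun_eval:
  fixes Q :: "((nat \<Rightarrow> 'k::field) \<Rightarrow> 'k) poly"
  shows "poly Q (\<lambda>x. x n) y = poly (map_poly (\<lambda>a. a y) Q) (y n)"
  by (induction Q) (auto simp: map_poly_pCons)

lemma poly_fun_eval_upd:
  fixes Q :: "((nat \<Rightarrow> 'k::field) \<Rightarrow> 'k) poly"
  assumes "Q \<in> polys_over (poly_fun n)"
  shows "poly Q (\<lambda>x. x n) (x(n := z)) = poly (map_poly (\<lambda>a. a x) Q) z"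
proof -
  have "map_poly (\<lambda>a. a (x(n := z))) Q = map_poly (\<lambda>a. a x) Q"
  proof (rule poly_eqI)
    fix i
    have "Polynomial.coeff Q i (x(n := z)) = Polynomial.coeff Q i x"
      by (rule poly_fun_cong[OF polys_overD[OF assms]]) auto
    then show "Polynomial.coeff (map_poly (\<lambda>a. a (x(n := z))) Q) i = Polynomial.coeff (map_poly (\<lambda>a. a x) Q) i"
      by (simp add: coeff_map_poly)
  qed
  then show ?thesis by (simp add: poly_fun_eval)
qed

text \<open>
  Induction on the number of variables: a point at which the leading coefficient of the \<open>h\<close> of
  \<open>prime_over_polys_cases\<close> does not vanish is extended by a root of \<open>h\<close>.
\<close>

theorem prime_has_point:
  fixes Q :: "((nat \<Rightarrow> 'k::{alg_closed_field, field_char_0}) \<Rightarrow> 'k) set"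
  assumes "prime_in (poly_fun n) Q" "b \<in> poly_fun n" "b \<notin> Q"
  shows "\<exists>x \<in> {..<n} \<rightarrow>\<^sub>E UNIV. (\<forall>f\<in>Q. f x = 0) \<and> b x \<noteq> 0"
  using assms
proof (induction n arbitrary: Q b)
  case 0
  have const: "\<exists>c. p = (\<lambda>_. c)" if "p \<in> poly_fun 0" for p :: "(nat \<Rightarrow> 'k) \<Rightarrow> 'k"
    using that by induction auto
  have "p = 0" if p: "p \<in> Q" for p
  proof (rule ccontr)
    obtain c where c: "p = (\<lambda>_. c)" using p const prime_inD(1)[OF 0(1)] by blast
    assume "p \<noteq> 0"
    then have "(\<lambda>_. inverse c) * p = 1" using c by (auto simp: fun_eq_iff)
    then show False using prime_inD(3,5)[OF 0(1)] p poly_fun.const by metis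
  qed
  moreover obtain c where c: "b = (\<lambda>_. c)" using const[OF 0(2)] by blast
  moreover have "c \<noteq> 0"
    using c 0(3) prime_inD(2)[OF 0(1)] by (auto simp: zero_fun_def)
  \<comment> \<open>The only point of zero-dimensional affine space in the extensional
    encoding.\<close>
  ultimately show ?case by (intro bexI[of _ "\<lambda>_. undefined"]) (auto simp: zero_fun_def)
next
  case (Suc n)
  let ?A = "poly_fun n :: ((nat \<Rightarrow> 'k) \<Rightarrow> 'k) set" and ?ev = "\<lambda>F. poly F (\<lambda>x::nat \<Rightarrow> 'k. x n)"
  note A = subring_set_poly_fun[of n, where 'a='k] and P = subring_set_polys_over[OF subring_set_poly_fun[of n, where 'a='k]]
  have evP: "?ev F \<in> poly_fun (Suc n)" if "F \<in> polys_over ?A" for F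
    using that unfolding poly_fun_Suc by blast
  define R where "R = {F \<in> polys_over ?A. ?ev F \<in> Q}"
  have R: "prime_in (polys_over ?A) R"
    unfolding prime_in_def R_def
    using Suc.prems(1) P evP
    by (auto intro: subring_set_closed prime_inD dest: prime_inD(3,6))
  define p where "p = {a \<in> ?A. [:a:] \<in> R}"
  have p: "prime_in ?A p" unfolding p_def by (rule prime_in_consts[OF A R])
  obtain B where B: "B \<in> polys_over ?A" "b = ?ev B"
    using Suc.prems(2) unfolding poly_fun_Suc by auto
  have BR: "B \<notin> R" using B Suc.prems(3) by (auto simp: R_def)
  have Qev: "\<exists>F\<in>R. f = ?ev F" if "f \<in> Q" for f
    using that prime_inD(1)[OF Suc.prems(1)] unfolding poly_fun_Suc R_def by auto
  have upd: "x(n := z) \<in> {..<Suc n} \<rightarrow>\<^sub>E UNIV" if "x \<in> {..<n} \<rightarrow>\<^sub>E UNIV" for x :: "nat \<Rightarrow> 'k" and z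
    using that by (auto simp: PiE_def extensional_def)
  show ?case
  proof (rule prime_over_polys_cases[OF A R])
    \<comment> \<open>Here the elements of \<open>Q\<close> vanish along the whole line over a zero
      of \<open>p\<close>, so the last coordinate only has to avoid the finitely many roots of the
      specialised \<open>B\<close>.\<close>
    assume "R \<subseteq> polys_over {a \<in> ?A. [:a:] \<in> R}"
    then have tr: "Polynomial.coeff f i \<in> p" if "f \<in> R" for f i
      using that by (auto simp: p_def polys_over_def)
    have "\<exists>j. Polynomial.coeff B j \<notin> p"
      using polys_over_consts_in[OF A R, of B] BR unfolding p_def polys_over_def by blast
    then obtain j where j: "Polynomial.coeff B j \<notin> p" by blast
    then obtain x where x: "x \<in> {..<n} \<rightarrow>\<^sub>E UNIV" "\<And>f. f \<in> p \<Longrightarrow> f x = 0" "Polynomial.coeff B j x \<noteq> 0"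
      using Suc.IH[OF p, of "Polynomial.coeff B j"] polys_overD[OF B(1)] by blast
    let ?B = "map_poly (\<lambda>a. a x) B"
    have "?B \<noteq> 0" using x(3) by (auto simp: coeff_map_poly dest!: arg_cong[of _ _ "\<lambda>u. Polynomial.coeff u j"])
    then have "finite {z. poly ?B z = 0}" by (rule poly_roots_finite)
    moreover have "infinite (UNIV :: 'k set)" by (rule infinite_UNIV_char_0)
    ultimately obtain z where z: "poly ?B z \<noteq> 0" by (metis (mono_tags, lifting) UNIV_eq_I mem_Collect_eq)
    have "f (x(n := z)) = 0" if f: "f \<in> Q" for f
    proof -
      obtain F where F: "F \<in> R" "f = ?ev F" using Qev[OF f] by blast
      then have "map_poly (\<lambda>a. a x) F = 0"
        using tr[OF F(1)] x(2) by (intro poly_eqI) (auto simp: coeff_map_poly p_def)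
      then show ?thesis using F by (auto simp: R_def poly_fun_eval_upd)
    qed
    moreover have "b (x(n := z)) \<noteq> 0" using z B by (simp add: poly_fun_eval_upd)
    ultimately show ?thesis using upd[OF x(1)] by blast
  next
    fix h assume h: "h \<in> R" "Polynomial.lead_coeff h \<notin> {a \<in> ?A. [:a:] \<in> R}" "Polynomial.degree h > 0"
      and div: "\<And>f. f \<in> R \<Longrightarrow> \<exists>N s r. s \<in> polys_over ?A \<and> r \<in> polys_over {a \<in> ?A. [:a:] \<in> R} \<and>
        Polynomial.smult (Polynomial.lead_coeff h ^ N) f = h * s + r"
      and bez: "\<And>b. b \<in> polys_over ?A \<Longrightarrow> b \<notin> R \<Longrightarrow>
        \<exists>b' q a. b' \<in> polys_over ?A \<and> q \<in> R \<and> a \<in> ?A \<and> a \<notin> {a \<in> ?A. [:a:] \<in> R} \<and> [:a:] = b * b' + q"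
    let ?c = "Polynomial.lead_coeff h"
    have hP: "h \<in> polys_over ?A" using h by (auto simp: R_def)
    obtain B' q a where bz: "B' \<in> polys_over ?A" "q \<in> R" "a \<in> ?A" "a \<notin> p" "[:a:] = B * B' + q"
      using bez[OF B(1) BR] unfolding p_def by blast
    have cA: "?c \<in> ?A" using hP by (auto intro: polys_overD)
    \<comment> \<open>\<open>?c\<close> must not vanish at \<open>x\<close>, so that
      \<open>h\<close> keeps a positive degree there and has a root. \<open>a\<close> must not
      vanish, so that \<open>[:a:] = B * B' + q\<close> forces \<open>b\<close> to be nonzero at the
      extended point, where \<open>q\<close> vanishes.\<close>
    have "?c * a \<notin> p" using prime_inD(6)[OF p cA bz(3)] bz(4) h(2) unfolding p_def by blast
    from Suc.IH[OF p subring_set_mult[OF A cA bz(3)] this]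
    obtain x where x: "x \<in> {..<n} \<rightarrow>\<^sub>E UNIV" "\<And>f. f \<in> p \<Longrightarrow> f x = 0" "?c x \<noteq> 0" "a x \<noteq> 0"
      by auto
    have "Polynomial.degree (map_poly (\<lambda>a. a x) h) \<ge> Polynomial.degree h"
      by (rule le_degree) (use x(3) in \<open>simp add: coeff_map_poly\<close>)
    then obtain z where z: "poly (map_poly (\<lambda>a. a x) h) z = 0"
      using alg_closed_imp_poly_has_root[of "map_poly (\<lambda>a. a x) h"] h(3) by auto
    let ?y = "x(n := z)"
    have hz: "?ev h ?y = 0" using z hP by (simp add: poly_fun_eval_upd)
    have ay: "g ?y = g x" if "g \<in> ?A" for g by (rule poly_fun_cong[OF that]) auto
    have van: "?ev F ?y = 0" if F: "F \<in> R" for F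
    proof -
      obtain N s r where *: "s \<in> polys_over ?A" "\<forall>i. Polynomial.coeff r i \<in> p" "Polynomial.smult (?c ^ N) F = h * s + r"
        using div[OF F] unfolding p_def polys_over_def by blast
      have rP: "r \<in> polys_over ?A" using *(2) by (auto intro!: polys_overI simp: p_def)
      have "map_poly (\<lambda>a. a x) r = 0"
        using *(2) x(2) by (intro poly_eqI) (auto simp: coeff_map_poly)
      then have r0: "?ev r ?y = 0" using rP by (simp add: poly_fun_eval_upd)
      have "?ev (Polynomial.smult (?c ^ N) F) ?y = ?ev (h * s + r) ?y" using * by simp
      then have "(?c ^ N) ?y * ?ev F ?y = 0" using hz r0 by simp
      moreover have "(?c ^ N) ?y \<noteq> 0"
      proof -
        have "(f ^ m) w = f w ^ m" for f :: "(nat \<Rightarrow> 'k) \<Rightarrow> 'k" and m w by (induction m) auto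
        then show ?thesis using ay[OF cA] x(3) by simp
      qed
      ultimately show ?thesis by simp
    qed
    have "?ev [:a:] ?y = ?ev B ?y * ?ev B' ?y + ?ev q ?y" using bz(5) by simp
    then have "b ?y \<noteq> 0" using x(4) ay[OF bz(3)] van[OF bz(2)] B by auto
    moreover have "f ?y = 0" if "f \<in> Q" for f using Qev[OF that] van by blast
    ultimately show ?thesis using upd[OF x(1)] by blast
  qed
qed

text \<open>If no power of \<open>g\<close> were in the ideal, some prime would contain
  \<open>S\<close> and avoid \<open>g\<close>, and such a prime has a zero at which \<open>g\<close>
  does not vanish.\<close>

theorem nullstellensatz:
  fixes S :: "((nat \<Rightarrow> 'k::{alg_closed_field, field_char_0}) \<Rightarrow> 'k) set"
  assumes "S \<subseteq> poly_fun n" "g \<in> poly_fun n"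
    and "\<And>x. x \<in> {..<n} \<rightarrow>\<^sub>E UNIV \<Longrightarrow> (\<And>f. f \<in> S \<Longrightarrow> f x = 0) \<Longrightarrow> g x = 0"
  obtains N where "g ^ N \<in> ideal_span (poly_fun n) S"
proof (rule ccontr)
  assume "\<not> thesis"
  then have "\<And>N. g ^ N \<notin> ideal_span (poly_fun n) S" using that by blast
  then obtain Q where Q: "prime_in (poly_fun n) Q" "S \<subseteq> Q" "g \<notin> Q"
    using exists_prime_avoiding_powers[OF subring_set_poly_fun assms(1,2)] by metis
  then show False using prime_has_point[OF Q(1) assms(2) Q(3)] assms(3) by blast
qed

section \<open>Principal open sets of the Zariski topology\<close>

lemma topspace_zariski: "topspace (zariski_topology n V) = V"
proof -
  have "\<Union>{{x \<in> V. p x \<noteq> 0} |p. p \<in> poly_fun n} = V"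
  proof (intro equalityI subsetI)
    fix x assume "x \<in> V"
    then have "x \<in> {x \<in> V. (\<lambda>_. 1) x \<noteq> (0 :: 'a)}" by simp
    then show "x \<in> \<Union>{{x \<in> V. p x \<noteq> 0} |p. p \<in> poly_fun n}" using poly_fun.const[of 1 n] by blast
  qed auto
  then show ?thesis by (simp add: zariski_topology_def)
qed

lemma openin_zariski_basic: "p \<in> poly_fun n \<Longrightarrow> openin (zariski_topology n V) {x \<in> V. p x \<noteq> 0}"
  unfolding zariski_topology_def by (rule topology_generated_by_Basis) blast

text \<open>The generating sets are closed under intersection, by multiplying polynomials, and hence
  form a basis.\<close>

lemma zariski_basis:
  fixes V :: "(nat \<Rightarrow> 'k::field) set"
  assumes "openin (zariski_topology n V) W" "x \<in> W"
  obtains p where "p \<in> poly_fun n" "p x \<noteq> 0" "{y \<in> V. p y \<noteq> 0} \<subseteq> W"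
proof -
  have "generate_topology_on {{x \<in> V. p x \<noteq> 0} |p. p \<in> poly_fun n} W"
    using assms(1) by (simp add: zariski_topology_def openin_topology_generated_by_iff)
  then have "\<forall>x\<in>W. \<exists>p \<in> poly_fun n. p x \<noteq> 0 \<and> {y \<in> V. p y \<noteq> 0} \<subseteq> W"
  proof induction
    case (Int a b)
    show ?case
    proof
      fix x assume "x \<in> a \<inter> b"
      then obtain p q where "p \<in> poly_fun n" "p x \<noteq> 0" "{y \<in> V. p y \<noteq> 0} \<subseteq> a"
        "q \<in> poly_fun n" "q x \<noteq> 0" "{y \<in> V. q y \<noteq> 0} \<subseteq> b" using Int by blast
      then show "\<exists>p \<in> poly_fun n. p x \<noteq> 0 \<and> {y \<in> V. p y \<noteq> 0} \<subseteq> a \<inter> b"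
        by (intro bexI[of _ "\<lambda>x. p x * q x"]) (auto intro: poly_fun.mult)
    qed
  qed blast+
  then show ?thesis using assms(2) that by blast
qed

section \<open>Affine charts\<close>

text \<open>The content of an isomorphism with an affine algebraic set, transported to
  \<open>U\<close>: the inverse map and the topology of the model no longer occur, and everything is
  expressed by polynomial functions composed with \<open>h\<close>.\<close>

definition chart :: "('a, 'k::field) function_space \<Rightarrow> 'a set \<Rightarrow> nat \<Rightarrow> ('a \<Rightarrow> nat \<Rightarrow> 'k) \<Rightarrow> bool"
  where "chart \<V> U n h \<longleftrightarrow> openin (top_of \<V>) U \<and> algebraic_set n (h ` U) \<and>
    (\<forall>p \<in> poly_fun n. \<forall>q \<in> poly_fun n. openin (top_of \<V>) {y \<in> U. q (h y) \<noteq> 0} \<and>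
      (\<lambda>y\<in>{y \<in> U. q (h y) \<noteq> 0}. p (h y) / q (h y)) \<in> regular \<V> {y \<in> U. q (h y) \<noteq> 0}) \<and>
    (\<forall>W x. openin (top_of \<V>) W \<longrightarrow> W \<subseteq> U \<longrightarrow> x \<in> W \<longrightarrow>
      (\<exists>p \<in> poly_fun n. p (h x) \<noteq> 0 \<and> {y \<in> U. p (h y) \<noteq> 0} \<subseteq> W)) \<and>
    (\<forall>W f x. openin (top_of \<V>) W \<longrightarrow> W \<subseteq> U \<longrightarrow> f \<in> regular \<V> W \<longrightarrow> x \<in> W \<longrightarrow>
      (\<exists>p \<in> poly_fun n. \<exists>q \<in> poly_fun n. q (h x) \<noteq> 0 \<and> {y \<in> U. q (h y) \<noteq> 0} \<subseteq> W \<and>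
        (\<forall>y \<in> U. q (h y) \<noteq> 0 \<longrightarrow> f y = p (h y) / q (h y))))"

lemma chartD:
  assumes "chart \<V> U n h"
  shows chart_open: "openin (top_of \<V>) U"
    and chart_algebraic: "algebraic_set n (h ` U)"
    and chart_basic_open: "q \<in> poly_fun n \<Longrightarrow> openin (top_of \<V>) {y \<in> U. q (h y) \<noteq> 0}"
    and chart_quotient: "p \<in> poly_fun n \<Longrightarrow> q \<in> poly_fun n \<Longrightarrow>
      (\<lambda>y\<in>{y \<in> U. q (h y) \<noteq> 0}. p (h y) / q (h y)) \<in> regular \<V> {y \<in> U. q (h y) \<noteq> 0}"
proof -
  note c = assms[unfolded chart_def]
  show "openin (top_of \<V>) U" "algebraic_set n (h ` U)"
    by (rule c[THEN conjunct1], rule c[THEN conjunct2, THEN conjunct1])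
  note c3 = c[THEN conjunct2, THEN conjunct2, THEN conjunct1, rule_format]
  show "openin (top_of \<V>) {y \<in> U. q (h y) \<noteq> 0}" if "q \<in> poly_fun n"
    using c3[OF poly_fun.const that] by blast
  show "(\<lambda>y\<in>{y \<in> U. q (h y) \<noteq> 0}. p (h y) / q (h y)) \<in> regular \<V> {y \<in> U. q (h y) \<noteq> 0}"
    if "p \<in> poly_fun n" "q \<in> poly_fun n"
    using c3[OF that] by blast
qed

lemma chart_basis:
  assumes "chart \<V> U n h" "openin (top_of \<V>) W" "W \<subseteq> U" "x \<in> W"
  obtains p where "p \<in> poly_fun n" "p (h x) \<noteq> 0" "{y \<in> U. p (h y) \<noteq> 0} \<subseteq> W"
  using assms(1)[unfolded chart_def, THEN conjunct2, THEN conjunct2, THEN conjunct2, THEN conjunct1,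
      rule_format, OF assms(2-4)] that by blast

lemma chart_fraction:
  assumes "chart \<V> U n h" "openin (top_of \<V>) W" "W \<subseteq> U" "f \<in> regular \<V> W" "x \<in> W"
  obtains p q where "p \<in> poly_fun n" "q \<in> poly_fun n" "q (h x) \<noteq> 0" "{y \<in> U. q (h y) \<noteq> 0} \<subseteq> W"
    "\<And>y. y \<in> U \<Longrightarrow> q (h y) \<noteq> 0 \<Longrightarrow> f y = p (h y) / q (h y)"
  using assms(1)[unfolded chart_def, THEN conjunct2, THEN conjunct2, THEN conjunct2, THEN conjunct2,
      rule_format, OF assms(2-5)] that by blast

lemma affine_imp_chart:
  assumes aff: "affine (open_subspace \<V> U)" and U: "openin (top_of \<V>) U"
  shows "\<exists>n h. chart \<V> U n h"
proof -
  let ?O = "open_subspace \<V> U"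
  obtain n V h g where alg: "algebraic_set n V" and mh: "morphism ?O (affine_model n V) h"
    and mg: "morphism (affine_model n V) ?O g"
    and gh': "\<forall>x \<in> points ?O. g (h x) = x" and hg': "\<forall>y \<in> points (affine_model n V). h (g y) = y"
    using aff unfolding affine_def isomorphic_def by blast
  have ptO: "points ?O = U" using openin_subset[OF U] by (auto simp: open_subspace_def)
  have topO: "openin (top_of ?O) W \<longleftrightarrow> openin (top_of \<V>) W \<and> W \<subseteq> U" for W
    using U by (simp add: open_subspace_def openin_open_subtopology)
  have regO: "regular ?O = regular \<V>" by (simp add: open_subspace_def)
  have topM: "top_of (affine_model n V) = zariski_topology n V"
    and regM: "regular (affine_model n V) = affine_regular n V" by (auto simp: affine_model_def)
  have gh: "\<And>x. x \<in> U \<Longrightarrow> g (h x) = x" and hg: "\<And>y. y \<in> V \<Longrightarrow> h (g y) = y"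
    using gh' hg' by (auto simp: ptO topM topspace_zariski)
  have hV: "h x \<in> V" if "x \<in> U" for x
    using mh that by (auto simp: morphism_def topM topspace_zariski ptO dest!: continuous_map_funspace)
  have gU: "g v \<in> U" if "v \<in> V" for v
    using mg that by (auto simp: morphism_def topM topspace_zariski ptO dest!: continuous_map_funspace)
  have "h ` U = V" using hV gU hg by (metis image_iff image_subsetI subsetI subset_antisym)
  moreover have "openin (top_of \<V>) {y \<in> U. q (h y) \<noteq> 0}" if "q \<in> poly_fun n" for q
  proof -
    have "openin (top_of ?O) {x \<in> points ?O. h x \<in> {x \<in> V. q x \<noteq> 0}}"
      using mh openin_zariski_basic[OF that, of V] unfolding morphism_def topM
      by (intro openin_continuous_map_preimage) auto
    also have "{x \<in> points ?O. h x \<in> {x \<in> V. q x \<noteq> 0}} = {y \<in> U. q (h y) \<noteq> 0}"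
      using hV ptO by auto
    finally show ?thesis using topO by blast
  qed
  moreover have "(\<lambda>y\<in>{y \<in> U. q (h y) \<noteq> 0}. p (h y) / q (h y)) \<in> regular \<V> {y \<in> U. q (h y) \<noteq> 0}"
    if pq: "p \<in> poly_fun n" "q \<in> poly_fun n" for p q
  proof -
    let ?W = "{x \<in> V. q x \<noteq> 0}" and ?f = "\<lambda>y\<in>{x \<in> V. q x \<noteq> 0}. p y / q y"
    have "?f \<in> affine_regular n V ?W"
      unfolding affine_regular_def
    proof (intro CollectI conjI ballI exI)
      show "openin (zariski_topology n V) ?W" by (rule openin_zariski_basic[OF pq(2)])
      show "p \<in> poly_fun n" "q \<in> poly_fun n" by (rule pq)+
    qed auto
    then have "restrict (?f \<circ> h) {x \<in> points ?O. h x \<in> ?W} \<in> regular ?O {x \<in> points ?O. h x \<in> ?W}"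
      using mh openin_zariski_basic[OF pq(2), of V] unfolding morphism_def topM regM by blast
    moreover have "{x \<in> points ?O. h x \<in> ?W} = {y \<in> U. q (h y) \<noteq> 0}" using hV ptO by auto
    moreover have "restrict (?f \<circ> h) {y \<in> U. q (h y) \<noteq> 0} = (\<lambda>y\<in>{y \<in> U. q (h y) \<noteq> 0}. p (h y) / q (h y))"
      using hV by (auto simp: fun_eq_iff)
    ultimately show ?thesis by (simp add: regO)
  qed
  moreover have pull: "openin (zariski_topology n V) {v \<in> V. g v \<in> W}"
    if "openin (top_of \<V>) W" "W \<subseteq> U" for W
  proof -
    have "openin (top_of (affine_model n V)) {v \<in> points (affine_model n V). g v \<in> W}"
    proof (rule openin_continuous_map_preimage)
      show "continuous_map (top_of (affine_model n V)) (top_of ?O) g" using mg by (simp add: morphism_def)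
      show "openin (top_of ?O) W" using that topO by blast
    qed
    then show ?thesis by (simp add: topM topspace_zariski)
  qed
  moreover have "\<exists>p \<in> poly_fun n. p (h x) \<noteq> 0 \<and> {y \<in> U. p (h y) \<noteq> 0} \<subseteq> W"
    if W: "openin (top_of \<V>) W" "W \<subseteq> U" "x \<in> W" for W x
  proof -
    have hx: "h x \<in> {v \<in> V. g v \<in> W}" using W gh hV by auto
    obtain p where p: "p \<in> poly_fun n" "p (h x) \<noteq> 0" "{y \<in> V. p y \<noteq> 0} \<subseteq> {v \<in> V. g v \<in> W}"
      by (rule zariski_basis[OF pull[OF W(1,2)] hx])
    have "y \<in> W" if "y \<in> U" "p (h y) \<noteq> 0" for y
    proof -
      have "h y \<in> {y \<in> V. p y \<noteq> 0}" using that hV by simp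
      then have "g (h y) \<in> W" using p(3) by blast
      then show ?thesis using gh that(1) by simp
    qed
    then show ?thesis using p by blast
  qed
  moreover have "\<exists>p \<in> poly_fun n. \<exists>q \<in> poly_fun n. q (h x) \<noteq> 0 \<and> {y \<in> U. q (h y) \<noteq> 0} \<subseteq> W \<and>
        (\<forall>y \<in> U. q (h y) \<noteq> 0 \<longrightarrow> f y = p (h y) / q (h y))"
    if W: "openin (top_of \<V>) W" "W \<subseteq> U" "f \<in> regular \<V> W" "x \<in> W" for W f x
  proof -
    let ?G = "{v \<in> V. g v \<in> W}"
    have "restrict (f \<circ> g) {v \<in> points (affine_model n V). g v \<in> W} \<in>
      regular (affine_model n V) {v \<in> points (affine_model n V). g v \<in> W}"
      using mg W topO unfolding morphism_def regO by blast
    then have r: "restrict (f \<circ> g) ?G \<in> affine_regular n V ?G"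
      by (simp add: topM regM topspace_zariski)
    have hx: "h x \<in> ?G" using W gh hV by auto
    obtain O' p q where O': "openin (zariski_topology n V) O'" "h x \<in> O'" "O' \<subseteq> ?G"
      "p \<in> poly_fun n" "q \<in> poly_fun n" "\<forall>y \<in> O'. q y \<noteq> 0 \<and> restrict (f \<circ> g) ?G y = p y / q y"
      using r hx unfolding affine_regular_def by blast
    obtain r where r: "r \<in> poly_fun n" "r (h x) \<noteq> 0" "{y \<in> V. r y \<noteq> 0} \<subseteq> O'"
      by (rule zariski_basis[OF O'(1,2)])
    have *: "y \<in> W \<and> f y = p (h y) / q (h y)" if "y \<in> U" "r (h y) \<noteq> 0" for y
    proof -
      have "h y \<in> O'" using r(3) that hV by auto
      then have "h y \<in> ?G" "restrict (f \<circ> g) ?G (h y) = p (h y) / q (h y)" using O' by auto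
      then show ?thesis using gh that by auto
    qed
    \<comment> \<open>The quotient formula is known on \<open>O'\<close> only. Expanding the
      fraction by \<open>r\<close> replaces its domain by a principal open set inside
      \<open>O'\<close>.\<close>
    show ?thesis
    proof (rule bexI[of _ "\<lambda>x. p x * r x"], rule bexI[of _ "\<lambda>x. q x * r x"], intro conjI)
      show "(\<lambda>x. p x * r x) \<in> poly_fun n" "(\<lambda>x. q x * r x) \<in> poly_fun n"
        using O' r by (auto intro: poly_fun.mult)
      show "q (h x) * r (h x) \<noteq> 0" using r O' by auto
      show "{y \<in> U. q (h y) * r (h y) \<noteq> 0} \<subseteq> W" using * by auto
      show "\<forall>y\<in>U. q (h y) * r (h y) \<noteq> 0 \<longrightarrow> f y = p (h y) * r (h y) / (q (h y) * r (h y))"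
        using * by auto
    qed
  qed
  ultimately have "chart \<V> U n h"
    unfolding chart_def using U alg by blast
  then show ?thesis by blast
qed

context variety
begin

lemma chart_at:
  assumes "x \<in> points \<V>"
  obtains U n h where "chart \<V> U n h" "x \<in> U"
  using finite_affine_cover assms affine_imp_chart by (metis Union_iff)

text \<open>Otherwise the complements would be two closed sets covering \<open>P\<close>. It is this
  form of irreducibility that gives functions near \<open>P\<close> a common domain.\<close>

lemma open_meet:
  assumes "irreducible_in (top_of \<V>) P" "openin (top_of \<V>) A" "openin (top_of \<V>) B"
    and "A \<inter> P \<noteq> {}" "B \<inter> P \<noteq> {}"
  shows "A \<inter> B \<inter> P \<noteq> {}"
proof
  assume "A \<inter> B \<inter> P = {}"
  then have "P \<subseteq> (points \<V> - A) \<union> (points \<V> - B)"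
    using assms(1) unfolding irreducible_in_def by blast
  then have "P \<subseteq> points \<V> - A \<or> P \<subseteq> points \<V> - B"
    using assms(1-3) unfolding irreducible_in_def by blast
  then show False using assms(4,5) by blast
qed

lemma open_meet_points:
  assumes "openin (top_of \<V>) A" "openin (top_of \<V>) B" "A \<noteq> {}" "B \<noteq> {}"
  shows "A \<inter> B \<noteq> {}"
  using open_meet[OF irreducible_points assms(1,2)] assms openin_subset by blast

lemma nonzero_locus_open:
  assumes W: "openin (top_of \<V>) W" and f: "f \<in> regular \<V> W"
  shows "openin (top_of \<V>) {x \<in> W. f x \<noteq> 0}"
proof (subst openin_subopen, rule ballI)
  fix x assume x: "x \<in> {x \<in> W. f x \<noteq> 0}"
  then obtain U n h where U: "chart \<V> U n h" "x \<in> U" using chart_at openin_subset[OF W] by blast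
  have WU: "openin (top_of \<V>) (W \<inter> U)" and xWU: "x \<in> W \<inter> U"
    using W chart_open[OF U(1)] x U(2) by blast+
  obtain p q where pq: "p \<in> poly_fun n" "q \<in> poly_fun n" "q (h x) \<noteq> 0" "{y \<in> U. q (h y) \<noteq> 0} \<subseteq> W \<inter> U"
    "\<And>y. y \<in> U \<Longrightarrow> q (h y) \<noteq> 0 \<Longrightarrow> restrict f (W \<inter> U) y = p (h y) / q (h y)"
    by (rule chart_fraction[OF U(1) WU Int_lower2 regular_restrict[OF W WU Int_lower1 f] xWU]) blast
  have fy: "f y = p (h y) / q (h y)" if "y \<in> U" "q (h y) \<noteq> 0" for y
    using pq(4) pq(5)[OF that] that by auto
  show "\<exists>S. openin (top_of \<V>) S \<and> x \<in> S \<and> S \<subseteq> {x \<in> W. f x \<noteq> 0}"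
  proof (intro exI conjI)
    show "openin (top_of \<V>) {y \<in> U. (p * q) (h y) \<noteq> 0}"
      by (rule chart_basic_open[OF U(1) poly_fun_mult[OF pq(1,2)]])
    show "x \<in> {y \<in> U. (p * q) (h y) \<noteq> 0}" using x U(2) pq(3) fy[OF U(2) pq(3)] by auto
    show "{y \<in> U. (p * q) (h y) \<noteq> 0} \<subseteq> {x \<in> W. f x \<noteq> 0}" using pq(4) fy by auto
  qed
qed

lemma regular_inverse:
  assumes W: "openin (top_of \<V>) W" and f: "f \<in> regular \<V> W" and nz: "\<And>x. x \<in> W \<Longrightarrow> f x \<noteq> 0"
  shows "(\<lambda>x\<in>W. inverse (f x)) \<in> regular \<V> W"
proof (rule regular_glue[OF W])
  fix x assume x: "x \<in> W"
  then obtain U n h where U: "chart \<V> U n h" "x \<in> U" using chart_at openin_subset[OF W] by blast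
  have WU: "openin (top_of \<V>) (W \<inter> U)" and xWU: "x \<in> W \<inter> U"
    using W chart_open[OF U(1)] x U(2) by blast+
  obtain p q where pq: "p \<in> poly_fun n" "q \<in> poly_fun n" "q (h x) \<noteq> 0" "{y \<in> U. q (h y) \<noteq> 0} \<subseteq> W \<inter> U"
    "\<And>y. y \<in> U \<Longrightarrow> q (h y) \<noteq> 0 \<Longrightarrow> restrict f (W \<inter> U) y = p (h y) / q (h y)"
    by (rule chart_fraction[OF U(1) WU Int_lower2 regular_restrict[OF W WU Int_lower1 f] xWU]) blast
  have fy: "f y = p (h y) / q (h y)" if "y \<in> U" "q (h y) \<noteq> 0" for y
    using pq(4) pq(5)[OF that] that by auto
  let ?S = "{y \<in> U. (p * q) (h y) \<noteq> 0}"
  have S: "?S \<subseteq> W" using pq(4) by auto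
  show "\<exists>S. openin (top_of \<V>) S \<and> x \<in> S \<and> S \<subseteq> W \<and>
    restrict (\<lambda>x\<in>W. inverse (f x)) S \<in> regular \<V> S"
  proof (intro exI conjI)
    show "openin (top_of \<V>) ?S"
      by (rule chart_basic_open[OF U(1) poly_fun_mult[OF pq(1,2)]])
    show "x \<in> ?S" using x U(2) pq(3) fy[OF U(2) pq(3)] nz by auto
    show "?S \<subseteq> W" by (rule S)
    \<comment> \<open>The inverse is \<open>q / p\<close>, expanded by \<open>q\<close>: with
      denominator \<open>p * q\<close> its domain is a principal open set on which the formula for
      \<open>f\<close> is valid.\<close>
    have "restrict (\<lambda>x\<in>W. inverse (f x)) ?S = (\<lambda>y\<in>?S. (q * q) (h y) / (p * q) (h y))"
    proof (rule restrict_ext)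
      fix y assume y: "y \<in> ?S"
      then have "f y = p (h y) / q (h y)" using fy by auto
      then show "(\<lambda>x\<in>W. inverse (f x)) y = (q * q) (h y) / (p * q) (h y)" using y S by auto
    qed
    then show "restrict (\<lambda>x\<in>W. inverse (f x)) ?S \<in> regular \<V> ?S"
      using chart_quotient[OF U(1) poly_fun_mult[OF pq(2,2)] poly_fun_mult[OF pq(1,2)]] by simp
  qed
qed auto

section \<open>Noetherian topology\<close>

text \<open>The ideals of polynomial functions vanishing on \<open>Z k \<inter> U\<close> increase
  and stabilise by Hilbert's basis theorem. They determine the closed sets: a point of
  \<open>U\<close> off \<open>Z k\<close> has a principal neighbourhood avoiding \<open>Z k\<close>,
  whose polynomial is in the ideal of \<open>Z k\<close> and nonzero at the point.\<close>

lemma chart_dcc: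
  assumes U: "chart \<V> U n h" and cl: "\<And>k. closedin (top_of \<V>) (Z k)" and dec: "\<And>k. Z (Suc k) \<subseteq> Z k"
  shows "\<exists>K. \<forall>k\<ge>K. Z k \<inter> U = Z K \<inter> U"
proof -
  define I where "I k = {p \<in> poly_fun n. \<forall>y \<in> Z k \<inter> U. p (h y) = 0}" for k
  have Zm: "Z k \<subseteq> Z m" if "m \<le> k" for m k using lift_Suc_antimono_le[of Z, OF dec that] .
  then have Im: "I m \<subseteq> I k" if "m \<le> k" for m k using that unfolding I_def by fast
  obtain Y where Y: "Y \<subseteq> (\<Union>k. I k)" "finite Y" "(\<Union>k. I k) \<subseteq> ideal_span (poly_fun n) Y"
    using noetherian_poly_fun[of n, where 'k='b] unfolding noetherian_set_def I_def
    by (metis (no_types, lifting) UN_least mem_Collect_eq subsetI)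
  have "\<forall>y\<in>Y. \<exists>k. y \<in> I k" using Y(1) by blast
  then obtain k where k: "\<And>y. y \<in> Y \<Longrightarrow> y \<in> I (k y)" by metis
  define K where "K = Max (insert 0 (k ` Y))"
  have YK: "y \<in> I K" if "y \<in> Y" for y
  proof -
    have "k y \<le> K" unfolding K_def using Y(2) that by (intro Max_ge) auto
    then show ?thesis using k[OF that] Im by blast
  qed
  have IK: "I k \<subseteq> I K" for k
  proof
    fix p assume "p \<in> I k"
    then have p: "p \<in> ideal_span (poly_fun n) Y" "p \<in> poly_fun n" using Y(3) by (auto simp: I_def)
    have "p \<in> {p. \<forall>y \<in> Z K \<inter> U. p (h y) = 0}"
      using p(1) by (rule ideal_span_least) (use YK in \<open>auto simp: I_def\<close>)
    then show "p \<in> I K" using p(2) by (auto simp: I_def)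
  qed
  have "Z k \<inter> U = Z K \<inter> U" if "k \<ge> K" for k
  proof
    show "Z k \<inter> U \<subseteq> Z K \<inter> U" using Zm[OF that] by blast
    show "Z K \<inter> U \<subseteq> Z k \<inter> U"
    proof (rule ccontr)
      assume "\<not> ?thesis"
      then obtain x where x: "x \<in> Z K" "x \<in> U" "x \<notin> Z k" by blast
      have "openin (top_of \<V>) (U - Z k)" using chart_open[OF U] cl by blast
      then obtain p where p: "p \<in> poly_fun n" "p (h x) \<noteq> 0" "{y \<in> U. p (h y) \<noteq> 0} \<subseteq> U - Z k"
        using chart_basis[OF U, of "U - Z k" x] x by blast
      then have "p \<in> I k" by (auto simp: I_def)
      then have "p \<in> I K" using IK by blast
      then show False using x p by (auto simp: I_def)
    qed
  qed
  then show ?thesis by blast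
qed

text \<open>Finitely many charts cover the variety, so the stages at which the traces on them
  stabilise have a maximum.\<close>

lemma closed_dcc:
  assumes cl: "\<And>k. closedin (top_of \<V>) (Z k)" and dec: "\<And>k. Z (Suc k) \<subseteq> Z k"
  shows "\<exists>k. Z (Suc k) = Z k"
proof -
  obtain \<U> where \<U>: "finite \<U>" "\<Union>\<U> = points \<V>"
      "\<And>U. U \<in> \<U> \<Longrightarrow> openin (top_of \<V>) U \<and> affine (open_subspace \<V> U)"
    using finite_affine_cover by blast
  have "\<forall>U\<in>\<U>. \<exists>K. \<forall>k\<ge>K. Z k \<inter> U = Z K \<inter> U"
  proof
    fix U assume "U \<in> \<U>"
    then obtain n h where "chart \<V> U n h" using \<U>(3) affine_imp_chart by blast
    then show "\<exists>K. \<forall>k\<ge>K. Z k \<inter> U = Z K \<inter> U" by (rule chart_dcc) (use cl dec in auto)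
  qed
  then obtain K where K: "\<And>U k. U \<in> \<U> \<Longrightarrow> k \<ge> K U \<Longrightarrow> Z k \<inter> U = Z (K U) \<inter> U" by metis
  define M where "M = Max (insert 0 (K ` \<U>))"
  have "K U \<le> M" if "U \<in> \<U>" for U unfolding M_def using \<U>(1) that by (intro Max_ge) auto
  then have "Z (Suc M) \<inter> U = Z M \<inter> U" if "U \<in> \<U>" for U
    using K[OF that, of M] K[OF that, of "Suc M"] that le_SucI by metis
  then have "Z (Suc M) \<inter> \<Union>\<U> = Z M \<inter> \<Union>\<U>" by blast
  moreover have "Z k \<subseteq> \<Union>\<U>" for k using closedin_subset[OF cl] \<U>(2) by simp
  ultimately show ?thesis by blast
qed

text \<open>Noetherian induction on closed sets: a reducible set is cut by two closed sets into
  strictly smaller ones.\<close>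

lemma closed_components:
  assumes "closedin (top_of \<V>) Z"
  shows "\<exists>\<C>. finite \<C> \<and> Z = \<Union>\<C> \<and> (\<forall>Y\<in>\<C>. closedin (top_of \<V>) Y \<and> irreducible_in (top_of \<V>) Y)"
proof -
  let ?r = "{(A, B). closedin (top_of \<V>) A \<and> closedin (top_of \<V>) B \<and> A \<subset> B}"
  have "wf ?r"
    unfolding wf_iff_no_infinite_down_chain
  proof
    assume "\<exists>f. \<forall>i. (f (Suc i), f i) \<in> ?r"
    then obtain f where "\<forall>i. (f (Suc i), f i) \<in> ?r" ..
    then have f: "closedin (top_of \<V>) (f i)" "f (Suc i) \<subset> f i" for i by auto
    have "\<exists>k. f (Suc k) = f k" by (rule closed_dcc) (use f in auto)
    then show False using f(2) by blast
  qed
  then show ?thesis using assms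
  proof (induction Z rule: wf_induct_rule)
    case (less Z)
    consider "Z = {}" | "irreducible_in (top_of \<V>) Z" | "Z \<noteq> {}" "\<not> irreducible_in (top_of \<V>) Z" by blast
    then show ?case
    proof cases
      case 1
      then show ?thesis by (intro exI[of _ "{}"]) auto
    next
      case 2
      then show ?thesis using less(2) by (intro exI[of _ "{Z}"]) auto
    next
      case 3
      then obtain A B where AB: "closedin (top_of \<V>) A" "closedin (top_of \<V>) B" "Z \<subseteq> A \<union> B"
        "\<not> Z \<subseteq> A" "\<not> Z \<subseteq> B" using closedin_subset[OF less(2)] unfolding irreducible_in_def by blast
      then have "(Z \<inter> A, Z) \<in> ?r" "(Z \<inter> B, Z) \<in> ?r" using less(2) by auto
      with less(1) obtain \<A> \<B> where
        "finite \<A> \<and> Z \<inter> A = \<Union>\<A> \<and> (\<forall>Y\<in>\<A>. closedin (top_of \<V>) Y \<and> irreducible_in (top_of \<V>) Y)"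
        "finite \<B> \<and> Z \<inter> B = \<Union>\<B> \<and> (\<forall>Y\<in>\<B>. closedin (top_of \<V>) Y \<and> irreducible_in (top_of \<V>) Y)"
        using less(2) AB by (metis (no_types, lifting) closedin_Int)
      moreover have "Z = (Z \<inter> A) \<union> (Z \<inter> B)" using AB(3) by blast
      ultimately show ?thesis by (intro exI[of _ "\<A> \<union> \<B>"]) (metis Un_iff Union_Un_distrib finite_UnI)
    qed
  qed
qed

lemma irreducible_subset_Union:
  assumes "irreducible_in (top_of \<V>) P" "finite \<C>" "P \<subseteq> \<Union>\<C>" "\<And>Y. Y \<in> \<C> \<Longrightarrow> closedin (top_of \<V>) Y"
  shows "\<exists>Y\<in>\<C>. P \<subseteq> Y"
  using assms(2-4)
proof (induction \<C> rule: finite_induct)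
  case empty
  then show ?case using assms(1) by (auto simp: irreducible_in_def)
next
  case (insert Y \<C>)
  then have "closedin (top_of \<V>) Y" "closedin (top_of \<V>) (\<Union>\<C>)" "P \<subseteq> Y \<union> \<Union>\<C>"
    by (auto intro!: closedin_Union)
  then have "P \<subseteq> Y \<or> P \<subseteq> \<Union>\<C>" using assms(1) unfolding irreducible_in_def by blast
  then show ?case using insert by blast
qed

lemma prime_divisorD:
  assumes "P \<in> prime_divisors \<V>"
  shows "closedin (top_of \<V>) P" "irreducible_in (top_of \<V>) P" "P \<subset> points \<V>" "P \<noteq> {}"
    "\<And>Z. closedin (top_of \<V>) Z \<Longrightarrow> irreducible_in (top_of \<V>) Z \<Longrightarrow> P \<subseteq> Z \<Longrightarrow> Z \<noteq> points \<V> \<Longrightarrow> Z = P"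
proof -
  from assms show 1: "closedin (top_of \<V>) P" "irreducible_in (top_of \<V>) P" "P \<subset> points \<V>"
    unfolding prime_divisors_def by simp_all
  then show "P \<noteq> {}" by (simp add: irreducible_in_def)
  fix Z assume Z: "closedin (top_of \<V>) Z" "irreducible_in (top_of \<V>) Z" "P \<subseteq> Z" "Z \<noteq> points \<V>"
  have "\<not> (closedin (top_of \<V>) Z \<and> irreducible_in (top_of \<V>) Z \<and> P \<subset> Z \<and> Z \<subset> points \<V>)"
    using assms unfolding prime_divisors_def by simp
  then show "Z = P" using Z closedin_subset[OF Z(1)] by blast
qed

text \<open>A prime divisor that misses \<open>U\<close> is contained in one of the finitely many
  irreducible closed sets making up the complement, and codimension one makes it equal to that
  set.\<close>

lemma finite_prime_divisors_missing:
  assumes "openin (top_of \<V>) U" "U \<noteq> {}"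
  shows "finite {P \<in> prime_divisors \<V>. P \<inter> U = {}}"
proof -
  have "closedin (top_of \<V>) (points \<V> - U)" using assms(1) by blast
  from closed_components[OF this] obtain \<C> where \<C>: "finite \<C>" "points \<V> - U = \<Union>\<C>"
    "\<forall>Y\<in>\<C>. closedin (top_of \<V>) Y \<and> irreducible_in (top_of \<V>) Y"
    by (elim exE conjE)
  have "P \<in> \<C>" if P: "P \<in> prime_divisors \<V>" "P \<inter> U = {}" for P
  proof -
    have "P \<subseteq> \<Union>\<C>" using prime_divisorD(3)[OF P(1)] P(2) \<C>(2) by blast
    then obtain Y where Y: "Y \<in> \<C>" "P \<subseteq> Y"
      using irreducible_subset_Union[OF prime_divisorD(2)[OF P(1)] \<C>(1) _ \<C>(3)[rule_format, THEN conjunct1]] by blast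
    have "Y \<noteq> points \<V>" using Y(1) \<C>(2) assms openin_subset by blast
    then show ?thesis using prime_divisorD(5)[OF P(1) _ _ Y(2)] \<C>(3) Y(1) by simp
  qed
  then have "{P \<in> prime_divisors \<V>. P \<inter> U = {}} \<subseteq> \<C>" by blast
  then show ?thesis using \<C>(1) finite_subset by blast
qed

end

section \<open>Discrete valuation rings inside a field\<close>

text \<open>The counterpart of \<open>ideal_span\<close> for rings given as records, such as the
  function field.\<close>

inductive_set lin_span :: "('r, 'm) ring_scheme \<Rightarrow> 'r set \<Rightarrow> 'r set \<Rightarrow> 'r set" for R A Y
  where
    zero: "\<zero>\<^bsub>R\<^esub> \<in> lin_span R A Y"
  | step: "z \<in> lin_span R A Y \<Longrightarrow> a \<in> A \<Longrightarrow> y \<in> Y \<Longrightarrow> a \<otimes>\<^bsub>R\<^esub> y \<oplus>\<^bsub>R\<^esub> z \<in> lin_span R A Y"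

lemma lin_span_mono: "u \<in> lin_span R A Z \<Longrightarrow> Z \<subseteq> Y \<Longrightarrow> u \<in> lin_span R A Y"
  by (induction rule: lin_span.induct) (auto intro: lin_span.intros)

context field
begin

lemma inv_nonzero:
  assumes "x \<in> carrier R" "x \<noteq> \<zero>"
  shows "inv x \<in> carrier R" "x \<otimes> inv x = \<one>" "inv x \<otimes> x = \<one>" "inv x \<noteq> \<zero>"
proof -
  have x: "x \<in> Units R" using assms by (simp add: field_Units)
  show "inv x \<in> carrier R" "x \<otimes> inv x = \<one>" "inv x \<otimes> x = \<one>" using x by simp_all
  then show "inv x \<noteq> \<zero>" using assms by auto
qed

lemma mult_inv_cancel:
  assumes "x \<in> carrier R" "x \<noteq> \<zero>" "y \<in> carrier R"
  shows "y \<otimes> inv x \<otimes> x = y" "y \<otimes> x \<otimes> inv x = y" "x \<otimes> (inv x \<otimes> y) = y" "inv x \<otimes> (x \<otimes> y) = y"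
proof -
  note i = inv_nonzero[OF assms(1,2)]
  show "y \<otimes> inv x \<otimes> x = y" using i assms m_assoc[of y "inv x" x] by simp
  show "y \<otimes> x \<otimes> inv x = y" using i assms m_assoc[of y x "inv x"] by simp
  show "x \<otimes> (inv x \<otimes> y) = y" using i assms m_assoc[of x "inv x" y] by simp
  show "inv x \<otimes> (x \<otimes> y) = y" using i assms m_assoc[of "inv x" x y] by simp
qed

lemma nonzero_mult: "x \<in> carrier R \<Longrightarrow> y \<in> carrier R \<Longrightarrow> x \<noteq> \<zero> \<Longrightarrow> y \<noteq> \<zero> \<Longrightarrow> x \<otimes> y \<noteq> \<zero>"
  using integral by blast

lemma inv_mult_nonzero:
  assumes "x \<in> carrier R" "y \<in> carrier R" "x \<noteq> \<zero>" "y \<noteq> \<zero>"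
  shows "inv (x \<otimes> y) = inv x \<otimes> inv y"
proof -
  have "(x \<otimes> y) \<otimes> (inv x \<otimes> inv y) = (x \<otimes> inv x) \<otimes> (y \<otimes> inv y)"
    using inv_nonzero assms by (simp add: m_ac)
  then have "(x \<otimes> y) \<otimes> (inv x \<otimes> inv y) = \<one>" using inv_nonzero assms by simp
  then show ?thesis using inv_nonzero assms by (intro comm_inv_char) auto
qed

lemma units_of_int_pow:
  assumes "x \<in> Units R"
  shows "x [^]\<^bsub>units_of R\<^esub> (n::int) = x [^] n"
  unfolding int_pow_def2 units_of_pow[OF assms] units_of_inv[OF Units_pow_closed[OF assms]] ..

lemma int_pow_add:
  assumes "x \<in> carrier R" "x \<noteq> \<zero>"
  shows "x [^] (m + n :: int) = x [^] m \<otimes> x [^] n"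
proof -
  have x: "x \<in> Units R" using assms by (simp add: field_Units)
  show ?thesis
    using group.int_pow_mult[OF units_group, of x m n] x
    by (simp add: units_of_int_pow units_of_carrier units_of_mult)
qed

lemma int_pow_nonzero:
  assumes "x \<in> carrier R" "x \<noteq> \<zero>"
  shows "x [^] (n :: int) \<in> carrier R" "x [^] (n :: int) \<noteq> \<zero>"
proof -
  have x: "x \<in> Units R" using assms by (simp add: field_Units)
  have "x [^] n \<in> Units R"
    using group.int_pow_closed[OF units_group, of x n] x by (simp add: units_of_int_pow units_of_carrier)
  then show "x [^] n \<in> carrier R" "x [^] n \<noteq> \<zero>" by (auto simp: field_Units)
qed

lemma int_pow_minus:
  assumes "x \<in> carrier R" "x \<noteq> \<zero>"
  shows "inv (x [^] (n :: int)) = x [^] (- n)"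
proof (rule comm_inv_char)
  show "x [^] n \<otimes> x [^] (- n) = \<one>" using int_pow_add[OF assms, of n "- n"] by simp
qed (use int_pow_nonzero assms in auto)

lemma int_pow_mult_nonzero:
  assumes "x \<in> carrier R" "x \<noteq> \<zero>" "y \<in> carrier R" "y \<noteq> \<zero>"
  shows "(x \<otimes> y) [^] (n::int) = x [^] n \<otimes> y [^] n"
proof -
  have xy: "x \<in> Units R" "y \<in> Units R" using assms by (simp_all add: field_Units)
  show ?thesis
    using group.int_pow_mult_distrib[OF units_group, of x y n] xy m_comm[OF assms(1,3)]
    by (simp add: units_of_int_pow units_of_carrier units_of_mult)
qed

section \<open>Units of a subring of a field\<close>

definition unit_in :: "'a set \<Rightarrow> 'a set"
  where "unit_in A = {u \<in> A. u \<noteq> \<zero> \<and> inv u \<in> A}"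

lemma unit_in_mult:
  assumes "subring A R" "u \<in> unit_in A" "v \<in> unit_in A"
  shows "u \<otimes> v \<in> unit_in A"
  using assms subringE(1,6)[OF assms(1)] unfolding unit_in_def
  by (auto simp: inv_mult_nonzero subset_iff dest: integral)

lemma unit_in_inv:
  assumes "subring A R" "u \<in> unit_in A"
  shows "inv u \<in> unit_in A"
proof -
  have u: "u \<in> carrier R" "u \<noteq> \<zero>" using assms subringE(1)[OF assms(1)] by (auto simp: unit_in_def)
  then have "inv (inv u) = u" by (simp add: field_Units)
  then show ?thesis using inv_nonzero(4)[OF u] assms(2) by (simp add: unit_in_def)
qed

lemma unit_in_one: "subring A R \<Longrightarrow> \<one> \<in> unit_in A"
  using subringE(3)[of A] unfolding unit_in_def by auto

lemma unit_in_factor: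
  assumes A: "subring A R" and "a \<in> A" "b \<in> A" "a \<otimes> b \<in> unit_in A"
  shows "a \<in> unit_in A"
proof -
  have c: "a \<in> carrier R" "b \<in> carrier R" using assms subringE(1)[OF A] by auto
  then have nz: "a \<noteq> \<zero>" "b \<noteq> \<zero>" using assms(4) by (auto simp: unit_in_def)
  have "inv a = b \<otimes> inv (a \<otimes> b)"
    using c nz inv_nonzero by (simp add: inv_mult_nonzero m_lcomm[of b])
  also have "\<dots> \<in> A" using assms subringE(6)[OF A] by (auto simp: unit_in_def)
  finally show ?thesis using nz assms by (simp add: unit_in_def)
qed

lemma unit_in_Units:
  assumes A: "subring A R"
  shows "Units (R\<lparr>carrier := A\<rparr>) = unit_in A"
proof (intro equalityI subsetI)
  fix u assume "u \<in> Units (R\<lparr>carrier := A\<rparr>)"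
  then obtain v where v: "u \<in> A" "v \<in> A" "v \<otimes> u = \<one>" by (auto simp: Units_def)
  have "u \<in> carrier R" "v \<in> carrier R" using v subringE(1)[OF A] by auto
  then have "u \<otimes> v \<in> unit_in A" using v(3) unit_in_one[OF A] by (simp add: m_comm)
  then show "u \<in> unit_in A" using unit_in_factor[OF A v(1,2)] by simp
next
  fix u assume "u \<in> unit_in A"
  then show "u \<in> Units (R\<lparr>carrier := A\<rparr>)"
    using inv_nonzero[of u] subringE(1)[OF A] unfolding unit_in_def Units_def by auto
qed

text \<open>The set \<open>{x \<otimes> t | x. x \<in> A}\<close> is the principal ideal that occurs
  in \<open>ord_along\<close>. The last clause makes \<open>R\<close> the fraction field of
  \<open>A\<close> and gives every nonzero element an order.\<close>

definition uniformizer :: "'a set \<Rightarrow> 'a \<Rightarrow> bool"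
  where "uniformizer A t \<longleftrightarrow> t \<in> A \<and> t \<noteq> \<zero> \<and> A - unit_in A = {x \<otimes> t | x. x \<in> A} \<and>
    (\<forall>\<phi> \<in> carrier R - {\<zero>}. \<exists>u \<in> unit_in A. \<exists>n :: int. \<phi> = u \<otimes> t [^] n)"

lemma eval_replicate_zero: "y \<in> carrier R \<Longrightarrow> eval (replicate n \<zero>) y = \<zero>"
  by (induction n) auto

text \<open>Coefficient lists start with the highest coefficient and may begin with zeros. Keeping
  the length fixed lets a \<open>\<one>\<close> be put in front later, to obtain a monic polynomial
  of known degree.\<close>

lemma eval_add_monomial:
  assumes A: "subring A R" and y: "y \<in> carrier R" and c: "c \<in> A"
  shows "k < length p \<Longrightarrow> set p \<subseteq> A \<Longrightarrow>
    \<exists>q. length q = length p \<and> set q \<subseteq> A \<and> eval q y = c \<otimes> y [^] k \<oplus> eval p y"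
proof (induction p)
  case (Cons x p)
  have AR: "A \<subseteq> carrier R" using subringE(1)[OF A] .
  have cl: "x \<in> carrier R" "c \<in> carrier R" "y [^] n \<in> carrier R" "eval p y \<in> carrier R" for n :: nat
    using Cons AR y c eval_in_carrier[of p y] by auto
  show ?case
  proof (cases "k = length p")
    case True
    have "(c \<oplus> x) \<otimes> y [^] length p \<oplus> eval p y = c \<otimes> y [^] k \<oplus> (x \<otimes> y [^] length p \<oplus> eval p y)"
      using cl True by (simp add: l_distr a_assoc)
    then show ?thesis using Cons.prems c subringE(7)[OF A] by (intro exI[of _ "(c \<oplus> x) # p"]) auto
  next
    case False
    then obtain q where q: "length q = length p" "set q \<subseteq> A" "eval q y = c \<otimes> y [^] k \<oplus> eval p y"
      using Cons by auto
    have "x \<otimes> y [^] length p \<oplus> (c \<otimes> y [^] k \<oplus> eval p y) = c \<otimes> y [^] k \<oplus> (x \<otimes> y [^] length p \<oplus> eval p y)"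
      using cl by (simp add: a_lcomm)
    then show ?thesis using q Cons.prems by (intro exI[of _ "x # q"]) auto
  qed
qed auto

lemma eval_minus:
  assumes A: "subring A R" and y: "y \<in> carrier R"
  shows "set p \<subseteq> A \<Longrightarrow> set (map (a_inv R) p) \<subseteq> A \<and> eval (map (a_inv R) p) y = \<ominus> eval p y"
proof (induction p)
  case (Cons x p)
  have "x \<in> carrier R" "eval p y \<in> carrier R" "y [^] length p \<in> carrier R"
    using Cons subringE(1)[OF A] y eval_in_carrier[of p y] by auto
  then show ?case using Cons subringE(5)[OF A] by (auto simp: l_minus minus_add)
qed auto

text \<open>The common factor \<open>a\<close> cancels in the field, so a relation expressing
  \<open>y [^] n \<otimes> a\<close> by the lower terms is a monic equation for
  \<open>y\<close>.\<close>

lemma integral_of_power_in_span: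
  assumes A: "subring A R" and y: "y \<in> carrier R" and a: "a \<in> carrier R" "a \<noteq> \<zero>"
    and span: "y [^] n \<otimes> a \<in> lin_span R A ((\<lambda>k. y [^] k \<otimes> a) ` {..<n::nat})"
  shows "\<exists>p. polynomial\<^bsub>R\<^esub> A p \<and> p \<noteq> [] \<and> lead_coeff p = \<one> \<and> eval p y = \<zero>"
proof -
  have AR: "A \<subseteq> carrier R" using subringE(1)[OF A] .
  have "\<exists>p. length p = n \<and> set p \<subseteq> A \<and> z = eval p y \<otimes> a"
    if "z \<in> lin_span R A ((\<lambda>k. y [^] k \<otimes> a) ` {..<n})" for z
    using that
  proof induction
    case zero
    show ?case
      using eval_replicate_zero[OF y, of n] a subringE(2)[OF A]
      by (intro exI[of _ "replicate n \<zero>"]) auto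
  next
    case (step z c w)
    then obtain p k where p: "length p = n" "set p \<subseteq> A" "z = eval p y \<otimes> a"
      and k: "k < n" "w = y [^] k \<otimes> a" by auto
    obtain q where q: "length q = n" "set q \<subseteq> A" "eval q y = c \<otimes> y [^] k \<oplus> eval p y"
      using eval_add_monomial[OF A y step(2), of k p] p k by auto
    have "c \<in> carrier R" "eval p y \<in> carrier R" "y [^] k \<in> carrier R"
      using step(2) AR y p(2) eval_in_carrier[of p y] by auto
    then have "c \<otimes> w \<oplus> z = eval q y \<otimes> a"
      unfolding p(3) k(2) q(3) using a by (simp add: l_distr m_assoc)
    then show ?case using q by blast
  qed
  then obtain p where p: "length p = n" "set p \<subseteq> A" "y [^] n \<otimes> a = eval p y \<otimes> a" using span by blast
  have "eval p y \<in> carrier R" using p AR y eval_in_carrier[of p y] by auto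
  then have eq: "y [^] n = eval p y" using p(3) a y m_rcancel[of a] by auto
  let ?p = "\<one> # map (a_inv R) p"
  have "eval ?p y = \<zero>"
    using eval_minus[OF A y p(2)] p(1) eq \<open>eval p y \<in> carrier R\<close> y by (simp add: r_neg)
  moreover have "polynomial\<^bsub>R\<^esub> A ?p"
    using eval_minus[OF A y p(2)] subringE(3)[OF A] by (auto simp: polynomial_def)
  ultimately show ?thesis by (intro exI[of _ ?p]) auto
qed

text \<open>
  For a nonzero nonunit \<open>a\<close> some \<open>b \<notin> aA\<close> is multiplied into \<open>aA\<close> by every nonunit. By integral
  closedness, \<open>b/a\<close> does not map the nonunits to themselves, so it is the inverse of a uniformizer
  up to a unit.
\<close>

lemma uniformizer_exists:
  assumes A: "subring A R"
    and frac: "\<And>\<phi>. \<phi> \<in> carrier R \<Longrightarrow> \<exists>a\<in>A. \<exists>b\<in>A. b \<noteq> \<zero> \<and> \<phi> \<otimes> b = a"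
    and noeth: "\<And>Y. Y \<subseteq> A \<Longrightarrow> \<exists>Y0\<subseteq>Y. finite Y0 \<and> Y \<subseteq> lin_span R A Y0"
    and rad: "\<And>f g. f \<in> A - unit_in A \<Longrightarrow> f \<noteq> \<zero> \<Longrightarrow> g \<in> A - unit_in A \<Longrightarrow> \<exists>N::nat. \<exists>c\<in>A. g [^] N = c \<otimes> f"
    and closed: "integrally_closed_in R A"
    and nontriv: "\<exists>a \<in> A - unit_in A. a \<noteq> \<zero>"
  shows "\<exists>t. uniformizer A t"
proof -
  let ?m = "A - unit_in A"
  have AR: "\<And>x. x \<in> A \<Longrightarrow> x \<in> carrier R" using subringE(1)[OF A] by blast
  note AE = subringE(2,3)[OF A] subringE(5-7)[OF A]
  have Apow: "x [^] n \<in> A" if "x \<in> A" for x and n :: nat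
    using that AE by (induction n) auto
  have mmult: "x \<otimes> g \<in> ?m" if "x \<in> A" "g \<in> ?m" for x g
    using that unit_in_factor[OF A, of g x] AE AR by (auto simp: m_comm[of g])
  obtain a where a: "a \<in> ?m" "a \<noteq> \<zero>" using nontriv by blast
  have aR: "a \<in> carrier R" using a AR by blast
  let ?aA = "{c \<otimes> a | c. c \<in> A}"
  have aAmult: "x \<otimes> z \<in> ?aA" if xz: "x \<in> A" "z \<in> ?aA" for x z
  proof -
    obtain c where "c \<in> A" "z = c \<otimes> a" using xz by blast
    then show ?thesis using xz AE AR aR by (intro CollectI exI[of _ "x \<otimes> c"]) (auto simp: m_assoc)
  qed
  have aAadd: "x \<oplus> z \<in> ?aA" if xz: "x \<in> ?aA" "z \<in> ?aA" for x z
  proof -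
    obtain c d where "c \<in> A" "x = c \<otimes> a" "d \<in> A" "z = d \<otimes> a" using xz by blast
    then show ?thesis using AE AR aR by (intro CollectI exI[of _ "c \<oplus> d"]) (auto simp: l_distr)
  qed
  have one: "\<one> \<notin> ?aA"
  proof
    assume "\<one> \<in> ?aA"
    then obtain c where "c \<in> A" "\<one> = c \<otimes> a" by blast
    then have "a \<otimes> c \<in> unit_in A" using unit_in_one[OF A] AR aR by (simp add: m_comm)
    then show False using unit_in_factor[OF A] a \<open>c \<in> A\<close> by blast
  qed
  obtain G where G: "G \<subseteq> ?m" "finite G" "?m \<subseteq> lin_span R A G"
    using noeth[of ?m] by blast
  \<comment> \<open>The generators of the nonunits are treated one at a time, starting from
    \<open>\<one>\<close>. By \<open>rad\<close> some power of \<open>g\<close> lies in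
    \<open>?aA\<close>, so there is a last power whose product with the current \<open>b\<close> is
    still outside; this product is the new \<open>b\<close>.\<close>
  have "\<exists>b\<in>A. b \<notin> ?aA \<and> (\<forall>g\<in>G. g \<otimes> b \<in> ?aA)"
    using G(2,1)
  proof (induction G rule: finite_induct)
    case empty
    then show ?case using one AE by blast
  next
    case (insert g G)
    then obtain b where b: "b \<in> A" "b \<notin> ?aA" "\<forall>g\<in>G. g \<otimes> b \<in> ?aA" by blast
    have g: "g \<in> ?m" "g \<in> carrier R" using insert AR by auto
    obtain N :: nat and c where "c \<in> A" "g [^] N = c \<otimes> a" using rad[OF a g(1)] by blast
    then have bN: "b \<otimes> g [^] N \<in> ?aA" using b by (intro aAmult) auto
    define j where "j = (LEAST N::nat. b \<otimes> g [^] N \<in> ?aA)"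
    have j: "b \<otimes> g [^] j \<in> ?aA" 
      unfolding j_def by (rule LeastI[of "\<lambda>N::nat. b \<otimes> g [^] N \<in> ?aA", OF bN])
    have jmin: "b \<otimes> g [^] i \<notin> ?aA" if "i < j" for i 
      using not_less_Least[of i "\<lambda>N::nat. b \<otimes> g [^] N \<in> ?aA"] that unfolding j_def by blast
    have "j \<noteq> 0" using j b AR by (intro notI) auto
    then obtain i where i: "j = Suc i" using not0_implies_Suc by blast
    let ?b = "b \<otimes> g [^] i"
    have bA: "?b \<in> A" using b g AE Apow by auto
    have "g \<otimes> ?b = b \<otimes> g [^] j" using b(1) g(2) AR i by (simp add: m_ac)
    then have 1: "g \<otimes> ?b \<in> ?aA" using j by simp
    have 2: "g' \<otimes> ?b \<in> ?aA" if "g' \<in> G" for g'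
    proof -
      have g': "g' \<in> carrier R" "g' \<otimes> b \<in> ?aA" using that insert AR b by auto
      have "g' \<otimes> ?b = g [^] i \<otimes> (g' \<otimes> b)"
        using g'(1) b(1) g(2) AR by (simp add: m_ac)
      also have "\<dots> \<in> ?aA" by (rule aAmult[OF Apow g'(2)]) (use g in blast)
      finally show ?thesis .
    qed
    show ?case using bA jmin[of i] i 1 2 by (intro bexI[of _ ?b]) auto
  qed
  then obtain b where b: "b \<in> A" "b \<notin> ?aA" "\<And>g. g \<in> G \<Longrightarrow> g \<otimes> b \<in> ?aA" by blast
  have bR: "b \<in> carrier R" using b AR by blast
  have bm: "g \<otimes> b \<in> ?aA" if "g \<in> ?m" for g
  proof -
    have "g \<in> lin_span R A G" using that G by blast
    then have "g \<in> carrier R \<and> g \<otimes> b \<in> ?aA"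
    proof induction
      case zero
      show ?case using AE aR bR by (auto intro!: exI[of _ \<zero>])
    next
      case (step z c y)
      have y: "y \<in> carrier R" "c \<in> carrier R" using step G AR by auto
      have "(c \<otimes> y \<oplus> z) \<otimes> b = c \<otimes> (y \<otimes> b) \<oplus> z \<otimes> b"
        using step y bR by (simp add: l_distr m_assoc)
      also have "\<dots> \<in> ?aA"
        by (rule aAadd[OF aAmult[OF step(2) b(3)[OF step(3)]] conjunct2[OF step.IH]])
      finally show ?case using step y by auto
    qed
    then show ?thesis by blast
  qed
  \<comment> \<open>\<open>y\<close> is not in \<open>A\<close>, yet it multiplies every nonunit
    into \<open>A\<close>.\<close>
  define y where "y = b \<otimes> inv a"
  have ia: "inv a \<in> carrier R" "inv a \<otimes> a = \<one>" "a \<otimes> inv a = \<one>" using inv_nonzero[OF aR a(2)] by auto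
  have yR: "y \<in> carrier R" using bR ia by (simp add: y_def)
  have ya: "y \<otimes> a = b" using bR ia aR by (simp add: y_def m_assoc)
  have yA: "y \<notin> A" using ya b(2) by blast
  have my: "g \<otimes> y \<in> A" if g: "g \<in> ?m" for g
  proof -
    obtain c where c: "c \<in> A" "g \<otimes> b = c \<otimes> a" using bm[OF g] by blast
    have "g \<otimes> y = g \<otimes> b \<otimes> inv a" using g AR bR ia by (simp add: y_def m_assoc)
    also have "\<dots> = c" using c AR aR ia by (simp add: m_assoc)
    finally show ?thesis using c by simp
  qed
  \<comment> \<open>Otherwise all \<open>y [^] k \<otimes> a\<close> stay among the nonunits.
    Finitely many of them span the rest, so \<open>y\<close> is integral over \<open>A\<close> and
    lies in \<open>A\<close> by integral closedness.\<close>
  have "\<exists>c\<in>?m. c \<otimes> y \<notin> ?m"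
  proof (rule ccontr)
    assume "\<not> ?thesis"
    then have *: "c \<otimes> y \<in> ?m" if "c \<in> ?m" for c using that by blast
    have yk: "y [^] k \<otimes> a \<in> ?m" for k :: nat
    proof (induction k)
      case 0
      then show ?case using a aR by simp
    next
      case (Suc k)
      have "y [^] Suc k \<otimes> a = (y [^] k \<otimes> a) \<otimes> y" using yR aR by (simp add: m_ac)
      then show ?case using *[OF Suc] by (simp only:)
    qed
    let ?f = "\<lambda>k::nat. y [^] k \<otimes> a"
    have "range ?f \<subseteq> A" using yk by blast
    from noeth[OF this] obtain Y0 where Y0: "Y0 \<subseteq> range ?f" "finite Y0" "range ?f \<subseteq> lin_span R A Y0" by blast
    obtain I where I: "finite I" "Y0 = ?f ` I" using finite_subset_image[OF Y0(2,1)] by blast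
    define n where "n = Suc (Max (insert 0 I))"
    have In: "I \<subseteq> {..<n}" unfolding n_def using I(1) by (auto simp: less_Suc_eq_le)
    have "?f n \<in> lin_span R A Y0" using Y0(3) by blast
    then have "?f n \<in> lin_span R A (?f ` {..<n})" by (rule lin_span_mono) (use I(2) In in auto)
    from integral_of_power_in_span[OF A yR aR a(2) this]
    have "y \<in> A" using closed yR unfolding integrally_closed_in_def by blast
    then show False using yA by simp
  qed
  then obtain c where c: "c \<in> ?m" "c \<otimes> y \<in> unit_in A" using my by blast
  have cR: "c \<in> carrier R" using c AR by blast
  have y0: "y \<noteq> \<zero>" using c(2) cR by (auto simp: unit_in_def)
  \<comment> \<open>As \<open>c \<otimes> y\<close> is a unit, \<open>t\<close> is a unit times
    \<open>c\<close> and so a nonunit. Conversely a nonunit \<open>g\<close> equals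
    \<open>(g \<otimes> y) \<otimes> t\<close>, with first factor in \<open>A\<close>.\<close>
  define t where "t = inv y"
  have iy: "t \<in> carrier R" "t \<otimes> y = \<one>" "y \<otimes> t = \<one>" "t \<noteq> \<zero>"
    using inv_nonzero[OF yR y0] by (auto simp: t_def)
  have ucy: "inv (c \<otimes> y) \<in> unit_in A" using unit_in_inv[OF A c(2)] .
  have "t = inv (c \<otimes> y) \<otimes> c"
  proof -
    have "inv (c \<otimes> y) \<otimes> c = inv (c \<otimes> y) \<otimes> (c \<otimes> y) \<otimes> t"
      using cR yR iy ucy AR by (simp add: m_assoc unit_in_def)
    then show ?thesis using inv_nonzero[of "c \<otimes> y"] c(2) iy AR by (simp add: unit_in_def)
  qed
  then have tm: "t \<in> ?m" using mmult[of "inv (c \<otimes> y)" c] ucy c(1) by (simp add: unit_in_def)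
  have mt: "?m = {x \<otimes> t | x. x \<in> A}"
  proof (intro equalityI subsetI)
    fix g assume g: "g \<in> ?m"
    have "g = (g \<otimes> y) \<otimes> t" using g AR yR iy by (simp add: m_assoc)
    then show "g \<in> {x \<otimes> t | x. x \<in> A}" using my[OF g] by blast
  next
    fix g assume "g \<in> {x \<otimes> t | x. x \<in> A}"
    then show "g \<in> ?m" using mmult tm by blast
  qed
  \<comment> \<open>Induction on an exponent \<open>N\<close> for which \<open>\<phi>\<close>
    divides \<open>t [^] N\<close>: if \<open>\<phi>\<close> is a nonunit, one factor
    \<open>t\<close> cancels on both sides.\<close>
  have pw: "\<exists>u \<in> unit_in A. \<exists>n :: nat. \<phi> = u \<otimes> t [^] n"
    if "\<phi> \<in> A" "\<phi> \<noteq> \<zero>" "c \<in> A" "t [^] N = c \<otimes> \<phi>" for \<phi> c and N :: nat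
    using that
  proof (induction N arbitrary: \<phi>)
    case 0
    then have "\<phi> \<otimes> c \<in> unit_in A" using unit_in_one[OF A] AR by (simp add: m_comm)
    then have "\<phi> \<in> unit_in A" using 0 unit_in_factor[OF A] by blast
    then show ?case using AR[OF 0(1)] by (intro bexI[of _ \<phi>] exI[of _ 0]) auto
  next
    case (Suc N)
    show ?case
    proof (cases "\<phi> \<in> unit_in A")
      case True
      then show ?thesis using Suc AR by (intro bexI[of _ \<phi>] exI[of _ 0]) auto
    next
      case False
      then obtain \<psi> where \<psi>: "\<psi> \<in> A" "\<phi> = \<psi> \<otimes> t" using Suc(2) mt by blast
      have cl: "\<psi> \<in> carrier R" "c \<in> carrier R" using \<psi> Suc AR by auto
      have "t [^] N \<otimes> t = (c \<otimes> \<psi>) \<otimes> t" using Suc(5) \<psi>(2) cl iy by (simp add: m_assoc)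
      then have "t [^] N = c \<otimes> \<psi>" using cl iy m_rcancel[of t "t [^] N" "c \<otimes> \<psi>"] by auto
      moreover have "\<psi> \<noteq> \<zero>" using \<psi> Suc(3) iy by auto
      ultimately obtain u and n :: nat where u: "u \<in> unit_in A" "\<psi> = u \<otimes> t [^] n"
        using Suc.IH[OF \<psi>(1)] Suc(4) by blast
      have "\<phi> = u \<otimes> t [^] Suc n" using u \<psi>(2) AR iy by (simp add: m_assoc unit_in_def)
      then show ?thesis using u by blast
    qed
  qed
  have pw': "\<exists>u \<in> unit_in A. \<exists>n :: nat. \<phi> = u \<otimes> t [^] n" if \<phi>: "\<phi> \<in> A" "\<phi> \<noteq> \<zero>" for \<phi>
  proof (cases "\<phi> \<in> unit_in A")
    case True
    then show ?thesis using \<phi> AR by (intro bexI[of _ \<phi>] exI[of _ 0]) auto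
  next
    case False
    then obtain N :: nat and c where "c \<in> A" "t [^] N = c \<otimes> \<phi>" using rad[of \<phi> t] \<phi> tm by blast
    then show ?thesis using pw[OF \<phi>] by blast
  qed
  have "\<exists>u \<in> unit_in A. \<exists>n :: int. \<phi> = u \<otimes> t [^] n" if \<phi>: "\<phi> \<in> carrier R" "\<phi> \<noteq> \<zero>" for \<phi>
  proof -
    obtain p q where pq: "p \<in> A" "q \<in> A" "q \<noteq> \<zero>" "\<phi> \<otimes> q = p" using frac[OF \<phi>(1)] by blast
    have cl: "p \<in> carrier R" "q \<in> carrier R" using pq AR by auto
    have "p \<noteq> \<zero>" using pq \<phi> cl integral by blast
    then obtain u v and n k :: nat where uv: "u \<in> unit_in A" "p = u \<otimes> t [^] n" "v \<in> unit_in A" "q = v \<otimes> t [^] k"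
      using pw' pq by metis
    have ucl: "u \<in> carrier R" "v \<in> carrier R" "v \<noteq> \<zero>" "inv v \<in> carrier R" "inv v \<otimes> v = \<one>"
      using uv AR inv_nonzero[of v] by (auto simp: unit_in_def)
    let ?u = "u \<otimes> inv v" and ?n = "int n - int k"
    have tc: "t [^] ?n \<in> carrier R" "t [^] k \<in> carrier R" using int_pow_nonzero[OF iy(1,4)] iy by auto
    have "t [^] ?n \<otimes> t [^] k = t [^] n"
      using int_pow_add[OF iy(1,4), of ?n "int k"] by (simp add: int_pow_int)
    moreover have "(?u \<otimes> t [^] ?n) \<otimes> (v \<otimes> t [^] k) = u \<otimes> ((inv v \<otimes> v) \<otimes> (t [^] ?n \<otimes> t [^] k))"
      using ucl(1,2,4) tc by (simp add: m_ac)
    ultimately have "(?u \<otimes> t [^] ?n) \<otimes> q = \<phi> \<otimes> q" using ucl uv(2,4) pq(4) iy by simp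
    moreover have "?u \<otimes> t [^] ?n \<in> carrier R" using ucl tc by simp
    ultimately have "\<phi> = ?u \<otimes> t [^] ?n" using m_rcancel[of q \<phi> "?u \<otimes> t [^] ?n"] pq cl \<phi> by auto
    then show ?thesis using unit_in_mult[OF A uv(1) unit_in_inv[OF A uv(3)]] by blast
  qed
  then have "uniformizer A t" unfolding uniformizer_def using tm iy mt by blast
  then show ?thesis by blast
qed

text \<open>A generator of the nonunits is itself a nonunit, hence so are its positive powers; a
  negative exponent reduces to this by inversion.\<close>

lemma uniformizer_power_unit:
  assumes A: "subring A R" and t: "uniformizer A t" and "t [^] (n :: int) \<in> unit_in A"
  shows "n = 0"
proof -
  have AR: "\<And>x. x \<in> A \<Longrightarrow> x \<in> carrier R" using subringE(1)[OF A] by blast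
  have tR: "t \<in> carrier R" "t \<noteq> \<zero>" "t \<in> A" using t AR by (auto simp: uniformizer_def)
  have "\<one> \<otimes> t \<in> {x \<otimes> t |x. x \<in> A}" using subringE(3)[OF A] by blast
  then have "t \<in> A - unit_in A" using t tR unfolding uniformizer_def by auto
  then have nu: "t [^] Suc k \<notin> unit_in A" for k :: nat
  proof (intro notI)
    assume k: "t [^] Suc k \<in> unit_in A"
    have "t [^] k \<in> A" using tR subringE(3,6)[OF A] by (induction k) auto
    then have "t \<in> unit_in A" using k unit_in_factor[OF A tR(3), of "t [^] k"] tR by (simp add: m_comm)
    then show False using \<open>t \<in> A - unit_in A\<close> by blast
  qed
  show ?thesis
  proof (rule ccontr)
    assume "n \<noteq> 0"
    then consider k where "n = int (Suc k)" | k where "- n = int (Suc k)"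
      using zero_less_imp_eq_int[of n] zero_less_imp_eq_int[of "- n"]
      by (metis gr0_implies_Suc linorder_neqE_linordered_idom neg_0_less_iff_less)
    then show False
    proof cases
      case 1
      then show ?thesis using assms(3) nu[of k] by (simp only: int_pow_int)
    next
      case 2
      have "t [^] (- n) \<in> unit_in A" using unit_in_inv[OF A assms(3)] int_pow_minus[OF tR(1,2)] by simp
      then show ?thesis using 2 nu[of k] by (simp only: int_pow_int)
    qed
  qed
qed

lemma uniformizer_exponent_unique:
  assumes A: "subring A R" and t: "uniformizer A t" and u: "u \<in> unit_in A" "v \<in> unit_in A"
    and eq: "u \<otimes> t [^] (m :: int) = v \<otimes> t [^] (n :: int)"
  shows "m = n"
proof -
  have AR: "\<And>x. x \<in> A \<Longrightarrow> x \<in> carrier R" using subringE(1)[OF A] by blast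
  have tR: "t \<in> carrier R" "t \<noteq> \<zero>" using t AR by (auto simp: uniformizer_def)
  note tp = int_pow_nonzero[OF tR]
  have uR: "u \<in> carrier R" "u \<noteq> \<zero>" "v \<in> carrier R" using u AR by (auto simp: unit_in_def)
  note iu = inv_nonzero[OF uR(1,2)]
  have "t [^] (m - n) = t [^] m \<otimes> t [^] (- n)" using int_pow_add[OF tR, of m "- n"] by simp
  also have "t [^] m = inv u \<otimes> (u \<otimes> t [^] m)" using mult_inv_cancel(4)[OF uR(1,2) tp(1)] by simp
  also have "\<dots> = (inv u \<otimes> v) \<otimes> t [^] n" using eq iu uR tp by (simp add: m_assoc)
  finally have "t [^] (m - n) = (inv u \<otimes> v) \<otimes> (t [^] n \<otimes> t [^] (- n))"
    using iu uR tp by (simp add: m_assoc)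
  also have "t [^] n \<otimes> t [^] (- n) = \<one>" using int_pow_add[OF tR, of n "- n"] by simp
  finally have "t [^] (m - n) = inv u \<otimes> v" using iu uR by simp
  then have "t [^] (m - n) \<in> unit_in A" using unit_in_mult[OF A unit_in_inv[OF A u(1)] u(2)] by simp
  from uniformizer_power_unit[OF A t this] show ?thesis by simp
qed

text \<open>The description in \<open>ord_along\<close> quantifies over the generator
  \<open>s\<close> together with the unit. Two generators of the same principal ideal divide each
  other, so they differ by a unit and the exponent does not depend on the choice.\<close>

lemma uniformizer_order_unique:
  assumes A: "subring A R" and t: "uniformizer A t"
    and s: "s \<in> A" "{x \<otimes> s | x. x \<in> A} = A - unit_in A"
    and u: "u \<in> unit_in A" "v \<in> unit_in A" and eq: "u \<otimes> t [^] (m :: int) = v \<otimes> s [^] (n :: int)"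
  shows "m = n"
proof -
  have AR: "\<And>x. x \<in> A \<Longrightarrow> x \<in> carrier R" using subringE(1)[OF A] by blast
  have tR: "t \<in> carrier R" "t \<noteq> \<zero>" "t \<in> A" using t AR by (auto simp: uniformizer_def)
  have eqm: "{x \<otimes> s | x. x \<in> A} = {x \<otimes> t | x. x \<in> A}" using s t by (simp add: uniformizer_def)
  have "\<one> \<otimes> t \<in> {x \<otimes> s | x. x \<in> A}" unfolding eqm using subringE(3)[OF A] by blast
  then obtain x where x: "x \<in> A" "t = x \<otimes> s" using tR by auto
  have "\<one> \<otimes> s \<in> {x \<otimes> t | x. x \<in> A}" unfolding eqm[symmetric] using subringE(3)[OF A] by blast
  then obtain z where z: "z \<in> A" "s = z \<otimes> t" using s AR by auto
  have xz: "x \<in> carrier R" "z \<in> carrier R" using x(1) z(1) AR by auto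
  have "(x \<otimes> z) \<otimes> t = x \<otimes> (z \<otimes> t)" using xz tR(1) by (rule m_assoc)
  also have "\<dots> = \<one> \<otimes> t" unfolding z(2)[symmetric] x(2)[symmetric] using tR(1) by simp
  finally have "x \<otimes> z = \<one>" using m_rcancel[of t "x \<otimes> z" \<one>] xz tR(1,2) by auto
  then have "z \<otimes> x \<in> unit_in A" using unit_in_one[OF A] xz by (simp add: m_comm)
  then have zu: "z \<in> unit_in A" using unit_in_factor[OF A z(1) x(1)] by blast
  have zR: "z \<in> carrier R" "z \<noteq> \<zero>" using zu AR by (auto simp: unit_in_def)
  have zn: "z [^] n \<in> unit_in A"
  proof -
    have nat: "z [^] (k::nat) \<in> unit_in A" for k
      by (induction k) (use zu unit_in_one[OF A] unit_in_mult[OF A] in auto)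
    show ?thesis
    proof (cases "n < 0")
      case True
      show ?thesis unfolding int_pow_def2 if_P[OF True] by (rule unit_in_inv[OF A nat])
    next
      case False
      show ?thesis unfolding int_pow_def2 if_not_P[OF False] by (rule nat)
    qed
  qed
  have "v \<otimes> s [^] n = (v \<otimes> z [^] n) \<otimes> t [^] n"
    unfolding z(2) int_pow_mult_nonzero[OF zR tR(1,2)]
    by (rule m_assoc[symmetric]) (use int_pow_nonzero[OF zR] int_pow_nonzero[OF tR(1,2)] u AR in \<open>auto simp: unit_in_def\<close>)
  then show ?thesis
    using uniformizer_exponent_unique[OF A t u(1) unit_in_mult[OF A u(2) zn]] eq by simp
qed

end

section \<open>The function field and its local rings\<close>

lemma (in field) lin_span_scale:
  assumes A: "subring A R" and Y: "Y \<subseteq> carrier R" and "a \<in> A" and "u \<in> lin_span R A Y"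
  shows "a \<otimes> u \<in> lin_span R A Y"
proof -
  have AR: "A \<subseteq> carrier R" using subringE(1)[OF A] .
  from assms(4) have "u \<in> carrier R \<and> a \<otimes> u \<in> lin_span R A Y"
  proof induction
    case zero
    have "a \<in> carrier R" using assms AR by blast
    then show ?case by (simp add: lin_span.zero)
  next
    case (step z b y)
    have c: "z \<in> carrier R" "a \<in> carrier R" "b \<in> carrier R" "y \<in> carrier R" using step assms AR by auto
    have "(a \<otimes> b) \<otimes> y \<oplus> a \<otimes> z \<in> lin_span R A Y"
      using step assms subringE(6)[OF A] by (intro lin_span.step) auto
    then show ?case using c by (simp add: r_distr m_assoc)
  qed
  then show ?thesis ..
qed

context variety
begin

abbreviation "FF \<equiv> function_field \<V>"
abbreviation "rc \<equiv> rational_class \<V>"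

text \<open>Values outside \<open>U\<close> are left free, so that functions can be written as plain
  lambda terms; \<open>rational_class\<close> ignores these values as well.\<close>

definition rat :: "'a set \<Rightarrow> ('a \<Rightarrow> 'b) \<Rightarrow> bool"
  where "rat U f \<longleftrightarrow> openin (top_of \<V>) U \<and> U \<noteq> {} \<and> restrict f U \<in> regular \<V> U"

lemma ratD: "rat U f \<Longrightarrow> openin (top_of \<V>) U" "rat U f \<Longrightarrow> U \<noteq> {}" "rat U f \<Longrightarrow> restrict f U \<in> regular \<V> U"
  by (auto simp: rat_def)

lemma points_open: "openin (top_of \<V>) (points \<V>)" and points_nonempty: "points \<V> \<noteq> {}"
  using irreducible_points by (auto simp: irreducible_in_def)

lemma rat_mono: "rat U f \<Longrightarrow> openin (top_of \<V>) V \<Longrightarrow> V \<noteq> {} \<Longrightarrow> V \<subseteq> U \<Longrightarrow> rat V f"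
  using regular_restrict[of U V "restrict f U"] by (simp add: rat_def Int_absorb1)

lemma rat_regular: "openin (top_of \<V>) U \<Longrightarrow> U \<noteq> {} \<Longrightarrow> f \<in> regular \<V> U \<Longrightarrow> rat U f"
  using regular_extensional by (auto simp: rat_def extensional_restrict)

lemma rat_const: "openin (top_of \<V>) U \<Longrightarrow> U \<noteq> {} \<Longrightarrow> rat U (\<lambda>_. c)"
  using regular_const by (auto simp: rat_def)

lemma rat_add: "rat U f \<Longrightarrow> rat U g \<Longrightarrow> rat U (\<lambda>x. f x + g x)"
  using regular_add[of U "restrict f U" "restrict g U"] by (simp add: rat_def cong: restrict_cong)

lemma rat_mult: "rat U f \<Longrightarrow> rat U g \<Longrightarrow> rat U (\<lambda>x. f x * g x)"
  using regular_mult[of U "restrict f U" "restrict g U"] by (simp add: rat_def cong: restrict_cong)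

lemma rat_nonzero_open:
  assumes "rat U f"
  shows "openin (top_of \<V>) {x \<in> U. f x \<noteq> 0}"
proof -
  have "{x \<in> U. restrict f U x \<noteq> 0} = {x \<in> U. f x \<noteq> 0}" by auto
  then show ?thesis using nonzero_locus_open[OF ratD(1,3)[OF assms]] by simp
qed

lemma rat_inverse:
  assumes "rat U f" "\<And>x. x \<in> U \<Longrightarrow> f x \<noteq> 0"
  shows "rat U (\<lambda>x. inverse (f x))"
  using regular_inverse[OF ratD(1,3)[OF assms(1)]] assms by (simp add: rat_def cong: restrict_cong)

text \<open>The identity principle: the set where \<open>f\<close> and \<open>g\<close> differ is
  open, so if it were nonempty it would meet \<open>W\<close>.\<close>

lemma agree_extend:
  assumes f: "rat U f" and g: "rat V g" and W: "openin (top_of \<V>) W" "W \<noteq> {}"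
    and eq: "\<And>x. x \<in> W \<Longrightarrow> x \<in> U \<Longrightarrow> x \<in> V \<Longrightarrow> f x = g x" and x: "x \<in> U" "x \<in> V"
  shows "f x = g x"
proof (rule ccontr)
  assume "f x \<noteq> g x"
  let ?U = "U \<inter> V" and ?d = "\<lambda>x. f x + (- 1) * g x"
  have U: "openin (top_of \<V>) ?U" "?U \<noteq> {}" using ratD(1)[OF f] ratD(1)[OF g] x by auto
  have "rat ?U ?d"
    by (rule rat_add[OF rat_mono[OF f U] rat_mult[OF rat_const[OF U] rat_mono[OF g U]]]) auto
  then have "openin (top_of \<V>) {x \<in> ?U. ?d x \<noteq> 0}" by (rule rat_nonzero_open)
  moreover have "x \<in> {x \<in> ?U. ?d x \<noteq> 0}" using x \<open>f x \<noteq> g x\<close> by simp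
  ultimately have "W \<inter> {x \<in> ?U. ?d x \<noteq> 0} \<noteq> {}" using open_meet_points[OF W(1) _ W(2)] by blast
  then show False using eq by auto
qed

lemma rc_mem: "(V, g) \<in> rc U f \<longleftrightarrow> openin (top_of \<V>) V \<and> V \<noteq> {} \<and> g \<in> regular \<V> V \<and> (\<forall>x\<in>U \<inter> V. f x = g x)"
  by (simp add: rational_class_def)

lemma rc_eqI:
  assumes f: "rat U f" and g: "rat V g" and W: "openin (top_of \<V>) W" "W \<noteq> {}"
    and eq: "\<And>x. x \<in> W \<Longrightarrow> x \<in> U \<Longrightarrow> x \<in> V \<Longrightarrow> f x = g x"
  shows "rc U f = rc V g"
proof -
  have sub: "rc U f \<subseteq> rc V g"
    if f: "rat U f" and g: "rat V g" and eq: "\<And>x. x \<in> U \<Longrightarrow> x \<in> V \<Longrightarrow> f x = g x" for U V f g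
  proof clarify
    fix W k assume "(W, k) \<in> rc U f"
    then have k: "openin (top_of \<V>) W" "W \<noteq> {}" "k \<in> regular \<V> W" "\<And>x. x \<in> U \<Longrightarrow> x \<in> W \<Longrightarrow> f x = k x"
      by (auto simp: rc_mem)
    have "g x = k x" if "x \<in> V" "x \<in> W" for x
    proof (rule agree_extend[OF g rat_regular[OF k(1-3)] ratD(1,2)[OF f] _ that])
      fix y assume "y \<in> U" "y \<in> V" "y \<in> W"
      then show "g y = k y" using eq[of y] k(4)[of y] by simp
    qed
    then show "(W, k) \<in> rc V g" using k by (auto simp: rc_mem)
  qed
  have "f x = g x" if "x \<in> U" "x \<in> V" for x
    using agree_extend[OF f g W eq that] .
  then show ?thesis using sub[OF f g] sub[OF g f] by auto
qed

lemma rc_eqD: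
  assumes f: "rat U f" and g: "rat V g" and eq: "rc U f = rc V g" and x: "x \<in> U" "x \<in> V"
  shows "f x = g x"
proof -
  have "(U, restrict f U) \<in> rc U f" using f by (auto simp: rc_mem rat_def)
  then show ?thesis using x unfolding eq by (auto simp: rc_mem)
qed

lemma rc_restrict: "rc U (restrict f U) = rc U f"
  by (auto simp: rational_class_def)

lemma rc_shrink: "rat U f \<Longrightarrow> openin (top_of \<V>) V \<Longrightarrow> V \<noteq> {} \<Longrightarrow> V \<subseteq> U \<Longrightarrow> rc U f = rc V f"
  using rc_eqI[of U f V f V] rat_mono by blast

lemma carrier_FF: "carrier FF = {rc U f | U f. rat U f}"
proof -
  have "carrier FF = {rc U f | U f. openin (top_of \<V>) U \<and> U \<noteq> {} \<and> f \<in> regular \<V> U}"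
    by (simp add: function_field_def)
  also have "\<dots> = {rc U f | U f. rat U f}"
    using rat_regular rc_restrict unfolding rat_def by blast
  finally show ?thesis .
qed

lemma rc_carrier: "rat U f \<Longrightarrow> rc U f \<in> carrier FF"
  unfolding carrier_FF by blast

lemma rc_elem:
  assumes "rat U f" "(V, g) \<in> rc U f"
  shows "rat V g" "rc V g = rc U f"
proof -
  show g: "rat V g" using assms(2) rat_regular by (auto simp: rc_mem)
  show "rc V g = rc U f"
    by (rule rc_eqI[OF g assms(1) ratD(1,2)[OF g]]) (use assms in \<open>auto simp: rc_mem\<close>)
qed

text \<open>The operations of \<open>function_field\<close> are unions over all pairs of
  representatives. By the identity principle all pairs give the same class, so the union is that
  class; addition and multiplication share this argument.\<close>

lemma rc_lift2:
  assumes f: "rat U f" and g: "rat V g"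
    and op: "\<And>U f g. rat U f \<Longrightarrow> rat U g \<Longrightarrow> rat U (\<lambda>x. op (f x) (g x))"
  shows "(\<Union>(U, f) \<in> rc U f. \<Union>(V, g) \<in> rc V g. rc (U \<inter> V) (\<lambda>x. op (f x) (g x))) =
    rc (U \<inter> V) (\<lambda>x. op (f x) (g x))"
proof -
  have int: "openin (top_of \<V>) (U \<inter> V) \<and> U \<inter> V \<noteq> {}" if "rat U f" "rat V g" for U V f g
    using ratD[OF that(1)] ratD[OF that(2)] open_meet_points by blast
  have rop: "rat (U \<inter> V) (\<lambda>x. op (f x) (g x))" if "rat U f" "rat V g" for U V f g
    using int[OF that] rat_mono[OF that(1), of "U \<inter> V"] rat_mono[OF that(2), of "U \<inter> V"]
    by (auto intro: op)
  have "rc (U' \<inter> V') (\<lambda>x. op (f' x) (g' x)) = rc (U \<inter> V) (\<lambda>x. op (f x) (g x))"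
    if "(U', f') \<in> rc U f" "(V', g') \<in> rc V g" for U' f' V' g'
  proof (rule rc_eqI[OF rop rop[OF f g] points_open points_nonempty])
    show "rat U' f'" "rat V' g'" using rc_elem[OF f that(1)] rc_elem[OF g that(2)] by auto
  qed (use that in \<open>auto simp: rc_mem\<close>)
  moreover have "(U, restrict f U) \<in> rc U f" "(V, restrict g V) \<in> rc V g"
    using f g by (auto simp: rc_mem rat_def)
  ultimately show ?thesis by fast
qed

lemma mult_rc: "rat U f \<Longrightarrow> rat V g \<Longrightarrow> rc U f \<otimes>\<^bsub>FF\<^esub> rc V g = rc (U \<inter> V) (\<lambda>x. f x * g x)"
  using rc_lift2[of U f V g "(*)"] rat_mult by (simp add: function_field_def)

lemma add_rc: "rat U f \<Longrightarrow> rat V g \<Longrightarrow> rc U f \<oplus>\<^bsub>FF\<^esub> rc V g = rc (U \<inter> V) (\<lambda>x. f x + g x)"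
  using rc_lift2[of U f V g "(+)"] rat_add by (simp add: function_field_def)

lemma mult_rc_same: "rat U f \<Longrightarrow> rat U g \<Longrightarrow> rc U f \<otimes>\<^bsub>FF\<^esub> rc U g = rc U (\<lambda>x. f x * g x)"
  by (simp add: mult_rc)

lemma add_rc_same: "rat U f \<Longrightarrow> rat U g \<Longrightarrow> rc U f \<oplus>\<^bsub>FF\<^esub> rc U g = rc U (\<lambda>x. f x + g x)"
  by (simp add: add_rc)

lemma rc_const: "openin (top_of \<V>) U \<Longrightarrow> U \<noteq> {} \<Longrightarrow> rc U (\<lambda>_. c) = const_rational \<V> c"
  unfolding const_rational_def
  by (rule rc_shrink[symmetric, OF rat_const[OF points_open points_nonempty]]) (auto simp: openin_subset)

lemma one_FF: "\<one>\<^bsub>FF\<^esub> = const_rational \<V> 1" and zero_FF: "\<zero>\<^bsub>FF\<^esub> = const_rational \<V> 0"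
  by (simp_all add: function_field_def const_rational_def)

lemma const_carrier: "const_rational \<V> c \<in> carrier FF"
  unfolding const_rational_def by (rule rc_carrier[OF rat_const[OF points_open points_nonempty]])

lemma FF_rep:
  assumes "\<phi> \<in> carrier FF"
  obtains U f where "rat U f" "\<phi> = rc U f"
  using assms unfolding carrier_FF by blast

lemma FF_rep2:
  assumes "\<phi> \<in> carrier FF" "\<psi> \<in> carrier FF"
  obtains U f g where "rat U f" "rat U g" "\<phi> = rc U f" "\<psi> = rc U g"
proof -
  obtain U f where f: "rat U f" "\<phi> = rc U f" by (rule FF_rep[OF assms(1)])
  obtain V g where g: "rat V g" "\<psi> = rc V g" by (rule FF_rep[OF assms(2)])
  have W: "openin (top_of \<V>) (U \<inter> V)" "U \<inter> V \<noteq> {}"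
    using ratD[OF f(1)] ratD[OF g(1)] open_meet_points by blast+
  show ?thesis
    using that[OF rat_mono[OF f(1) W] rat_mono[OF g(1) W]] rc_shrink[OF f(1) W] rc_shrink[OF g(1) W] f g
    by auto
qed

lemma FF_rep3:
  assumes "\<phi> \<in> carrier FF" "\<psi> \<in> carrier FF" "\<theta> \<in> carrier FF"
  obtains U f g k where "rat U f" "rat U g" "rat U k" "\<phi> = rc U f" "\<psi> = rc U g" "\<theta> = rc U k"
proof -
  obtain U f g where f: "rat U f" "rat U g" "\<phi> = rc U f" "\<psi> = rc U g" by (rule FF_rep2[OF assms(1,2)])
  obtain V k where k: "rat V k" "\<theta> = rc V k" by (rule FF_rep[OF assms(3)])
  have W: "openin (top_of \<V>) (U \<inter> V)" "U \<inter> V \<noteq> {}"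
    using ratD[OF f(1)] ratD[OF k(1)] open_meet_points by blast+
  show ?thesis
    using that[OF rat_mono[OF f(1) W] rat_mono[OF f(2) W] rat_mono[OF k(1) W]]
      rc_shrink[OF f(1) W] rc_shrink[OF f(2) W] rc_shrink[OF k(1) W] f k
    by auto
qed

lemma cring_FF: "cring FF"
proof (rule cringI)
  show "abelian_group FF"
  proof (rule abelian_groupI)
    fix x y z assume x: "x \<in> carrier FF" and y: "y \<in> carrier FF" and z: "z \<in> carrier FF"
    show "x \<oplus>\<^bsub>FF\<^esub> y \<oplus>\<^bsub>FF\<^esub> z = x \<oplus>\<^bsub>FF\<^esub> (y \<oplus>\<^bsub>FF\<^esub> z)"
      by (rule FF_rep3[OF x y z]) (simp add: add_rc_same rat_add add.assoc)
  next
    fix x y assume x: "x \<in> carrier FF" and y: "y \<in> carrier FF"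
    show "x \<oplus>\<^bsub>FF\<^esub> y \<in> carrier FF"
      by (rule FF_rep2[OF x y]) (simp add: add_rc_same rat_add rc_carrier)
    show "x \<oplus>\<^bsub>FF\<^esub> y = y \<oplus>\<^bsub>FF\<^esub> x"
      by (rule FF_rep2[OF x y]) (simp add: add_rc_same add.commute)
  next
    show "\<zero>\<^bsub>FF\<^esub> \<in> carrier FF" by (simp add: zero_FF const_carrier)
  next
    fix x assume "x \<in> carrier FF"
    then obtain U f where f: "rat U f" "x = rc U f" by (rule FF_rep)
    note U = ratD(1,2)[OF f(1)]
    show "\<zero>\<^bsub>FF\<^esub> \<oplus>\<^bsub>FF\<^esub> x = x"
      unfolding zero_FF rc_const[OF U, symmetric] f(2) by (simp add: add_rc_same f rat_const[OF U])
    have "rat U (\<lambda>x. (- 1) * f x)" by (rule rat_mult[OF rat_const[OF U] f(1)])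
    then show "\<exists>y\<in>carrier FF. y \<oplus>\<^bsub>FF\<^esub> x = \<zero>\<^bsub>FF\<^esub>"
      unfolding zero_FF rc_const[OF U, symmetric] f(2)
      by (intro bexI[of _ "rc U (\<lambda>x. (- 1) * f x)"]) (simp_all add: add_rc_same f rc_carrier)
  qed
  show "comm_monoid FF"
  proof (rule comm_monoidI)
    fix x y z assume x: "x \<in> carrier FF" and y: "y \<in> carrier FF" and z: "z \<in> carrier FF"
    show "x \<otimes>\<^bsub>FF\<^esub> y \<otimes>\<^bsub>FF\<^esub> z = x \<otimes>\<^bsub>FF\<^esub> (y \<otimes>\<^bsub>FF\<^esub> z)"
      by (rule FF_rep3[OF x y z]) (simp add: mult_rc_same rat_mult mult.assoc)
  next
    fix x y assume x: "x \<in> carrier FF" and y: "y \<in> carrier FF"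
    show "x \<otimes>\<^bsub>FF\<^esub> y \<in> carrier FF"
      by (rule FF_rep2[OF x y]) (simp add: mult_rc_same rat_mult rc_carrier)
    show "x \<otimes>\<^bsub>FF\<^esub> y = y \<otimes>\<^bsub>FF\<^esub> x"
      by (rule FF_rep2[OF x y]) (simp add: mult_rc_same mult.commute)
  next
    show "\<one>\<^bsub>FF\<^esub> \<in> carrier FF" by (simp add: one_FF const_carrier)
  next
    fix x assume "x \<in> carrier FF"
    then obtain U f where f: "rat U f" "x = rc U f" by (rule FF_rep)
    note U = ratD(1,2)[OF f(1)]
    show "\<one>\<^bsub>FF\<^esub> \<otimes>\<^bsub>FF\<^esub> x = x"
      unfolding one_FF rc_const[OF U, symmetric] f(2) by (simp add: mult_rc_same f rat_const[OF U])
  qed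
  fix x y z assume x: "x \<in> carrier FF" and y: "y \<in> carrier FF" and z: "z \<in> carrier FF"
  show "(x \<oplus>\<^bsub>FF\<^esub> y) \<otimes>\<^bsub>FF\<^esub> z = x \<otimes>\<^bsub>FF\<^esub> z \<oplus>\<^bsub>FF\<^esub> y \<otimes>\<^bsub>FF\<^esub> z"
    by (rule FF_rep3[OF x y z]) (simp add: add_rc_same mult_rc_same rat_mult rat_add distrib_right)
qed

lemma rc_zero_iff:
  assumes "rat U f"
  shows "rc U f = \<zero>\<^bsub>FF\<^esub> \<longleftrightarrow> (\<forall>x\<in>U. f x = 0)"
proof -
  note U = ratD(1,2)[OF assms]
  show ?thesis
    unfolding zero_FF rc_const[OF U, symmetric]
  proof
    assume "rc U f = rc U (\<lambda>_. 0)"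
    then show "\<forall>x\<in>U. f x = 0" using rc_eqD[OF assms rat_const[OF U]] by blast
  next
    assume "\<forall>x\<in>U. f x = 0"
    then show "rc U f = rc U (\<lambda>_. 0)" by (intro rc_eqI[OF assms rat_const[OF U] U]) simp
  qed
qed

lemma rc_inverse:
  assumes f: "rat U f" and V: "V = {x \<in> U. f x \<noteq> 0}" "V \<noteq> {}"
  shows "rat V (\<lambda>x. inverse (f x))" "rc U f \<otimes>\<^bsub>FF\<^esub> rc V (\<lambda>x. inverse (f x)) = \<one>\<^bsub>FF\<^esub>"
proof -
  have oV: "openin (top_of \<V>) V" using rat_nonzero_open[OF f] V by simp
  have fV: "rat V f" by (rule rat_mono[OF f oV V(2)]) (use V in auto)
  show i: "rat V (\<lambda>x. inverse (f x))" by (rule rat_inverse[OF fV]) (use V in auto)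
  have "rc U f = rc V f" by (rule rc_shrink[OF f oV V(2)]) (use V in auto)
  then have "rc U f \<otimes>\<^bsub>FF\<^esub> rc V (\<lambda>x. inverse (f x)) = rc V (\<lambda>x. f x * inverse (f x))"
    using mult_rc_same[OF fV i] by simp
  also have "\<dots> = rc V (\<lambda>_. 1)"
    by (rule rc_eqI[OF rat_mult[OF fV i] rat_const[OF oV V(2)] oV V(2)]) (use V in auto)
  finally show "rc U f \<otimes>\<^bsub>FF\<^esub> rc V (\<lambda>x. inverse (f x)) = \<one>\<^bsub>FF\<^esub>"
    by (simp add: one_FF rc_const[OF oV V(2)])
qed

lemma field_FF: "field FF"
proof (rule cring.cring_fieldI[OF cring_FF], intro equalityI subsetI)
  interpret cring FF by (rule cring_FF)
  have "\<one>\<^bsub>FF\<^esub> \<noteq> \<zero>\<^bsub>FF\<^esub>"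
    using rc_zero_iff[OF rat_const[OF points_open points_nonempty, of 1]] points_nonempty
    by (auto simp: one_FF const_rational_def)
  moreover have "x \<noteq> \<zero>\<^bsub>FF\<^esub>" if "x \<in> Units FF" "\<one>\<^bsub>FF\<^esub> \<noteq> \<zero>\<^bsub>FF\<^esub>" for x
    using that(2) Units_l_inv[OF that(1)] r_null[OF Units_inv_closed[OF that(1)]] by metis
  ultimately show "x \<in> carrier FF - {\<zero>\<^bsub>FF\<^esub>}" if "x \<in> Units FF" for x
    using that Units_closed by blast
  fix x assume x: "x \<in> carrier FF - {\<zero>\<^bsub>FF\<^esub>}"
  then obtain U f where f: "rat U f" "x = rc U f" using FF_rep by blast
  let ?V = "{x \<in> U. f x \<noteq> 0}"
  have "?V \<noteq> {}" using rc_zero_iff[OF f(1)] x f by auto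
  note i = rc_inverse[OF f(1) refl this]
  then show "x \<in> Units FF"
    using x f rc_carrier[OF i(1)] m_comm[of x "rc ?V (\<lambda>x. inverse (f x))"] by (auto simp: Units_def)
qed

end

sublocale variety \<subseteq> F: field "function_field \<V>"
  by (rule field_FF)

context variety
begin

section \<open>Local rings along irreducible sets\<close>

abbreviation "loc P \<equiv> carrier (local_ring_at \<V> P)"

lemma local_ring_eq: "local_ring_at \<V> P = FF\<lparr>carrier := loc P\<rparr>"
  by (simp add: local_ring_at_def)

lemma loc_iff: "\<phi> \<in> loc P \<longleftrightarrow> (\<exists>U f. rat U f \<and> U \<inter> P \<noteq> {} \<and> \<phi> = rc U f)"
proof
  assume "\<phi> \<in> loc P"
  then obtain U f where *: "\<phi> \<in> carrier FF" "(U, f) \<in> \<phi>" "U \<inter> P \<noteq> {}" by (auto simp: local_ring_at_def)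
  then obtain V g where g: "rat V g" "\<phi> = rc V g" using FF_rep by blast
  then show "\<exists>U f. rat U f \<and> U \<inter> P \<noteq> {} \<and> \<phi> = rc U f" using rc_elem[OF g(1), of U f] * by metis
next
  assume "\<exists>U f. rat U f \<and> U \<inter> P \<noteq> {} \<and> \<phi> = rc U f"
  then obtain U f where f: "rat U f" "U \<inter> P \<noteq> {}" "\<phi> = rc U f" by blast
  moreover have "(U, restrict f U) \<in> rc U f" using f by (auto simp: rc_mem rat_def)
  ultimately show "\<phi> \<in> loc P" using rc_carrier[OF f(1)] by (auto simp: local_ring_at_def)
qed

lemma locI: "rat U f \<Longrightarrow> U \<inter> P \<noteq> {} \<Longrightarrow> rc U f \<in> loc P"
  unfolding loc_iff by blast

lemma loc_rep:
  assumes "\<phi> \<in> loc P"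
  obtains U f where "rat U f" "U \<inter> P \<noteq> {}" "\<phi> = rc U f"
  using assms unfolding loc_iff by blast

text \<open>Domains are intersected one after the other, and irreducibility keeps the intersection
  in contact with \<open>P\<close>. This serves for two factors in the ring operations and for all
  coefficients of an integral equation.\<close>

lemma loc_common:
  assumes P: "irreducible_in (top_of \<V>) P" and "finite S" "S \<subseteq> loc P"
  obtains V where "openin (top_of \<V>) V" "V \<inter> P \<noteq> {}" "\<forall>\<phi>\<in>S. \<exists>f. rat V f \<and> \<phi> = rc V f"
proof -
  have "\<exists>V. openin (top_of \<V>) V \<and> V \<inter> P \<noteq> {} \<and> (\<forall>\<phi>\<in>S. \<exists>f. rat V f \<and> \<phi> = rc V f)"
    using assms(2,3)
  proof (induction S rule: finite_induct)
    case empty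
    have "points \<V> \<inter> P \<noteq> {}" using P by (auto simp: irreducible_in_def)
    then show ?case using points_open by blast
  next
    case (insert \<psi> S)
    then obtain V where V: "openin (top_of \<V>) V" "V \<inter> P \<noteq> {}" "\<forall>\<phi>\<in>S. \<exists>f. rat V f \<and> \<phi> = rc V f" by auto
    obtain U g where g: "rat U g" "U \<inter> P \<noteq> {}" "\<psi> = rc U g" using insert loc_rep by (metis insert_subset)
    have m: "U \<inter> V \<inter> P \<noteq> {}" by (rule open_meet[OF P ratD(1)[OF g(1)] V(1) g(2) V(2)])
    have o: "openin (top_of \<V>) (U \<inter> V)" "U \<inter> V \<noteq> {}" using ratD(1)[OF g(1)] V(1) m by auto
    have "\<exists>f. rat (U \<inter> V) f \<and> \<phi> = rc (U \<inter> V) f" if "\<phi> \<in> insert \<psi> S" for \<phi>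
    proof (cases "\<phi> = \<psi>")
      case True
      then show ?thesis using rat_mono[OF g(1) o] rc_shrink[OF g(1) o] g by auto
    next
      case False
      then obtain f where f: "rat V f" "\<phi> = rc V f" using \<open>\<phi> \<in> insert \<psi> S\<close> V(3) by auto
      then show ?thesis using rat_mono[OF f(1) o] rc_shrink[OF f(1) o] by auto
    qed
    then show ?case using o m by blast
  qed
  then show ?thesis using that by blast
qed

lemma loc_subring:
  assumes P: "irreducible_in (top_of \<V>) P"
  shows "subring (loc P) FF"
proof (rule F.subringI)
  show "loc P \<subseteq> carrier FF" by (auto simp: local_ring_at_def)
  have pP: "points \<V> \<inter> P \<noteq> {}" using P by (auto simp: irreducible_in_def)
  have const: "const_rational \<V> c \<in> loc P" for c
    unfolding const_rational_def by (rule locI[OF rat_const[OF points_open points_nonempty] pP])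
  then show "\<one>\<^bsub>FF\<^esub> \<in> loc P" by (simp add: one_FF)
  have ops: "\<phi> \<otimes>\<^bsub>FF\<^esub> \<psi> \<in> loc P \<and> \<phi> \<oplus>\<^bsub>FF\<^esub> \<psi> \<in> loc P" if fg: "{\<phi>, \<psi>} \<subseteq> loc P" for \<phi> \<psi>
  proof -
    have fin: "finite {\<phi>, \<psi>}" by simp
    obtain V where V: "openin (top_of \<V>) V" "V \<inter> P \<noteq> {}" "\<forall>\<theta>\<in>{\<phi>, \<psi>}. \<exists>f. rat V f \<and> \<theta> = rc V f"
      by (rule loc_common[OF P fin fg])
    obtain f where f: "rat V f" "\<phi> = rc V f" using V(3) by (meson insertI1)
    obtain g where g: "rat V g" "\<psi> = rc V g" using V(3) by (meson insertI1 insertI2)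
    show ?thesis
      unfolding f(2) g(2) mult_rc_same[OF f(1) g(1)] add_rc_same[OF f(1) g(1)]
      using locI[OF rat_mult[OF f(1) g(1)] V(2)] locI[OF rat_add[OF f(1) g(1)] V(2)] by blast
  qed
  then show "\<phi> \<otimes>\<^bsub>FF\<^esub> \<psi> \<in> loc P" "\<phi> \<oplus>\<^bsub>FF\<^esub> \<psi> \<in> loc P" if "\<phi> \<in> loc P" "\<psi> \<in> loc P" for \<phi> \<psi>
    using ops that by simp_all
  show "\<ominus>\<^bsub>FF\<^esub> \<phi> \<in> loc P" if \<phi>: "\<phi> \<in> loc P" for \<phi>
  proof -
    obtain U f where f: "rat U f" "U \<inter> P \<noteq> {}" "\<phi> = rc U f" by (rule loc_rep[OF \<phi>])
    note U = ratD(1,2)[OF f(1)]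
    have m: "rat U (\<lambda>x. (- 1) * f x)" by (rule rat_mult[OF rat_const[OF U] f(1)])
    have "rc U (\<lambda>x. (- 1) * f x) \<oplus>\<^bsub>FF\<^esub> \<phi> = \<zero>\<^bsub>FF\<^esub>"
      unfolding zero_FF rc_const[OF U, symmetric] f(3) add_rc_same[OF m f(1)] by simp
    then have "\<ominus>\<^bsub>FF\<^esub> \<phi> = rc U (\<lambda>x. (- 1) * f x)"
      using F.minus_equality rc_carrier[OF m] rc_carrier[OF f(1)] f(3) by blast
    then show ?thesis using locI[OF m f(2)] by simp
  qed
qed

text \<open>The inverse of \<open>f\<close> is regular where \<open>f\<close> does not vanish, and
  this set has to meet \<open>P\<close>. The nonunits are therefore the functions that vanish on the
  part of \<open>P\<close> in their domain.\<close>

lemma loc_unit_iff: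
  assumes P: "irreducible_in (top_of \<V>) P" and f: "rat U f" "U \<inter> P \<noteq> {}"
  shows "rc U f \<in> F.unit_in (loc P) \<longleftrightarrow> (\<exists>x\<in>U \<inter> P. f x \<noteq> 0)"
proof
  assume u: "rc U f \<in> F.unit_in (loc P)"
  then obtain V g where g: "rat V g" "V \<inter> P \<noteq> {}" "inv\<^bsub>FF\<^esub> (rc U f) = rc V g"
    unfolding F.unit_in_def using loc_rep by blast
  have m: "U \<inter> V \<inter> P \<noteq> {}" by (rule open_meet[OF P ratD(1)[OF f(1)] ratD(1)[OF g(1)] f(2) g(2)])
  then have o: "openin (top_of \<V>) (U \<inter> V)" "U \<inter> V \<noteq> {}" using ratD(1)[OF g(1)] ratD(1)[OF f(1)] by auto
  have "rc (U \<inter> V) (\<lambda>x. f x * g x) = rc (U \<inter> V) (\<lambda>_. 1)"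
    using F.inv_nonzero(2)[OF rc_carrier[OF f(1)]] u unfolding g(3) mult_rc[OF f(1) g(1)] F.unit_in_def
    by (simp add: one_FF rc_const[OF o])
  then have "f x * g x = 1" if "x \<in> U \<inter> V" for x
    using rc_eqD[OF rat_mult[OF rat_mono[OF f(1) o] rat_mono[OF g(1) o]] rat_const[OF o], of 1 x] that by simp
  then show "\<exists>x\<in>U \<inter> P. f x \<noteq> 0" using m by fastforce
next
  assume "\<exists>x\<in>U \<inter> P. f x \<noteq> 0"
  then have V: "{x \<in> U. f x \<noteq> 0} \<inter> P \<noteq> {}" by blast
  let ?g = "rc {x \<in> U. f x \<noteq> 0} (\<lambda>x. inverse (f x))"
  have "{x \<in> U. f x \<noteq> 0} \<noteq> {}" using V by blast
  note i = rc_inverse[OF f(1) refl this]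
  note c = rc_carrier[OF f(1)] rc_carrier[OF i(1)]
  have "inv\<^bsub>FF\<^esub> (rc U f) = ?g" by (rule F.comm_inv_char[OF c i(2)])
  moreover have "rc U f \<noteq> \<zero>\<^bsub>FF\<^esub>" using i(2) c by auto
  ultimately show "rc U f \<in> F.unit_in (loc P)"
    using locI[OF i(1) V] locI[OF f] by (simp add: F.unit_in_def)
qed

lemma const_unit:
  assumes P: "irreducible_in (top_of \<V>) P" and c: "c \<noteq> 0"
  shows "const_rational \<V> c \<in> F.unit_in (loc P)"
proof -
  have "points \<V> \<inter> P \<noteq> {}" using P by (auto simp: irreducible_in_def)
  then show ?thesis
    unfolding const_rational_def
    using loc_unit_iff[OF P rat_const[OF points_open points_nonempty]] c by blast
qed

end

section \<open>Orders along prime divisors\<close>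

context variety
begin

lemma rat_chart:
  assumes U: "chart \<V> U n h" "U \<noteq> {}" and p: "p \<in> poly_fun n"
  shows "rat U (\<lambda>y. p (h y))"
proof -
  have "(\<lambda>y\<in>{y \<in> U. (1::'b) \<noteq> 0}. p (h y) / 1) \<in> regular \<V> {y \<in> U. (1::'b) \<noteq> 0}"
    by (rule chart_quotient[OF U(1) p poly_fun.const])
  then show ?thesis using U chart_open[OF U(1)] by (simp add: rat_def)
qed

lemma chart_class_add:
  assumes "chart \<V> U n h" "U \<noteq> {}" "p \<in> poly_fun n" "q \<in> poly_fun n"
  shows "rc U (\<lambda>y. (p + q) (h y)) = rc U (\<lambda>y. p (h y)) \<oplus>\<^bsub>FF\<^esub> rc U (\<lambda>y. q (h y))"
  using add_rc_same[OF rat_chart rat_chart] assms by simp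

lemma chart_class_mult:
  assumes "chart \<V> U n h" "U \<noteq> {}" "p \<in> poly_fun n" "q \<in> poly_fun n"
  shows "rc U (\<lambda>y. (p * q) (h y)) = rc U (\<lambda>y. p (h y)) \<otimes>\<^bsub>FF\<^esub> rc U (\<lambda>y. q (h y))"
  using mult_rc_same[OF rat_chart rat_chart] assms by simp

lemma chart_class_power:
  assumes U: "chart \<V> U n h" "U \<noteq> {}" and p: "p \<in> poly_fun n"
  shows "rc U (\<lambda>y. (p ^ N) (h y)) = rc U (\<lambda>y. p (h y)) [^]\<^bsub>FF\<^esub> N"
proof (induction N)
  case 0
  show ?case using rc_const[OF chart_open[OF U(1)] U(2), of 1] by (simp add: one_FF)
next
  case (Suc N)
  have "rc U (\<lambda>y. (p ^ N * p) (h y)) = rc U (\<lambda>y. (p ^ N) (h y)) \<otimes>\<^bsub>FF\<^esub> rc U (\<lambda>y. p (h y))"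
    by (rule chart_class_mult[OF U subring_set_power[OF subring_set_poly_fun p] p])
  then show ?case using Suc by (simp add: mult.commute)
qed

text \<open>Read in the function field, a local quotient representation becomes an identity of
  classes, since agreement on the principal open set of \<open>q\<close> is enough.\<close>

lemma chart_fraction_class:
  assumes U: "chart \<V> U n h" and f: "rat V f" and x: "x \<in> U" "x \<in> V"
  obtains p q where "p \<in> poly_fun n" "q \<in> poly_fun n" "q (h x) \<noteq> 0"
    "rc V f \<otimes>\<^bsub>FF\<^esub> rc U (\<lambda>y. q (h y)) = rc U (\<lambda>y. p (h y))"
proof -
  have Une: "U \<noteq> {}" using x by blast
  have W: "openin (top_of \<V>) (U \<inter> V)" using chart_open[OF U] ratD(1)[OF f] by blast
  have Wne: "U \<inter> V \<noteq> {}" and xW: "x \<in> U \<inter> V" using x by blast+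
  obtain p q where pq: "p \<in> poly_fun n" "q \<in> poly_fun n" "q (h x) \<noteq> 0" "{y \<in> U. q (h y) \<noteq> 0} \<subseteq> U \<inter> V"
    "\<And>y. y \<in> U \<Longrightarrow> q (h y) \<noteq> 0 \<Longrightarrow> restrict f (U \<inter> V) y = p (h y) / q (h y)"
    by (rule chart_fraction[OF U W Int_lower1 ratD(3)[OF rat_mono[OF f W Wne Int_lower2]] xW]) blast
  have q: "rat U (\<lambda>y. q (h y))" and p: "rat U (\<lambda>y. p (h y))"
    using rat_chart[OF U Une] pq(1,2) by blast+
  have VU: "openin (top_of \<V>) (V \<inter> U)" "V \<inter> U \<noteq> {}" using W Wne by (simp_all add: Int_commute)
  have "rc V f \<otimes>\<^bsub>FF\<^esub> rc U (\<lambda>y. q (h y)) = rc (V \<inter> U) (\<lambda>y. f y * q (h y))"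
    by (rule mult_rc[OF f q])
  also have "\<dots> = rc U (\<lambda>y. p (h y))"
  proof (rule rc_eqI[OF _ p chart_basic_open[OF U pq(2)]])
    show "rat (V \<inter> U) (\<lambda>y. f y * q (h y))"
      by (rule rat_mult[OF rat_mono[OF f VU] rat_mono[OF q VU]]) auto
    show "{y \<in> U. q (h y) \<noteq> 0} \<noteq> {}" using x pq(3) by blast
    fix y assume y: "y \<in> {y \<in> U. q (h y) \<noteq> 0}"
    then have "y \<in> U \<inter> V" using pq(4) by blast
    then show "f y * q (h y) = p (h y)" using pq(5)[of y] y by simp
  qed
  finally show ?thesis using that pq(1-3) by blast
qed

context
  fixes P U n h
  assumes P: "irreducible_in (top_of \<V>) P" and U: "chart \<V> U n h" and UP: "U \<inter> P \<noteq> {}"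
begin

lemma chart_nonempty: "U \<noteq> {}" using UP by blast

lemma chart_class_loc: "p \<in> poly_fun n \<Longrightarrow> rc U (\<lambda>y. p (h y)) \<in> loc P"
  by (rule locI[OF rat_chart[OF U chart_nonempty] UP])

lemma chart_class_unit_iff:
  "p \<in> poly_fun n \<Longrightarrow> rc U (\<lambda>y. p (h y)) \<in> F.unit_in (loc P) \<longleftrightarrow> (\<exists>x\<in>U \<inter> P. p (h x) \<noteq> 0)"
  by (rule loc_unit_iff[OF P rat_chart[OF U chart_nonempty] UP])

text \<open>The local ring is a localisation of the coordinate ring of any chart that meets
  \<open>P\<close>; the denominator stays on the left as a factor, so no inverse appears.\<close>

lemma loc_fraction:
  assumes "\<phi> \<in> loc P"
  obtains p q where "p \<in> poly_fun n" "q \<in> poly_fun n" "rc U (\<lambda>y. q (h y)) \<in> F.unit_in (loc P)"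
    "\<phi> \<otimes>\<^bsub>FF\<^esub> rc U (\<lambda>y. q (h y)) = rc U (\<lambda>y. p (h y))"
proof -
  obtain V f where f: "rat V f" "V \<inter> P \<noteq> {}" "\<phi> = rc V f" by (rule loc_rep[OF assms])
  have "U \<inter> V \<inter> P \<noteq> {}" by (rule open_meet[OF P chart_open[OF U] ratD(1)[OF f(1)] UP f(2)])
  then obtain x where x: "x \<in> U" "x \<in> V" "x \<in> P" by blast
  obtain p q where pq: "p \<in> poly_fun n" "q \<in> poly_fun n" "q (h x) \<noteq> 0"
    "rc V f \<otimes>\<^bsub>FF\<^esub> rc U (\<lambda>y. q (h y)) = rc U (\<lambda>y. p (h y))"
    by (rule chart_fraction_class[OF U f(1) x(1,2)])
  have "rc U (\<lambda>y. q (h y)) \<in> F.unit_in (loc P)"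
    using chart_class_unit_iff[OF pq(2)] pq(3) x by blast
  then show ?thesis using that[OF pq(1,2)] pq(4) f(3) by simp
qed

text \<open>Up to a unit every element of \<open>Y\<close> is its numerator in the chart. Hilbert's
  basis theorem selects finitely many of these numerators, and the elements of \<open>Y\<close> they
  belong to generate.\<close>

lemma loc_noetherian:
  assumes "Y \<subseteq> loc P"
  shows "\<exists>Y0\<subseteq>Y. finite Y0 \<and> Y \<subseteq> lin_span FF (loc P) Y0"
proof -
  let ?c = "\<lambda>p. rc U (\<lambda>y. p (h y))"
  note A = loc_subring[OF P]
  have AR: "loc P \<subseteq> carrier FF" using subringE(1)[OF A] .
  have "\<forall>\<phi>\<in>Y. \<exists>p q. p \<in> poly_fun n \<and> q \<in> poly_fun n \<and> ?c q \<in> F.unit_in (loc P) \<and> \<phi> \<otimes>\<^bsub>FF\<^esub> ?c q = ?c p"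
  proof
    fix \<phi> assume "\<phi> \<in> Y"
    then have "\<phi> \<in> loc P" using assms by blast
    then show "\<exists>p q. p \<in> poly_fun n \<and> q \<in> poly_fun n \<and> ?c q \<in> F.unit_in (loc P) \<and> \<phi> \<otimes>\<^bsub>FF\<^esub> ?c q = ?c p"
      by (rule loc_fraction) blast
  qed
  then obtain p q where pq: "\<And>\<phi>. \<phi> \<in> Y \<Longrightarrow> p \<phi> \<in> poly_fun n \<and> q \<phi> \<in> poly_fun n \<and>
      ?c (q \<phi>) \<in> F.unit_in (loc P) \<and> \<phi> \<otimes>\<^bsub>FF\<^esub> ?c (q \<phi>) = ?c (p \<phi>)"
    by metis
  have "p ` Y \<subseteq> poly_fun n" using pq by blast
  then obtain Z where Z: "Z \<subseteq> p ` Y" "finite Z" "p ` Y \<subseteq> ideal_span (poly_fun n) Z"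
    using noetherian_poly_fun[of n, where 'k='b] unfolding noetherian_set_def by meson
  obtain Y0 where Y0: "Y0 \<subseteq> Y" "finite Y0" "Z = p ` Y0"
    using finite_subset_image[OF Z(2,1)] by blast
  have Y0R: "Y0 \<subseteq> carrier FF" using Y0(1) assms AR by blast
  have span: "w \<in> poly_fun n \<and> ?c w \<in> lin_span FF (loc P) Y0" if "w \<in> ideal_span (poly_fun n) Z" for w
    using that
  proof induction
    case zero
    have "?c 0 = \<zero>\<^bsub>FF\<^esub>" using rc_const[OF chart_open[OF U] chart_nonempty, of 0] by (simp add: zero_FF)
    then show ?case using lin_span.zero subring_set_zero[OF subring_set_poly_fun] by metis
  next
    case (step z a w)
    obtain \<phi> where \<phi>: "\<phi> \<in> Y0" "w = p \<phi>" using step(3) Y0(3) by blast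
    then have \<phi>Y: "\<phi> \<in> Y" "\<phi> \<in> carrier FF" using Y0 Y0R by auto
    note q = pq[OF \<phi>Y(1)]
    have cl: "?c a \<in> loc P" "?c (q \<phi>) \<in> loc P" using step(2) q chart_class_loc by auto
    have clR: "?c a \<in> carrier FF" "?c (q \<phi>) \<in> carrier FF" using cl AR by auto
    have wn: "w \<in> poly_fun n" using q \<phi>(2) by simp
    have aw: "a * w \<in> poly_fun n" using step(2) wn by (rule poly_fun_mult)
    have "?c (a * w + z) = ?c a \<otimes>\<^bsub>FF\<^esub> ?c w \<oplus>\<^bsub>FF\<^esub> ?c z"
      using chart_class_add[OF U chart_nonempty aw] chart_class_mult[OF U chart_nonempty step(2) wn] step.IH
      by simp
    also have "?c a \<otimes>\<^bsub>FF\<^esub> ?c w = (?c a \<otimes>\<^bsub>FF\<^esub> ?c (q \<phi>)) \<otimes>\<^bsub>FF\<^esub> \<phi>"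
    proof -
      have "?c w = \<phi> \<otimes>\<^bsub>FF\<^esub> ?c (q \<phi>)" using q \<phi>(2) by simp
      then show ?thesis using clR \<phi>Y(2) by (simp only: F.m_ac F.m_closed)
    qed
    finally have "?c (a * w + z) = (?c a \<otimes>\<^bsub>FF\<^esub> ?c (q \<phi>)) \<otimes>\<^bsub>FF\<^esub> \<phi> \<oplus>\<^bsub>FF\<^esub> ?c z" .
    moreover have "\<dots> \<in> lin_span FF (loc P) Y0"
      using step.IH subringE(6)[OF A cl] \<phi>(1) by (intro lin_span.step) auto
    ultimately show ?case using poly_fun_add[OF aw] step.IH by metis
  qed
  have "\<phi> \<in> lin_span FF (loc P) Y0" if \<phi>: "\<phi> \<in> Y" for \<phi>
  proof -
    note q = pq[OF \<phi>]
    have \<phi>R: "\<phi> \<in> carrier FF" using \<phi> assms AR by blast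
    have u: "?c (q \<phi>) \<in> carrier FF" "?c (q \<phi>) \<noteq> \<zero>\<^bsub>FF\<^esub>" "inv\<^bsub>FF\<^esub> ?c (q \<phi>) \<in> loc P"
      using q AR by (auto simp: F.unit_in_def)
    have "p \<phi> \<in> ideal_span (poly_fun n) Z" using Z(3) \<phi> by blast
    then have "?c (p \<phi>) \<in> lin_span FF (loc P) Y0" using span by blast
    from F.lin_span_scale[OF A Y0R u(3) this]
    have "inv\<^bsub>FF\<^esub> ?c (q \<phi>) \<otimes>\<^bsub>FF\<^esub> (\<phi> \<otimes>\<^bsub>FF\<^esub> ?c (q \<phi>)) \<in> lin_span FF (loc P) Y0" using q by simp
    then show ?thesis
      using F.mult_inv_cancel(4)[OF u(1,2) \<phi>R] F.m_comm[OF \<phi>R u(1)] by simp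
  qed
  then show ?thesis using Y0(1,2) by blast
qed

text \<open>Says that the nonunits are the only nonzero prime of the local ring. Near a suitable
  point of \<open>P\<close> the zero set of the numerator \<open>p\<close> of \<open>f\<close> lies
  in \<open>P\<close>, because a component containing \<open>P\<close> equals \<open>P\<close>. The
  numerator \<open>p'\<close> of \<open>g\<close> vanishes on \<open>P\<close>, so after
  multiplication by an \<open>s\<close> that kills the other components the Nullstellensatz applies;
  \<open>s\<close> does not vanish identically on \<open>P\<close> and is a unit.\<close>

lemma loc_radical:
  assumes PD: "P \<in> prime_divisors \<V>"
    and f: "f \<in> loc P - F.unit_in (loc P)" "f \<noteq> \<zero>\<^bsub>FF\<^esub>" and g: "g \<in> loc P - F.unit_in (loc P)"
  shows "\<exists>N::nat. \<exists>c\<in>loc P. g [^]\<^bsub>FF\<^esub> N = c \<otimes>\<^bsub>FF\<^esub> f"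
proof -
  let ?c = "\<lambda>p. rc U (\<lambda>y. p (h y))"
  note A = loc_subring[OF P]
  have AR: "\<And>x. x \<in> loc P \<Longrightarrow> x \<in> carrier FF" using subringE(1)[OF A] by blast
  have fL: "f \<in> loc P" and gL: "g \<in> loc P" using f g by auto
  obtain p q where pq: "p \<in> poly_fun n" "q \<in> poly_fun n" "?c q \<in> F.unit_in (loc P)" "f \<otimes>\<^bsub>FF\<^esub> ?c q = ?c p"
    by (rule loc_fraction[OF fL])
  obtain p' q' where pq': "p' \<in> poly_fun n" "q' \<in> poly_fun n" "?c q' \<in> F.unit_in (loc P)" "g \<otimes>\<^bsub>FF\<^esub> ?c q' = ?c p'"
    by (rule loc_fraction[OF gL])
  have nonunit: "?c p \<notin> F.unit_in (loc P)" if "\<phi> \<in> loc P - F.unit_in (loc P)" "q \<in> poly_fun n" "\<phi> \<otimes>\<^bsub>FF\<^esub> ?c q = ?c p" for \<phi> p q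
    using that F.unit_in_factor[OF A _ chart_class_loc[OF that(2)], of \<phi>] by auto
  have pP: "p (h y) = 0" if "y \<in> U" "y \<in> P" for y
    using nonunit[OF f(1) pq(2,4)] chart_class_unit_iff[OF pq(1)] that by blast
  have p'P: "p' (h y) = 0" if "y \<in> U" "y \<in> P" for y
    using nonunit[OF g pq'(2,4)] chart_class_unit_iff[OF pq'(1)] that by blast
  have qR: "?c q \<in> carrier FF" "?c q \<noteq> \<zero>\<^bsub>FF\<^esub>" "?c q \<in> loc P" using pq(3) AR by (auto simp: F.unit_in_def)
  have "?c p \<noteq> \<zero>\<^bsub>FF\<^esub>" using F.nonzero_mult[OF AR[OF fL] qR(1) f(2) qR(2)] pq(4) by simp
  then obtain y0 where y0: "y0 \<in> U" "p (h y0) \<noteq> 0"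
    using rc_zero_iff[OF rat_chart[OF U chart_nonempty pq(1)]] by blast
  \<comment> \<open>Points outside the chart are included, so that \<open>Z\<close> is closed in the
    whole variety.\<close>
  define Z where "Z = points \<V> - {y \<in> U. p (h y) \<noteq> 0}"
  have "closedin (top_of \<V>) Z" unfolding Z_def using chart_basic_open[OF U pq(1)] by blast
  from closed_components[OF this] obtain \<C> where \<C>: "finite \<C>" "Z = \<Union>\<C>"
    "\<forall>Y\<in>\<C>. closedin (top_of \<V>) Y \<and> irreducible_in (top_of \<V>) Y"
    by (elim exE conjE)
  have Pin: "Y = P" if "Y \<in> \<C>" "P \<subseteq> Y" for Y
  proof (rule prime_divisorD(5)[OF PD])
    have "y0 \<notin> Y" using that(1) \<C>(2) y0 by (auto simp: Z_def)
    moreover have "y0 \<in> points \<V>" using y0(1) openin_subset[OF chart_open[OF U]] by blast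
    ultimately show "Y \<noteq> points \<V>" by blast
  qed (use that \<C>(3) in auto)
  define Z' where "Z' = \<Union>(\<C> - {P})"
  have Z'cl: "closedin (top_of \<V>) Z'" unfolding Z'_def using \<C>(1,3) by (intro closedin_Union) auto
  have PZ': "\<not> P \<subseteq> Z'"
  proof
    assume "P \<subseteq> Z'"
    then obtain Y where "Y \<in> \<C> - {P}" "P \<subseteq> Y"
      using irreducible_subset_Union[OF P, of "\<C> - {P}"] \<C>(1,3) unfolding Z'_def by auto
    then show False using Pin by blast
  qed
  have "openin (top_of \<V>) (points \<V> - Z')" using Z'cl by blast
  moreover have "(points \<V> - Z') \<inter> P \<noteq> {}" using PZ' P unfolding irreducible_in_def by blast
  ultimately have "U \<inter> (points \<V> - Z') \<inter> P \<noteq> {}"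
    by (intro open_meet[OF P chart_open[OF U] _ UP])
  then obtain x where x: "x \<in> U" "x \<in> P" "x \<notin> Z'" by blast
  have oUZ: "openin (top_of \<V>) (U - Z')" using chart_open[OF U] Z'cl by blast
  have xUZ: "x \<in> U - Z'" using x by blast
  obtain s where s: "s \<in> poly_fun n" "s (h x) \<noteq> 0" "{y \<in> U. s (h y) \<noteq> 0} \<subseteq> U - Z'"
    by (rule chart_basis[OF U oUZ Diff_subset xUZ])
  have van: "s (h y) * p' (h y) = 0" if "y \<in> U" "p (h y) = 0" for y
  proof -
    have "y \<in> \<Union>\<C>" using that openin_subset[OF chart_open[OF U]] \<C>(2) by (auto simp: Z_def)
    then have "y \<in> P \<or> y \<in> Z'" by (auto simp: Z'_def)
    then show ?thesis using p'P[OF that(1)] s(3) that(1) by auto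
  qed
  obtain S where S: "S \<subseteq> poly_fun n" "h ` U = {x \<in> {..<n} \<rightarrow>\<^sub>E UNIV. \<forall>p \<in> S. p x = 0}"
    using chart_algebraic[OF U] unfolding algebraic_set_def by blast
  \<comment> \<open>\<open>S\<close> consists of equations of the image of the chart, so the common
    zeros of \<open>p\<close> and \<open>S\<close> are the images of the zeros of \<open>p\<close>
    in \<open>U\<close>.\<close>
  have "insert p S \<subseteq> poly_fun n" using S(1) pq(1) by simp
  moreover have sp': "s * p' \<in> poly_fun n" using s(1) pq'(1) by (rule poly_fun_mult)
  moreover have "(s * p') v = 0" if v: "v \<in> {..<n} \<rightarrow>\<^sub>E UNIV" "\<And>f. f \<in> insert p S \<Longrightarrow> f v = 0" for v
  proof -
    have "v \<in> h ` U" unfolding S(2) using v by simp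
    then obtain y where "y \<in> U" "v = h y" by blast
    then show ?thesis using van[of y] v(2)[of p] by simp
  qed
  ultimately obtain N where N: "(s * p') ^ N \<in> ideal_span (poly_fun n) (insert p S)"
    by (rule nullstellensatz)
  \<comment> \<open>The elements of \<open>S\<close> vanish on the image of the chart, so membership
    in the ideal becomes divisibility by \<open>p\<close> as functions on \<open>U\<close>.\<close>
  have "(s * p') ^ N \<in> {w. \<exists>c\<in>poly_fun n. \<forall>y\<in>U. w (h y) = c (h y) * p (h y)}"
    using N
  proof (rule ideal_span_least)
    show "0 \<in> {w. \<exists>c\<in>poly_fun n. \<forall>y\<in>U. w (h y) = c (h y) * p (h y)}"
      using subring_set_zero[OF subring_set_poly_fun, of n] by (intro CollectI bexI[of _ 0]) auto
    fix u v assume "u \<in> {w. \<exists>c\<in>poly_fun n. \<forall>y\<in>U. w (h y) = c (h y) * p (h y)}"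
      "v \<in> {w. \<exists>c\<in>poly_fun n. \<forall>y\<in>U. w (h y) = c (h y) * p (h y)}"
    then obtain c d where "c \<in> poly_fun n" "\<forall>y\<in>U. u (h y) = c (h y) * p (h y)"
      "d \<in> poly_fun n" "\<forall>y\<in>U. v (h y) = d (h y) * p (h y)" by blast
    then show "u + v \<in> {w. \<exists>c\<in>poly_fun n. \<forall>y\<in>U. w (h y) = c (h y) * p (h y)}"
      by (intro CollectI bexI[of _ "c + d"]) (auto simp: distrib_right poly_fun_add)
  next
    fix a u :: "(nat \<Rightarrow> 'b) \<Rightarrow> 'b" assume a: "a \<in> poly_fun n" "u \<in> insert p S"
    show "a * u \<in> {w. \<exists>c\<in>poly_fun n. \<forall>y\<in>U. w (h y) = c (h y) * p (h y)}"
    proof (cases "u = p")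
      case True
      then show ?thesis using a by auto
    next
      case False
      then have "u (h y) = 0" if "y \<in> U" for y using S(2) a(2) that by blast
      then show ?thesis using subring_set_zero[OF subring_set_poly_fun, of n]
        by (intro CollectI bexI[of _ 0]) auto
    qed
  qed
  then obtain c where c: "c \<in> poly_fun n" "\<And>y. y \<in> U \<Longrightarrow> ((s * p') ^ N) (h y) = c (h y) * p (h y)" by blast
  let ?s = "?c s" and ?v = "?c s \<otimes>\<^bsub>FF\<^esub> ?c q'"
  have su: "?c s \<in> F.unit_in (loc P)" using chart_class_unit_iff[OF s(1)] s(2) x by blast
  have vu: "?v \<in> F.unit_in (loc P)" by (rule F.unit_in_mult[OF A su pq'(3)])
  have vN: "?v [^]\<^bsub>FF\<^esub> N \<in> F.unit_in (loc P)"
  proof (induction N)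
    case (Suc N)
    then show ?case using F.unit_in_mult[OF A Suc vu] by simp
  qed (simp add: F.unit_in_one[OF A])
  have cR: "?c c \<in> loc P" "?c s \<in> loc P" "?c q' \<in> loc P" "?c p' \<in> loc P"
    using chart_class_loc c s pq' by blast+
  note R = cR[THEN AR] AR[OF gL] AR[OF fL] qR(1)
  have "?c ((s * p') ^ N) = ?c (c * p)"
    by (rule rc_eqI[OF rat_chart[OF U chart_nonempty subring_set_power[OF subring_set_poly_fun sp']]
          rat_chart[OF U chart_nonempty poly_fun_mult[OF c(1) pq(1)]] chart_open[OF U] chart_nonempty])
      (use c(2) in simp)
  then have "(?c s \<otimes>\<^bsub>FF\<^esub> ?c p') [^]\<^bsub>FF\<^esub> N = ?c c \<otimes>\<^bsub>FF\<^esub> ?c p"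
    unfolding chart_class_power[OF U chart_nonempty sp'] chart_class_mult[OF U chart_nonempty s(1) pq'(1)]
      chart_class_mult[OF U chart_nonempty c(1) pq(1)] .
  moreover have "?c s \<otimes>\<^bsub>FF\<^esub> ?c p' = g \<otimes>\<^bsub>FF\<^esub> ?v"
    unfolding pq'(4)[symmetric] using R by (simp only: F.m_ac F.m_closed)
  moreover have "(g \<otimes>\<^bsub>FF\<^esub> ?v) [^]\<^bsub>FF\<^esub> N = g [^]\<^bsub>FF\<^esub> N \<otimes>\<^bsub>FF\<^esub> ?v [^]\<^bsub>FF\<^esub> N"
    using R by (intro F.nat_pow_distrib) auto
  ultimately have eq: "g [^]\<^bsub>FF\<^esub> N \<otimes>\<^bsub>FF\<^esub> ?v [^]\<^bsub>FF\<^esub> N = ?c c \<otimes>\<^bsub>FF\<^esub> (f \<otimes>\<^bsub>FF\<^esub> ?c q)"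
    using pq(4) by simp
  let ?w = "?v [^]\<^bsub>FF\<^esub> N"
  have w: "?w \<in> carrier FF" "?w \<noteq> \<zero>\<^bsub>FF\<^esub>" "inv\<^bsub>FF\<^esub> ?w \<in> loc P"
    using vN AR by (auto simp: F.unit_in_def)
  have gN: "g [^]\<^bsub>FF\<^esub> N \<in> carrier FF" using R by simp
  have "g [^]\<^bsub>FF\<^esub> N = (g [^]\<^bsub>FF\<^esub> N \<otimes>\<^bsub>FF\<^esub> ?w) \<otimes>\<^bsub>FF\<^esub> inv\<^bsub>FF\<^esub> ?w"
    using F.mult_inv_cancel(2)[OF w(1,2) gN] by simp
  also have "\<dots> = (inv\<^bsub>FF\<^esub> ?w \<otimes>\<^bsub>FF\<^esub> (?c c \<otimes>\<^bsub>FF\<^esub> ?c q)) \<otimes>\<^bsub>FF\<^esub> f"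
    unfolding eq using R AR[OF w(3)] by (simp only: F.m_ac F.m_closed)
  finally show ?thesis
    using subringE(6)[OF A w(3) subringE(6)[OF A cR(1) qR(3)]] by blast
qed

end

end

context normal_variety
begin

text \<open>Normality is given at points. The coefficients of a monic equation are regular on a
  common open set meeting \<open>P\<close>; at a point \<open>x\<close> of \<open>P\<close> in it,
  normality makes \<open>\<phi>\<close> regular near \<open>x\<close>, hence on an open set meeting
  \<open>P\<close>.\<close>

lemma loc_integrally_closed:
  assumes P: "irreducible_in (top_of \<V>) P"
  shows "integrally_closed_in FF (loc P)"
  unfolding integrally_closed_in_def
proof (intro ballI impI)
  fix \<phi> assume \<phi>: "\<phi> \<in> carrier FF"
    and "\<exists>p. polynomial\<^bsub>FF\<^esub> (loc P) p \<and> p \<noteq> [] \<and> lead_coeff p = \<one>\<^bsub>FF\<^esub> \<and> ring.eval FF p \<phi> = \<zero>\<^bsub>FF\<^esub>"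
  then obtain p where p: "polynomial\<^bsub>FF\<^esub> (loc P) p" "p \<noteq> []" "lead_coeff p = \<one>\<^bsub>FF\<^esub>" "ring.eval FF p \<phi> = \<zero>\<^bsub>FF\<^esub>"
    by blast
  have "set p \<subseteq> loc P" using p(1) by (auto simp: polynomial_def)
  from loc_common[OF P finite_set this]
  obtain V where V: "openin (top_of \<V>) V" "V \<inter> P \<noteq> {}" "\<forall>\<phi>\<in>set p. \<exists>f. rat V f \<and> \<phi> = rc V f" .
  then obtain x where x: "x \<in> V" "x \<in> P" by blast
  have "set p \<subseteq> loc {x}"
  proof
    fix a assume "a \<in> set p"
    then obtain f where "rat V f" "a = rc V f" using V(3) by blast
    then show "a \<in> loc {x}" using locI[of V f "{x}"] x(1) by auto
  qed
  then have "polynomial\<^bsub>FF\<^esub> (loc {x}) p" using p(1) by (auto simp: polynomial_def)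
  moreover have "x \<in> points \<V>" using x(1) openin_subset[OF V(1)] by blast
  ultimately have "\<phi> \<in> loc {x}"
    using normal[of x] \<phi> p(2-4) unfolding integrally_closed_in_def by blast
  then obtain W f where f: "rat W f" "W \<inter> {x} \<noteq> {}" "\<phi> = rc W f" by (rule loc_rep)
  then have "W \<inter> P \<noteq> {}" using x(2) by blast
  then show "\<phi> \<in> loc P" using locI[OF f(1)] f(3) by simp
qed

text \<open>Fractions and Noetherianity come from a chart, the condition on powers from codimension
  one, and integral closedness from normality.\<close>

theorem prime_divisor_uniformizer:
  assumes PD: "P \<in> prime_divisors \<V>"
  shows "\<exists>t. F.uniformizer (loc P) t"
proof -
  note P = prime_divisorD(2)[OF PD]
  obtain x where x: "x \<in> P" "x \<in> points \<V>" using prime_divisorD(3,4)[OF PD] by blast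
  obtain U n h where U: "chart \<V> U n h" "x \<in> U" by (rule chart_at[OF x(2)])
  have UP: "U \<inter> P \<noteq> {}" and Une: "U \<noteq> {}" using x U by blast+
  note ctx = P U(1) UP
  show ?thesis
  proof (rule F.uniformizer_exists[OF loc_subring[OF P]])
    fix \<phi> assume "\<phi> \<in> carrier FF"
    then obtain V f where f: "rat V f" "\<phi> = rc V f" by (rule FF_rep)
    have "U \<inter> V \<noteq> {}" by (rule open_meet_points[OF chart_open[OF U(1)] ratD(1)[OF f(1)] Une ratD(2)[OF f(1)]])
    then obtain z where z: "z \<in> U" "z \<in> V" by blast
    obtain p q where pq: "p \<in> poly_fun n" "q \<in> poly_fun n" "q (h z) \<noteq> 0"
      "rc V f \<otimes>\<^bsub>FF\<^esub> rc U (\<lambda>y. q (h y)) = rc U (\<lambda>y. p (h y))"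
      by (rule chart_fraction_class[OF U(1) f(1) z])
    have "rc U (\<lambda>y. q (h y)) \<noteq> \<zero>\<^bsub>FF\<^esub>"
      using rc_zero_iff[OF rat_chart[OF U(1) Une pq(2)]] z(1) pq(3) by blast
    then show "\<exists>a\<in>loc P. \<exists>b\<in>loc P. b \<noteq> \<zero>\<^bsub>FF\<^esub> \<and> \<phi> \<otimes>\<^bsub>FF\<^esub> b = a"
      using chart_class_loc[OF ctx pq(1)] chart_class_loc[OF ctx pq(2)] pq(4) f(2) by blast
  next
    show "\<exists>Y0\<subseteq>Y. finite Y0 \<and> Y \<subseteq> lin_span FF (loc P) Y0" if "Y \<subseteq> loc P" for Y
      by (rule loc_noetherian[OF ctx that])
    show "\<exists>N::nat. \<exists>c\<in>loc P. g [^]\<^bsub>FF\<^esub> N = c \<otimes>\<^bsub>FF\<^esub> f"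
      if "f \<in> loc P - F.unit_in (loc P)" "f \<noteq> \<zero>\<^bsub>FF\<^esub>" "g \<in> loc P - F.unit_in (loc P)" for f g
      by (rule loc_radical[OF ctx PD that])
    show "integrally_closed_in FF (loc P)" by (rule loc_integrally_closed[OF P])
  next
    \<comment> \<open>For a nonzero nonunit: a polynomial function on the chart whose nonvanishing
      locus is nonempty and avoids \<open>P\<close>.\<close>
    have oP: "openin (top_of \<V>) (points \<V> - P)" using prime_divisorD(1)[OF PD] by blast
    have nP: "points \<V> - P \<noteq> {}" using prime_divisorD(3)[OF PD] by blast
    have "U \<inter> (points \<V> - P) \<noteq> {}" by (rule open_meet_points[OF chart_open[OF U(1)] oP Une nP])
    then obtain z where z: "z \<in> U \<inter> (points \<V> - P)" by blast
    have oUP: "openin (top_of \<V>) (U \<inter> (points \<V> - P))" using chart_open[OF U(1)] oP by blast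
    obtain p where p: "p \<in> poly_fun n" "p (h z) \<noteq> 0" "{y \<in> U. p (h y) \<noteq> 0} \<subseteq> U \<inter> (points \<V> - P)"
      by (rule chart_basis[OF U(1) oUP Int_lower1 z])
    have "rc U (\<lambda>y. p (h y)) \<noteq> \<zero>\<^bsub>FF\<^esub>"
      using rc_zero_iff[OF rat_chart[OF U(1) Une p(1)]] z p(2) by blast
    moreover have "rc U (\<lambda>y. p (h y)) \<notin> F.unit_in (loc P)"
      using chart_class_unit_iff[OF ctx p(1)] p(3) by blast
    ultimately show "\<exists>a\<in>loc P - F.unit_in (loc P). a \<noteq> \<zero>\<^bsub>FF\<^esub>"
      using chart_class_loc[OF ctx p(1)] by blast
  qed
qed

text \<open>Existence and uniqueness for the description in \<open>ord_along\<close>. From here on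
  an order is found by exhibiting a unit and a power of one fixed uniformizer.\<close>

lemma ord_along_eq:
  assumes PD: "P \<in> prime_divisors \<V>" and t: "F.uniformizer (loc P) t" and u: "u \<in> F.unit_in (loc P)"
  shows "ord_along \<V> P (u \<otimes>\<^bsub>FF\<^esub> t [^]\<^bsub>FF\<^esub> (n :: int)) = n"
proof -
  note A = loc_subring[OF prime_divisorD(2)[OF PD]]
  let ?A = "local_ring_at \<V> P"
  have Un: "Units ?A = F.unit_in (loc P)"
    using F.unit_in_Units[OF A] local_ring_eq[of P] by simp
  have mult: "x \<otimes>\<^bsub>?A\<^esub> y = x \<otimes>\<^bsub>FF\<^esub> y" for x y by (simp add: local_ring_at_def)
  have PI: "PIdl\<^bsub>?A\<^esub> s = {x \<otimes>\<^bsub>FF\<^esub> s | x. x \<in> loc P}" for s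
    unfolding cgenideal_def mult ..
  let ?Q = "\<lambda>m. \<exists>v s. v \<in> Units ?A \<and> s \<in> loc P \<and> PIdl\<^bsub>?A\<^esub> s = loc P - Units ?A \<and>
    u \<otimes>\<^bsub>FF\<^esub> t [^]\<^bsub>FF\<^esub> n = v \<otimes>\<^bsub>FF\<^esub> s [^]\<^bsub>FF\<^esub> (m :: int)"
  have "(THE m. ?Q m) = n"
  proof (rule the_equality)
    have "t \<in> loc P" "{x \<otimes>\<^bsub>FF\<^esub> t | x. x \<in> loc P} = loc P - F.unit_in (loc P)"
      using t by (simp_all add: F.uniformizer_def)
    with u show "?Q n" unfolding PI Un by (intro exI[of _ u] exI[of _ t] conjI refl)
  next
    fix m assume "?Q m"
    then obtain v s where "v \<in> F.unit_in (loc P)" "s \<in> loc P"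
      "{x \<otimes>\<^bsub>FF\<^esub> s | x. x \<in> loc P} = loc P - F.unit_in (loc P)"
      "u \<otimes>\<^bsub>FF\<^esub> t [^]\<^bsub>FF\<^esub> n = v \<otimes>\<^bsub>FF\<^esub> s [^]\<^bsub>FF\<^esub> m"
      unfolding PI Un by blast
    from F.uniformizer_order_unique[OF A t this(2,3) u this(1,4)] show "m = n" by simp
  qed
  then show ?thesis unfolding ord_along_def Let_def .
qed

lemma ord_rep:
  assumes PD: "P \<in> prime_divisors \<V>"
  obtains t where "F.uniformizer (loc P) t" "t \<in> carrier FF" "t \<noteq> \<zero>\<^bsub>FF\<^esub>"
    "\<And>\<phi>. \<phi> \<in> carrier FF \<Longrightarrow> \<phi> \<noteq> \<zero>\<^bsub>FF\<^esub> \<Longrightarrow>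
      \<exists>u \<in> F.unit_in (loc P). \<phi> = u \<otimes>\<^bsub>FF\<^esub> t [^]\<^bsub>FF\<^esub> ord_along \<V> P \<phi>"
proof -
  note A = loc_subring[OF prime_divisorD(2)[OF PD]]
  obtain t where t: "F.uniformizer (loc P) t" using prime_divisor_uniformizer[OF PD] by blast
  show ?thesis
  proof (rule that[OF t])
    show "t \<in> carrier FF" "t \<noteq> \<zero>\<^bsub>FF\<^esub>" using t subringE(1)[OF A] by (auto simp: F.uniformizer_def)
    fix \<phi> assume "\<phi> \<in> carrier FF" "\<phi> \<noteq> \<zero>\<^bsub>FF\<^esub>"
    then obtain u n where "u \<in> F.unit_in (loc P)" "\<phi> = u \<otimes>\<^bsub>FF\<^esub> t [^]\<^bsub>FF\<^esub> (n :: int)"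
      using t unfolding F.uniformizer_def by blast
    then show "\<exists>u \<in> F.unit_in (loc P). \<phi> = u \<otimes>\<^bsub>FF\<^esub> t [^]\<^bsub>FF\<^esub> ord_along \<V> P \<phi>"
      using ord_along_eq[OF PD t, of u n] by auto
  qed
qed

lemma ord_unit:
  assumes PD: "P \<in> prime_divisors \<V>" and u: "u \<in> F.unit_in (loc P)"
  shows "ord_along \<V> P u = 0"
proof -
  note A = loc_subring[OF prime_divisorD(2)[OF PD]]
  obtain t where t: "F.uniformizer (loc P) t" using prime_divisor_uniformizer[OF PD] by blast
  have "u \<in> carrier FF" using u subringE(1)[OF A] by (auto simp: F.unit_in_def)
  then show ?thesis using ord_along_eq[OF PD t u, of 0] by simp
qed

lemma ord_mult:
  assumes PD: "P \<in> prime_divisors \<V>"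
    and \<phi>: "\<phi> \<in> carrier FF" "\<phi> \<noteq> \<zero>\<^bsub>FF\<^esub>" and \<psi>: "\<psi> \<in> carrier FF" "\<psi> \<noteq> \<zero>\<^bsub>FF\<^esub>"
  shows "ord_along \<V> P (\<phi> \<otimes>\<^bsub>FF\<^esub> \<psi>) = ord_along \<V> P \<phi> + ord_along \<V> P \<psi>"
proof -
  note A = loc_subring[OF prime_divisorD(2)[OF PD]]
  obtain t where t: "F.uniformizer (loc P) t" "t \<in> carrier FF" "t \<noteq> \<zero>\<^bsub>FF\<^esub>"
    and rep: "\<And>\<phi>. \<phi> \<in> carrier FF \<Longrightarrow> \<phi> \<noteq> \<zero>\<^bsub>FF\<^esub> \<Longrightarrow>
      \<exists>u \<in> F.unit_in (loc P). \<phi> = u \<otimes>\<^bsub>FF\<^esub> t [^]\<^bsub>FF\<^esub> ord_along \<V> P \<phi>"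
    by (rule ord_rep[OF PD]) blast
  let ?m = "ord_along \<V> P \<phi>" and ?n = "ord_along \<V> P \<psi>"
  obtain u where u: "u \<in> F.unit_in (loc P)" "\<phi> = u \<otimes>\<^bsub>FF\<^esub> t [^]\<^bsub>FF\<^esub> ?m" using rep[OF \<phi>] by blast
  obtain v where v: "v \<in> F.unit_in (loc P)" "\<psi> = v \<otimes>\<^bsub>FF\<^esub> t [^]\<^bsub>FF\<^esub> ?n" using rep[OF \<psi>] by blast
  have uv: "u \<in> carrier FF" "v \<in> carrier FF" using u v subringE(1)[OF A] by (auto simp: F.unit_in_def)
  note tp = F.int_pow_nonzero(1)[OF t(2,3)]
  have "\<phi> \<otimes>\<^bsub>FF\<^esub> \<psi> = (u \<otimes>\<^bsub>FF\<^esub> t [^]\<^bsub>FF\<^esub> ?m) \<otimes>\<^bsub>FF\<^esub> (v \<otimes>\<^bsub>FF\<^esub> t [^]\<^bsub>FF\<^esub> ?n)"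
    using u(2) v(2) by simp
  also have "\<dots> = (u \<otimes>\<^bsub>FF\<^esub> v) \<otimes>\<^bsub>FF\<^esub> (t [^]\<^bsub>FF\<^esub> ?m \<otimes>\<^bsub>FF\<^esub> t [^]\<^bsub>FF\<^esub> ?n)"
    using uv tp by (simp only: F.m_ac F.m_closed)
  also have "t [^]\<^bsub>FF\<^esub> ?m \<otimes>\<^bsub>FF\<^esub> t [^]\<^bsub>FF\<^esub> ?n = t [^]\<^bsub>FF\<^esub> (?m + ?n)"
    using F.int_pow_add[OF t(2,3)] by simp
  finally show ?thesis using ord_along_eq[OF PD t(1) F.unit_in_mult[OF A u(1) v(1)]] by simp
qed

lemma ord_nonneg:
  assumes PD: "P \<in> prime_divisors \<V>" and \<phi>: "\<phi> \<in> loc P" "\<phi> \<noteq> \<zero>\<^bsub>FF\<^esub>"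
  shows "ord_along \<V> P \<phi> \<ge> 0"
proof (rule ccontr)
  note A = loc_subring[OF prime_divisorD(2)[OF PD]]
  assume neg: "\<not> ?thesis"
  obtain t where t: "F.uniformizer (loc P) t" "t \<in> carrier FF" "t \<noteq> \<zero>\<^bsub>FF\<^esub>"
    and rep: "\<And>\<phi>. \<phi> \<in> carrier FF \<Longrightarrow> \<phi> \<noteq> \<zero>\<^bsub>FF\<^esub> \<Longrightarrow>
      \<exists>u \<in> F.unit_in (loc P). \<phi> = u \<otimes>\<^bsub>FF\<^esub> t [^]\<^bsub>FF\<^esub> ord_along \<V> P \<phi>"
    by (rule ord_rep[OF PD]) blast
  have AR: "\<And>x. x \<in> loc P \<Longrightarrow> x \<in> carrier FF" using subringE(1)[OF A] by blast
  let ?m = "ord_along \<V> P \<phi>"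
  obtain u where u: "u \<in> F.unit_in (loc P)" "\<phi> = u \<otimes>\<^bsub>FF\<^esub> t [^]\<^bsub>FF\<^esub> ?m" using rep[OF AR[OF \<phi>(1)] \<phi>(2)] by blast
  obtain k where k: "- ?m = int k" using neg by (metis linear neg_0_le_iff_le zero_le_imp_eq_int)
  have uR: "u \<in> carrier FF" using u AR by (auto simp: F.unit_in_def)
  note tp = F.int_pow_nonzero(1)[OF t(2,3)]
  have tL: "t \<in> loc P" using t(1) by (simp add: F.uniformizer_def)
  have "t [^]\<^bsub>FF\<^esub> (j::nat) \<in> loc P" for j
    using tL subringE(3,6)[OF A] by (induction j) auto
  then have tk: "t [^]\<^bsub>FF\<^esub> (- ?m) \<in> loc P" unfolding k int_pow_int by simp
  have "t [^]\<^bsub>FF\<^esub> (- ?m) \<otimes>\<^bsub>FF\<^esub> \<phi> = t [^]\<^bsub>FF\<^esub> (- ?m) \<otimes>\<^bsub>FF\<^esub> (u \<otimes>\<^bsub>FF\<^esub> t [^]\<^bsub>FF\<^esub> ?m)"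
    using u(2) by simp
  also have "\<dots> = u \<otimes>\<^bsub>FF\<^esub> (t [^]\<^bsub>FF\<^esub> ?m \<otimes>\<^bsub>FF\<^esub> t [^]\<^bsub>FF\<^esub> (- ?m))"
    using uR tp by (simp only: F.m_ac F.m_closed)
  also have "t [^]\<^bsub>FF\<^esub> ?m \<otimes>\<^bsub>FF\<^esub> t [^]\<^bsub>FF\<^esub> (- ?m) = \<one>\<^bsub>FF\<^esub>"
    using F.int_pow_add[OF t(2,3), of ?m "- ?m"] by simp
  finally have "t [^]\<^bsub>FF\<^esub> (- ?m) \<otimes>\<^bsub>FF\<^esub> \<phi> \<in> F.unit_in (loc P)" using u(1) uR by simp
  from F.uniformizer_power_unit[OF A t(1) F.unit_in_factor[OF A tk \<phi>(1) this]] neg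
  show False by simp
qed

text \<open>Both summands are \<open>t [^] d\<close> times an element of the local ring, where
  orders are nonnegative.\<close>

lemma ord_add:
  assumes PD: "P \<in> prime_divisors \<V>"
    and \<phi>: "\<phi> \<in> carrier FF" "\<phi> \<noteq> \<zero>\<^bsub>FF\<^esub>" and \<psi>: "\<psi> \<in> carrier FF" "\<psi> \<noteq> \<zero>\<^bsub>FF\<^esub>"
    and nz: "\<phi> \<oplus>\<^bsub>FF\<^esub> \<psi> \<noteq> \<zero>\<^bsub>FF\<^esub>" and d: "ord_along \<V> P \<phi> \<ge> d" "ord_along \<V> P \<psi> \<ge> d"
  shows "ord_along \<V> P (\<phi> \<oplus>\<^bsub>FF\<^esub> \<psi>) \<ge> d"
proof -
  note A = loc_subring[OF prime_divisorD(2)[OF PD]]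
  obtain t where t: "F.uniformizer (loc P) t" "t \<in> carrier FF" "t \<noteq> \<zero>\<^bsub>FF\<^esub>"
    and rep: "\<And>\<phi>. \<phi> \<in> carrier FF \<Longrightarrow> \<phi> \<noteq> \<zero>\<^bsub>FF\<^esub> \<Longrightarrow>
      \<exists>u \<in> F.unit_in (loc P). \<phi> = u \<otimes>\<^bsub>FF\<^esub> t [^]\<^bsub>FF\<^esub> ord_along \<V> P \<phi>"
    by (rule ord_rep[OF PD]) blast
  have AR: "\<And>x. x \<in> loc P \<Longrightarrow> x \<in> carrier FF" using subringE(1)[OF A] by blast
  note tp = F.int_pow_nonzero[OF t(2,3)]
  have tL: "t \<in> loc P" using t(1) by (simp add: F.uniformizer_def)
  have tj: "t [^]\<^bsub>FF\<^esub> (j::nat) \<in> loc P" for j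
    using tL subringE(3,6)[OF A] by (induction j) auto
  have fac: "\<exists>w\<in>loc P. \<theta> = t [^]\<^bsub>FF\<^esub> d \<otimes>\<^bsub>FF\<^esub> w"
    if th: "\<theta> \<in> carrier FF" "\<theta> \<noteq> \<zero>\<^bsub>FF\<^esub>" "ord_along \<V> P \<theta> \<ge> d" for \<theta>
  proof -
    let ?m = "ord_along \<V> P \<theta>"
    obtain u where u: "u \<in> F.unit_in (loc P)" "\<theta> = u \<otimes>\<^bsub>FF\<^esub> t [^]\<^bsub>FF\<^esub> ?m" using rep[OF th(1,2)] by blast
    obtain k where k: "?m - d = int k" using th(3) by (metis diff_ge_0_iff_ge zero_le_imp_eq_int)
    have uL: "u \<in> loc P" using u by (simp add: F.unit_in_def)
    have "t [^]\<^bsub>FF\<^esub> ?m = t [^]\<^bsub>FF\<^esub> d \<otimes>\<^bsub>FF\<^esub> t [^]\<^bsub>FF\<^esub> (?m - d)"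
      using F.int_pow_add[OF t(2,3), of d "?m - d"] by simp
    also have "t [^]\<^bsub>FF\<^esub> (?m - d) = t [^]\<^bsub>FF\<^esub> k" unfolding k int_pow_int ..
    finally have "u \<otimes>\<^bsub>FF\<^esub> t [^]\<^bsub>FF\<^esub> ?m = u \<otimes>\<^bsub>FF\<^esub> (t [^]\<^bsub>FF\<^esub> d \<otimes>\<^bsub>FF\<^esub> t [^]\<^bsub>FF\<^esub> k)" by simp
    also have "\<dots> = t [^]\<^bsub>FF\<^esub> d \<otimes>\<^bsub>FF\<^esub> (u \<otimes>\<^bsub>FF\<^esub> t [^]\<^bsub>FF\<^esub> k)"
      by (rule F.m_lcomm[OF AR[OF uL] tp(1) AR[OF tj]])
    finally show ?thesis using u(2) subringE(6)[OF A uL tj[of k]] by metis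
  qed
  obtain w where w: "w \<in> loc P" "\<phi> = t [^]\<^bsub>FF\<^esub> d \<otimes>\<^bsub>FF\<^esub> w" using fac[OF \<phi> d(1)] by blast
  obtain z where z: "z \<in> loc P" "\<psi> = t [^]\<^bsub>FF\<^esub> d \<otimes>\<^bsub>FF\<^esub> z" using fac[OF \<psi> d(2)] by blast
  have wz: "w \<oplus>\<^bsub>FF\<^esub> z \<in> loc P" by (rule subringE(7)[OF A w(1) z(1)])
  have eq: "\<phi> \<oplus>\<^bsub>FF\<^esub> \<psi> = t [^]\<^bsub>FF\<^esub> d \<otimes>\<^bsub>FF\<^esub> (w \<oplus>\<^bsub>FF\<^esub> z)"
    unfolding w(2) z(2) by (rule F.r_distr[symmetric, OF AR[OF w(1)] AR[OF z(1)] tp(1)])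
  then have wz0: "w \<oplus>\<^bsub>FF\<^esub> z \<noteq> \<zero>\<^bsub>FF\<^esub>" using nz tp by auto
  have "ord_along \<V> P (t [^]\<^bsub>FF\<^esub> d) = d"
    using ord_along_eq[OF PD t(1) F.unit_in_one[OF A], of d] tp(1) by simp
  then show ?thesis
    unfolding eq using ord_mult[OF PD tp AR[OF wz] wz0] ord_nonneg[OF PD wz wz0] by simp
qed

end

section \<open>Group algebras\<close>

definition single :: "('r, 'm) ring_scheme \<Rightarrow> 'g set \<Rightarrow> 'g \<Rightarrow> 'r \<Rightarrow> 'g \<Rightarrow> 'r"
  where "single R K D a = (\<lambda>E\<in>K. if E = D then a else \<zero>\<^bsub>R\<^esub>)"

text \<open>The divisorial algebra with the conditions on poles dropped. Section rings over nonempty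
  open sets, and all stalks, become subrings of this one ring, and restriction maps become
  inclusions.\<close>

definition group_algebra :: "('r, 'm) ring_scheme \<Rightarrow> 'g::ab_group_add set \<Rightarrow> ('g \<Rightarrow> 'r) ring"
  where "group_algebra R K =
    \<lparr>carrier = {s \<in> K \<rightarrow>\<^sub>E carrier R. finite {D \<in> K. s D \<noteq> \<zero>\<^bsub>R\<^esub>}},
     monoid.mult = (\<lambda>s t. \<lambda>D\<in>K. \<Oplus>\<^bsub>R\<^esub>E\<in>{E \<in> K. s E \<noteq> \<zero>\<^bsub>R\<^esub>}. s E \<otimes>\<^bsub>R\<^esub> t (D - E)),
     monoid.one = single R K 0 \<one>\<^bsub>R\<^esub>,
     ring.zero = single R K 0 \<zero>\<^bsub>R\<^esub>,
     ring.add = (\<lambda>s t. \<lambda>D\<in>K. s D \<oplus>\<^bsub>R\<^esub> t D)\<rparr>"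

locale group_algebra_data = cring R for R (structure) +
  fixes K :: "'g::ab_group_add set"
  assumes K_zero: "0 \<in> K" and K_diff: "D \<in> K \<Longrightarrow> E \<in> K \<Longrightarrow> D - E \<in> K"
begin

abbreviation "B \<equiv> group_algebra R K"
abbreviation "hmg \<equiv> single R K"

lemma K_minus: "D \<in> K \<Longrightarrow> - D \<in> K"
  using K_diff[OF K_zero] by force

lemma K_add: "D \<in> K \<Longrightarrow> E \<in> K \<Longrightarrow> D + E \<in> K"
  using K_diff[OF _ K_minus] by force

lemma mem_B: "s \<in> carrier B \<longleftrightarrow> s \<in> extensional K \<and> (\<forall>D\<in>K. s D \<in> carrier R) \<and> finite {D \<in> K. s D \<noteq> \<zero>}"
  by (auto simp: group_algebra_def PiE_def)

lemma B_val: "s \<in> carrier B \<Longrightarrow> D \<in> K \<Longrightarrow> s D \<in> carrier R"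
  and B_fin: "s \<in> carrier B \<Longrightarrow> finite {D \<in> K. s D \<noteq> \<zero>}"
  and B_ext: "s \<in> carrier B \<Longrightarrow> s \<in> extensional K"
  by (auto simp: mem_B)

lemma B_eqI: "s \<in> extensional K \<Longrightarrow> t \<in> extensional K \<Longrightarrow> (\<And>D. D \<in> K \<Longrightarrow> s D = t D) \<Longrightarrow> s = t"
  by (rule extensionalityI)

lemma add_B: "s \<oplus>\<^bsub>B\<^esub> t = (\<lambda>D\<in>K. s D \<oplus> t D)" and one_B: "\<one>\<^bsub>B\<^esub> = hmg 0 \<one>" and zero_B: "\<zero>\<^bsub>B\<^esub> = (\<lambda>D\<in>K. \<zero>)"
  by (auto simp: group_algebra_def single_def)

lemma mult_B: "s \<otimes>\<^bsub>B\<^esub> t = (\<lambda>D\<in>K. \<Oplus>E\<in>{E \<in> K. s E \<noteq> \<zero>}. s E \<otimes> t (D - E))"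
  by (simp add: group_algebra_def)

lemma mult_ext: "s \<otimes>\<^bsub>B\<^esub> t \<in> extensional K"
  by (simp add: mult_B)

lemma finsum_zeroI: "(\<And>i. i \<in> A \<Longrightarrow> f i = \<zero>) \<Longrightarrow> finsum R f A = \<zero>"
  by (rule add.finprod_one_eqI)

lemma finsum_superset:
  assumes "finite Y" "A \<subseteq> Y" "\<And>i. i \<in> Y \<Longrightarrow> i \<notin> A \<Longrightarrow> f i = \<zero>" "\<And>i. i \<in> Y \<Longrightarrow> f i \<in> carrier R"
  shows "finsum R f A = finsum R f Y"
  using assms by (intro add.finprod_mono_neutral_cong_left) auto

text \<open>The convolution runs over the support of the left factor only; a common larger index set
  makes products with different left factors comparable.\<close>

lemma mult_superset:
  assumes s: "s \<in> carrier B" and t: "t \<in> carrier B" and D: "D \<in> K"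
    and Y: "finite Y" "Y \<subseteq> K" "{E \<in> K. s E \<noteq> \<zero>} \<subseteq> Y"
  shows "(s \<otimes>\<^bsub>B\<^esub> t) D = (\<Oplus>E\<in>Y. s E \<otimes> t (D - E))"
proof -
  have "(s \<otimes>\<^bsub>B\<^esub> t) D = (\<Oplus>E\<in>{E \<in> K. s E \<noteq> \<zero>}. s E \<otimes> t (D - E))" using D by (simp add: mult_B)
  also have "\<dots> = (\<Oplus>E\<in>Y. s E \<otimes> t (D - E))"
  proof (rule finsum_superset[OF Y(1,3)])
    fix i assume i: "i \<in> Y"
    then have iK: "i \<in> K" using Y by blast
    have c: "s i \<in> carrier R" "t (D - i) \<in> carrier R" using B_val[OF s iK] B_val[OF t K_diff[OF D iK]] .
    show "s i \<otimes> t (D - i) \<in> carrier R" using c by simp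
    show "s i \<otimes> t (D - i) = \<zero>" if "i \<notin> {E \<in> K. s E \<noteq> \<zero>}" using that iK c by auto
  qed
  finally show ?thesis .
qed

lemma hom_closed: "a \<in> carrier R \<Longrightarrow> hmg D a \<in> carrier B"
proof -
  assume a: "a \<in> carrier R"
  have "{E \<in> K. hmg D a E \<noteq> \<zero>} \<subseteq> {D}" by (auto simp: single_def)
  then have "finite {E \<in> K. hmg D a E \<noteq> \<zero>}" using finite_subset by blast
  then show ?thesis using a by (auto simp: mem_B) (auto simp: single_def)
qed

lemma zero_B_closed: "\<zero>\<^bsub>B\<^esub> \<in> carrier B"
  unfolding zero_B by (simp add: mem_B)

lemma add_B_closed:
  assumes "s \<in> carrier B" "t \<in> carrier B"
  shows "s \<oplus>\<^bsub>B\<^esub> t \<in> carrier B"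
proof -
  have "{D \<in> K. (s \<oplus>\<^bsub>B\<^esub> t) D \<noteq> \<zero>} \<subseteq> {D \<in> K. s D \<noteq> \<zero>} \<union> {D \<in> K. t D \<noteq> \<zero>}" by (auto simp: add_B)
  then have "finite {D \<in> K. (s \<oplus>\<^bsub>B\<^esub> t) D \<noteq> \<zero>}"
    using B_fin[OF assms(1)] B_fin[OF assms(2)] finite_subset by blast
  then show ?thesis using assms B_val by (auto simp: mem_B add_B)
qed

lemma mult_B_val:
  assumes s: "s \<in> carrier B" and t: "t \<in> carrier B" and D: "D \<in> K"
  shows "(s \<otimes>\<^bsub>B\<^esub> t) D \<in> carrier R"
proof -
  have "(\<Oplus>E\<in>{E \<in> K. s E \<noteq> \<zero>}. s E \<otimes> t (D - E)) \<in> carrier R"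
  proof (rule finsum_closed, rule Pi_I)
    fix E assume "E \<in> {E \<in> K. s E \<noteq> \<zero>}"
    then have E: "E \<in> K" by blast
    show "s E \<otimes> t (D - E) \<in> carrier R" by (rule m_closed[OF B_val[OF s E] B_val[OF t K_diff[OF D E]]])
  qed
  then show ?thesis using D by (simp add: mult_B)
qed

lemma mult_B_closed:
  assumes s: "s \<in> carrier B" and t: "t \<in> carrier B"
  shows "s \<otimes>\<^bsub>B\<^esub> t \<in> carrier B"
proof -
  let ?S = "{D \<in> K. s D \<noteq> \<zero>}" and ?T = "{D \<in> K. t D \<noteq> \<zero>}"
  have "D \<in> (\<lambda>(E, G). E + G) ` (?S \<times> ?T)" if D: "D \<in> K" "(s \<otimes>\<^bsub>B\<^esub> t) D \<noteq> \<zero>" for D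
  proof (rule ccontr)
    assume nD: "D \<notin> (\<lambda>(E, G). E + G) ` (?S \<times> ?T)"
    have "s E \<otimes> t (D - E) = \<zero>" if E: "E \<in> ?S" for E
    proof -
      have "D - E \<notin> ?T"
      proof
        assume "D - E \<in> ?T"
        then have "(E, D - E) \<in> ?S \<times> ?T" using E by blast
        then show False using nD by (force simp: image_iff)
      qed
      then show ?thesis using E K_diff[OF D(1)] B_val[OF s] by auto
    qed
    then have "(\<Oplus>E\<in>?S. s E \<otimes> t (D - E)) = \<zero>" by (rule finsum_zeroI)
    then have "(s \<otimes>\<^bsub>B\<^esub> t) D = \<zero>" using D(1) by (simp add: mult_B)
    then show False using D(2) by simp
  qed
  then have "{D \<in> K. (s \<otimes>\<^bsub>B\<^esub> t) D \<noteq> \<zero>} \<subseteq> (\<lambda>(E, G). E + G) ` (?S \<times> ?T)" by blast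
  moreover have "finite ((\<lambda>(E, G). E + G) ` (?S \<times> ?T))" using B_fin[OF s] B_fin[OF t] by simp
  ultimately have "finite {D \<in> K. (s \<otimes>\<^bsub>B\<^esub> t) D \<noteq> \<zero>}" by (rule finite_subset)
  then show ?thesis using mult_B_val[OF s t] mult_ext by (simp add: mem_B)
qed

lemma B_l_distr:
  assumes s: "s \<in> carrier B" and s': "s' \<in> carrier B" and t: "t \<in> carrier B"
  shows "(s \<oplus>\<^bsub>B\<^esub> s') \<otimes>\<^bsub>B\<^esub> t = s \<otimes>\<^bsub>B\<^esub> t \<oplus>\<^bsub>B\<^esub> s' \<otimes>\<^bsub>B\<^esub> t"
proof (rule B_eqI)
  let ?X = "{D \<in> K. s D \<noteq> \<zero>} \<union> {D \<in> K. s' D \<noteq> \<zero>}"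
  have Y: "finite ?X" "?X \<subseteq> K" using B_fin[OF s] B_fin[OF s'] by auto
  fix D assume D: "D \<in> K"
  have cl: "s E \<otimes> t (D - E) \<in> carrier R" "s' E \<otimes> t (D - E) \<in> carrier R" if "E \<in> ?X" for E
    using that B_val[OF s] B_val[OF s'] B_val[OF t] K_diff[OF D] by auto
  have "((s \<oplus>\<^bsub>B\<^esub> s') \<otimes>\<^bsub>B\<^esub> t) D = (\<Oplus>E\<in>?X. (s \<oplus>\<^bsub>B\<^esub> s') E \<otimes> t (D - E))"
    by (rule mult_superset[OF add_B_closed[OF s s'] t D Y]) (auto simp: add_B)
  also have "\<dots> = (\<Oplus>E\<in>?X. s E \<otimes> t (D - E) \<oplus> s' E \<otimes> t (D - E))"
  proof (rule finsum_cong')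
    fix E assume E: "E \<in> ?X"
    then have EK: "E \<in> K" by blast
    show "(s \<oplus>\<^bsub>B\<^esub> s') E \<otimes> t (D - E) = s E \<otimes> t (D - E) \<oplus> s' E \<otimes> t (D - E)"
      using EK l_distr[OF B_val[OF s EK] B_val[OF s' EK] B_val[OF t K_diff[OF D EK]]] by (simp add: add_B)
  qed (use cl in auto)
  also have "\<dots> = (\<Oplus>E\<in>?X. s E \<otimes> t (D - E)) \<oplus> (\<Oplus>E\<in>?X. s' E \<otimes> t (D - E))"
    by (rule finsum_addf) (use cl in auto)
  also have "(\<Oplus>E\<in>?X. s E \<otimes> t (D - E)) = (s \<otimes>\<^bsub>B\<^esub> t) D"
    by (rule mult_superset[OF s t D Y, symmetric]) auto
  also have "(\<Oplus>E\<in>?X. s' E \<otimes> t (D - E)) = (s' \<otimes>\<^bsub>B\<^esub> t) D"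
    by (rule mult_superset[OF s' t D Y, symmetric]) auto
  finally show "((s \<oplus>\<^bsub>B\<^esub> s') \<otimes>\<^bsub>B\<^esub> t) D = (s \<otimes>\<^bsub>B\<^esub> t \<oplus>\<^bsub>B\<^esub> s' \<otimes>\<^bsub>B\<^esub> t) D"
    using D by (simp add: add_B[of "s \<otimes>\<^bsub>B\<^esub> t"])
qed (auto simp: mult_B add_B)

lemma B_r_distr:
  assumes s: "s \<in> carrier B" and t: "t \<in> carrier B" and t': "t' \<in> carrier B"
  shows "s \<otimes>\<^bsub>B\<^esub> (t \<oplus>\<^bsub>B\<^esub> t') = s \<otimes>\<^bsub>B\<^esub> t \<oplus>\<^bsub>B\<^esub> s \<otimes>\<^bsub>B\<^esub> t'"
proof (rule B_eqI)
  let ?X = "{D \<in> K. s D \<noteq> \<zero>}"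
  fix D assume D: "D \<in> K"
  have cl: "s E \<otimes> t (D - E) \<in> carrier R" "s E \<otimes> t' (D - E) \<in> carrier R" if "E \<in> ?X" for E
    using that B_val[OF s] B_val[OF t'] B_val[OF t] K_diff[OF D] by auto
  have "(s \<otimes>\<^bsub>B\<^esub> (t \<oplus>\<^bsub>B\<^esub> t')) D = (\<Oplus>E\<in>?X. s E \<otimes> (t \<oplus>\<^bsub>B\<^esub> t') (D - E))"
    using D by (simp add: mult_B)
  also have "\<dots> = (\<Oplus>E\<in>?X. s E \<otimes> t (D - E) \<oplus> s E \<otimes> t' (D - E))"
  proof (rule finsum_cong')
    fix E assume E: "E \<in> ?X"
    then have EK: "E \<in> K" by blast
    show "s E \<otimes> (t \<oplus>\<^bsub>B\<^esub> t') (D - E) = s E \<otimes> t (D - E) \<oplus> s E \<otimes> t' (D - E)"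
      using K_diff[OF D EK] r_distr[OF B_val[OF t K_diff[OF D EK]] B_val[OF t' K_diff[OF D EK]] B_val[OF s EK]]
      by (simp add: add_B)
  qed (use cl in auto)
  also have "\<dots> = (\<Oplus>E\<in>?X. s E \<otimes> t (D - E)) \<oplus> (\<Oplus>E\<in>?X. s E \<otimes> t' (D - E))"
    by (rule finsum_addf) (use cl in auto)
  finally show "(s \<otimes>\<^bsub>B\<^esub> (t \<oplus>\<^bsub>B\<^esub> t')) D = (s \<otimes>\<^bsub>B\<^esub> t \<oplus>\<^bsub>B\<^esub> s \<otimes>\<^bsub>B\<^esub> t') D"
    using D by (simp add: add_B mult_B)
qed (auto simp: mult_B add_B)

lemma hom_mult_val:
  assumes a: "a \<in> carrier R" and F: "F \<in> K" and t: "t \<in> carrier B" and D: "D \<in> K"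
  shows "(hmg F a \<otimes>\<^bsub>B\<^esub> t) D = a \<otimes> t (D - F)"
proof -
  have "(hmg F a \<otimes>\<^bsub>B\<^esub> t) D = (\<Oplus>E\<in>{F}. hmg F a E \<otimes> t (D - E))"
    by (rule mult_superset[OF hom_closed[OF a] t D]) (use F in \<open>auto simp: single_def\<close>)
  also have "\<dots> = a \<otimes> t (D - F)"
    using F a B_val[OF t K_diff[OF D F]] by (simp add: single_def)
  finally show ?thesis .
qed

lemma hom_mult:
  assumes "a \<in> carrier R" "b \<in> carrier R" "D \<in> K" "E \<in> K"
  shows "hmg D a \<otimes>\<^bsub>B\<^esub> hmg E b = hmg (D + E) (a \<otimes> b)"
proof (rule B_eqI)
  fix G assume G: "G \<in> K"
  have "G - D = E \<longleftrightarrow> G = D + E" by (auto simp: algebra_simps)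
  then show "(hmg D a \<otimes>\<^bsub>B\<^esub> hmg E b) G = hmg (D + E) (a \<otimes> b) G"
    using hom_mult_val[OF assms(1,3) hom_closed[OF assms(2)] G] G K_diff[OF G assms(3)] assms(1)
    by (simp add: single_def)
qed (auto simp: mult_B single_def)

lemma hom_add: "hmg D (a \<oplus> b) = hmg D a \<oplus>\<^bsub>B\<^esub> hmg D b" if "a \<in> carrier R" "b \<in> carrier R"
  using that by (intro B_eqI) (auto simp: add_B single_def)

lemma hom_zero: "hmg D \<zero> = \<zero>\<^bsub>B\<^esub>"
  by (auto simp: single_def zero_B)

text \<open>The homogeneous case is restricted to the components of \<open>s\<close> itself, so that
  facts about them, such as being sections over an open set, are available.\<close>

lemma B_induct [consumes 1, case_names zero hmg add]:
  assumes s: "s \<in> carrier B" and z: "P \<zero>\<^bsub>B\<^esub>"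
    and h: "\<And>D. D \<in> K \<Longrightarrow> s D \<noteq> \<zero> \<Longrightarrow> P (hmg D (s D))"
    and a: "\<And>u v. u \<in> carrier B \<Longrightarrow> v \<in> carrier B \<Longrightarrow> P u \<Longrightarrow> P v \<Longrightarrow> P (u \<oplus>\<^bsub>B\<^esub> v)"
  shows "P s"
proof -
  let ?r = "\<lambda>Y. \<lambda>D\<in>K. if D \<in> Y then s D else \<zero>"
  have r: "?r Y \<in> carrier B" for Y
  proof -
    have "{D \<in> K. ?r Y D \<noteq> \<zero>} \<subseteq> {D \<in> K. s D \<noteq> \<zero>}" by auto
    then have "finite {D \<in> K. ?r Y D \<noteq> \<zero>}" using B_fin[OF s] finite_subset by blast
    then show ?thesis using B_val[OF s] by (auto simp: mem_B)
  qed
  have "P (?r Y)" if "finite Y" "Y \<subseteq> {D \<in> K. s D \<noteq> \<zero>}" for Y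
    using that
  proof (induction Y rule: finite_induct)
    case empty
    have "?r {} = \<zero>\<^bsub>B\<^esub>" by (rule B_eqI) (auto simp: zero_B)
    then show ?case using z by simp
  next
    case (insert D Y)
    have DK: "D \<in> K" "s D \<noteq> \<zero>" using insert by auto
    have "?r (insert D Y) = hmg D (s D) \<oplus>\<^bsub>B\<^esub> ?r Y"
      using insert(2) B_val[OF s] by (intro B_eqI) (auto simp: add_B single_def)
    have "P (?r Y)" using insert by blast
    then show ?case
      unfolding \<open>?r (insert D Y) = hmg D (s D) \<oplus>\<^bsub>B\<^esub> ?r Y\<close>
      by (rule a[OF hom_closed[OF B_val[OF s DK(1)]] r h[OF DK]])
  qed
  from this[OF B_fin[OF s]] have "P (?r {D \<in> K. s D \<noteq> \<zero>})" by simp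
  moreover have "?r {D \<in> K. s D \<noteq> \<zero>} = s" by (rule B_eqI) (auto simp: B_ext[OF s])
  ultimately show ?thesis by simp
qed

lemma B_zero_mult: "t \<in> carrier B \<Longrightarrow> \<zero>\<^bsub>B\<^esub> \<otimes>\<^bsub>B\<^esub> t = \<zero>\<^bsub>B\<^esub>"
  by (intro B_eqI) (auto simp: mult_B zero_B)

lemma B_mult_zero:
  assumes "t \<in> carrier B"
  shows "t \<otimes>\<^bsub>B\<^esub> \<zero>\<^bsub>B\<^esub> = \<zero>\<^bsub>B\<^esub>"
  using assms by (intro B_eqI) (auto simp: mult_B zero_B B_val K_diff intro!: add.finprod_one_eqI)

lemma B_add_comm: "s \<in> carrier B \<Longrightarrow> t \<in> carrier B \<Longrightarrow> s \<oplus>\<^bsub>B\<^esub> t = t \<oplus>\<^bsub>B\<^esub> s"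
  by (rule B_eqI) (auto simp: add_B B_val a_comm)

lemma B_add_assoc:
  "s \<in> carrier B \<Longrightarrow> t \<in> carrier B \<Longrightarrow> u \<in> carrier B \<Longrightarrow>
    (s \<oplus>\<^bsub>B\<^esub> t) \<oplus>\<^bsub>B\<^esub> u = s \<oplus>\<^bsub>B\<^esub> (t \<oplus>\<^bsub>B\<^esub> u)"
  by (rule B_eqI) (auto simp: add_B B_val a_assoc)

lemma B_abelian_group: "abelian_group B"
proof (rule abelian_groupI)
  fix s assume s: "s \<in> carrier B"
  show "\<zero>\<^bsub>B\<^esub> \<oplus>\<^bsub>B\<^esub> s = s" by (rule B_eqI) (auto simp: add_B zero_B B_val[OF s] B_ext[OF s])
  have "{D \<in> K. (\<lambda>D\<in>K. \<ominus> s D) D \<noteq> \<zero>} \<subseteq> {D \<in> K. s D \<noteq> \<zero>}" by auto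
  then have "finite {D \<in> K. (\<lambda>D\<in>K. \<ominus> s D) D \<noteq> \<zero>}" using B_fin[OF s] finite_subset by blast
  then have "(\<lambda>D\<in>K. \<ominus> s D) \<in> carrier B" using B_val[OF s] by (auto simp: mem_B)
  moreover have "(\<lambda>D\<in>K. \<ominus> s D) \<oplus>\<^bsub>B\<^esub> s = \<zero>\<^bsub>B\<^esub>"
    by (rule B_eqI) (auto simp: add_B zero_B B_val[OF s] l_neg)
  ultimately show "\<exists>t\<in>carrier B. t \<oplus>\<^bsub>B\<^esub> s = \<zero>\<^bsub>B\<^esub>" by blast
qed (fact add_B_closed zero_B_closed B_add_comm B_add_assoc)+

text \<open>The convolution is asymmetric in its support, but both sides are additive in each
  factor, so homogeneous elements suffice.\<close>

lemma B_mult_comm: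
  assumes s: "s \<in> carrier B" and t: "t \<in> carrier B"
  shows "s \<otimes>\<^bsub>B\<^esub> t = t \<otimes>\<^bsub>B\<^esub> s"
  using s
proof (induction rule: B_induct)
  case zero
  show ?case using t by (simp add: B_zero_mult B_mult_zero)
next
  case (add u v)
  then show ?case using t by (simp add: B_l_distr B_r_distr)
next
  case (hmg D)
  have a: "s D \<in> carrier R" "D \<in> K" using B_val[OF s hmg(1)] hmg(1) .
  show ?case
    using t
  proof (induction rule: B_induct)
    case zero
    show ?case using hom_closed[OF a(1)] by (simp add: B_zero_mult B_mult_zero)
  next
    case (add u v)
    then show ?case using hom_closed[OF a(1)] by (simp add: B_l_distr B_r_distr)
  next
    case (hmg E)
    then show ?case
      using hom_mult[OF a(1) B_val[OF t hmg(1)] a(2) hmg(1)] hom_mult[OF B_val[OF t hmg(1)] a(1) hmg(1) a(2)]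
        m_comm[OF a(1) B_val[OF t hmg(1)]] by (simp add: add.commute)
  qed
qed

lemma B_mult_assoc:
  assumes s: "s \<in> carrier B" and t: "t \<in> carrier B" and u: "u \<in> carrier B"
  shows "(s \<otimes>\<^bsub>B\<^esub> t) \<otimes>\<^bsub>B\<^esub> u = s \<otimes>\<^bsub>B\<^esub> (t \<otimes>\<^bsub>B\<^esub> u)"
  using s
proof (induction rule: B_induct)
  case zero
  show ?case using t u by (simp add: B_zero_mult mult_B_closed)
next
  case (add v w)
  then show ?case using t u by (simp add: B_l_distr mult_B_closed)
next
  case (hmg D)
  note D = hmg(1) and a = B_val[OF s hmg(1)]
  note hD = hom_closed[OF a, of D]
  show ?case
    using t
  proof (induction rule: B_induct)
    case zero
    show ?case using u hD by (simp add: B_zero_mult B_mult_zero)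
  next
    case (add v w)
    then show ?case using u hD by (simp add: B_l_distr B_r_distr mult_B_closed)
  next
    case (hmg E)
    note b = B_val[OF t hmg(1)] and E = hmg(1)
    show ?case
    proof (rule B_eqI[OF mult_ext mult_ext])
      fix G assume G: "G \<in> K"
      have "((hmg D (s D) \<otimes>\<^bsub>B\<^esub> hmg E (t E)) \<otimes>\<^bsub>B\<^esub> u) G = s D \<otimes> t E \<otimes> u (G - (D + E))"
        using hom_mult_val[OF m_closed[OF a b] K_add[OF D E] u G] by (simp add: hom_mult[OF a b D E])
      also have "\<dots> = s D \<otimes> (t E \<otimes> u (G - D - E))"
        using m_assoc[OF a b B_val[OF u K_diff[OF K_diff[OF G D] E]]] by (simp add: diff_diff_eq)
      also have "\<dots> = (hmg D (s D) \<otimes>\<^bsub>B\<^esub> (hmg E (t E) \<otimes>\<^bsub>B\<^esub> u)) G"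
        using hom_mult_val[OF a D mult_B_closed[OF hom_closed[OF b] u] G] hom_mult_val[OF b E u K_diff[OF G D]]
        by simp
      finally show "((hmg D (s D) \<otimes>\<^bsub>B\<^esub> hmg E (t E)) \<otimes>\<^bsub>B\<^esub> u) G =
        (hmg D (s D) \<otimes>\<^bsub>B\<^esub> (hmg E (t E) \<otimes>\<^bsub>B\<^esub> u)) G" .
    qed
  qed
qed

lemma cring_B: "cring B"
proof (rule cringI[OF B_abelian_group])
  show "comm_monoid B"
  proof (rule comm_monoidI)
    show "\<one>\<^bsub>B\<^esub> \<in> carrier B" by (simp add: one_B hom_closed)
    show "\<one>\<^bsub>B\<^esub> \<otimes>\<^bsub>B\<^esub> s = s" if "s \<in> carrier B" for s
      unfolding one_B using that hom_mult_val[OF one_closed K_zero that]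
      by (intro B_eqI[OF mult_ext B_ext]) (auto simp: B_val)
  qed (fact mult_B_closed B_mult_comm B_mult_assoc)+
qed (fact B_l_distr)

end

sublocale group_algebra_data \<subseteq> B: cring "group_algebra R K"
  by (rule cring_B)

context group_algebra_data
begin

lemma minus_B: "s \<in> carrier B \<Longrightarrow> D \<in> K \<Longrightarrow> (\<ominus>\<^bsub>B\<^esub> s) D = \<ominus> s D"
proof -
  assume s: "s \<in> carrier B" and D: "D \<in> K"
  have "(\<ominus>\<^bsub>B\<^esub> s \<oplus>\<^bsub>B\<^esub> s) D = \<zero>" using s D by (simp add: B.l_neg zero_B)
  then have "(\<ominus>\<^bsub>B\<^esub> s) D \<oplus> s D = \<zero>" using D by (simp add: add_B)
  then show ?thesis
    using minus_equality[of "(\<ominus>\<^bsub>B\<^esub> s) D" "s D"] B_val[OF s D] B_val[OF B.a_inv_closed[OF s] D] by simp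
qed

lemma finsum_in:
  assumes "S \<subseteq> carrier R" "\<zero> \<in> S" "\<And>a b. a \<in> S \<Longrightarrow> b \<in> S \<Longrightarrow> a \<oplus> b \<in> S" "\<And>i. i \<in> Y \<Longrightarrow> f i \<in> S"
  shows "finsum R f Y \<in> S"
  using assms(4)
proof (induction Y rule: infinite_finite_induct)
  case (insert x Y)
  have "finsum R f (insert x Y) = f x \<oplus> finsum R f Y"
    using insert assms(1) by (intro finsum_insert) auto
  then show ?case using insert assms(3) by auto
qed (auto simp: assms(2) finsum_infinite)

lemma graded_subring:
  assumes S: "\<And>D. D \<in> K \<Longrightarrow> S D \<subseteq> carrier R" "\<And>D. D \<in> K \<Longrightarrow> \<zero> \<in> S D" "\<one> \<in> S 0"
    "\<And>D a b. D \<in> K \<Longrightarrow> a \<in> S D \<Longrightarrow> b \<in> S D \<Longrightarrow> a \<oplus> b \<in> S D"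
    "\<And>D a. D \<in> K \<Longrightarrow> a \<in> S D \<Longrightarrow> \<ominus> a \<in> S D"
    "\<And>D E a b. D \<in> K \<Longrightarrow> E \<in> K \<Longrightarrow> a \<in> S D \<Longrightarrow> b \<in> S E \<Longrightarrow> a \<otimes> b \<in> S (D + E)"
  shows "subring {s \<in> carrier B. \<forall>D\<in>K. s D \<in> S D} B"
proof (rule B.subringI)
  let ?T = "{s \<in> carrier B. \<forall>D\<in>K. s D \<in> S D}"
  show "?T \<subseteq> carrier B" by blast
  have "\<one>\<^bsub>B\<^esub> D \<in> S D" if "D \<in> K" for D using that S(2,3) by (auto simp: one_B single_def)
  then show "\<one>\<^bsub>B\<^esub> \<in> ?T" using B.one_closed by blast
  show "\<ominus>\<^bsub>B\<^esub> s \<in> ?T" if "s \<in> ?T" for s using that S(5) by (auto simp: minus_B)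
  fix s t assume s: "s \<in> ?T" and t: "t \<in> ?T"
  have "(s \<oplus>\<^bsub>B\<^esub> t) D \<in> S D" if "D \<in> K" for D using that S(4) s t by (auto simp: add_B)
  then show "s \<oplus>\<^bsub>B\<^esub> t \<in> ?T" using s t B.a_closed by blast
  have "(s \<otimes>\<^bsub>B\<^esub> t) D \<in> S D" if D: "D \<in> K" for D
  proof -
    have "(\<Oplus>E\<in>{E \<in> K. s E \<noteq> \<zero>}. s E \<otimes> t (D - E)) \<in> S D"
    proof (rule finsum_in[OF S(1)[OF D] S(2)[OF D] S(4)[OF D]])
      fix E assume "E \<in> {E \<in> K. s E \<noteq> \<zero>}"
      then have E: "E \<in> K" by blast
      have "s E \<otimes> t (D - E) \<in> S (E + (D - E))"
        using s t E K_diff[OF D E] by (intro S(6)) auto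
      then show "s E \<otimes> t (D - E) \<in> S D" by simp
    qed
    then show ?thesis using D by (simp add: mult_B)
  qed
  then show "s \<otimes>\<^bsub>B\<^esub> t \<in> ?T" using s t B.m_closed by blast
qed

end

text \<open>
  A homomorphism \<open>\<chi>\<close> from a subgroup \<open>L0\<close> identifies degrees that differ by \<open>L0\<close>.
  The value \<open>collapse D s\<close> gathers all components of \<open>s\<close> of degree in \<open>D + L0\<close>
  after moving them to degree \<open>D\<close>.
\<close>

locale collapsed_group_algebra = group_algebra_data R K for R (structure) and K :: "'g::ab_group_add set" +
  fixes L0 :: "'g set" and \<chi> :: "'g \<Rightarrow> 'a"
  assumes L0_sub: "L0 \<subseteq> K" and L0_zero: "0 \<in> L0" and L0_diff: "D \<in> L0 \<Longrightarrow> E \<in> L0 \<Longrightarrow> D - E \<in> L0"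
    and \<chi>_closed: "E \<in> L0 \<Longrightarrow> \<chi> E \<in> carrier R" and \<chi>_zero: "\<chi> 0 = \<one>"
    and \<chi>_add: "D \<in> L0 \<Longrightarrow> E \<in> L0 \<Longrightarrow> \<chi> (D + E) = \<chi> D \<otimes> \<chi> E"
begin

definition collapse :: "'g \<Rightarrow> ('g \<Rightarrow> 'a) \<Rightarrow> 'a"
  where "collapse D s = (\<Oplus>E\<in>{E \<in> L0. s (D + E) \<noteq> \<zero>}. s (D + E) \<otimes> \<chi> E)"

lemma L0_minus: "D \<in> L0 \<Longrightarrow> - D \<in> L0"
  using L0_diff[OF L0_zero] by force

lemma L0_add: "D \<in> L0 \<Longrightarrow> E \<in> L0 \<Longrightarrow> D + E \<in> L0"
  using L0_diff[OF _ L0_minus] by force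

lemma shift_in: "D \<in> K \<Longrightarrow> E \<in> L0 \<Longrightarrow> D + E \<in> K"
  using K_add L0_sub by blast

lemma collapse_index_finite:
  assumes "s \<in> carrier B" "D \<in> K"
  shows "finite {E \<in> L0. s (D + E) \<noteq> \<zero>}"
proof -
  have "{E \<in> L0. s (D + E) \<noteq> \<zero>} \<subseteq> (\<lambda>G. G - D) ` {G \<in> K. s G \<noteq> \<zero>}"
  proof
    fix E assume "E \<in> {E \<in> L0. s (D + E) \<noteq> \<zero>}"
    then show "E \<in> (\<lambda>G. G - D) ` {G \<in> K. s G \<noteq> \<zero>}"
      using shift_in[OF assms(2)] by (intro image_eqI[of _ _ "D + E"]) auto
  qed
  then show ?thesis using B_fin[OF assms(1)] finite_surj by blast
qed

lemma collapse_term: "s \<in> carrier B \<Longrightarrow> D \<in> K \<Longrightarrow> E \<in> L0 \<Longrightarrow> s (D + E) \<otimes> \<chi> E \<in> carrier R"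
  by (simp add: B_val shift_in \<chi>_closed)

lemma collapse_superset:
  assumes "s \<in> carrier B" "D \<in> K" "finite Y" "Y \<subseteq> L0" "{E \<in> L0. s (D + E) \<noteq> \<zero>} \<subseteq> Y"
  shows "collapse D s = (\<Oplus>E\<in>Y. s (D + E) \<otimes> \<chi> E)"
  unfolding collapse_def using assms
  by (intro finsum_superset) (auto simp: collapse_term \<chi>_closed subset_iff)

lemma collapse_closed: "s \<in> carrier B \<Longrightarrow> D \<in> K \<Longrightarrow> collapse D s \<in> carrier R"
  unfolding collapse_def by (intro finsum_closed) (auto simp: collapse_term)

lemma collapse_add:
  assumes s: "s \<in> carrier B" and t: "t \<in> carrier B" and D: "D \<in> K"
  shows "collapse D (s \<oplus>\<^bsub>B\<^esub> t) = collapse D s \<oplus> collapse D t"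
proof -
  let ?X = "{E \<in> L0. s (D + E) \<noteq> \<zero>} \<union> {E \<in> L0. t (D + E) \<noteq> \<zero>}"
  have Y: "finite ?X" "?X \<subseteq> L0" using collapse_index_finite s t D by auto
  have "collapse D (s \<oplus>\<^bsub>B\<^esub> t) = (\<Oplus>E\<in>?X. (s \<oplus>\<^bsub>B\<^esub> t) (D + E) \<otimes> \<chi> E)"
    by (rule collapse_superset[OF B.a_closed[OF s t] D Y]) (auto simp: add_B shift_in[OF D])
  also have "\<dots> = (\<Oplus>E\<in>?X. s (D + E) \<otimes> \<chi> E \<oplus> t (D + E) \<otimes> \<chi> E)"
  proof (rule finsum_cong')
    fix E assume "E \<in> ?X"
    then have E: "E \<in> L0" by blast
    show "(s \<oplus>\<^bsub>B\<^esub> t) (D + E) \<otimes> \<chi> E = s (D + E) \<otimes> \<chi> E \<oplus> t (D + E) \<otimes> \<chi> E"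
      using l_distr[OF B_val[OF s shift_in[OF D E]] B_val[OF t shift_in[OF D E]] \<chi>_closed[OF E]]
      by (simp add: add_B shift_in[OF D E])
  qed (use collapse_term s t D in auto)
  also have "\<dots> = (\<Oplus>E\<in>?X. s (D + E) \<otimes> \<chi> E) \<oplus> (\<Oplus>E\<in>?X. t (D + E) \<otimes> \<chi> E)"
    by (rule finsum_addf) (use collapse_term s t D in auto)
  also have "(\<Oplus>E\<in>?X. s (D + E) \<otimes> \<chi> E) = collapse D s"
    by (rule collapse_superset[OF s D Y, symmetric]) auto
  also have "(\<Oplus>E\<in>?X. t (D + E) \<otimes> \<chi> E) = collapse D t"
    by (rule collapse_superset[OF t D Y, symmetric]) auto
  finally show ?thesis .
qed

lemma collapse_zero: "D \<in> K \<Longrightarrow> collapse D \<zero>\<^bsub>B\<^esub> = \<zero>"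
  unfolding collapse_def using shift_in by (auto simp: zero_B intro!: add.finprod_one_eqI)

lemma collapse_minus:
  assumes s: "s \<in> carrier B" and D: "D \<in> K"
  shows "collapse D (\<ominus>\<^bsub>B\<^esub> s) = \<ominus> collapse D s"
proof -
  have "collapse D (\<ominus>\<^bsub>B\<^esub> s) \<oplus> collapse D s = \<zero>"
    using collapse_add[OF B.a_inv_closed[OF s] s D] s D by (simp add: B.l_neg collapse_zero)
  then show ?thesis
    using minus_equality collapse_closed[OF s D] collapse_closed[OF B.a_inv_closed[OF s] D] by simp
qed

lemma collapse_hom:
  assumes a: "a \<in> carrier R" and F: "F \<in> K" and D: "D \<in> K"
  shows "collapse D (hmg F a) = (if F - D \<in> L0 then a \<otimes> \<chi> (F - D) else \<zero>)"
proof (cases "F - D \<in> L0")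
  case True
  have "collapse D (hmg F a) = (\<Oplus>E\<in>{F - D}. hmg F a (D + E) \<otimes> \<chi> E)"
  proof (rule collapse_superset[OF hom_closed[OF a] D])
    show "{E \<in> L0. hmg F a (D + E) \<noteq> \<zero>} \<subseteq> {F - D}"
      using shift_in[OF D] by (auto simp: single_def split: if_splits)
  qed (use True in auto)
  then show ?thesis using True a F \<chi>_closed[OF True] by (simp add: single_def)
next
  case False
  have "hmg F a (D + E) = \<zero>" if "E \<in> L0" for E
    using that False shift_in[OF D that] by (auto simp: single_def)
  then have e: "{E \<in> L0. hmg F a (D + E) \<noteq> \<zero>} = {}" by blast
  show ?thesis unfolding collapse_def e using False by simp
qed

text \<open>On a homogeneous element of degree \<open>F\<close> this is
  \<open>\<chi> (F - D) = \<chi> (F - (D + E)) \<otimes> \<chi> E\<close>. One value in each coset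
  of \<open>L0\<close> thus determines the others.\<close>

lemma collapse_shift:
  assumes s: "s \<in> carrier B" and D: "D \<in> K" and E: "E \<in> L0"
  shows "collapse D s = collapse (D + E) s \<otimes> \<chi> E"
  using s
proof (induction rule: B_induct)
  case zero
  show ?case using D E shift_in \<chi>_closed by (simp add: collapse_zero)
next
  case (add u v)
  then show ?case
    using D E shift_in[OF D E] \<chi>_closed[OF E] by (simp add: collapse_add l_distr collapse_closed)
next
  case (hmg F)
  note a = B_val[OF s hmg(1)]
  have iff: "F - D \<in> L0 \<longleftrightarrow> F - (D + E) \<in> L0"
    using L0_diff[OF _ E, of "F - D"] L0_add[OF _ E, of "F - (D + E)"] by (auto simp: algebra_simps)
  show ?case
  proof (cases "F - D \<in> L0")
    case True
    then have FE: "F - (D + E) \<in> L0" using iff by blast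
    have "\<chi> (F - D) = \<chi> (F - (D + E)) \<otimes> \<chi> E" using \<chi>_add[OF FE E] by simp
    then show ?thesis
      using True FE a hmg(1) D E shift_in[OF D E] \<chi>_closed[OF E] \<chi>_closed[OF FE] by (simp add: collapse_hom m_assoc)
  next
    case False
    then show ?thesis using iff a hmg(1) D E shift_in[OF D E] \<chi>_closed[OF E] by (simp add: collapse_hom)
  qed
qed

lemma collapse_hom_mult:
  assumes a: "a \<in> carrier R" and F: "F \<in> K" and t: "t \<in> carrier B" and D: "D \<in> K"
  shows "collapse D (hmg F a \<otimes>\<^bsub>B\<^esub> t) = a \<otimes> collapse (D - F) t"
  using t
proof (induction rule: B_induct)
  case zero
  show ?case using hom_closed[OF a] a D F K_diff by (simp add: collapse_zero)
next
  case (add u v)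
  then show ?case
    using hom_closed[OF a] a D F K_diff[OF D F]
    by (simp add: B.r_distr collapse_add collapse_closed r_distr)
next
  case (hmg G)
  note b = B_val[OF t hmg(1)]
  have e: "F + G - D = G - (D - F)" by (simp add: algebra_simps)
  show ?case
    unfolding hom_mult[OF a b F hmg(1)] collapse_hom[OF m_closed[OF a b] K_add[OF F hmg(1)] D]
      collapse_hom[OF b hmg(1) K_diff[OF D F]] e
    using a b \<chi>_closed by (simp add: m_assoc)
qed

definition collapse_kernel :: "('g \<Rightarrow> 'a) set"
  where "collapse_kernel = {s \<in> carrier B. \<forall>D\<in>K. collapse D s = \<zero>}"

lemma collapse_kernel_ideal: "ideal collapse_kernel B"
proof (rule idealI[OF B.ring_axioms])
  show "subgroup collapse_kernel (add_monoid B)"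
  proof (rule B.add.subgroupI)
    show "collapse_kernel \<subseteq> carrier B" by (auto simp: collapse_kernel_def)
    show "collapse_kernel \<noteq> {}" using B.zero_closed collapse_zero by (auto simp: collapse_kernel_def)
    show "\<ominus>\<^bsub>B\<^esub> a \<in> collapse_kernel" if "a \<in> collapse_kernel" for a
      using that by (auto simp: collapse_kernel_def collapse_minus)
    show "a \<oplus>\<^bsub>B\<^esub> b \<in> collapse_kernel" if "a \<in> collapse_kernel" "b \<in> collapse_kernel" for a b
      using that by (auto simp: collapse_kernel_def collapse_add)
  qed
  have l: "x \<otimes>\<^bsub>B\<^esub> a \<in> collapse_kernel" if a: "a \<in> collapse_kernel" and x: "x \<in> carrier B" for a x
    using x
  proof (induction rule: B_induct)
    case zero
    have "\<zero>\<^bsub>B\<^esub> \<otimes>\<^bsub>B\<^esub> a = \<zero>\<^bsub>B\<^esub>" using a by (simp add: collapse_kernel_def)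
    then show ?case using B.zero_closed collapse_zero by (auto simp: collapse_kernel_def)
  next
    case (add u v)
    then show ?case using a by (auto simp: collapse_kernel_def B.l_distr collapse_add)
  next
    case (hmg F)
    note c = B_val[OF x hmg(1)]
    show ?case
      using a hom_closed[OF c, of F] collapse_hom_mult[OF c hmg(1)] K_diff[OF _ hmg(1)] c
      by (auto simp: collapse_kernel_def)
  qed
  then show "x \<otimes>\<^bsub>B\<^esub> a \<in> collapse_kernel" if "a \<in> collapse_kernel" "x \<in> carrier B" for a x
    using that by blast
  show "a \<otimes>\<^bsub>B\<^esub> x \<in> collapse_kernel" if "a \<in> collapse_kernel" "x \<in> carrier B" for a x
    using that l[OF that] B.m_comm[of a x] by (simp add: collapse_kernel_def)
qed

text \<open>Moved to degree \<open>D\<close>, both \<open>\<one>\<close> and \<open>\<chi> E\<close>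
  in degree \<open>- E\<close> become \<open>\<chi> (- D)\<close>, by
  \<open>\<chi> E \<otimes> \<chi> (- E - D) = \<chi> (- D)\<close>, or both become zero. These
  differences are the generators of the Cox ideal.\<close>

lemma collapse_generator:
  assumes E: "E \<in> L0"
  shows "\<one>\<^bsub>B\<^esub> \<ominus>\<^bsub>B\<^esub> hmg (- E) (\<chi> E) \<in> collapse_kernel"
proof -
  note c = hom_closed[OF \<chi>_closed[OF E], of "- E"] and EK = K_minus[OF subsetD[OF L0_sub E]]
  have "collapse D (\<one>\<^bsub>B\<^esub> \<ominus>\<^bsub>B\<^esub> hmg (- E) (\<chi> E)) = \<zero>" if D: "D \<in> K" for D
  proof -
    have iff: "- E - D \<in> L0 \<longleftrightarrow> 0 - D \<in> L0"
    proof
      show "0 - D \<in> L0" if "- E - D \<in> L0" using L0_add[OF that E] by simp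
      have e: "0 - D - E = - E - D" by simp
      show "- E - D \<in> L0" if "0 - D \<in> L0" using L0_diff[OF that E] unfolding e .
    qed
    have "collapse D (hmg (- E) (\<chi> E)) = collapse D (hmg 0 \<one>)"
    proof (cases "0 - D \<in> L0")
      case True
      then have ED: "- E - D \<in> L0" using iff by blast
      have "\<chi> E \<otimes> \<chi> (- E - D) = \<chi> (0 - D)" using \<chi>_add[OF E ED] by (simp add: algebra_simps)
      then show ?thesis
        using True ED \<chi>_closed[OF E] \<chi>_closed[OF True] EK K_zero D by (simp add: collapse_hom)
    next
      case False
      then show ?thesis using iff \<chi>_closed[OF E] EK K_zero D by (simp add: collapse_hom)
    qed
    then show ?thesis
      using collapse_closed[OF c D]
      by (simp add: B.minus_eq collapse_add collapse_minus c D one_B[symmetric] r_neg)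
  qed
  then show ?thesis using c by (simp add: collapse_kernel_def)
qed

section \<open>Normal forms modulo the collapse kernel\<close>

definition rep :: "'g \<Rightarrow> 'g"
  where "rep D = (SOME D'. D' - D \<in> L0)"

lemma rep_diff: "rep D - D \<in> L0"
  unfolding rep_def by (rule someI[of _ D]) (simp add: L0_zero)

text \<open>Congruent degrees have the same candidates, and the choice operator returns equal values
  on equal predicates.\<close>

lemma rep_eq:
  assumes "D - D' \<in> L0"
  shows "rep D = rep D'"
proof -
  have "G - D \<in> L0 \<longleftrightarrow> G - D' \<in> L0" for G
    using L0_add[OF _ assms, of "G - D"] L0_diff[OF _ assms, of "G - D'"] by (auto simp: algebra_simps)
  then show ?thesis by (simp add: rep_def)
qed

text \<open>Each coset of \<open>L0\<close> is concentrated in its representative degree. The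
  components of a normal form are collapsed values, so an assumption about collapsed values becomes
  one about components.\<close>

definition normal_form :: "('g \<Rightarrow> 'a) \<Rightarrow> 'g \<Rightarrow> 'a"
  where "normal_form s = (\<lambda>D\<in>K. if rep D = D then collapse D s else \<zero>)"

lemma rep_in: "D \<in> K \<Longrightarrow> rep D \<in> K"
  using shift_in[OF _ rep_diff[of D], of D] by simp

lemma rep_rep: "rep (rep D) = rep D"
  by (rule rep_eq) (rule rep_diff)

lemma normal_form_closed:
  assumes s: "s \<in> carrier B"
  shows "normal_form s \<in> carrier B"
proof -
  have "{D \<in> K. normal_form s D \<noteq> \<zero>} \<subseteq> rep ` {D \<in> K. s D \<noteq> \<zero>}"
  proof
    fix D assume "D \<in> {D \<in> K. normal_form s D \<noteq> \<zero>}"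
    then have D: "D \<in> K" "rep D = D" "collapse D s \<noteq> \<zero>" by (auto simp: normal_form_def split: if_splits)
    then have "{E \<in> L0. s (D + E) \<noteq> \<zero>} \<noteq> {}" unfolding collapse_def by (intro notI) simp
    then obtain E where E: "E \<in> L0" "s (D + E) \<noteq> \<zero>" by blast
    have "rep (D + E) = D" using rep_eq[of "D + E" D] E(1) D(2) by simp
    then show "D \<in> rep ` {D \<in> K. s D \<noteq> \<zero>}"
      using E shift_in[OF D(1) E(1)] by (intro image_eqI[of _ _ "D + E"]) auto
  qed
  then have "finite {D \<in> K. normal_form s D \<noteq> \<zero>}" using B_fin[OF s] finite_surj by blast
  then show ?thesis using collapse_closed[OF s] by (auto simp: mem_B normal_form_def)
qed

lemma collapse_normal_form:
  assumes s: "s \<in> carrier B" and D: "D \<in> K"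
  shows "collapse D (normal_form s) = collapse D s"
proof -
  have "collapse D (normal_form s) = (\<Oplus>E\<in>{rep D - D}. normal_form s (D + E) \<otimes> \<chi> E)"
  proof (rule collapse_superset[OF normal_form_closed[OF s] D])
    show "{E \<in> L0. normal_form s (D + E) \<noteq> \<zero>} \<subseteq> {rep D - D}"
    proof
      fix E assume "E \<in> {E \<in> L0. normal_form s (D + E) \<noteq> \<zero>}"
      then have E: "E \<in> L0" "rep (D + E) = D + E"
        using shift_in[OF D] by (auto simp: normal_form_def split: if_splits)
      then show "E \<in> {rep D - D}" using rep_eq[of "D + E" D] by (auto simp: algebra_simps)
    qed
  qed (use rep_diff in auto)
  also have "\<dots> = normal_form s (rep D) \<otimes> \<chi> (rep D - D)"
    using collapse_term[OF normal_form_closed[OF s] D rep_diff[of D]] by simp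
  also have "\<dots> = collapse (rep D) s \<otimes> \<chi> (rep D - D)" by (simp add: normal_form_def rep_in[OF D] rep_rep)
  also have "\<dots> = collapse D s" using collapse_shift[OF s D rep_diff[of D]] by simp
  finally show ?thesis .
qed

lemma normal_form_kernel:
  assumes s: "s \<in> carrier B"
  shows "s \<ominus>\<^bsub>B\<^esub> normal_form s \<in> collapse_kernel"
  using s normal_form_closed[OF s] collapse_normal_form[OF s] collapse_closed[OF s]
  by (auto simp: collapse_kernel_def B.minus_eq collapse_add collapse_minus r_neg)

lemma collapse_cong:
  assumes s: "s \<in> carrier B" and t: "t \<in> carrier B" and "s \<ominus>\<^bsub>B\<^esub> t \<in> collapse_kernel" and D: "D \<in> K"
  shows "collapse D s = collapse D t"
proof -
  have "collapse D s \<oplus> \<ominus> collapse D t = \<zero>"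
    using assms by (simp add: collapse_kernel_def B.minus_eq collapse_add collapse_minus)
  then show ?thesis using collapse_closed[OF s D] collapse_closed[OF t D]
    by (metis a_inv_closed minus_equality minus_minus)
qed

text \<open>Only the collapsed values of \<open>s\<close> and \<open>t\<close> are known to lie in
  the sets \<open>S D\<close>, not their components. Replacing both factors by normal forms changes
  the product by an element of the kernel, and the convolution then involves elements of these sets
  only.\<close>

lemma collapse_mult_in:
  assumes S: "\<And>D. D \<in> K \<Longrightarrow> S D \<subseteq> carrier R" "\<And>D. D \<in> K \<Longrightarrow> \<zero> \<in> S D"
    "\<And>D a b. D \<in> K \<Longrightarrow> a \<in> S D \<Longrightarrow> b \<in> S D \<Longrightarrow> a \<oplus> b \<in> S D"
    "\<And>D E a b. D \<in> K \<Longrightarrow> E \<in> K \<Longrightarrow> a \<in> S D \<Longrightarrow> b \<in> S E \<Longrightarrow> a \<otimes> b \<in> S (D + E)"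
    "\<And>D E a. D \<in> K \<Longrightarrow> E \<in> L0 \<Longrightarrow> a \<in> S (D + E) \<Longrightarrow> a \<otimes> \<chi> E \<in> S D"
    and s: "s \<in> carrier B" "\<And>D. D \<in> K \<Longrightarrow> collapse D s \<in> S D"
    and t: "t \<in> carrier B" "\<And>D. D \<in> K \<Longrightarrow> collapse D t \<in> S D"
    and D: "D \<in> K"
  shows "collapse D (s \<otimes>\<^bsub>B\<^esub> t) \<in> S D"
proof -
  interpret J: ideal collapse_kernel B by (rule collapse_kernel_ideal)
  let ?s = "normal_form s" and ?t = "normal_form t"
  note c = s(1) t(1) normal_form_closed[OF s(1)] normal_form_closed[OF t(1)]
  have "s \<otimes>\<^bsub>B\<^esub> t \<ominus>\<^bsub>B\<^esub> ?s \<otimes>\<^bsub>B\<^esub> ?t = (s \<ominus>\<^bsub>B\<^esub> ?s) \<otimes>\<^bsub>B\<^esub> t \<oplus>\<^bsub>B\<^esub> ?s \<otimes>\<^bsub>B\<^esub> (t \<ominus>\<^bsub>B\<^esub> ?t)"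
    using c by algebra
  also have "\<dots> \<in> collapse_kernel"
    using normal_form_kernel[OF s(1)] normal_form_kernel[OF t(1)] c
    by (intro J.a_closed J.I_l_closed J.I_r_closed) auto
  finally have "collapse D (s \<otimes>\<^bsub>B\<^esub> t) = collapse D (?s \<otimes>\<^bsub>B\<^esub> ?t)"
    using c D by (intro collapse_cong) auto
  also have "\<dots> \<in> S D"
    unfolding collapse_def
  proof (rule finsum_in[OF S(1)[OF D] S(2)[OF D] S(3)[OF D]])
    fix E assume "E \<in> {E \<in> L0. (?s \<otimes>\<^bsub>B\<^esub> ?t) (D + E) \<noteq> \<zero>}"
    then have E: "E \<in> L0" by blast
    note DE = shift_in[OF D E]
    have "(\<Oplus>G\<in>{G \<in> K. ?s G \<noteq> \<zero>}. ?s G \<otimes> ?t (D + E - G)) \<in> S (D + E)"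
    proof (rule finsum_in[OF S(1)[OF DE] S(2)[OF DE] S(3)[OF DE]])
      fix G assume "G \<in> {G \<in> K. ?s G \<noteq> \<zero>}"
      then have G: "G \<in> K" by blast
      have "?s G \<in> S G" "?t (D + E - G) \<in> S (D + E - G)"
        using G K_diff[OF DE G] S(2) s(2) t(2) by (auto simp: normal_form_def)
      from S(4)[OF G K_diff[OF DE G] this] show "?s G \<otimes> ?t (D + E - G) \<in> S (D + E)" by simp
    qed
    then have "(?s \<otimes>\<^bsub>B\<^esub> ?t) (D + E) \<in> S (D + E)" using DE by (simp add: mult_B)
    then show "(?s \<otimes>\<^bsub>B\<^esub> ?t) (D + E) \<otimes> \<chi> E \<in> S D" by (rule S(5)[OF D E])
  qed
  finally show ?thesis .
qed

end

section \<open>Divisors and sections\<close>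

lemma poly_mapping_keys_diff: "Poly_Mapping.keys (x - y) \<subseteq> Poly_Mapping.keys x \<union> Poly_Mapping.keys (y :: 'b \<Rightarrow>\<^sub>0 int)"
  by (metis keys_diff)

context normal_variety
begin

lemma WDiv_carrier: "E \<in> carrier (WDiv \<V>) \<longleftrightarrow> Poly_Mapping.keys E \<subseteq> prime_divisors \<V>"
  by (simp add: WDiv_def)

lemma WDiv_mult: "D \<otimes>\<^bsub>WDiv \<V>\<^esub> E = D + E"
  by (simp add: WDiv_def)

lemma WDiv_one: "\<one>\<^bsub>WDiv \<V>\<^esub> = 0"
  by (simp add: WDiv_def)

lemma WDiv_subgroup:
  assumes "subgroup K (WDiv \<V>)"
  shows "K \<subseteq> carrier (WDiv \<V>)" "0 \<in> K" "D \<in> K \<Longrightarrow> E \<in> K \<Longrightarrow> D - E \<in> K"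
proof -
  show K: "K \<subseteq> carrier (WDiv \<V>)" using assms by (rule subgroup.subset)
  show "0 \<in> K" using subgroup.one_closed[OF assms] by (simp add: WDiv_one)
  have inv: "inv\<^bsub>WDiv \<V>\<^esub> E = - E" if "E \<in> K" for E
    using that K by (auto simp: WDiv_def)
  show "D - E \<in> K" if "D \<in> K" "E \<in> K"
    using subgroup.m_closed[OF assms that(1) subgroup.m_inv_closed[OF assms that(2)]]
    by (simp add: WDiv_mult inv[OF that(2)])
qed

lemma const_mult: "const_rational \<V> c \<otimes>\<^bsub>FF\<^esub> const_rational \<V> d = const_rational \<V> (c * d)"
  unfolding const_rational_def
  by (rule mult_rc_same) (rule rat_const[OF points_open points_nonempty])+

lemma const_nonzero: "c \<noteq> 0 \<Longrightarrow> const_rational \<V> c \<noteq> \<zero>\<^bsub>FF\<^esub>"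
  unfolding const_rational_def
  using rc_zero_iff[OF rat_const[OF points_open points_nonempty, of c]] points_nonempty by auto

lemma minus_eq_const_mult:
  assumes "\<phi> \<in> carrier FF"
  shows "\<ominus>\<^bsub>FF\<^esub> \<phi> = const_rational \<V> (- 1) \<otimes>\<^bsub>FF\<^esub> \<phi>"
proof -
  obtain U f where f: "rat U f" "\<phi> = rc U f" by (rule FF_rep[OF assms])
  note U = ratD(1,2)[OF f(1)]
  have m: "rat U (\<lambda>x. (- 1) * f x)" by (rule rat_mult[OF rat_const[OF U] f(1)])
  have "const_rational \<V> (- 1) \<otimes>\<^bsub>FF\<^esub> \<phi> = rc U (\<lambda>x. (- 1) * f x)"
    unfolding rc_const[OF U, symmetric] f(2) by (rule mult_rc_same[OF rat_const[OF U] f(1)])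
  moreover have "rc U (\<lambda>x. (- 1) * f x) \<oplus>\<^bsub>FF\<^esub> \<phi> = \<zero>\<^bsub>FF\<^esub>"
    unfolding zero_FF rc_const[OF U, symmetric] f(2) add_rc_same[OF m f(1)] by simp
  ultimately show ?thesis
    using F.minus_equality rc_carrier[OF m] assms by metis
qed

definition nonzero :: "('a, 'b) rational set"
  where "nonzero = carrier FF - {\<zero>\<^bsub>FF\<^esub>}"

lemma nonzeroD: "\<phi> \<in> nonzero \<Longrightarrow> \<phi> \<in> carrier FF" "\<phi> \<in> nonzero \<Longrightarrow> \<phi> \<noteq> \<zero>\<^bsub>FF\<^esub>"
  by (auto simp: nonzero_def)

lemma nonzero_mult: "\<phi> \<in> nonzero \<Longrightarrow> \<psi> \<in> nonzero \<Longrightarrow> \<phi> \<otimes>\<^bsub>FF\<^esub> \<psi> \<in> nonzero"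
  using F.nonzero_mult by (auto simp: nonzero_def)

lemma nonzero_inv: "\<phi> \<in> nonzero \<Longrightarrow> inv\<^bsub>FF\<^esub> \<phi> \<in> nonzero"
  using F.inv_nonzero by (auto simp: nonzero_def)

lemma nonzero_one: "\<one>\<^bsub>FF\<^esub> \<in> nonzero"
  by (simp add: nonzero_def)

lemma div_mult:
  assumes "\<phi> \<in> nonzero" "\<psi> \<in> nonzero"
  shows "div_of \<V> (\<phi> \<otimes>\<^bsub>FF\<^esub> \<psi>) P = div_of \<V> \<phi> P + div_of \<V> \<psi> P"
  using ord_mult[of P \<phi> \<psi>] assms by (simp add: div_of_def nonzero_def)

lemma div_const: "c \<noteq> 0 \<Longrightarrow> div_of \<V> (const_rational \<V> c) P = 0"
  using ord_unit[OF _ const_unit[OF prime_divisorD(2)]] by (simp add: div_of_def)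

lemma div_one: "div_of \<V> \<one>\<^bsub>FF\<^esub> P = 0"
  unfolding one_FF by (rule div_const) simp

lemma div_inv:
  assumes "\<phi> \<in> nonzero"
  shows "div_of \<V> (inv\<^bsub>FF\<^esub> \<phi>) P = - div_of \<V> \<phi> P"
  using div_mult[OF assms nonzero_inv[OF assms], of P] F.inv_nonzero(2)[OF nonzeroD[OF assms]] div_one[of P]
  by simp

lemma PDiv_iff: "E \<in> PDiv \<V> \<longleftrightarrow> E \<in> carrier (WDiv \<V>) \<and> (\<exists>\<phi>\<in>nonzero. div_of \<V> \<phi> = Poly_Mapping.lookup E)"
  by (simp add: PDiv_def nonzero_def)

lemma PDiv_zero: "0 \<in> PDiv \<V>"
  unfolding PDiv_iff using nonzero_one div_one by (auto simp: WDiv_carrier fun_eq_iff)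

lemma PDiv_diff:
  assumes "D \<in> PDiv \<V>" "E \<in> PDiv \<V>"
  shows "D - E \<in> PDiv \<V>"
proof -
  obtain \<phi> where \<phi>: "\<phi> \<in> nonzero" "div_of \<V> \<phi> = Poly_Mapping.lookup D" using assms PDiv_iff by blast
  obtain \<psi> where \<psi>: "\<psi> \<in> nonzero" "div_of \<V> \<psi> = Poly_Mapping.lookup E" using assms PDiv_iff by blast
  have "D - E \<in> carrier (WDiv \<V>)"
    using assms poly_mapping_keys_diff[of D E] unfolding PDiv_iff WDiv_carrier by blast
  moreover have "div_of \<V> (\<phi> \<otimes>\<^bsub>FF\<^esub> inv\<^bsub>FF\<^esub> \<psi>) = Poly_Mapping.lookup (D - E)"
    using div_mult[OF \<phi>(1) nonzero_inv[OF \<psi>(1)]] div_inv[OF \<psi>(1)] \<phi>(2) \<psi>(2)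
    by (auto simp: fun_eq_iff lookup_minus)
  ultimately show ?thesis
    unfolding PDiv_iff using nonzero_mult[OF \<phi>(1) nonzero_inv[OF \<psi>(1)]] by blast
qed

lemma divisor_class_eq: "divisor_class \<V> D = {E + D | E. E \<in> PDiv \<V>}"
  by (auto simp: divisor_class_def r_coset_def WDiv_mult)

lemma divisor_class_eq_one_iff: "divisor_class \<V> D = PDiv \<V> \<longleftrightarrow> D \<in> PDiv \<V>"
proof
  assume "divisor_class \<V> D = PDiv \<V>"
  moreover have "0 + D \<in> divisor_class \<V> D" unfolding divisor_class_eq using PDiv_zero by blast
  ultimately show "D \<in> PDiv \<V>" by simp
next
  assume D: "D \<in> PDiv \<V>"
  have m: "E - - D \<in> PDiv \<V>" if "E \<in> PDiv \<V>" for E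
    using PDiv_diff[OF that PDiv_diff[OF PDiv_zero D]] by simp
  show "divisor_class \<V> D = PDiv \<V>"
  proof (intro equalityI subsetI)
    fix G assume "G \<in> divisor_class \<V> D"
    then obtain E where "E \<in> PDiv \<V>" "G = E + D" unfolding divisor_class_eq by blast
    then show "G \<in> PDiv \<V>" using m by simp
  next
    fix G assume "G \<in> PDiv \<V>"
    then have "G - D \<in> PDiv \<V>" "G = (G - D) + D" using PDiv_diff D by auto
    then show "G \<in> divisor_class \<V> D" unfolding divisor_class_eq by blast
  qed
qed

lemma principal_part_iff: "E \<in> principal_part \<V> L \<longleftrightarrow> E \<in> L \<and> E \<in> PDiv \<V>"
  by (simp add: principal_part_def kernel_def Cl_def FactGroup_def divisor_class_eq_one_iff)

lemma class_representative:
  assumes L: "divisor_class \<V> ` L = carrier (Cl \<V>)" and D: "D \<in> carrier (WDiv \<V>)"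
  obtains D' \<psi> where "D' \<in> L" "\<psi> \<in> nonzero" "div_of \<V> \<psi> = Poly_Mapping.lookup (D' - D)"
proof -
  have "divisor_class \<V> D \<in> carrier (Cl \<V>)"
    using D unfolding Cl_def FactGroup_def RCOSETS_def divisor_class_def by auto
  then obtain D' where D': "D' \<in> L" "divisor_class \<V> D' = divisor_class \<V> D" using L by (metis imageE)
  have "0 + D' \<in> divisor_class \<V> D'" unfolding divisor_class_eq using PDiv_zero by blast
  then have "0 + D' \<in> divisor_class \<V> D" using D'(2) by simp
  then obtain E where E: "E \<in> PDiv \<V>" "D' = E + D" unfolding divisor_class_eq by auto
  then have "D' - D = E" by simp
  then show ?thesis using that[OF D'(1)] E(1) unfolding PDiv_iff by blast
qed

section \<open>Sections of O(D) as sets of rational functions\<close>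

abbreviation "sec \<equiv> divisor_sections \<V>"

lemma sec_iff: "\<phi> \<in> sec D W \<longleftrightarrow> \<phi> = \<zero>\<^bsub>FF\<^esub> \<or> \<phi> \<in> nonzero \<and> W \<noteq> {} \<and>
    (\<forall>P \<in> prime_divisors \<V>. P \<inter> W \<noteq> {} \<longrightarrow> div_of \<V> \<phi> P + Poly_Mapping.lookup D P \<ge> 0)"
  by (simp add: divisor_sections_def nonzero_def)

lemma sec_zero: "\<zero>\<^bsub>FF\<^esub> \<in> sec D W"
  by (simp add: sec_iff)

lemma sec_carrier: "sec D W \<subseteq> carrier FF"
  by (auto simp: sec_iff nonzero_def)

lemma sec_mono: "W' \<subseteq> W \<Longrightarrow> W' \<noteq> {} \<Longrightarrow> sec D W \<subseteq> sec D W'"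
  unfolding subset_iff sec_iff by blast

lemma secI:
  assumes "\<phi> \<in> nonzero" "W \<noteq> {}"
    "\<And>P. P \<in> prime_divisors \<V> \<Longrightarrow> P \<inter> W \<noteq> {} \<Longrightarrow> div_of \<V> \<phi> P + Poly_Mapping.lookup D P \<ge> 0"
  shows "\<phi> \<in> sec D W"
  using assms by (simp add: sec_iff)

lemma sec_add:
  assumes "\<phi> \<in> sec D W" "\<psi> \<in> sec D W"
  shows "\<phi> \<oplus>\<^bsub>FF\<^esub> \<psi> \<in> sec D W"
proof (cases "\<phi> = \<zero>\<^bsub>FF\<^esub> \<or> \<psi> = \<zero>\<^bsub>FF\<^esub> \<or> \<phi> \<oplus>\<^bsub>FF\<^esub> \<psi> = \<zero>\<^bsub>FF\<^esub>")
  case True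
  then show ?thesis using assms sec_zero sec_carrier by (auto simp: subset_iff)
next
  case False
  then have \<phi>: "\<phi> \<in> nonzero" and \<psi>: "\<psi> \<in> nonzero" and W: "W \<noteq> {}" using assms by (auto simp: sec_iff)
  show ?thesis
  proof (rule secI[OF _ W])
    show "\<phi> \<oplus>\<^bsub>FF\<^esub> \<psi> \<in> nonzero" using False \<phi> \<psi> by (simp add: nonzero_def)
    fix P assume P: "P \<in> prime_divisors \<V>" "P \<inter> W \<noteq> {}"
    have "ord_along \<V> P (\<phi> \<oplus>\<^bsub>FF\<^esub> \<psi>) \<ge> - Poly_Mapping.lookup D P"
    proof (rule ord_add[OF P(1) nonzeroD[OF \<phi>] nonzeroD[OF \<psi>]])
      show "ord_along \<V> P \<phi> \<ge> - Poly_Mapping.lookup D P" "ord_along \<V> P \<psi> \<ge> - Poly_Mapping.lookup D P"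
        using assms False P by (auto simp: sec_iff div_of_def)
    qed (use False in auto)
    then show "div_of \<V> (\<phi> \<oplus>\<^bsub>FF\<^esub> \<psi>) P + Poly_Mapping.lookup D P \<ge> 0" using P(1) by (simp add: div_of_def)
  qed
qed

lemma sec_mult:
  assumes "\<phi> \<in> sec D W" "\<psi> \<in> sec E W"
  shows "\<phi> \<otimes>\<^bsub>FF\<^esub> \<psi> \<in> sec (D + E) W"
proof (cases "\<phi> = \<zero>\<^bsub>FF\<^esub> \<or> \<psi> = \<zero>\<^bsub>FF\<^esub>")
  case True
  then show ?thesis using assms sec_zero sec_carrier by (auto simp: subset_iff)
next
  case False
  then have \<phi>: "\<phi> \<in> nonzero" and \<psi>: "\<psi> \<in> nonzero" and W: "W \<noteq> {}" using assms by (auto simp: sec_iff)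
  show ?thesis
  proof (rule secI[OF nonzero_mult[OF \<phi> \<psi>] W])
    fix P assume P: "P \<in> prime_divisors \<V>" "P \<inter> W \<noteq> {}"
    then have "div_of \<V> \<phi> P + Poly_Mapping.lookup D P \<ge> 0" "div_of \<V> \<psi> P + Poly_Mapping.lookup E P \<ge> 0"
      using assms False by (auto simp: sec_iff)
    then show "div_of \<V> (\<phi> \<otimes>\<^bsub>FF\<^esub> \<psi>) P + Poly_Mapping.lookup (D + E) P \<ge> 0"
      by (simp add: div_mult[OF \<phi> \<psi>] lookup_add)
  qed
qed

lemma sec_const:
  assumes "W \<noteq> {}"
  shows "const_rational \<V> c \<in> sec 0 W"
proof (cases "c = 0")
  case True
  then show ?thesis using sec_zero by (simp add: zero_FF)
next
  case False
  then show ?thesis using assms const_nonzero const_carrier div_const by (intro secI) (auto simp: nonzero_def)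
qed

lemma sec_one: "W \<noteq> {} \<Longrightarrow> \<one>\<^bsub>FF\<^esub> \<in> sec 0 W"
  unfolding one_FF by (rule sec_const)

lemma sec_minus:
  assumes "\<phi> \<in> sec D W"
  shows "\<ominus>\<^bsub>FF\<^esub> \<phi> \<in> sec D W"
proof (cases "\<phi> = \<zero>\<^bsub>FF\<^esub>")
  case True
  then show ?thesis using sec_zero by simp
next
  case False
  then have "W \<noteq> {}" using assms by (auto simp: sec_iff)
  from sec_mult[OF sec_const[OF this] assms, of "- 1"] show ?thesis
    using minus_eq_const_mult[of \<phi>] assms sec_carrier by (auto simp: subset_iff)
qed

text \<open>The sign comes from O(D) allowing poles up to \<open>D\<close>: a function with divisor
  \<open>E\<close> belongs to degree \<open>- E\<close>, the degree in which \<open>\<chi> E\<close>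
  is placed.\<close>

lemma sec_principal:
  assumes "\<phi> \<in> nonzero" "div_of \<V> \<phi> = Poly_Mapping.lookup E" "W \<noteq> {}"
  shows "\<phi> \<in> sec (- E) W"
  using assms by (intro secI) auto

section \<open>Sheaves of divisorial algebras\<close>

abbreviation "big K \<equiv> group_algebra FF K"

definition graded_sections :: "'a divisor set \<Rightarrow> 'a set \<Rightarrow> ('a divisor \<Rightarrow> ('a, 'b) rational) set"
  where "graded_sections K W = {s \<in> carrier (big K). \<forall>D\<in>K. s D \<in> sec D W}"

lemma homogeneous_single: "homogeneous \<V> K D \<phi> = single FF K D \<phi>"
  by (simp add: homogeneous_def single_def)

lemma divisorial_carrier: "carrier (divisorial_algebra \<V> K W) = graded_sections K W"
  using sec_carrier
  by (force simp: divisorial_algebra_def graded_sections_def group_algebra_def Let_def PiE_iff)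

lemma divisorial_algebra_eq:
  assumes "W \<noteq> {}"
  shows "divisorial_algebra \<V> K W = (big K)\<lparr>carrier := graded_sections K W\<rparr>"
  using divisorial_carrier[of K W] assms
  by (simp add: divisorial_algebra_def group_algebra_def Let_def homogeneous_single)

lemma group_algebra_data_K:
  assumes "subgroup K (WDiv \<V>)"
  shows "group_algebra_data FF K"
  using WDiv_subgroup[OF assms] cring_FF
  by (simp add: group_algebra_data_def group_algebra_data_axioms_def)

lemma graded_sections_subring:
  assumes K: "subgroup K (WDiv \<V>)" and W: "W \<noteq> {}"
  shows "subring (graded_sections K W) (big K)"
proof -
  interpret group_algebra_data FF K by (rule group_algebra_data_K[OF K])
  show ?thesis
    unfolding graded_sections_def
    by (rule graded_subring[where S = "\<lambda>D. sec D W"])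
      (use sec_one[OF W] in \<open>auto intro: sec_zero sec_add sec_minus sec_mult subsetD[OF sec_carrier]\<close>)
qed

lemma graded_sections_mono: "W' \<subseteq> W \<Longrightarrow> W' \<noteq> {} \<Longrightarrow> graded_sections K W \<subseteq> graded_sections K W'"
  using sec_mono[of W' W] unfolding graded_sections_def by blast

lemma graded_sections_hom:
  assumes K: "subgroup K (WDiv \<V>)" and \<phi>: "\<phi> \<in> sec D W"
  shows "single FF K D \<phi> \<in> graded_sections K W"
proof -
  interpret group_algebra_data FF K by (rule group_algebra_data_K[OF K])
  show ?thesis
    using hom_closed[of \<phi> D] \<phi> sec_carrier sec_zero
    by (auto simp: graded_sections_def single_def subset_iff)
qed

definition stalk_carrier :: "'a divisor set \<Rightarrow> 'a \<Rightarrow> ('a divisor \<Rightarrow> ('a, 'b) rational) set"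
  where "stalk_carrier K x = \<Union>{graded_sections K W | W. openin (top_of \<V>) W \<and> x \<in> W}"

lemma stalk_eq: "divisorial_stalk \<V> K x = (big K)\<lparr>carrier := stalk_carrier K x\<rparr>"
  unfolding divisorial_stalk_def divisorial_carrier stalk_carrier_def
  by (simp add: divisorial_algebra_eq[OF points_nonempty])

lemma stalk_carrierI:
  "s \<in> graded_sections K W \<Longrightarrow> openin (top_of \<V>) W \<Longrightarrow> x \<in> W \<Longrightarrow> s \<in> stalk_carrier K x"
  unfolding stalk_carrier_def by blast

text \<open>Restriction to a smaller nonempty open set is inclusion, so the union defining the stalk
  is directed.\<close>

lemma stalk_subring:
  assumes K: "subgroup K (WDiv \<V>)" and x: "x \<in> points \<V>"
  shows "subring (stalk_carrier K x) (big K)"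
proof -
  interpret group_algebra_data FF K by (rule group_algebra_data_K[OF K])
  have sub: "subring (graded_sections K W) (big K)" if "x \<in> W" for W
    using graded_sections_subring[OF K] that by blast
  have two: "\<exists>W. openin (top_of \<V>) W \<and> x \<in> W \<and> s \<in> graded_sections K W \<and> t \<in> graded_sections K W"
    if st: "s \<in> stalk_carrier K x" "t \<in> stalk_carrier K x" for s t
  proof -
    obtain W where W: "openin (top_of \<V>) W" "x \<in> W" "s \<in> graded_sections K W"
      using st(1) unfolding stalk_carrier_def by blast
    obtain W' where W': "openin (top_of \<V>) W'" "x \<in> W'" "t \<in> graded_sections K W'"
      using st(2) unfolding stalk_carrier_def by blast
    have "W \<inter> W' \<noteq> {}" using W(2) W'(2) by blast
    then have "s \<in> graded_sections K (W \<inter> W')" "t \<in> graded_sections K (W \<inter> W')"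
      using graded_sections_mono[of "W \<inter> W'" W K] graded_sections_mono[of "W \<inter> W'" W' K] W(3) W'(3) by auto
    moreover have "openin (top_of \<V>) (W \<inter> W')" "x \<in> W \<inter> W'" using W W' by auto
    ultimately show ?thesis by blast
  qed
  show ?thesis
  proof (rule B.subringI)
    show "stalk_carrier K x \<subseteq> carrier (big K)" by (auto simp: stalk_carrier_def graded_sections_def)
    show "\<one>\<^bsub>big K\<^esub> \<in> stalk_carrier K x"
      by (rule stalk_carrierI[OF subringE(3)[OF sub[OF x]] points_open x])
    show "\<ominus>\<^bsub>big K\<^esub> s \<in> stalk_carrier K x" if s: "s \<in> stalk_carrier K x" for s
    proof -
      obtain W where W: "openin (top_of \<V>) W" "x \<in> W" "s \<in> graded_sections K W" using two[OF s s] by blast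
      then show ?thesis using stalk_carrierI[OF subringE(5)[OF sub[OF W(2)] W(3)] W(1,2)] by simp
    qed
    fix s t assume st: "s \<in> stalk_carrier K x" "t \<in> stalk_carrier K x"
    obtain W where W: "openin (top_of \<V>) W" "x \<in> W" "s \<in> graded_sections K W" "t \<in> graded_sections K W"
      using two[OF st] by blast
    show "s \<otimes>\<^bsub>big K\<^esub> t \<in> stalk_carrier K x" "s \<oplus>\<^bsub>big K\<^esub> t \<in> stalk_carrier K x"
      using stalk_carrierI[OF subringE(6)[OF sub[OF W(2)] W(3,4)] W(1,2)]
        stalk_carrierI[OF subringE(7)[OF sub[OF W(2)] W(3,4)] W(1,2)] by simp_all
  qed
qed

section \<open>Stalks of the Cox sheaf\<close>

lemma cox_collapsed:
  assumes cd: "cox_data \<V> L \<chi>"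
  shows "collapsed_group_algebra FF L (principal_part \<V> L) \<chi>"
    and "E \<in> principal_part \<V> L \<Longrightarrow> \<chi> E \<in> nonzero"
proof -
  have L: "subgroup L (WDiv \<V>)" and h: "\<chi> \<in> hom ((WDiv \<V>)\<lparr>carrier := principal_part \<V> L\<rparr>) (units_of FF)"
    using cd by (auto simp: cox_data_def)
  have nz: "\<chi> E \<in> nonzero" if "E \<in> principal_part \<V> L" for E
    using h that by (auto simp: hom_def units_of_carrier F.field_Units nonzero_def)
  then show "E \<in> principal_part \<V> L \<Longrightarrow> \<chi> E \<in> nonzero" by blast
  have add: "\<chi> (D + E) = \<chi> D \<otimes>\<^bsub>FF\<^esub> \<chi> E" if "D \<in> principal_part \<V> L" "E \<in> principal_part \<V> L" for D E
    using h that by (auto simp: hom_def units_of_mult WDiv_mult)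
  have z: "0 \<in> principal_part \<V> L" unfolding principal_part_iff using WDiv_subgroup(2)[OF L] PDiv_zero by blast
  have "\<chi> 0 \<otimes>\<^bsub>FF\<^esub> \<chi> 0 = \<chi> 0 \<otimes>\<^bsub>FF\<^esub> \<one>\<^bsub>FF\<^esub>" using add[OF z z] nonzeroD(1)[OF nz[OF z]] by simp
  then have "\<chi> 0 = \<one>\<^bsub>FF\<^esub>" using F.m_lcancel[OF nonzeroD(2,1)[OF nz[OF z]] nonzeroD(1)[OF nz[OF z]] F.one_closed] by blast
  then show "collapsed_group_algebra FF L (principal_part \<V> L) \<chi>"
    using group_algebra_data_K[OF L] nz nonzeroD(1) add z PDiv_diff WDiv_subgroup(3)[OF L]
    by (simp add: collapsed_group_algebra_def collapsed_group_algebra_axioms_def principal_part_iff subset_iff)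
qed

lemma ideal_Int_subring:
  assumes B: "ring B" and J: "ideal J B" and A: "subring A B"
  shows "ideal (J \<inter> A) (B\<lparr>carrier := A\<rparr>)"
proof -
  interpret B: ring B by fact
  interpret J: ideal J B by fact
  interpret A: ring "B\<lparr>carrier := A\<rparr>" by (rule B.subring_is_ring[OF A])
  have AB: "\<And>x. x \<in> A \<Longrightarrow> x \<in> carrier B" using subringE(1)[OF A] by blast
  have minus: "\<ominus>\<^bsub>B\<lparr>carrier := A\<rparr>\<^esub> x = \<ominus>\<^bsub>B\<^esub> x" if x: "x \<in> A" for x
  proof -
    have "\<ominus>\<^bsub>B\<^esub> x \<in> A" by (rule subringE(5)[OF A x])
    then show ?thesis using A.minus_equality[of "\<ominus>\<^bsub>B\<^esub> x" x] x B.l_neg[OF AB[OF x]] by simp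
  qed
  show ?thesis
  proof (rule idealI[OF A.ring_axioms])
    show "subgroup (J \<inter> A) (add_monoid (B\<lparr>carrier := A\<rparr>))"
    proof (rule A.add.subgroupI)
      show "J \<inter> A \<subseteq> carrier (B\<lparr>carrier := A\<rparr>)" by simp
      show "J \<inter> A \<noteq> {}" using J.zero_closed subringE(2)[OF A] by blast
      show "\<ominus>\<^bsub>B\<lparr>carrier := A\<rparr>\<^esub> a \<in> J \<inter> A" if "a \<in> J \<inter> A" for a
        using that minus J.a_inv_closed subringE(5)[OF A] by auto
      show "a \<oplus>\<^bsub>B\<lparr>carrier := A\<rparr>\<^esub> b \<in> J \<inter> A" if "a \<in> J \<inter> A" "b \<in> J \<inter> A" for a b
        using that J.a_closed subringE(7)[OF A] by auto
    qed
    show "x \<otimes>\<^bsub>B\<lparr>carrier := A\<rparr>\<^esub> a \<in> J \<inter> A" "a \<otimes>\<^bsub>B\<lparr>carrier := A\<rparr>\<^esub> x \<in> J \<inter> A"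
      if "a \<in> J \<inter> A" "x \<in> carrier (B\<lparr>carrier := A\<rparr>)" for a x
      using that J.I_l_closed J.I_r_closed AB subringE(6)[OF A] by auto
  qed
qed

context
  fixes L \<chi>
  assumes cd: "cox_data \<V> L \<chi>"
begin

interpretation C: collapsed_group_algebra FF L "principal_part \<V> L" \<chi>
  by (rule cox_collapsed(1)[OF cd])

lemma L_subgroup: "subgroup L (WDiv \<V>)"
  using cd by (simp add: cox_data_def)

lemma stalk_ring: "x \<in> points \<V> \<Longrightarrow> ring (divisorial_stalk \<V> L x)"
  unfolding stalk_eq by (rule C.B.subring_is_ring[OF stalk_subring[OF L_subgroup]])

lemma stalk_minus:
  assumes x: "x \<in> points \<V>" and s: "s \<in> stalk_carrier L x"
  shows "\<ominus>\<^bsub>divisorial_stalk \<V> L x\<^esub> s = \<ominus>\<^bsub>big L\<^esub> s"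
proof -
  interpret S: ring "divisorial_stalk \<V> L x" by (rule stalk_ring[OF x])
  note A = stalk_subring[OF L_subgroup x]
  have "s \<in> carrier (big L)" using s subringE(1)[OF A] by blast
  then have "\<ominus>\<^bsub>big L\<^esub> s \<oplus>\<^bsub>divisorial_stalk \<V> L x\<^esub> s = \<zero>\<^bsub>divisorial_stalk \<V> L x\<^esub>"
    by (simp add: stalk_eq C.B.l_neg)
  then show ?thesis
    using S.minus_equality[of "\<ominus>\<^bsub>big L\<^esub> s" s] s subringE(5)[OF A s] by (simp add: stalk_eq)
qed

text \<open>The collapse kernel is an ideal of the whole group algebra, so its trace on the stalk is
  an ideal there; it contains the generators and hence the ideal they generate.\<close>

lemma cox_ideal_stalk:
  assumes x: "x \<in> points \<V>"
  shows "ideal (cox_ideal_stalk \<V> L \<chi> x) (divisorial_stalk \<V> L x)"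
    and "cox_ideal_stalk \<V> L \<chi> x \<subseteq> C.collapse_kernel"
proof -
  interpret S: ring "divisorial_stalk \<V> L x" by (rule stalk_ring[OF x])
  note A = stalk_subring[OF L_subgroup x]
  let ?S = "divisorial_stalk \<V> L x"
  let ?G = "{\<one>\<^bsub>?S\<^esub> \<ominus>\<^bsub>?S\<^esub> homogeneous \<V> L (- E) (\<chi> E) | E. E \<in> principal_part \<V> L}"
  have hs: "homogeneous \<V> L (- E) (\<chi> E) \<in> stalk_carrier L x" if E: "E \<in> principal_part \<V> L" for E
  proof -
    have "div_of \<V> (\<chi> E) = Poly_Mapping.lookup E" using cd E by (simp add: cox_data_def)
    then have "\<chi> E \<in> sec (- E) (points \<V>)"
      by (rule sec_principal[OF cox_collapsed(2)[OF cd E] _ points_nonempty])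
    then show ?thesis
      unfolding homogeneous_single
      by (rule stalk_carrierI[OF graded_sections_hom[OF L_subgroup] points_open x])
  qed
  have g: "\<one>\<^bsub>?S\<^esub> \<ominus>\<^bsub>?S\<^esub> homogeneous \<V> L (- E) (\<chi> E) \<in> C.collapse_kernel \<inter> stalk_carrier L x"
    if E: "E \<in> principal_part \<V> L" for E
  proof -
    have "\<one>\<^bsub>?S\<^esub> \<ominus>\<^bsub>?S\<^esub> homogeneous \<V> L (- E) (\<chi> E) = \<one>\<^bsub>big L\<^esub> \<ominus>\<^bsub>big L\<^esub> single FF L (- E) (\<chi> E)"
      unfolding a_minus_def stalk_minus[OF x hs[OF E]] by (simp add: stalk_eq homogeneous_single)
    moreover have "\<one>\<^bsub>?S\<^esub> \<ominus>\<^bsub>?S\<^esub> homogeneous \<V> L (- E) (\<chi> E) \<in> carrier ?S"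
      using hs[OF E] by (intro S.minus_closed) (auto simp: stalk_eq subringE(3)[OF A])
    ultimately show ?thesis using C.collapse_generator[OF E] by (simp add: stalk_eq)
  qed
  then have "?G \<subseteq> carrier ?S" by (auto simp: stalk_eq)
  then show "ideal (cox_ideal_stalk \<V> L \<chi> x) ?S"
    unfolding cox_ideal_stalk_def Let_def by (rule S.genideal_ideal)
  have "ideal (C.collapse_kernel \<inter> stalk_carrier L x) ?S"
    unfolding stalk_eq by (rule ideal_Int_subring[OF C.B.ring_axioms C.collapse_kernel_ideal A])
  moreover have "?G \<subseteq> C.collapse_kernel \<inter> stalk_carrier L x" using g by blast
  ultimately show "cox_ideal_stalk \<V> L \<chi> x \<subseteq> C.collapse_kernel"
    unfolding cox_ideal_stalk_def Let_def genideal_def by blast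
qed

lemma germ_hom: "x \<in> points \<V> \<Longrightarrow> ring_hom_ring (divisorial_stalk \<V> L x) (cox_stalk \<V> L \<chi> x) (\<lambda>s. cox_germ \<V> L \<chi> s x)"
  using ideal.rcos_ring_hom_ring[OF cox_ideal_stalk(1)] unfolding cox_stalk_def cox_germ_def by simp

text \<open>Gives a germ of the Cox sheaf components in the function field that do not depend on the
  lift. As these values do not refer to \<open>x\<close>, they can be compared between
  points.\<close>

lemma germ_eq_collapse:
  assumes x: "x \<in> points \<V>" and s: "s \<in> stalk_carrier L x" and t: "t \<in> stalk_carrier L x"
    and eq: "cox_germ \<V> L \<chi> s x = cox_germ \<V> L \<chi> t x" and D: "D \<in> L"
  shows "C.collapse D s = C.collapse D t"
proof -
  interpret I: ideal "cox_ideal_stalk \<V> L \<chi> x" "divisorial_stalk \<V> L x" by (rule cox_ideal_stalk(1)[OF x])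
  let ?S = "divisorial_stalk \<V> L x"
  note A = stalk_subring[OF L_subgroup x]
  have sB: "s \<in> carrier (big L)" and tB: "t \<in> carrier (big L)" using s t subringE(1)[OF A] by auto
  have "s \<in> carrier ?S" using s by (simp add: stalk_eq)
  then have "s \<in> cox_germ \<V> L \<chi> s x" unfolding cox_germ_def by (rule I.a_rcos_self)
  then have "s \<in> cox_germ \<V> L \<chi> t x" using eq by simp
  then obtain i where i: "i \<in> cox_ideal_stalk \<V> L \<chi> x" "s = i \<oplus>\<^bsub>big L\<^esub> t"
    unfolding cox_germ_def a_r_coset_def' by (auto simp: stalk_eq)
  have iK: "i \<in> C.collapse_kernel" using i(1) cox_ideal_stalk(2)[OF x] by blast
  then have iB: "i \<in> carrier (big L)" "C.collapse D i = \<zero>\<^bsub>FF\<^esub>" using D by (auto simp: C.collapse_kernel_def)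
  show ?thesis
    unfolding i(2) using C.collapse_add[OF iB(1) tB D] iB(2) C.collapse_closed[OF tB D] by simp
qed

end

end

section \<open>Finitely generated monoids\<close>

text \<open>Induction on the alphabet. When the letter \<open>a\<close> is forgotten, a finite
  \<open>S1\<close> suffices, and it serves all multisets in which \<open>a\<close> occurs at least
  \<open>N\<close> times, \<open>N\<close> being the largest multiplicity of \<open>a\<close> in
  \<open>S1\<close>. The finitely many multiplicities \<open>k < N\<close> get a finite set
  \<open>S2 k\<close> each.\<close>

lemma multiset_dickson:
  assumes "finite A" "S \<subseteq> {\<mu>. set_mset \<mu> \<subseteq> A}"
  shows "\<exists>S0\<subseteq>S. finite S0 \<and> (\<forall>\<mu>\<in>S. \<exists>\<nu>\<in>S0. \<nu> \<subseteq># \<mu>)"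
  using assms
proof (induction A arbitrary: S rule: finite_induct)
  case empty
  then have "S \<subseteq> {{#}}" by auto
  then show ?case using finite_subset[of S "{{#}}"] by (intro exI[of _ S]) auto
next
  case (insert a A)
  let ?r = "\<lambda>\<mu>. filter_mset (\<lambda>x. x \<noteq> a) \<mu>"
  have le: "\<nu> \<subseteq># \<mu>" if "?r \<nu> \<subseteq># ?r \<mu>" "count \<nu> a \<le> count \<mu> a" for \<nu> \<mu>
  proof (rule mset_subset_eqI)
    fix x
    show "count \<nu> x \<le> count \<mu> x"
      using that(2) mset_subset_eq_count[OF that(1), of x] by (cases "x = a") auto
  qed
  have sub: "\<exists>S0\<subseteq>S'. finite S0 \<and> (\<forall>\<mu>\<in>S'. \<exists>\<nu>\<in>S0. ?r \<nu> \<subseteq># ?r \<mu>)" if "S' \<subseteq> S" for S'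
  proof -
    have "set_mset (?r \<mu>) \<subseteq> A" if "\<mu> \<in> S'" for \<mu>
    proof -
      have "set_mset \<mu> \<subseteq> insert a A" using \<open>S' \<subseteq> S\<close> that insert(4) by blast
      then show ?thesis by auto
    qed
    then have "?r ` S' \<subseteq> {\<mu>. set_mset \<mu> \<subseteq> A}" by blast
    from insert.IH[OF this] obtain T where T: "T \<subseteq> ?r ` S'" "finite T" "\<forall>\<mu>\<in>?r ` S'. \<exists>\<nu>\<in>T. \<nu> \<subseteq># \<mu>"
      by blast
    obtain S0 where S0: "S0 \<subseteq> S'" "finite S0" "T = ?r ` S0" using finite_subset_image[OF T(2,1)] by blast
    have "\<exists>\<nu>\<in>S0. ?r \<nu> \<subseteq># ?r \<mu>" if \<mu>: "\<mu> \<in> S'" for \<mu>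
    proof -
      have "?r \<mu> \<in> ?r ` S'" using \<mu> by (rule imageI)
      from bspec[OF T(3) this] obtain \<nu> where "\<nu> \<in> T" "\<nu> \<subseteq># ?r \<mu>" by blast
      then show ?thesis unfolding S0(3) by auto
    qed
    then show ?thesis using S0(1,2) by (intro exI[of _ S0] conjI ballI)
  qed
  obtain S1 where S1: "S1 \<subseteq> S" "finite S1" "\<forall>\<mu>\<in>S. \<exists>\<nu>\<in>S1. ?r \<nu> \<subseteq># ?r \<mu>" using sub[of S] by blast
  define N where "N = Max (insert 0 ((\<lambda>\<nu>. count \<nu> a) ` S1))"
  have N: "count \<nu> a \<le> N" if "\<nu> \<in> S1" for \<nu> unfolding N_def using S1(2) that by (intro Max_ge) auto
  have "\<forall>k. \<exists>S0\<subseteq>{\<mu> \<in> S. count \<mu> a = k}. finite S0 \<and>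
    (\<forall>\<mu>\<in>{\<mu> \<in> S. count \<mu> a = k}. \<exists>\<nu>\<in>S0. ?r \<nu> \<subseteq># ?r \<mu>)"
    by (intro allI sub) blast
  from choice[OF this] obtain S2 where S2': "\<forall>k. S2 k \<subseteq> {\<mu> \<in> S. count \<mu> a = k} \<and> finite (S2 k) \<and>
    (\<forall>\<mu>\<in>{\<mu> \<in> S. count \<mu> a = k}. \<exists>\<nu>\<in>S2 k. ?r \<nu> \<subseteq># ?r \<mu>)" ..
  then have S2: "S2 k \<subseteq> {\<mu> \<in> S. count \<mu> a = k}" "finite (S2 k)" for k by simp_all
  have S2r: "\<exists>\<nu>\<in>S2 (count \<mu> a). ?r \<nu> \<subseteq># ?r \<mu>" if "\<mu> \<in> S" for \<mu>
    using S2' that by simp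
  show ?case
  proof (intro exI conjI ballI)
    show "S1 \<union> (\<Union>k<N. S2 k) \<subseteq> S" using S1(1) S2(1) by blast
    show "finite (S1 \<union> (\<Union>k<N. S2 k))" using S1(2) S2(2) by blast
    fix \<mu> assume \<mu>: "\<mu> \<in> S"
    show "\<exists>\<nu>\<in>S1 \<union> (\<Union>k<N. S2 k). \<nu> \<subseteq># \<mu>"
    proof (cases "count \<mu> a < N")
      case True
      obtain \<nu> where \<nu>: "\<nu> \<in> S2 (count \<mu> a)" "?r \<nu> \<subseteq># ?r \<mu>" using S2r[OF \<mu>] by blast
      moreover have "count \<nu> a = count \<mu> a" using \<nu>(1) S2(1) by blast
      ultimately show ?thesis using le True by fastforce
    next
      case False
      obtain \<nu> where \<nu>: "\<nu> \<in> S1" "?r \<nu> \<subseteq># ?r \<mu>" using S1(3) \<mu> by blast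
      then show ?thesis using le[OF \<nu>(2)] N[OF \<nu>(1)] False by fastforce
    qed
  qed
qed

text \<open>Dickson's finite set only controls divisibility. Closure under differences turns it into
  generators: subtracting one of its elements stays in \<open>M\<close> and lowers the size.
  Generation is phrased as an induction rule, ready to be applied to membership in a generated
  ring.\<close>

lemma submonoid_induct:
  assumes A: "finite A" and M: "M \<subseteq> {\<mu>. set_mset \<mu> \<subseteq> A}"
    and diff: "\<And>\<mu> \<nu>. \<mu> \<in> M \<Longrightarrow> \<nu> \<in> M \<Longrightarrow> \<nu> \<subseteq># \<mu> \<Longrightarrow> \<mu> - \<nu> \<in> M"
  obtains G where "finite G" "G \<subseteq> M"
    "\<And>P \<mu>. P {#} \<Longrightarrow> (\<And>\<nu> \<mu>. \<nu> \<in> G \<Longrightarrow> \<mu> \<in> M \<Longrightarrow> P \<mu> \<Longrightarrow> P (\<nu> + \<mu>)) \<Longrightarrow> \<mu> \<in> M \<Longrightarrow> P \<mu>"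
proof -
  have "M - {{#}} \<subseteq> {\<mu>. set_mset \<mu> \<subseteq> A}" using M by blast
  from multiset_dickson[OF A this] obtain G where
    G: "G \<subseteq> M - {{#}}" "finite G" "\<forall>\<mu>\<in>M - {{#}}. \<exists>\<nu>\<in>G. \<nu> \<subseteq># \<mu>" by blast
  show ?thesis
  proof (rule that[OF G(2)])
    show "G \<subseteq> M" using G(1) by blast
    fix P \<mu> assume P0: "P {#}" and Pa: "\<And>\<nu> \<mu>. \<nu> \<in> G \<Longrightarrow> \<mu> \<in> M \<Longrightarrow> P \<mu> \<Longrightarrow> P (\<nu> + \<mu>)" and "\<mu> \<in> M"
    from this(3) show "P \<mu>"
    proof (induction "size \<mu>" arbitrary: \<mu> rule: less_induct)
      case less
      show ?case
      proof (cases "\<mu> = {#}")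
        case False
        then obtain \<nu> where \<nu>: "\<nu> \<in> G" "\<nu> \<subseteq># \<mu>" using G(3) less(2) by blast
        then have nM: "\<nu> \<in> M" "\<nu> \<noteq> {#}" using G(1) by auto
        have eq: "\<nu> + (\<mu> - \<nu>) = \<mu>" using \<nu>(2) by simp
        have "size \<nu> + size (\<mu> - \<nu>) = size \<mu>" using eq by (metis size_union)
        moreover have "size \<nu> > 0" using nM(2) by (simp add: nonempty_has_size)
        ultimately have "size (\<mu> - \<nu>) < size \<mu>" by linarith
        from less(1)[OF this diff[OF less(2) nM(1) \<nu>(2)]]
        have "P (\<nu> + (\<mu> - \<nu>))" using Pa[OF \<nu>(1) diff[OF less(2) nM(1) \<nu>(2)]] by blast
        then show ?thesis using eq by simp
      qed (use P0 in simp)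
    qed
  qed
qed

text \<open>The sets of terms to which this is applied already contain all constant multiples, so
  that these sums are linear combinations over the ground field.\<close>

inductive_set add_span :: "('r, 'm) ring_scheme \<Rightarrow> 'r set \<Rightarrow> 'r set" for R T
  where
    zero: "\<zero>\<^bsub>R\<^esub> \<in> add_span R T"
  | step: "t \<in> T \<Longrightarrow> z \<in> add_span R T \<Longrightarrow> t \<oplus>\<^bsub>R\<^esub> z \<in> add_span R T"

context cring
begin

lemma add_span_carrier: "T \<subseteq> carrier R \<Longrightarrow> z \<in> add_span R T \<Longrightarrow> z \<in> carrier R"
  by (rotate_tac, induction rule: add_span.induct) auto

lemma add_span_incl: "T \<subseteq> carrier R \<Longrightarrow> t \<in> T \<Longrightarrow> t \<in> add_span R T"
  using add_span.step[OF _ add_span.zero, of t T R] by auto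

lemma add_span_add:
  assumes T: "T \<subseteq> carrier R" and "y \<in> add_span R T" and z: "z \<in> add_span R T"
  shows "y \<oplus> z \<in> add_span R T"
  using assms(2)
proof induction
  case zero
  show ?case using z add_span_carrier[OF T z] by simp
next
  case (step t y)
  have "t \<in> carrier R" "y \<in> carrier R" "z \<in> carrier R" using step T add_span_carrier[OF T] z by auto
  then have "(t \<oplus> y) \<oplus> z = t \<oplus> (y \<oplus> z)" by (rule a_assoc)
  then show ?case using add_span.step[OF step(1) step.IH] by simp
qed

lemma add_span_mult_right:
  assumes T: "T \<subseteq> carrier R" and w: "w \<in> carrier R" and tw: "\<And>t. t \<in> T \<Longrightarrow> t \<otimes> w \<in> add_span R T'"
    and T': "T' \<subseteq> carrier R" and "z \<in> add_span R T"
  shows "z \<otimes> w \<in> add_span R T'"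
  using assms(5)
proof induction
  case zero
  show ?case using w add_span.zero[of R T'] by simp
next
  case (step t z)
  have "t \<in> carrier R" "z \<in> carrier R" using step T add_span_carrier[OF T] by auto
  then have "(t \<oplus> z) \<otimes> w = t \<otimes> w \<oplus> z \<otimes> w" using w by (rule l_distr)
  then show ?case using add_span_add[OF T' tw[OF step(1)] step.IH] by simp
qed

lemma add_span_mult:
  assumes T: "T1 \<subseteq> carrier R" "T2 \<subseteq> carrier R" "T3 \<subseteq> carrier R"
    and tt: "\<And>t u. t \<in> T1 \<Longrightarrow> u \<in> T2 \<Longrightarrow> t \<otimes> u \<in> T3"
    and y: "y \<in> add_span R T1" and z: "z \<in> add_span R T2"
  shows "y \<otimes> z \<in> add_span R T3"
proof (rule add_span_mult_right[OF T(1) add_span_carrier[OF T(2) z] _ T(3) y])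
  fix t assume t: "t \<in> T1"
  then have tR: "t \<in> carrier R" using T by blast
  have "z \<otimes> t \<in> add_span R T3"
  proof (rule add_span_mult_right[OF T(2) tR _ T(3) z])
    fix u assume u: "u \<in> T2"
    then have "u \<otimes> t = t \<otimes> u" using T tR by (intro m_comm) auto
    then show "u \<otimes> t \<in> add_span R T3" using add_span_incl[OF T(3) tt[OF t u]] by simp
  qed
  then show "t \<otimes> z \<in> add_span R T3" using m_comm[OF tR add_span_carrier[OF T(2) z]] by simp
qed

end

section \<open>Products over multisets\<close>

context comm_monoid
begin

text \<open>The chosen list does not matter for multisets over the carrier.\<close>

definition mprod :: "'a multiset \<Rightarrow> 'a"
  where "mprod M = foldr (\<otimes>) (SOME xs. mset xs = M) \<one>"

lemma mprod_mset:
  assumes "set xs \<subseteq> carrier G"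
  shows "mprod (mset xs) = foldr (\<otimes>) xs \<one>"
proof -
  have "mset (SOME ys. mset ys = mset xs) = mset xs" by (rule someI) simp
  then show ?thesis
    unfolding mprod_def using assms by (intro multlist_perm_cong) (auto dest: mset_eq_setD)
qed

lemma mprod_empty: "mprod {#} = \<one>"
  using mprod_mset[of "[]"] by simp

lemma mprod_add_mset:
  assumes "a \<in> carrier G" "set_mset M \<subseteq> carrier G"
  shows "mprod (add_mset a M) = a \<otimes> mprod M"
proof -
  obtain xs where xs: "mset xs = M" using ex_mset by blast
  then have "set xs \<subseteq> carrier G" using assms(2) by auto
  then show ?thesis using mprod_mset[of "a # xs"] mprod_mset[of xs] assms(1) xs by auto
qed

lemma mprod_closed: "set_mset M \<subseteq> carrier G \<Longrightarrow> mprod M \<in> carrier G"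
  by (induction M) (auto simp: mprod_empty mprod_add_mset)

lemma mprod_union:
  "set_mset M \<subseteq> carrier G \<Longrightarrow> set_mset N \<subseteq> carrier G \<Longrightarrow> mprod (M + N) = mprod M \<otimes> mprod N"
  by (induction M) (auto simp: mprod_empty mprod_add_mset mprod_closed m_assoc)

lemma mprod_single: "a \<in> carrier G \<Longrightarrow> mprod {#a#} = a"
  using mprod_add_mset[of a "{#}"] by (simp add: mprod_empty)

end

section \<open>Generators extracted from the Cox ring\<close>

context normal_variety
begin

lemma mprod_nonzero: "set_mset M \<subseteq> nonzero \<Longrightarrow> F.mprod M \<in> nonzero"
proof (induction M)
  case empty
  show ?case using nonzero_one by (simp add: F.mprod_empty)
next
  case (add a M)
  have "set_mset M \<subseteq> carrier FF" using add.prems nonzeroD(1) by auto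
  then show ?case using add nonzero_mult nonzeroD(1) by (auto simp: F.mprod_add_mset)
qed

context
  fixes L \<chi>
  assumes cd: "cox_data \<V> L \<chi>"
begin

interpretation C: collapsed_group_algebra FF L "principal_part \<V> L" \<chi>
  by (rule cox_collapsed(1)[OF cd])

section \<open>The Cox ring as a ring of families of germs\<close>

lemma germ_ops:
  assumes x: "x \<in> points \<V>" and s: "s \<in> stalk_carrier L x" and t: "t \<in> stalk_carrier L x"
  shows "cox_germ \<V> L \<chi> s x \<in> carrier (cox_stalk \<V> L \<chi> x)"
    and "cox_germ \<V> L \<chi> (s \<oplus>\<^bsub>big L\<^esub> t) x = cox_germ \<V> L \<chi> s x \<oplus>\<^bsub>cox_stalk \<V> L \<chi> x\<^esub> cox_germ \<V> L \<chi> t x"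
    and "cox_germ \<V> L \<chi> (s \<otimes>\<^bsub>big L\<^esub> t) x = cox_germ \<V> L \<chi> s x \<otimes>\<^bsub>cox_stalk \<V> L \<chi> x\<^esub> cox_germ \<V> L \<chi> t x"
    and "cox_germ \<V> L \<chi> (\<ominus>\<^bsub>big L\<^esub> s) x = \<ominus>\<^bsub>cox_stalk \<V> L \<chi> x\<^esub> cox_germ \<V> L \<chi> s x"
proof -
  interpret h: ring_hom_ring "divisorial_stalk \<V> L x" "cox_stalk \<V> L \<chi> x" "\<lambda>s. cox_germ \<V> L \<chi> s x"
    by (rule germ_hom[OF cd x])
  have st: "s \<in> carrier (divisorial_stalk \<V> L x)" "t \<in> carrier (divisorial_stalk \<V> L x)"
    using s t by (simp_all add: stalk_eq)
  show "cox_germ \<V> L \<chi> s x \<in> carrier (cox_stalk \<V> L \<chi> x)" using st by (rule_tac h.hom_closed)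
  show "cox_germ \<V> L \<chi> (s \<oplus>\<^bsub>big L\<^esub> t) x = cox_germ \<V> L \<chi> s x \<oplus>\<^bsub>cox_stalk \<V> L \<chi> x\<^esub> cox_germ \<V> L \<chi> t x"
    using h.hom_add[OF st] by (simp add: stalk_eq)
  show "cox_germ \<V> L \<chi> (s \<otimes>\<^bsub>big L\<^esub> t) x = cox_germ \<V> L \<chi> s x \<otimes>\<^bsub>cox_stalk \<V> L \<chi> x\<^esub> cox_germ \<V> L \<chi> t x"
    using h.hom_mult[OF st] by (simp add: stalk_eq)
  show "cox_germ \<V> L \<chi> (\<ominus>\<^bsub>big L\<^esub> s) x = \<ominus>\<^bsub>cox_stalk \<V> L \<chi> x\<^esub> cox_germ \<V> L \<chi> s x"
    using h.hom_a_inv[OF st(1)] stalk_minus[OF cd x s] by simp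
qed

lemma germ_one_zero:
  assumes x: "x \<in> points \<V>"
  shows "cox_germ \<V> L \<chi> \<one>\<^bsub>big L\<^esub> x = \<one>\<^bsub>cox_stalk \<V> L \<chi> x\<^esub>" "cox_germ \<V> L \<chi> \<zero>\<^bsub>big L\<^esub> x = \<zero>\<^bsub>cox_stalk \<V> L \<chi> x\<^esub>"
proof -
  interpret h: ring_hom_ring "divisorial_stalk \<V> L x" "cox_stalk \<V> L \<chi> x" "\<lambda>s. cox_germ \<V> L \<chi> s x"
    by (rule germ_hom[OF cd x])
  show "cox_germ \<V> L \<chi> \<one>\<^bsub>big L\<^esub> x = \<one>\<^bsub>cox_stalk \<V> L \<chi> x\<^esub>" "cox_germ \<V> L \<chi> \<zero>\<^bsub>big L\<^esub> x = \<zero>\<^bsub>cox_stalk \<V> L \<chi> x\<^esub>"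
    using h.hom_one h.hom_zero by (simp_all add: stalk_eq)
qed

lemma cox_stalk_ring: "x \<in> points \<V> \<Longrightarrow> ring (cox_stalk \<V> L \<chi> x)"
  using germ_hom[OF cd] by (simp add: ring_hom_ring_def)

text \<open>The values of a locally induced family lie in the quotient stalks automatically, so
  local representability is the whole condition.\<close>

lemma cox_carrier_iff:
  "\<sigma> \<in> carrier (cox_ring \<V> L \<chi>) \<longleftrightarrow> \<sigma> \<in> extensional (points \<V>) \<and>
    (\<forall>x\<in>points \<V>. \<exists>W s. openin (top_of \<V>) W \<and> x \<in> W \<and> s \<in> graded_sections L W \<and>
      (\<forall>y\<in>W. \<sigma> y = cox_germ \<V> L \<chi> s y))"
proof
  assume "\<sigma> \<in> carrier (cox_ring \<V> L \<chi>)"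
  then have "\<sigma> \<in> extensional (points \<V>)" and loc: "\<forall>x\<in>points \<V>. \<exists>W s. openin (top_of \<V>) W \<and> x \<in> W \<and>
    W \<subseteq> points \<V> \<and> s \<in> graded_sections L W \<and> (\<forall>y\<in>W. \<sigma> y = cox_germ \<V> L \<chi> s y)"
    by (simp_all add: cox_ring_def cox_sections_def divisorial_carrier PiE_def)
  then show "\<sigma> \<in> extensional (points \<V>) \<and> (\<forall>x\<in>points \<V>. \<exists>W s. openin (top_of \<V>) W \<and> x \<in> W \<and>
    s \<in> graded_sections L W \<and> (\<forall>y\<in>W. \<sigma> y = cox_germ \<V> L \<chi> s y))" by meson
next
  assume *: "\<sigma> \<in> extensional (points \<V>) \<and> (\<forall>x\<in>points \<V>. \<exists>W s. openin (top_of \<V>) W \<and> x \<in> W \<and>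
    s \<in> graded_sections L W \<and> (\<forall>y\<in>W. \<sigma> y = cox_germ \<V> L \<chi> s y))"
  have "\<sigma> x \<in> carrier (cox_stalk \<V> L \<chi> x)" if x: "x \<in> points \<V>" for x
  proof -
    obtain W s where W: "openin (top_of \<V>) W" "x \<in> W" "s \<in> graded_sections L W" "\<sigma> x = cox_germ \<V> L \<chi> s x"
      using * x by blast
    show ?thesis unfolding W(4) by (rule germ_ops(1)[OF x stalk_carrierI[OF W(3,1,2)] stalk_carrierI[OF W(3,1,2)]])
  qed
  moreover have "\<exists>W s. openin (top_of \<V>) W \<and> x \<in> W \<and> W \<subseteq> points \<V> \<and>
    s \<in> graded_sections L W \<and> (\<forall>y\<in>W. \<sigma> y = cox_germ \<V> L \<chi> s y)" if "x \<in> points \<V>" for x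
    using * that openin_subset by metis
  ultimately show "\<sigma> \<in> carrier (cox_ring \<V> L \<chi>)"
    using * by (simp add: cox_ring_def cox_sections_def divisorial_carrier PiE_def)
qed

lemma cox_ops:
  "\<sigma> \<oplus>\<^bsub>cox_ring \<V> L \<chi>\<^esub> \<tau> = (\<lambda>x\<in>points \<V>. \<sigma> x \<oplus>\<^bsub>cox_stalk \<V> L \<chi> x\<^esub> \<tau> x)"
  "\<sigma> \<otimes>\<^bsub>cox_ring \<V> L \<chi>\<^esub> \<tau> = (\<lambda>x\<in>points \<V>. \<sigma> x \<otimes>\<^bsub>cox_stalk \<V> L \<chi> x\<^esub> \<tau> x)"
  "\<one>\<^bsub>cox_ring \<V> L \<chi>\<^esub> = (\<lambda>x\<in>points \<V>. \<one>\<^bsub>cox_stalk \<V> L \<chi> x\<^esub>)"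
  "\<zero>\<^bsub>cox_ring \<V> L \<chi>\<^esub> = (\<lambda>x\<in>points \<V>. \<zero>\<^bsub>cox_stalk \<V> L \<chi> x\<^esub>)"
  by (simp_all add: cox_ring_def cox_sections_def)

lemma cox_local:
  assumes \<sigma>: "\<sigma> \<in> carrier (cox_ring \<V> L \<chi>)" and x: "x \<in> points \<V>"
  obtains W s where "openin (top_of \<V>) W" "x \<in> W" "s \<in> graded_sections L W"
    "\<forall>y\<in>W. \<sigma> y = cox_germ \<V> L \<chi> s y"
  using \<sigma> x unfolding cox_carrier_iff by blast

lemma cox_sectionI:
  assumes "\<And>x. x \<in> points \<V> \<Longrightarrow> \<exists>W s. openin (top_of \<V>) W \<and> x \<in> W \<and> s \<in> graded_sections L W \<and>
      (\<forall>y\<in>W. \<sigma> y = cox_germ \<V> L \<chi> s y)"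
  shows "restrict \<sigma> (points \<V>) \<in> carrier (cox_ring \<V> L \<chi>)"
  unfolding cox_carrier_iff
proof (intro conjI ballI)
  fix x assume "x \<in> points \<V>"
  from assms[OF this] obtain W s where W: "openin (top_of \<V>) W" "x \<in> W" "s \<in> graded_sections L W"
    "\<forall>y\<in>W. \<sigma> y = cox_germ \<V> L \<chi> s y" by blast
  moreover have "\<forall>y\<in>W. restrict \<sigma> (points \<V>) y = cox_germ \<V> L \<chi> s y"
    using W(4) openin_subset[OF W(1)] by auto
  ultimately show "\<exists>W s. openin (top_of \<V>) W \<and> x \<in> W \<and> s \<in> graded_sections L W \<and>
      (\<forall>y\<in>W. restrict \<sigma> (points \<V>) y = cox_germ \<V> L \<chi> s y)" by blast
qed simp

lemma cox_global: "s \<in> graded_sections L (points \<V>) \<Longrightarrow>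
    (\<lambda>x\<in>points \<V>. cox_germ \<V> L \<chi> s x) \<in> carrier (cox_ring \<V> L \<chi>)"
  by (rule cox_sectionI) (use points_open in blast)

text \<open>An operation \<open>op\<close> on sections is paired with its stalkwise counterpart
  \<open>op'\<close>. This covers sums, products and, with the second argument ignored,
  negatives.\<close>

lemma cox_binop_closed:
  assumes \<sigma>: "\<sigma> \<in> carrier (cox_ring \<V> L \<chi>)" and \<tau>: "\<tau> \<in> carrier (cox_ring \<V> L \<chi>)"
    and gr: "\<And>W s t. W \<noteq> {} \<Longrightarrow> s \<in> graded_sections L W \<Longrightarrow> t \<in> graded_sections L W \<Longrightarrow> op s t \<in> graded_sections L W"
    and germ: "\<And>x s t. x \<in> points \<V> \<Longrightarrow> s \<in> stalk_carrier L x \<Longrightarrow> t \<in> stalk_carrier L x \<Longrightarrow>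
      cox_germ \<V> L \<chi> (op s t) x = op' x (cox_germ \<V> L \<chi> s x) (cox_germ \<V> L \<chi> t x)"
  shows "(\<lambda>x\<in>points \<V>. op' x (\<sigma> x) (\<tau> x)) \<in> carrier (cox_ring \<V> L \<chi>)"
proof (rule cox_sectionI)
  fix x assume x: "x \<in> points \<V>"
  obtain W s where W: "openin (top_of \<V>) W" "x \<in> W" "s \<in> graded_sections L W"
    "\<forall>y\<in>W. \<sigma> y = cox_germ \<V> L \<chi> s y" by (rule cox_local[OF \<sigma> x])
  obtain W' t where W': "openin (top_of \<V>) W'" "x \<in> W'" "t \<in> graded_sections L W'"
    "\<forall>y\<in>W'. \<tau> y = cox_germ \<V> L \<chi> t y" by (rule cox_local[OF \<tau> x])
  have ne: "W \<inter> W' \<noteq> {}" and xW: "x \<in> W \<inter> W'" using W(2) W'(2) by blast+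
  have o: "openin (top_of \<V>) (W \<inter> W')" using W(1) W'(1) by blast
  have st: "s \<in> graded_sections L (W \<inter> W')" "t \<in> graded_sections L (W \<inter> W')"
    using graded_sections_mono[OF Int_lower1 ne] graded_sections_mono[OF Int_lower2 ne] W(3) W'(3) by auto
  have "op' y (\<sigma> y) (\<tau> y) = cox_germ \<V> L \<chi> (op s t) y" if y: "y \<in> W \<inter> W'" for y
    using germ[OF _ stalk_carrierI[OF st(1) o y] stalk_carrierI[OF st(2) o y]] y W(4) W'(4) openin_subset[OF o]
    by auto
  then show "\<exists>W s. openin (top_of \<V>) W \<and> x \<in> W \<and> s \<in> graded_sections L W \<and>
      (\<forall>y\<in>W. op' y (\<sigma> y) (\<tau> y) = cox_germ \<V> L \<chi> s y)"
    using o xW gr[OF ne st] by blast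
qed

lemma cox_add_closed:
  assumes "\<sigma> \<in> carrier (cox_ring \<V> L \<chi>)" "\<tau> \<in> carrier (cox_ring \<V> L \<chi>)"
  shows "\<sigma> \<oplus>\<^bsub>cox_ring \<V> L \<chi>\<^esub> \<tau> \<in> carrier (cox_ring \<V> L \<chi>)"
  unfolding cox_ops
  by (rule cox_binop_closed[OF assms, where op = "(\<oplus>\<^bsub>big L\<^esub>)" and op' = "\<lambda>x. (\<oplus>\<^bsub>cox_stalk \<V> L \<chi> x\<^esub>)"])
    (rule subringE(7)[OF graded_sections_subring[OF L_subgroup[OF cd]]] germ_ops(2); assumption)+

lemma cox_mult_closed:
  assumes "\<sigma> \<in> carrier (cox_ring \<V> L \<chi>)" "\<tau> \<in> carrier (cox_ring \<V> L \<chi>)"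
  shows "\<sigma> \<otimes>\<^bsub>cox_ring \<V> L \<chi>\<^esub> \<tau> \<in> carrier (cox_ring \<V> L \<chi>)"
  unfolding cox_ops
  by (rule cox_binop_closed[OF assms, where op = "(\<otimes>\<^bsub>big L\<^esub>)" and op' = "\<lambda>x. (\<otimes>\<^bsub>cox_stalk \<V> L \<chi> x\<^esub>)"])
    (rule subringE(6)[OF graded_sections_subring[OF L_subgroup[OF cd]]] germ_ops(3); assumption)+

lemma cox_minus_closed:
  assumes "\<sigma> \<in> carrier (cox_ring \<V> L \<chi>)"
  shows "(\<lambda>x\<in>points \<V>. \<ominus>\<^bsub>cox_stalk \<V> L \<chi> x\<^esub> \<sigma> x) \<in> carrier (cox_ring \<V> L \<chi>)"
  by (rule cox_binop_closed[OF assms assms, where op' = "\<lambda>x a b. \<ominus>\<^bsub>cox_stalk \<V> L \<chi> x\<^esub> a"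
        and op = "\<lambda>s t. \<ominus>\<^bsub>big L\<^esub> s"])
    (rule subringE(5)[OF graded_sections_subring[OF L_subgroup[OF cd]]] germ_ops(4); assumption)+

lemma cox_one_closed: "\<one>\<^bsub>cox_ring \<V> L \<chi>\<^esub> \<in> carrier (cox_ring \<V> L \<chi>)"
proof -
  have "(\<lambda>x\<in>points \<V>. cox_germ \<V> L \<chi> \<one>\<^bsub>big L\<^esub> x) \<in> carrier (cox_ring \<V> L \<chi>)"
    by (rule cox_global[OF subringE(3)[OF graded_sections_subring[OF L_subgroup[OF cd] points_nonempty]]])
  then show ?thesis unfolding cox_ops by (simp add: germ_one_zero cong: restrict_cong)
qed

lemma cox_zero_closed: "\<zero>\<^bsub>cox_ring \<V> L \<chi>\<^esub> \<in> carrier (cox_ring \<V> L \<chi>)"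
proof -
  have "(\<lambda>x\<in>points \<V>. cox_germ \<V> L \<chi> \<zero>\<^bsub>big L\<^esub> x) \<in> carrier (cox_ring \<V> L \<chi>)"
    by (rule cox_global[OF subringE(2)[OF graded_sections_subring[OF L_subgroup[OF cd] points_nonempty]]])
  then show ?thesis unfolding cox_ops by (simp add: germ_one_zero cong: restrict_cong)
qed

lemma cox_value: "\<sigma> \<in> carrier (cox_ring \<V> L \<chi>) \<Longrightarrow> x \<in> points \<V> \<Longrightarrow> \<sigma> x \<in> carrier (cox_stalk \<V> L \<chi> x)"
  by (auto simp: cox_ring_def cox_sections_def)

lemma cox_ext: "\<sigma> \<in> carrier (cox_ring \<V> L \<chi>) \<Longrightarrow> \<sigma> \<in> extensional (points \<V>)"
  by (simp add: cox_carrier_iff)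

text \<open>\<open>generate_ring\<close> closes under the additive inverse of the Cox ring, which is
  a definite description in the additive monoid; the group laws identify it with the stalkwise
  inverse.\<close>

lemma cox_abelian_group: "abelian_group (cox_ring \<V> L \<chi>)"
proof (rule abelian_groupI)
  have Q: "abelian_group (cox_stalk \<V> L \<chi> x)" if "x \<in> points \<V>" for x
    using cox_stalk_ring[OF that] by (rule ring.is_abelian_group)
  note E = abelian_groupE[OF Q]
  fix \<sigma> \<tau> \<upsilon> assume \<sigma>: "\<sigma> \<in> carrier (cox_ring \<V> L \<chi>)" and \<tau>: "\<tau> \<in> carrier (cox_ring \<V> L \<chi>)"
    and \<upsilon>: "\<upsilon> \<in> carrier (cox_ring \<V> L \<chi>)"
  show "\<sigma> \<oplus>\<^bsub>cox_ring \<V> L \<chi>\<^esub> \<tau> \<oplus>\<^bsub>cox_ring \<V> L \<chi>\<^esub> \<upsilon> = \<sigma> \<oplus>\<^bsub>cox_ring \<V> L \<chi>\<^esub> (\<tau> \<oplus>\<^bsub>cox_ring \<V> L \<chi>\<^esub> \<upsilon>)"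
    unfolding cox_ops using E(3) cox_value \<sigma> \<tau> \<upsilon> by (auto intro!: restrict_ext)
next
  have Q: "abelian_group (cox_stalk \<V> L \<chi> x)" if "x \<in> points \<V>" for x
    using cox_stalk_ring[OF that] by (rule ring.is_abelian_group)
  note E = abelian_groupE[OF Q]
  fix \<sigma> \<tau> assume \<sigma>: "\<sigma> \<in> carrier (cox_ring \<V> L \<chi>)" and \<tau>: "\<tau> \<in> carrier (cox_ring \<V> L \<chi>)"
  show "\<sigma> \<oplus>\<^bsub>cox_ring \<V> L \<chi>\<^esub> \<tau> = \<tau> \<oplus>\<^bsub>cox_ring \<V> L \<chi>\<^esub> \<sigma>"
    unfolding cox_ops using E(4) cox_value \<sigma> \<tau> by (auto intro!: restrict_ext)
next
  fix \<sigma> assume \<sigma>: "\<sigma> \<in> carrier (cox_ring \<V> L \<chi>)"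
  have r: "\<zero>\<^bsub>cox_stalk \<V> L \<chi> x\<^esub> \<oplus>\<^bsub>cox_stalk \<V> L \<chi> x\<^esub> \<sigma> x = \<sigma> x"
    "\<ominus>\<^bsub>cox_stalk \<V> L \<chi> x\<^esub> \<sigma> x \<oplus>\<^bsub>cox_stalk \<V> L \<chi> x\<^esub> \<sigma> x = \<zero>\<^bsub>cox_stalk \<V> L \<chi> x\<^esub>"
    if x: "x \<in> points \<V>" for x
  proof -
    interpret ring "cox_stalk \<V> L \<chi> x" by (rule cox_stalk_ring[OF x])
    show "\<zero>\<^bsub>cox_stalk \<V> L \<chi> x\<^esub> \<oplus>\<^bsub>cox_stalk \<V> L \<chi> x\<^esub> \<sigma> x = \<sigma> x"
      "\<ominus>\<^bsub>cox_stalk \<V> L \<chi> x\<^esub> \<sigma> x \<oplus>\<^bsub>cox_stalk \<V> L \<chi> x\<^esub> \<sigma> x = \<zero>\<^bsub>cox_stalk \<V> L \<chi> x\<^esub>"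
      using cox_value[OF \<sigma> x] by (simp_all add: l_neg)
  qed
  show "\<zero>\<^bsub>cox_ring \<V> L \<chi>\<^esub> \<oplus>\<^bsub>cox_ring \<V> L \<chi>\<^esub> \<sigma> = \<sigma>"
    by (rule extensionalityI[OF _ cox_ext[OF \<sigma>]]) (simp_all add: cox_ops r)
  have "(\<lambda>x\<in>points \<V>. \<ominus>\<^bsub>cox_stalk \<V> L \<chi> x\<^esub> \<sigma> x) \<oplus>\<^bsub>cox_ring \<V> L \<chi>\<^esub> \<sigma> = \<zero>\<^bsub>cox_ring \<V> L \<chi>\<^esub>"
    unfolding cox_ops by (rule restrict_ext) (simp add: r)
  then show "\<exists>\<tau>\<in>carrier (cox_ring \<V> L \<chi>). \<tau> \<oplus>\<^bsub>cox_ring \<V> L \<chi>\<^esub> \<sigma> = \<zero>\<^bsub>cox_ring \<V> L \<chi>\<^esub>"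
    using cox_minus_closed[OF \<sigma>] by blast
qed (fact cox_add_closed cox_zero_closed)+

lemma cox_a_inv:
  assumes \<sigma>: "\<sigma> \<in> carrier (cox_ring \<V> L \<chi>)"
  shows "\<ominus>\<^bsub>cox_ring \<V> L \<chi>\<^esub> \<sigma> = (\<lambda>x\<in>points \<V>. \<ominus>\<^bsub>cox_stalk \<V> L \<chi> x\<^esub> \<sigma> x)"
proof -
  interpret A: abelian_group "cox_ring \<V> L \<chi>" by (rule cox_abelian_group)
  have "\<ominus>\<^bsub>cox_stalk \<V> L \<chi> x\<^esub> \<sigma> x \<oplus>\<^bsub>cox_stalk \<V> L \<chi> x\<^esub> \<sigma> x = \<zero>\<^bsub>cox_stalk \<V> L \<chi> x\<^esub>"
    if x: "x \<in> points \<V>" for x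
  proof -
    interpret ring "cox_stalk \<V> L \<chi> x" by (rule cox_stalk_ring[OF x])
    show ?thesis using cox_value[OF \<sigma> x] by (simp add: l_neg)
  qed
  then have "(\<lambda>x\<in>points \<V>. \<ominus>\<^bsub>cox_stalk \<V> L \<chi> x\<^esub> \<sigma> x) \<oplus>\<^bsub>cox_ring \<V> L \<chi>\<^esub> \<sigma> = \<zero>\<^bsub>cox_ring \<V> L \<chi>\<^esub>"
    unfolding cox_ops by (intro restrict_ext) simp
  then show ?thesis by (rule A.minus_equality[OF _ \<sigma> cox_minus_closed[OF \<sigma>]])
qed

text \<open>
  The components of a global section of the Cox sheaf do not depend on the point, since any two
  nonempty open sets meet; hence they are global sections.
\<close>

lemma collapse_global:
  assumes \<sigma>: "\<sigma> \<in> carrier (cox_ring \<V> L \<chi>)" and x: "x \<in> points \<V>"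
    and s: "s \<in> stalk_carrier L x" "\<sigma> x = cox_germ \<V> L \<chi> s x" and D: "D \<in> L"
  shows "C.collapse D s \<in> sec D (points \<V>)"
proof -
  obtain W0 s0 where W0: "openin (top_of \<V>) W0" "x \<in> W0" "s0 \<in> graded_sections L W0"
    "\<forall>y\<in>W0. \<sigma> y = cox_germ \<V> L \<chi> s0 y" by (rule cox_local[OF \<sigma> x])
  have s0: "C.collapse D s = C.collapse D s0"
    by (rule germ_eq_collapse[OF cd x s(1) stalk_carrierI[OF W0(3,1,2)] _ D]) (use W0(2,4) s(2) in auto)
  have everywhere: "\<exists>W. openin (top_of \<V>) W \<and> y \<in> W \<and> C.collapse D s \<in> sec D W" if y: "y \<in> points \<V>" for y
  proof -
    obtain W t where W: "openin (top_of \<V>) W" "y \<in> W" "t \<in> graded_sections L W"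
      "\<forall>y\<in>W. \<sigma> y = cox_germ \<V> L \<chi> t y" by (rule cox_local[OF \<sigma> y])
    have "W0 \<inter> W \<noteq> {}" by (rule open_meet_points[OF W0(1) W(1)]) (use W0(2) W(2) in auto)
    then obtain z where z: "z \<in> W0" "z \<in> W" by blast
    have zp: "z \<in> points \<V>" using z(1) openin_subset[OF W0(1)] by blast
    have "C.collapse D s0 = C.collapse D t"
      by (rule germ_eq_collapse[OF cd zp stalk_carrierI[OF W0(3,1) z(1)] stalk_carrierI[OF W(3,1) z(2)] _ D])
        (use W0(4) W(4) z in auto)
    moreover have "C.collapse D t \<in> sec D W"
      unfolding C.collapse_def
    proof (rule C.finsum_in[OF sec_carrier sec_zero sec_add])
      fix E assume "E \<in> {E \<in> principal_part \<V> L. t (D + E) \<noteq> \<zero>\<^bsub>FF\<^esub>}"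
      then have E: "E \<in> principal_part \<V> L" by blast
      have "t (D + E) \<in> sec (D + E) W" using W(3) C.shift_in[OF D E] by (simp add: graded_sections_def)
      moreover have "\<chi> E \<in> sec (- E) W"
        using cd E W(2) by (intro sec_principal cox_collapsed(2)[OF cd E]) (auto simp: cox_data_def)
      ultimately have "t (D + E) \<otimes>\<^bsub>FF\<^esub> \<chi> E \<in> sec (D + E + - E) W" by (rule sec_mult)
      then show "t (D + E) \<otimes>\<^bsub>FF\<^esub> \<chi> E \<in> sec D W" by simp
    qed
    ultimately show ?thesis using s0 W(1,2) by auto
  qed
  show ?thesis
  proof (cases "C.collapse D s = \<zero>\<^bsub>FF\<^esub>")
    case True
    then show ?thesis using sec_zero by simp
  next
    case False
    obtain W where "C.collapse D s \<in> sec D W" using everywhere[OF x] by blast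
    then have nz: "C.collapse D s \<in> nonzero" using False by (auto simp: sec_iff)
    show ?thesis
    proof (rule secI[OF nz points_nonempty])
      \<comment> \<open>The condition along \<open>P\<close> can be read off on any open set that
        meets \<open>P\<close>.\<close>
      fix P assume P: "P \<in> prime_divisors \<V>"
      obtain y where y: "y \<in> P" "y \<in> points \<V>" using prime_divisorD(3,4)[OF P] by blast
      obtain W where W: "y \<in> W" "C.collapse D s \<in> sec D W" using everywhere[OF y(2)] by blast
      then have "P \<inter> W \<noteq> {}" using y(1) by blast
      then show "div_of \<V> (C.collapse D s) P + Poly_Mapping.lookup D P \<ge> 0"
        using W(2) False P by (auto simp: sec_iff)
    qed
  qed
qed

text \<open>The monomials have degree \<open>D + E\<close> with \<open>E\<close> principal, and the
  factor \<open>\<chi> E\<close> of degree \<open>- E\<close> moves them to degree \<open>D\<close>.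
  The Cox ring identifies these degrees, so all of them contribute to degree
  \<open>D\<close>.\<close>

definition cox_terms :: "('a divisor \<times> ('a, 'b) rational) set \<Rightarrow> 'a divisor \<Rightarrow> ('a, 'b) rational set"
  where "cox_terms G D = {const_rational \<V> c \<otimes>\<^bsub>FF\<^esub> (\<chi> E \<otimes>\<^bsub>FF\<^esub> F.mprod (image_mset snd \<nu>)) | c E \<nu>.
    set_mset \<nu> \<subseteq> G \<and> E \<in> principal_part \<V> L \<and> sum_mset (image_mset fst \<nu>) = D + E}"

lemma cox_termsI:
  "set_mset \<nu> \<subseteq> G \<Longrightarrow> E \<in> principal_part \<V> L \<Longrightarrow> sum_mset (image_mset fst \<nu>) = D + E \<Longrightarrow>
    const_rational \<V> c \<otimes>\<^bsub>FF\<^esub> (\<chi> E \<otimes>\<^bsub>FF\<^esub> F.mprod (image_mset snd \<nu>)) \<in> cox_terms G D"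
  unfolding cox_terms_def by blast

context
  fixes G :: "('a divisor \<times> ('a, 'b) rational) set"
  assumes G: "snd ` G \<subseteq> carrier FF"
begin

lemma mprod_snd: "set_mset \<nu> \<subseteq> G \<Longrightarrow> F.mprod (image_mset snd \<nu>) \<in> carrier FF"
  using G by (intro F.mprod_closed) auto

lemma cox_terms_carrier: "cox_terms G D \<subseteq> carrier FF"
  unfolding cox_terms_def using mprod_snd C.\<chi>_closed const_carrier by auto

lemma cox_terms_mult:
  assumes "t \<in> cox_terms G D" "u \<in> cox_terms G D'"
  shows "t \<otimes>\<^bsub>FF\<^esub> u \<in> cox_terms G (D + D')"
proof -
  obtain c E \<nu> where t: "t = const_rational \<V> c \<otimes>\<^bsub>FF\<^esub> (\<chi> E \<otimes>\<^bsub>FF\<^esub> F.mprod (image_mset snd \<nu>))"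
    "set_mset \<nu> \<subseteq> G" "E \<in> principal_part \<V> L" "sum_mset (image_mset fst \<nu>) = D + E"
    using assms(1) unfolding cox_terms_def by blast
  obtain c' E' \<nu>' where u: "u = const_rational \<V> c' \<otimes>\<^bsub>FF\<^esub> (\<chi> E' \<otimes>\<^bsub>FF\<^esub> F.mprod (image_mset snd \<nu>'))"
    "set_mset \<nu>' \<subseteq> G" "E' \<in> principal_part \<V> L" "sum_mset (image_mset fst \<nu>') = D' + E'"
    using assms(2) unfolding cox_terms_def by blast
  note cl = const_carrier[of c] const_carrier[of c'] C.\<chi>_closed[OF t(3)] C.\<chi>_closed[OF u(3)]
    mprod_snd[OF t(2)] mprod_snd[OF u(2)]
  have "F.mprod (image_mset snd (\<nu> + \<nu>')) = F.mprod (image_mset snd \<nu>) \<otimes>\<^bsub>FF\<^esub> F.mprod (image_mset snd \<nu>')"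
    unfolding image_mset_union using G t(2) u(2) by (intro F.mprod_union) auto
  then have "t \<otimes>\<^bsub>FF\<^esub> u = const_rational \<V> (c * c') \<otimes>\<^bsub>FF\<^esub> (\<chi> (E + E') \<otimes>\<^bsub>FF\<^esub> F.mprod (image_mset snd (\<nu> + \<nu>')))"
    unfolding t(1) u(1) const_mult[symmetric] C.\<chi>_add[OF t(3) u(3)] using cl
    by (simp only: F.m_ac F.m_closed)
  moreover have "\<dots> \<in> cox_terms G (D + D')"
    by (rule cox_termsI) (use t u C.L0_add[OF t(3) u(3)] in \<open>auto simp: algebra_simps\<close>)
  ultimately show ?thesis by simp
qed

lemma cox_terms_shift:
  assumes "t \<in> cox_terms G (D + E)" and E: "E \<in> principal_part \<V> L"
  shows "t \<otimes>\<^bsub>FF\<^esub> \<chi> E \<in> cox_terms G D"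
proof -
  obtain c E' \<nu> where t: "t = const_rational \<V> c \<otimes>\<^bsub>FF\<^esub> (\<chi> E' \<otimes>\<^bsub>FF\<^esub> F.mprod (image_mset snd \<nu>))"
    "set_mset \<nu> \<subseteq> G" "E' \<in> principal_part \<V> L" "sum_mset (image_mset fst \<nu>) = D + E + E'"
    using assms(1) unfolding cox_terms_def by blast
  note cl = const_carrier[of c] C.\<chi>_closed[OF t(3)] C.\<chi>_closed[OF E] mprod_snd[OF t(2)]
  have "t \<otimes>\<^bsub>FF\<^esub> \<chi> E = const_rational \<V> c \<otimes>\<^bsub>FF\<^esub> (\<chi> (E + E') \<otimes>\<^bsub>FF\<^esub> F.mprod (image_mset snd \<nu>))"
    unfolding t(1) C.\<chi>_add[OF E t(3)] using cl by (simp only: F.m_ac F.m_closed)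
  also have "\<dots> \<in> cox_terms G D"
    by (rule cox_termsI[OF t(2) C.L0_add[OF E t(3)]]) (simp add: t(4) add.assoc)
  finally show ?thesis .
qed

lemma const_in_cox_terms:
  assumes "- D \<in> principal_part \<V> L"
  shows "const_rational \<V> c \<otimes>\<^bsub>FF\<^esub> \<chi> (- D) \<in> cox_terms G D"
  using cox_termsI[of "{#}" G "- D" D c] assms C.\<chi>_closed[OF assms] by (simp add: F.mprod_empty)

text \<open>The induction runs over the generated ring but follows the germ at one fixed point
  \<open>x\<close> only: lifts are added and multiplied in the stalk at \<open>x\<close>, and
  \<open>collapse_mult_in\<close> controls the products. Membership in the carrier is carried along
  because additive inverses are computed from it.\<close>

lemma collapse_generated:
  assumes x: "x \<in> points \<V>" and A: "A \<subseteq> carrier (cox_ring \<V> L \<chi>)"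
    and gen: "\<forall>a\<in>A. \<exists>s\<in>stalk_carrier L x. a x = cox_germ \<V> L \<chi> s x \<and>
      (\<forall>D\<in>L. C.collapse D s \<in> add_span FF (cox_terms G D))"
    and \<sigma>: "\<sigma> \<in> generate_ring (cox_ring \<V> L \<chi>) (range (cox_const \<V> L \<chi>) \<union> A)"
  shows "\<sigma> \<in> carrier (cox_ring \<V> L \<chi>) \<and> (\<exists>s\<in>stalk_carrier L x. \<sigma> x = cox_germ \<V> L \<chi> s x \<and>
      (\<forall>D\<in>L. C.collapse D s \<in> add_span FF (cox_terms G D)))"
  using \<sigma>
proof induction
  note sub = stalk_subring[OF L_subgroup[OF cd] x]
  note T = cox_terms_carrier
  have AR: "\<And>s. s \<in> stalk_carrier L x \<Longrightarrow> s \<in> carrier (big L)" using subringE(1)[OF sub] by blast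
  have const: "C.collapse D (single FF L 0 (const_rational \<V> c)) \<in> add_span FF (cox_terms G D)" if D: "D \<in> L" for D c
    unfolding C.collapse_hom[OF const_carrier C.K_zero D]
    using F.add_span_incl[OF T const_in_cox_terms] add_span.zero by auto
  {
    case one
    have "\<one>\<^bsub>big L\<^esub> = single FF L 0 (const_rational \<V> 1)" by (simp add: C.one_B one_FF)
    have v: "\<one>\<^bsub>cox_ring \<V> L \<chi>\<^esub> x = cox_germ \<V> L \<chi> \<one>\<^bsub>big L\<^esub> x"
      using germ_one_zero(1)[OF x] x by (simp add: cox_ops(3))
    have "C.collapse D \<one>\<^bsub>big L\<^esub> \<in> add_span FF (cox_terms G D)" if "D \<in> L" for D
      unfolding \<open>\<one>\<^bsub>big L\<^esub> = single FF L 0 (const_rational \<V> 1)\<close> by (rule const[OF that])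
    then show ?case
      by (intro conjI bexI[of _ "\<one>\<^bsub>big L\<^esub>"] cox_one_closed subringE(3)[OF sub] v) blast
  next
    case (incl h)
    then show ?case
    proof
      assume "h \<in> range (cox_const \<V> L \<chi>)"
      then obtain c where c: "h = cox_const \<V> L \<chi> c" by blast
      let ?s = "single FF L 0 (const_rational \<V> c)"
      have s: "?s \<in> graded_sections L (points \<V>)"
        by (rule graded_sections_hom[OF L_subgroup[OF cd] sec_const[OF points_nonempty]])
      have h: "h = (\<lambda>x\<in>points \<V>. cox_germ \<V> L \<chi> ?s x)"
        unfolding c cox_const_def divisorial_const_def if_not_P[OF points_nonempty] homogeneous_single ..
      show ?case
        unfolding h
      proof (intro conjI bexI[of _ ?s] ballI const)
        show "(\<lambda>x\<in>points \<V>. cox_germ \<V> L \<chi> ?s x) \<in> carrier (cox_ring \<V> L \<chi>)" by (rule cox_global[OF s])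
        show "(\<lambda>x\<in>points \<V>. cox_germ \<V> L \<chi> ?s x) x = cox_germ \<V> L \<chi> ?s x" using x by simp
        show "?s \<in> stalk_carrier L x" by (rule stalk_carrierI[OF s points_open x])
      qed
    next
      assume "h \<in> A"
      then show ?case using A gen by blast
    qed
  next
    case (a_inv \<sigma>)
    then obtain s where s: "s \<in> stalk_carrier L x" "\<sigma> x = cox_germ \<V> L \<chi> s x"
      "\<forall>D\<in>L. C.collapse D s \<in> add_span FF (cox_terms G D)" and \<sigma>: "\<sigma> \<in> carrier (cox_ring \<V> L \<chi>)" by blast
    have "C.collapse D (\<ominus>\<^bsub>big L\<^esub> s) \<in> add_span FF (cox_terms G D)" if D: "D \<in> L" for D
    proof -
      \<comment> \<open>An additive span has no negatives of its own; here they come from the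
        constant \<open>- 1\<close>, a term of degree \<open>0\<close>.\<close>
      have m1: "const_rational \<V> (- 1) \<in> add_span FF (cox_terms G 0)"
        using F.add_span_incl[OF T const_in_cox_terms[of 0 "- 1"]] C.L0_zero C.\<chi>_zero const_carrier by simp
      have "const_rational \<V> (- 1) \<otimes>\<^bsub>FF\<^esub> C.collapse D s \<in> add_span FF (cox_terms G (0 + D))"
        by (rule F.add_span_mult[OF T T T cox_terms_mult m1 s(3)[rule_format, OF D]])
      then show ?thesis
        using C.collapse_minus[OF AR[OF s(1)] D] minus_eq_const_mult C.collapse_closed[OF AR[OF s(1)] D] by simp
    qed
    moreover have "(\<ominus>\<^bsub>cox_ring \<V> L \<chi>\<^esub> \<sigma>) x = cox_germ \<V> L \<chi> (\<ominus>\<^bsub>big L\<^esub> s) x"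
      using cox_a_inv[OF \<sigma>] germ_ops(4)[OF x s(1) s(1)] s(2) x by simp
    moreover have "\<ominus>\<^bsub>cox_ring \<V> L \<chi>\<^esub> \<sigma> \<in> carrier (cox_ring \<V> L \<chi>)"
      using cox_a_inv[OF \<sigma>] cox_minus_closed[OF \<sigma>] by simp
    ultimately show ?case using subringE(5)[OF sub s(1)] by blast
  next
    case (eng_add \<sigma> \<tau>)
    then obtain s t where s: "s \<in> stalk_carrier L x" "\<sigma> x = cox_germ \<V> L \<chi> s x"
      "\<forall>D\<in>L. C.collapse D s \<in> add_span FF (cox_terms G D)" and \<sigma>: "\<sigma> \<in> carrier (cox_ring \<V> L \<chi>)"
      and t: "t \<in> stalk_carrier L x" "\<tau> x = cox_germ \<V> L \<chi> t x"
      "\<forall>D\<in>L. C.collapse D t \<in> add_span FF (cox_terms G D)" and \<tau>: "\<tau> \<in> carrier (cox_ring \<V> L \<chi>)" by blast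
    have "C.collapse D (s \<oplus>\<^bsub>big L\<^esub> t) \<in> add_span FF (cox_terms G D)" if D: "D \<in> L" for D
      using C.collapse_add[OF AR[OF s(1)] AR[OF t(1)] D] F.add_span_add[OF T] s(3) t(3) D by simp
    moreover have "(\<sigma> \<oplus>\<^bsub>cox_ring \<V> L \<chi>\<^esub> \<tau>) x = cox_germ \<V> L \<chi> (s \<oplus>\<^bsub>big L\<^esub> t) x"
      using germ_ops(2)[OF x s(1) t(1)] s(2) t(2) x by (simp add: cox_ops(1))
    ultimately show ?case using subringE(7)[OF sub s(1) t(1)] cox_add_closed[OF \<sigma> \<tau>] by blast
  next
    case (eng_mult \<sigma> \<tau>)
    then obtain s t where s: "s \<in> stalk_carrier L x" "\<sigma> x = cox_germ \<V> L \<chi> s x"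
      "\<forall>D\<in>L. C.collapse D s \<in> add_span FF (cox_terms G D)" and \<sigma>: "\<sigma> \<in> carrier (cox_ring \<V> L \<chi>)"
      and t: "t \<in> stalk_carrier L x" "\<tau> x = cox_germ \<V> L \<chi> t x"
      "\<forall>D\<in>L. C.collapse D t \<in> add_span FF (cox_terms G D)" and \<tau>: "\<tau> \<in> carrier (cox_ring \<V> L \<chi>)" by blast
    have "C.collapse D (s \<otimes>\<^bsub>big L\<^esub> t) \<in> add_span FF (cox_terms G D)" if D: "D \<in> L" for D
    proof (rule C.collapse_mult_in[where S = "\<lambda>D. add_span FF (cox_terms G D)"])
      show "add_span FF (cox_terms G D) \<subseteq> carrier FF" for D using F.add_span_carrier[OF T] by blast
      show "a \<otimes>\<^bsub>FF\<^esub> b \<in> add_span FF (cox_terms G (D + E))"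
        if "a \<in> add_span FF (cox_terms G D)" "b \<in> add_span FF (cox_terms G E)" for D E a b
        by (rule F.add_span_mult[OF T T T cox_terms_mult that])
      show "a \<otimes>\<^bsub>FF\<^esub> \<chi> E \<in> add_span FF (cox_terms G D)"
        if "E \<in> principal_part \<V> L" "a \<in> add_span FF (cox_terms G (D + E))" for D E a
        by (rule F.add_span_mult_right[OF T C.\<chi>_closed[OF that(1)] _ T that(2)])
          (rule F.add_span_incl[OF T cox_terms_shift[OF _ that(1)]])
    qed (use AR s t D F.add_span_add[OF T] in \<open>auto intro: add_span.zero\<close>)
    moreover have "(\<sigma> \<otimes>\<^bsub>cox_ring \<V> L \<chi>\<^esub> \<tau>) x = cox_germ \<V> L \<chi> (s \<otimes>\<^bsub>big L\<^esub> t) x"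
      using germ_ops(3)[OF x s(1) t(1)] s(2) t(2) x by (simp add: cox_ops(2))
    ultimately show ?case using subringE(6)[OF sub s(1) t(1)] cox_mult_closed[OF \<sigma> \<tau>] by blast
  }
qed

end

theorem cox_generators:
  assumes fg: "fin_gen_algebra (cox_ring \<V> L \<chi>) (cox_const \<V> L \<chi>)"
  shows "\<exists>G. finite G \<and> (\<forall>(D, f)\<in>G. D \<in> L \<and> f \<in> nonzero \<and> f \<in> sec D (points \<V>)) \<and>
    (\<forall>D\<in>L. sec D (points \<V>) \<subseteq> add_span FF (cox_terms G D))"
proof -
  obtain A where A: "finite A" "A \<subseteq> carrier (cox_ring \<V> L \<chi>)"
    "generate_ring (cox_ring \<V> L \<chi>) (range (cox_const \<V> L \<chi>) \<union> A) = carrier (cox_ring \<V> L \<chi>)"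
    using fg unfolding fin_gen_algebra_def by blast
  obtain x where x: "x \<in> points \<V>" using points_nonempty by blast
  note sub = stalk_subring[OF L_subgroup[OF cd] x]
  have AR: "\<And>s. s \<in> stalk_carrier L x \<Longrightarrow> s \<in> carrier (big L)" using subringE(1)[OF sub] by blast
  have "\<forall>a\<in>A. \<exists>s. s \<in> stalk_carrier L x \<and> a x = cox_germ \<V> L \<chi> s x"
  proof
    fix a assume "a \<in> A"
    then have "a \<in> carrier (cox_ring \<V> L \<chi>)" using A(2) by blast
    from cox_local[OF this x] obtain W s where "openin (top_of \<V>) W" "x \<in> W" "s \<in> graded_sections L W"
      "\<forall>y\<in>W. a y = cox_germ \<V> L \<chi> s y" .
    then show "\<exists>s. s \<in> stalk_carrier L x \<and> a x = cox_germ \<V> L \<chi> s x" using stalk_carrierI by blast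
  qed
  then obtain s where s: "\<And>a. a \<in> A \<Longrightarrow> s a \<in> stalk_carrier L x" "\<And>a. a \<in> A \<Longrightarrow> a x = cox_germ \<V> L \<chi> (s a) x"
    by metis
  \<comment> \<open>Only degrees in the support of a lift \<open>s a\<close> are taken, which keeps
    \<open>G\<close> finite; a nonzero collapsed value in another degree is a shift of one of these
    by some \<open>\<chi> E\<close>.\<close>
  define G where "G = {(D, C.collapse D (s a)) | D a. a \<in> A \<and> D \<in> {D \<in> L. s a D \<noteq> \<zero>\<^bsub>FF\<^esub>} \<and> C.collapse D (s a) \<noteq> \<zero>\<^bsub>FF\<^esub>}"
  have "G \<subseteq> (\<Union>a\<in>A. (\<lambda>D. (D, C.collapse D (s a))) ` {D \<in> L. s a D \<noteq> \<zero>\<^bsub>FF\<^esub>})" unfolding G_def by blast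
  moreover have "finite (\<Union>a\<in>A. (\<lambda>D. (D, C.collapse D (s a))) ` {D \<in> L. s a D \<noteq> \<zero>\<^bsub>FF\<^esub>})"
    using A(1) C.B_fin[OF AR[OF s(1)]] by blast
  ultimately have finG: "finite G" by (rule finite_subset)
  have Gprop: "D \<in> L \<and> f \<in> nonzero \<and> f \<in> sec D (points \<V>)" if Df: "(D, f) \<in> G" for D f
  proof -
    obtain a where a: "a \<in> A" "D \<in> L" "f = C.collapse D (s a)" "f \<noteq> \<zero>\<^bsub>FF\<^esub>" using Df unfolding G_def by blast
    have ac: "a \<in> carrier (cox_ring \<V> L \<chi>)" using A(2) a(1) by blast
    have "f \<in> sec D (points \<V>)"
      unfolding a(3) by (rule collapse_global[OF ac x s(1)[OF a(1)] s(2)[OF a(1)] a(2)])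
    then show ?thesis using a(2,4) sec_carrier by (auto simp: nonzero_def subset_iff)
  qed
  have GF: "snd ` G \<subseteq> carrier FF" using Gprop nonzeroD(1) by force
  note T = cox_terms_carrier[OF GF]
  have gen: "\<forall>a\<in>A. \<exists>s\<in>stalk_carrier L x. a x = cox_germ \<V> L \<chi> s x \<and>
      (\<forall>D\<in>L. C.collapse D s \<in> add_span FF (cox_terms G D))"
  proof (rule ballI)
    fix a assume a: "a \<in> A"
    have "C.collapse D (s a) \<in> add_span FF (cox_terms G D)" if D: "D \<in> L" for D
    proof (cases "C.collapse D (s a) = \<zero>\<^bsub>FF\<^esub>")
      case True
      then show ?thesis using add_span.zero by metis
    next
      case False
      then have "{E \<in> principal_part \<V> L. s a (D + E) \<noteq> \<zero>\<^bsub>FF\<^esub>} \<noteq> {}"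
        unfolding C.collapse_def by (intro notI) simp
      then obtain E where E: "E \<in> principal_part \<V> L" "s a (D + E) \<noteq> \<zero>\<^bsub>FF\<^esub>" by blast
      note sh = C.collapse_shift[OF AR[OF s(1)[OF a]] D E(1)]
      note DE = C.shift_in[OF D E(1)]
      let ?f = "C.collapse (D + E) (s a)"
      have fR: "?f \<in> carrier FF" by (rule C.collapse_closed[OF AR[OF s(1)[OF a]] DE])
      have "?f \<noteq> \<zero>\<^bsub>FF\<^esub>" using False sh C.\<chi>_closed[OF E(1)] by auto
      then have inG: "(D + E, ?f) \<in> G" unfolding G_def using a DE E(2) by blast
      have "const_rational \<V> 1 \<otimes>\<^bsub>FF\<^esub> (\<chi> E \<otimes>\<^bsub>FF\<^esub> F.mprod (image_mset snd {#(D + E, ?f)#})) \<in> cox_terms G D"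
        by (rule cox_termsI[OF _ E(1)]) (use inG in auto)
      then have "\<chi> E \<otimes>\<^bsub>FF\<^esub> ?f \<in> cox_terms G D"
        using fR C.\<chi>_closed[OF E(1)] by (simp add: F.mprod_single one_FF[symmetric])
      then show ?thesis
        unfolding sh using F.m_comm[OF fR C.\<chi>_closed[OF E(1)]] F.add_span_incl[OF T] by simp
    qed
    then show "\<exists>s\<in>stalk_carrier L x. a x = cox_germ \<V> L \<chi> s x \<and>
      (\<forall>D\<in>L. C.collapse D s \<in> add_span FF (cox_terms G D))"
      by (intro bexI[of _ "s a"] conjI ballI s[OF a])
  qed
  have "sec D (points \<V>) \<subseteq> add_span FF (cox_terms G D)" if D: "D \<in> L" for D
  proof
    fix \<phi> assume \<phi>: "\<phi> \<in> sec D (points \<V>)"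
    \<comment> \<open>Placed in degree \<open>D\<close>, \<open>\<phi>\<close> defines an element of
      the Cox ring. Its lift and a generated lift have the same germ at \<open>x\<close>, so
      \<open>\<phi>\<close>, which is its own collapse in degree \<open>D\<close>, lies in the span
      of \<open>cox_terms\<close>.\<close>
    let ?h = "single FF L D \<phi>"
    have \<phi>R: "\<phi> \<in> carrier FF" using \<phi> sec_carrier by blast
    have h: "?h \<in> graded_sections L (points \<V>)" by (rule graded_sections_hom[OF L_subgroup[OF cd] \<phi>])
    have "(\<lambda>x\<in>points \<V>. cox_germ \<V> L \<chi> ?h x) \<in>
      generate_ring (cox_ring \<V> L \<chi>) (range (cox_const \<V> L \<chi>) \<union> A)"
      unfolding A(3) by (rule cox_global[OF h])
    from collapse_generated[where A = A and G = G and x = x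
        and \<sigma> = "\<lambda>x\<in>points \<V>. cox_germ \<V> L \<chi> ?h x", OF GF x A(2) _ this] gen obtain t where t: "t \<in> stalk_carrier L x"
      "cox_germ \<V> L \<chi> ?h x = cox_germ \<V> L \<chi> t x" "C.collapse D t \<in> add_span FF (cox_terms G D)"
      using x D by auto
    have "C.collapse D ?h = C.collapse D t"
      by (rule germ_eq_collapse[OF cd x stalk_carrierI[OF h points_open x] t(1,2) D])
    moreover have "C.collapse D ?h = \<phi>"
      using C.collapse_hom[OF \<phi>R D D] C.L0_zero C.\<chi>_zero \<phi>R by simp
    ultimately show "\<phi> \<in> add_span FF (cox_terms G D)" using t(3) by simp
  qed
  then show ?thesis using finG Gprop by (intro exI[of _ G]) blast
qed

end

end

section \<open>Finite generation\<close>

text \<open>A triple \<open>(l, d, v)\<close> stands for a rational function \<open>v\<close>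
  regarded as homogeneous of degree \<open>l + d\<close>, with \<open>l\<close> from
  \<open>L\<close> and \<open>d\<close> from \<open>K\<close>. The summands are kept apart since
  \<open>K\<close> and \<open>L\<close> may intersect; \<open>lam\<close>, \<open>del\<close> and
  \<open>val\<close> extend the entries to monomials.\<close>

abbreviation lam :: "('d::comm_monoid_add \<times> 'e \<times> 'v) multiset \<Rightarrow> 'd"
  where "lam \<mu> \<equiv> sum_mset (image_mset fst \<mu>)"

abbreviation del :: "('d \<times> 'e::comm_monoid_add \<times> 'v) multiset \<Rightarrow> 'e"
  where "del \<mu> \<equiv> sum_mset (image_mset (\<lambda>t. fst (snd t)) \<mu>)"

context normal_variety
begin

abbreviation "val \<mu> \<equiv> F.mprod (image_mset (\<lambda>t. snd (snd t)) \<mu>)"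

lemma val_union:
  assumes "\<And>l d v. (l, d, v) \<in> T \<Longrightarrow> v \<in> nonzero" "set_mset \<mu> \<subseteq> T" "set_mset \<nu> \<subseteq> T"
  shows "val (\<mu> + \<nu>) = val \<mu> \<otimes>\<^bsub>FF\<^esub> val \<nu>"
proof -
  have "(\<lambda>t. snd (snd t)) ` T \<subseteq> carrier FF" using assms(1) nonzeroD(1) by force
  then show ?thesis unfolding image_mset_union using assms(2,3) by (intro F.mprod_union) auto
qed

lemma val_nonzero:
  assumes "\<And>l d v. (l, d, v) \<in> T \<Longrightarrow> v \<in> nonzero" "set_mset \<mu> \<subseteq> T"
  shows "val \<mu> \<in> nonzero"
proof -
  have "(\<lambda>t. snd (snd t)) ` T \<subseteq> nonzero" using assms(1) by force
  then show ?thesis using assms(2) by (intro mprod_nonzero) auto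
qed

lemma val_single: "v \<in> nonzero \<Longrightarrow> val {#(l, d, v)#} = v"
  by (simp add: F.mprod_single nonzeroD(1))

lemma val_sec:
  assumes U: "U \<noteq> {}" and T: "\<And>l d v. (l, d, v) \<in> T \<Longrightarrow> v \<in> nonzero \<and> v \<in> sec (l + d) U"
    and "set_mset \<mu> \<subseteq> T"
  shows "val \<mu> \<in> sec (lam \<mu> + del \<mu>) U"
  using assms(3)
proof (induction \<mu>)
  case empty
  show ?case using sec_one[OF U] by (simp add: F.mprod_empty)
next
  case (add t \<mu>)
  obtain l d v where t: "t = (l, d, v)" by (cases t)
  have vT: "v \<in> nonzero" "v \<in> sec (l + d) U" using T[of l d v] add.prems t by auto
  have "val ({#t#} + \<mu>) = v \<otimes>\<^bsub>FF\<^esub> val \<mu>"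
    using val_union[of T "{#t#}" \<mu>] T add.prems val_single[OF vT(1)] t by auto
  moreover have "v \<otimes>\<^bsub>FF\<^esub> val \<mu> \<in> sec ((l + d) + (lam \<mu> + del \<mu>)) U"
    by (rule sec_mult[OF vT(2) add.IH]) (use add.prems in simp)
  moreover have "lam (add_mset t \<mu>) + del (add_mset t \<mu>) = (l + d) + (lam \<mu> + del \<mu>)"
    by (simp add: t algebra_simps)
  ultimately show ?case by (simp only: add_mset_add_single[of t \<mu>] add.commute[of \<mu>])
qed

context
  fixes L \<chi>
  assumes cd: "cox_data \<V> L \<chi>"
begin

interpretation C: collapsed_group_algebra FF L "principal_part \<V> L" \<chi>
  by (rule cox_collapsed(1)[OF cd])

text \<open>\<open>val \<mu>\<close> has degree \<open>lam \<mu> + del \<mu>\<close>. For principal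
  \<open>lam \<mu>\<close> the factor \<open>\<chi> (lam \<mu>)\<close> has degree
  \<open>- lam \<mu>\<close>, and the product is left in degree \<open>D\<close>.\<close>

definition triple_terms ::
    "('a divisor \<times> 'a divisor \<times> ('a, 'b) rational) set \<Rightarrow> 'a divisor \<Rightarrow> ('a, 'b) rational set"
  where "triple_terms T D = {const_rational \<V> c \<otimes>\<^bsub>FF\<^esub> (\<chi> (lam \<mu>) \<otimes>\<^bsub>FF\<^esub> val \<mu>) | c \<mu>.
    set_mset \<mu> \<subseteq> T \<and> lam \<mu> \<in> principal_part \<V> L \<and> del \<mu> = D}"

lemma chi_sec: "E \<in> principal_part \<V> L \<Longrightarrow> W \<noteq> {} \<Longrightarrow> \<chi> E \<in> sec (- E) W"
  using cd by (intro sec_principal cox_collapsed(2)[OF cd]) (auto simp: cox_data_def)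

lemma triple_terms_carrier:
  assumes "\<And>l d v. (l, d, v) \<in> T \<Longrightarrow> v \<in> nonzero"
  shows "triple_terms T D \<subseteq> carrier FF"
proof -
  have "val \<mu> \<in> carrier FF" if "set_mset \<mu> \<subseteq> T" for \<mu>
    using nonzeroD(1)[OF val_nonzero[OF assms that]] .
  then show ?thesis using C.\<chi>_closed const_carrier by (auto simp: triple_terms_def)
qed

text \<open>The monomials with principal \<open>lam\<close> are closed under differences, so
  finitely many of them generate the rest. As \<open>\<chi>\<close> is multiplicative on principal
  divisors, \<open>e\<close> turns sums of exponents into products in the algebra.\<close>

lemma monomial_generation:
  assumes K: "subgroup K (WDiv \<V>)" and U: "U \<noteq> {}" and finT: "finite T"
    and T: "\<And>l d v. (l, d, v) \<in> T \<Longrightarrow> d \<in> K \<and> v \<in> nonzero \<and> v \<in> sec (l + d) U"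
    and span: "\<And>D \<phi>. D \<in> K \<Longrightarrow> \<phi> \<in> sec D U \<Longrightarrow> \<phi> \<noteq> \<zero>\<^bsub>FF\<^esub> \<Longrightarrow> \<phi> \<in> add_span FF (triple_terms T D)"
  shows "fin_gen_algebra (divisorial_algebra \<V> K U) (divisorial_const \<V> K U)"
proof -
  interpret KB: group_algebra_data FF K by (rule group_algebra_data_K[OF K])
  let ?R = "divisorial_algebra \<V> K U" and ?\<iota> = "divisorial_const \<V> K U"
  note sub = graded_sections_subring[OF K U] and R_eq = divisorial_algebra_eq[OF U, of K]
  have ringR: "ring ?R" unfolding R_eq by (rule KB.B.subring_is_ring[OF sub])
  interpret R: ring ?R by (rule ringR)
  have carR: "carrier ?R = graded_sections K U" by (rule divisorial_carrier)
  have opR: "s \<otimes>\<^bsub>?R\<^esub> t = s \<otimes>\<^bsub>big K\<^esub> t" "s \<oplus>\<^bsub>?R\<^esub> t = s \<oplus>\<^bsub>big K\<^esub> t" "\<one>\<^bsub>?R\<^esub> = \<one>\<^bsub>big K\<^esub>" "\<zero>\<^bsub>?R\<^esub> = \<zero>\<^bsub>big K\<^esub>" for s t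
    by (simp_all add: R_eq)
  define M where "M = {\<mu>. set_mset \<mu> \<subseteq> T \<and> lam \<mu> \<in> principal_part \<V> L}"
  define tm where "tm \<mu> = \<chi> (lam \<mu>) \<otimes>\<^bsub>FF\<^esub> val \<mu>" for \<mu> :: "('a divisor \<times> 'a divisor \<times> ('a, 'b) rational) multiset"
  define e where "e \<mu> = single FF K (del \<mu>) (tm \<mu>)" for \<mu> :: "('a divisor \<times> 'a divisor \<times> ('a, 'b) rational) multiset"
  have Tnz: "v \<in> nonzero" if "(l, d, v) \<in> T" for l d v using T[OF that] by blast
  have MT: "set_mset \<mu> \<subseteq> T" "lam \<mu> \<in> principal_part \<V> L" if "\<mu> \<in> M" for \<mu> using that by (auto simp: M_def)
  have valR: "val \<mu> \<in> carrier FF" if "\<mu> \<in> M" for \<mu> using nonzeroD(1)[OF val_nonzero[OF Tnz MT(1)[OF that]]] .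
  have termR: "tm \<mu> \<in> carrier FF" if "\<mu> \<in> M" for \<mu>
    unfolding tm_def by (rule F.m_closed[OF C.\<chi>_closed[OF MT(2)[OF that]] valR[OF that]])
  have delK: "del \<mu> \<in> K" if "set_mset \<mu> \<subseteq> T" for \<mu>
    using that
  proof (induction \<mu>)
    case (add t \<mu>)
    obtain l d v where "t = (l, d, v)" by (cases t)
    moreover from this have "d \<in> K" using T[of l d v] add.prems by auto
    then have "d + del \<mu> \<in> K" by (rule KB.K_add) (rule add.IH, use add.prems in simp)
    ultimately show ?case by simp
  qed (simp add: KB.K_zero)
  have term_sec: "tm \<mu> \<in> sec (del \<mu>) U" if \<mu>: "\<mu> \<in> M" for \<mu>
  proof -
    have "val \<mu> \<in> sec (lam \<mu> + del \<mu>) U" by (rule val_sec[OF U _ MT(1)[OF \<mu>]]) (use T in blast)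
    from sec_mult[OF chi_sec[OF MT(2)[OF \<mu>] U] this] show ?thesis by (simp add: tm_def algebra_simps)
  qed
  have e_mem: "e \<mu> \<in> carrier ?R" if "\<mu> \<in> M" for \<mu>
    unfolding carR e_def by (rule graded_sections_hom[OF K term_sec[OF that]])
  have e_mult: "e (\<nu> + \<mu>) = e \<nu> \<otimes>\<^bsub>?R\<^esub> e \<mu>" if \<nu>: "\<nu> \<in> M" and \<mu>: "\<mu> \<in> M" for \<mu> \<nu>
  proof -
    have vu: "val (\<nu> + \<mu>) = val \<nu> \<otimes>\<^bsub>FF\<^esub> val \<mu>"
      using Tnz MT(1) \<mu> \<nu> by (intro val_union[of T]) auto
    have "tm (\<nu> + \<mu>) = (\<chi> (lam \<nu>) \<otimes>\<^bsub>FF\<^esub> \<chi> (lam \<mu>)) \<otimes>\<^bsub>FF\<^esub> (val \<nu> \<otimes>\<^bsub>FF\<^esub> val \<mu>)"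
      unfolding tm_def vu
      using C.\<chi>_add[OF MT(2)[OF \<nu>] MT(2)[OF \<mu>]] by simp
    also have "\<dots> = tm \<nu> \<otimes>\<^bsub>FF\<^esub> tm \<mu>"
      unfolding tm_def using C.\<chi>_closed MT(2) valR \<mu> \<nu> by (simp only: F.m_ac F.m_closed)
    finally show ?thesis
      unfolding e_def opR using KB.hom_mult[OF termR[OF \<nu>] termR[OF \<mu>] delK delK] MT(1) \<mu> \<nu> by simp
  qed
  have diff: "\<mu> - \<nu> \<in> M" if \<mu>: "\<mu> \<in> M" and \<nu>: "\<nu> \<in> M" and le: "\<nu> \<subseteq># \<mu>" for \<mu> \<nu>
  proof -
    have eq: "\<mu> = \<nu> + (\<mu> - \<nu>)" using le by simp
    have "lam \<mu> = lam \<nu> + lam (\<mu> - \<nu>)" by (subst eq) simp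
    then have "lam (\<mu> - \<nu>) = lam \<mu> - lam \<nu>" by simp
    then have "lam (\<mu> - \<nu>) \<in> principal_part \<V> L" using C.L0_diff[OF MT(2)[OF \<mu>] MT(2)[OF \<nu>]] by simp
    moreover have "set_mset (\<mu> - \<nu>) \<subseteq> T" using MT(1)[OF \<mu>] by (meson in_diffD subset_iff)
    ultimately show ?thesis by (simp add: M_def)
  qed
  have MsubT: "M \<subseteq> {\<mu>. set_mset \<mu> \<subseteq> T}" by (auto simp: M_def)
  obtain G where G: "finite G" "G \<subseteq> M"
    and ind: "\<And>P \<mu>. P {#} \<Longrightarrow> (\<And>\<nu> \<mu>. \<nu> \<in> G \<Longrightarrow> \<mu> \<in> M \<Longrightarrow> P \<mu> \<Longrightarrow> P (\<nu> + \<mu>)) \<Longrightarrow> \<mu> \<in> M \<Longrightarrow> P \<mu>"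
    using submonoid_induct[OF finT MsubT diff] by blast
  let ?gen = "generate_ring ?R (range ?\<iota> \<union> e ` G)"
  have \<iota>: "?\<iota> c = single FF K 0 (const_rational \<V> c)" for c
    using U by (simp add: divisorial_const_def homogeneous_single)
  have \<iota>R: "?\<iota> c \<in> carrier ?R" for c
    unfolding \<iota> carR by (rule graded_sections_hom[OF K sec_const[OF U]])
  have gR: "range ?\<iota> \<union> e ` G \<subseteq> carrier ?R" using \<iota>R e_mem G(2) by blast
  have e_gen: "e \<mu> \<in> ?gen" if \<mu>: "\<mu> \<in> M" for \<mu>
  proof (rule ind[of "\<lambda>\<mu>. e \<mu> \<in> ?gen", OF _ _ \<mu>])
    have "e {#} = \<one>\<^bsub>?R\<^esub>" by (simp add: e_def tm_def F.mprod_empty C.\<chi>_zero opR KB.one_B)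
    then show "e {#} \<in> ?gen" using generate_ring.one by metis
    fix \<nu> \<mu> assume *: "\<nu> \<in> G" "\<mu> \<in> M" "e \<mu> \<in> ?gen"
    have "e \<nu> \<in> ?gen" using *(1) by (intro generate_ring.incl) blast
    then have "e \<nu> \<otimes>\<^bsub>?R\<^esub> e \<mu> \<in> ?gen" using *(3) by (rule generate_ring.eng_mult)
    then show "e (\<nu> + \<mu>) \<in> ?gen" using e_mult[of \<nu> \<mu>] *(1,2) G(2) by auto
  qed
  have TR: "triple_terms T D \<subseteq> carrier FF" for D
      by (rule triple_terms_carrier[OF Tnz])
  have span_gen: "single FF K D z \<in> ?gen" if D: "D \<in> K" and z: "z \<in> add_span FF (triple_terms T D)" for D z
    using z
  proof induction
    case zero
    have "single FF K D \<zero>\<^bsub>FF\<^esub> = \<zero>\<^bsub>?R\<^esub>" unfolding opR by (rule KB.hom_zero)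
    then show ?case using R.zero_in_generate by metis
  next
    case (step t z)
    obtain c \<mu> where t: "t = const_rational \<V> c \<otimes>\<^bsub>FF\<^esub> tm \<mu>" "\<mu> \<in> M" "del \<mu> = D"
      using step(1) unfolding triple_terms_def tm_def M_def by blast
    have "single FF K D t = ?\<iota> c \<otimes>\<^bsub>?R\<^esub> e \<mu>"
      unfolding \<iota> e_def opR t(1,3) using KB.hom_mult[OF const_carrier termR[OF t(2)] KB.K_zero D] by simp
    moreover have "?\<iota> c \<in> ?gen" by (intro generate_ring.incl) blast
    ultimately have tg: "single FF K D t \<in> ?gen" using generate_ring.eng_mult e_gen[OF t(2)] by metis
    have "t \<in> carrier FF" "z \<in> carrier FF" using step TR F.add_span_carrier[OF TR] by auto
    then have "single FF K D (t \<oplus>\<^bsub>FF\<^esub> z) = single FF K D t \<oplus>\<^bsub>?R\<^esub> single FF K D z"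
      unfolding opR by (rule KB.hom_add)
    then show ?case using generate_ring.eng_add[OF tg step.IH] by simp
  qed
  have "s \<in> ?gen" if s: "s \<in> carrier ?R" for s
  proof -
    have sB: "s \<in> carrier (big K)" and sD: "\<And>D. D \<in> K \<Longrightarrow> s D \<in> sec D U"
      using s unfolding carR graded_sections_def by auto
    show ?thesis
      using sB
    proof (induction rule: KB.B_induct)
      case zero
      show ?case using R.zero_in_generate by (simp add: opR)
    next
      case (hmg D)
      then show ?case using span_gen[OF hmg(1) span[OF hmg(1) sD[OF hmg(1)] hmg(2)]] by simp
    next
      case (add u v)
      then show ?case using generate_ring.eng_add[of u ?R _ v] by (simp add: opR)
    qed
  qed
  then have "?gen = carrier ?R" using R.generate_ring_incl[OF gR] by blast
  then show ?thesis
    unfolding fin_gen_algebra_def using G(1) e_mem G(2) by (intro exI[of _ "e ` G"]) blast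
qed

text \<open>
  A section over \<open>U\<close> becomes a global section of a divisor in \<open>L\<close> after division by a monomial:
  the triples \<open>(- l d, d, \<psi> d)\<close> move the degree \<open>d\<close> into \<open>L\<close>, and the triples attached to the
  prime divisors outside \<open>U\<close> remove the poles along them.
\<close>

theorem divisorial_algebra_fin_gen:
  assumes fg: "fin_gen_algebra (cox_ring \<V> L \<chi>) (cox_const \<V> L \<chi>)"
    and K: "subgroup K (WDiv \<V>)" and fgK: "fin_gen_subgroup (WDiv \<V>) K"
    and U: "openin (top_of \<V>) U" "U \<noteq> {}"
  shows "fin_gen_algebra (divisorial_algebra \<V> K U) (divisorial_const \<V> K U)"
proof -
  obtain G where finG: "finite G"
    and G: "\<And>D f. (D, f) \<in> G \<Longrightarrow> D \<in> L \<and> f \<in> nonzero \<and> f \<in> sec D (points \<V>)"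
    and Gspan: "\<And>D. D \<in> L \<Longrightarrow> sec D (points \<V>) \<subseteq> add_span FF (cox_terms L \<chi> G D)"
    using cox_generators[OF cd fg] by blast
  obtain B where B: "finite B" "B \<subseteq> carrier (WDiv \<V>)" "K = generate (WDiv \<V>) B"
    using fgK unfolding fin_gen_subgroup_def by blast
  have BK: "B \<subseteq> K" unfolding B(3) by (auto intro: generate.incl)
  note KW = WDiv_subgroup[OF K]
  have Lcl: "divisor_class \<V> ` L = carrier (Cl \<V>)" using cd by (simp add: cox_data_def)
  have "\<forall>E\<in>carrier (WDiv \<V>). \<exists>l\<psi>. fst l\<psi> \<in> L \<and> snd l\<psi> \<in> nonzero \<and> div_of \<V> (snd l\<psi>) = Poly_Mapping.lookup (fst l\<psi> - E)"
  proof
    fix E assume "E \<in> carrier (WDiv \<V>)"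
    from class_representative[OF Lcl this] obtain l \<psi> where "l \<in> L" "\<psi> \<in> nonzero" "div_of \<V> \<psi> = Poly_Mapping.lookup (l - E)" .
    then show "\<exists>l\<psi>. fst l\<psi> \<in> L \<and> snd l\<psi> \<in> nonzero \<and> div_of \<V> (snd l\<psi>) = Poly_Mapping.lookup (fst l\<psi> - E)"
      by (intro exI[of _ "(l, \<psi>)"]) simp
  qed
  from bchoice[OF this] obtain r where r: "\<forall>E\<in>carrier (WDiv \<V>). fst (r E) \<in> L \<and> snd (r E) \<in> nonzero \<and>
      div_of \<V> (snd (r E)) = Poly_Mapping.lookup (fst (r E) - E)" ..
  \<comment> \<open>\<open>l E\<close> is a divisor in \<open>L\<close> linearly equivalent to
    \<open>E\<close>, and \<open>\<psi> E\<close> realises the equivalence, with divisor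
    \<open>l E - E\<close>.\<close>
  define l where "l E = fst (r E)" for E
  define \<psi> where "\<psi> E = snd (r E)" for E
  have l: "l E \<in> L" and \<psi>: "\<psi> E \<in> nonzero" and div\<psi>: "div_of \<V> (\<psi> E) = Poly_Mapping.lookup (l E - E)"
    if "E \<in> carrier (WDiv \<V>)" for E
    using bspec[OF r that] by (auto simp: l_def \<psi>_def)
  let ?miss = "{P \<in> prime_divisors \<V>. P \<inter> U = {}}"
  let ?p = "\<lambda>P. Poly_Mapping.single P (1::int)"
  have pW: "?p P \<in> carrier (WDiv \<V>)" if "P \<in> prime_divisors \<V>" for P
    using that by (simp add: WDiv_carrier)
  \<comment> \<open>Cox generators have \<open>K\<close>-degree \<open>0\<close>. A generator
    \<open>d\<close> of the group \<open>K\<close> enters with both signs, \<open>\<psi> d\<close>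
    having degree \<open>- l d + d\<close>. A prime divisor missing \<open>U\<close> enters only
    once, since only nonnegative multiples of it occur.\<close>
  define T where "T = (\<lambda>(D, f). (D, 0, f)) ` G \<union> (\<lambda>d. (- l d, d, \<psi> d)) ` B \<union>
    (\<lambda>d. (l d, - d, inv\<^bsub>FF\<^esub> \<psi> d)) ` B \<union> (\<lambda>P. (- l (?p P), 0, \<psi> (?p P))) ` ?miss"
  have finT: "finite T"
    unfolding T_def using finG B(1) finite_prime_divisors_missing[OF U] by blast
  have Tprop: "m \<in> L \<and> d \<in> K \<and> v \<in> nonzero \<and> v \<in> sec (m + d) U" if mT: "(m, d, v) \<in> T" for m d v
  proof -
    consider (cox) "d = 0" "(m, v) \<in> G" | (pos) "d \<in> B" "m = - l d" "v = \<psi> d"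
      | (neg) b where "b \<in> B" "m = l b" "d = - b" "v = inv\<^bsub>FF\<^esub> \<psi> b"
      | (miss) P where "P \<in> ?miss" "m = - l (?p P)" "d = 0" "v = \<psi> (?p P)"
    proof -
      from mT have "(m, d, v) \<in> (\<lambda>(D, f). (D, 0, f)) ` G \<or> (m, d, v) \<in> (\<lambda>d. (- l d, d, \<psi> d)) ` B \<or>
          (m, d, v) \<in> (\<lambda>d. (l d, - d, inv\<^bsub>FF\<^esub> \<psi> d)) ` B \<or> (m, d, v) \<in> (\<lambda>P. (- l (?p P), 0, \<psi> (?p P))) ` ?miss"
        unfolding T_def by blast
      then show ?thesis
        by (elim disjE imageE) (auto intro: cox pos neg miss)
    qed
    then show ?thesis
    proof cases
      case cox
      have "sec m (points \<V>) \<subseteq> sec m U" by (rule sec_mono[OF openin_subset[OF U(1)] U(2)])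
      then show ?thesis using cox KW(2) G[OF cox(2)] by auto
    next
      case pos
      have d: "d \<in> carrier (WDiv \<V>)" using pos B(2) by blast
      have "\<psi> d \<in> sec (- (l d - d)) U" by (rule sec_principal[OF \<psi>[OF d] div\<psi>[OF d] U(2)])
      then show ?thesis using pos BK \<psi>[OF d] C.K_minus[OF l[OF d]] by auto
    next
      case neg
      have b: "b \<in> carrier (WDiv \<V>)" using neg B(2) by blast
      have "div_of \<V> (inv\<^bsub>FF\<^esub> \<psi> b) = Poly_Mapping.lookup (b - l b)"
        using div_inv[OF \<psi>[OF b]] div\<psi>[OF b] by (auto simp: fun_eq_iff lookup_minus)
      from sec_principal[OF nonzero_inv[OF \<psi>[OF b]] this U(2)]
      have "inv\<^bsub>FF\<^esub> \<psi> b \<in> sec (l b + - b) U" by simp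
      moreover have "- b \<in> K" using KW(3)[OF KW(2), of b] neg(1) BK by auto
      ultimately show ?thesis using neg nonzero_inv[OF \<psi>[OF b]] l[OF b] by auto
    next
      case miss
      have P: "?p P \<in> carrier (WDiv \<V>)" using miss pW by blast
      \<comment> \<open>The divisor of \<open>\<psi> (?p P)\<close> is
        \<open>l (?p P) - ?p P\<close>, and the second summand is invisible on
        \<open>U\<close>.\<close>
      have "\<psi> (?p P) \<in> sec (- l (?p P)) U"
      proof (rule secI[OF \<psi>[OF P] U(2)])
        fix Q assume "Q \<in> prime_divisors \<V>" "Q \<inter> U \<noteq> {}"
        then have "Q \<noteq> P" using miss by blast
        then show "div_of \<V> (\<psi> (?p P)) Q + Poly_Mapping.lookup (- l (?p P)) Q \<ge> 0"
          using div\<psi>[OF P] by (simp add: lookup_minus lookup_single)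
      qed
      then show ?thesis using miss KW(2) \<psi>[OF P] C.K_minus[OF l[OF P]] by auto
    qed
  qed
  have Tnz: "v \<in> nonzero" if "(m, d, v) \<in> T" for m d v using Tprop[OF that] by blast
  have lamL: "lam \<mu> \<in> L" if "set_mset \<mu> \<subseteq> T" for \<mu>
    using that
  proof (induction \<mu>)
    case (add t \<mu>)
    obtain m d v where "t = (m, d, v)" by (cases t)
    then show ?case using add Tprop[of m d v] C.K_add[of m "lam \<mu>"] by auto
  qed (simp add: C.K_zero)
  \<comment> \<open>A monomial of \<open>K\<close>-degree \<open>D\<close> whose divisor is exactly
    \<open>- lam \<mu> - D - N\<close>. For \<open>N = 0\<close> it trades degree \<open>D\<close>
    for a degree in \<open>L\<close>; an effective \<open>N\<close> supported outside
    \<open>U\<close> records poles to be removed. \<open>D\<close> and \<open>N\<close> add up under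
    sums of multisets.\<close>
  define realizes where "realizes \<mu> D N \<longleftrightarrow> set_mset \<mu> \<subseteq> T \<and> del \<mu> = D \<and>
    (\<forall>Q. div_of \<V> (val \<mu>) Q = - Poly_Mapping.lookup (lam \<mu>) Q - Poly_Mapping.lookup D Q - Poly_Mapping.lookup N Q)"
    for \<mu> D N
  have rz: "realizes {#} 0 0"
    unfolding realizes_def using div_one by (simp add: F.mprod_empty)
  have ra: "realizes (\<mu> + \<nu>) (D + E) (N + M)" if "realizes \<mu> D N" "realizes \<nu> E M" for \<mu> \<nu> D E N M
  proof -
    have T': "set_mset \<mu> \<subseteq> T" "set_mset \<nu> \<subseteq> T" using that by (auto simp: realizes_def)
    show ?thesis
      using that div_mult[OF val_nonzero[OF Tnz T'(1)] val_nonzero[OF Tnz T'(2)]] val_union[OF Tnz T']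
      unfolding realizes_def by (auto simp: lookup_add)
  qed
  have rs: "realizes {#(m, d, v)#} d N"
    if "(m, d, v) \<in> T" "div_of \<V> v = Poly_Mapping.lookup (- (m + d + N))" for m d v N
    unfolding realizes_def using that val_single[OF Tnz[OF that(1)], of m d]
    by (auto simp: lookup_add lookup_minus)
  have realK: "\<exists>\<mu>. realizes \<mu> D 0" if "D \<in> K" for D
  proof -
    have "D \<in> generate (WDiv \<V>) B" using that B(3) by simp
    then show ?thesis
    proof induction
      case one
      then show ?case using rz by (auto simp: WDiv_one)
    next
      case (incl b)
      have b: "b \<in> carrier (WDiv \<V>)" using incl B(2) by blast
      have "realizes {#(- l b, b, \<psi> b)#} b 0"
        by (rule rs) (use incl div\<psi>[OF b] in \<open>auto simp: T_def algebra_simps\<close>)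
      then show ?case by blast
    next
      case (inv b)
      have b: "b \<in> carrier (WDiv \<V>)" using inv B(2) by blast
      have "div_of \<V> (inv\<^bsub>FF\<^esub> \<psi> b) = Poly_Mapping.lookup (- (l b + - b + 0))"
        using div_inv[OF \<psi>[OF b]] div\<psi>[OF b] by (auto simp: fun_eq_iff lookup_minus)
      then have "realizes {#(l b, - b, inv\<^bsub>FF\<^esub> \<psi> b)#} (- b) 0"
        by (intro rs) (use inv in \<open>auto simp: T_def\<close>)
      moreover have "inv\<^bsub>WDiv \<V>\<^esub> b = - b" using b by (simp add: WDiv_def)
      ultimately show ?case by auto
    next
      case (eng D E)
      then obtain \<mu> \<nu> where "realizes \<mu> D 0" "realizes \<nu> E 0" by blast
      from ra[OF this] show ?case by (auto simp: WDiv_mult)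
    qed
  qed
  have realP: "\<exists>\<mu>. realizes \<mu> 0 (Poly_Mapping.single P (int n))" if P: "P \<in> ?miss" for P n
  proof (induction n)
    case 0
    then show ?case using rz by auto
  next
    case (Suc n)
    then obtain \<mu> where \<mu>: "realizes \<mu> 0 (Poly_Mapping.single P (int n))" by blast
    have p: "?p P \<in> carrier (WDiv \<V>)" using P pW by blast
    have "realizes {#(- l (?p P), 0, \<psi> (?p P))#} 0 (?p P)"
      by (rule rs) (use P div\<psi>[OF p] in \<open>auto simp: T_def\<close>)
    from ra[OF this \<mu>] have "realizes ({#(- l (?p P), 0, \<psi> (?p P))#} + \<mu>) 0 (Poly_Mapping.single P (int (Suc n)))"
      by (simp add: single_add[symmetric])
    then show ?case by blast
  qed
  have realN: "\<exists>\<mu>. realizes \<mu> 0 (\<Sum>P\<in>Q. Poly_Mapping.single P (int (n P)))" if "finite Q" "Q \<subseteq> ?miss" for Q n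
    using that
  proof (induction Q rule: finite_induct)
    case empty
    then show ?case using rz by auto
  next
    case (insert P Q)
    then obtain \<mu> where \<mu>: "realizes \<mu> 0 (\<Sum>P\<in>Q. Poly_Mapping.single P (int (n P)))" by auto
    obtain \<nu> where \<nu>: "realizes \<nu> 0 (Poly_Mapping.single P (int (n P)))" using realP[of P "n P"] insert by auto
    show ?case using ra[OF \<nu> \<mu>] insert by auto
  qed
  show ?thesis
  proof (rule monomial_generation[OF K U(2) finT])
    show "d \<in> K \<and> v \<in> nonzero \<and> v \<in> sec (m + d) U" if "(m, d, v) \<in> T" for m d v
      using Tprop[OF that] by blast
    fix D \<phi> assume D: "D \<in> K" and \<phi>: "\<phi> \<in> sec D U" "\<phi> \<noteq> \<zero>\<^bsub>FF\<^esub>"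
    have \<phi>nz: "\<phi> \<in> nonzero" using \<phi> sec_carrier by (auto simp: nonzero_def subset_iff)
    \<comment> \<open>The pole order along \<open>P\<close> in excess of what \<open>D\<close>
      allows; \<open>nat\<close> makes it \<open>0\<close> when there is no excess.\<close>
    define n where "n P = nat (- (div_of \<V> \<phi> P + Poly_Mapping.lookup D P))" for P
    define N where "N = (\<Sum>P\<in>?miss. Poly_Mapping.single P (int (n P)))"
    have finm: "finite ?miss" by (rule finite_prime_divisors_missing[OF U])
    have lookN: "Poly_Mapping.lookup N Q = (if Q \<in> ?miss then int (n Q) else 0)" for Q
      unfolding N_def lookup_sum lookup_single when_def using finm by (simp add: sum.delta' eq_commute)
    obtain \<kappa> where \<kappa>: "realizes \<kappa> D 0" using realK[OF D] by blast
    obtain \<epsilon> where \<epsilon>: "realizes \<epsilon> 0 N" using realN[OF finm subset_refl] unfolding N_def by blast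
    have ke: "realizes (\<kappa> + \<epsilon>) D N" using ra[OF \<kappa> \<epsilon>] by simp
    let ?\<mu> = "\<kappa> + \<epsilon>" and ?\<omega> = "val (\<kappa> + \<epsilon>)"
    have \<mu>T: "set_mset ?\<mu> \<subseteq> T" and \<mu>D: "del ?\<mu> = D" using ke unfolding realizes_def by blast+
    have div\<omega>: "div_of \<V> ?\<omega> Q = - Poly_Mapping.lookup (lam ?\<mu>) Q - Poly_Mapping.lookup D Q - Poly_Mapping.lookup N Q" for Q
      using ke unfolding realizes_def by blast
    have \<omega>: "?\<omega> \<in> nonzero" by (rule val_nonzero[OF Tnz \<mu>T])
    note i\<omega> = nonzero_inv[OF \<omega>]
    \<comment> \<open>The quotient has divisor \<open>lam ?\<mu>\<close> plus the sum of the divisor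
      of \<open>\<phi>\<close>, \<open>D\<close> and \<open>N\<close>. This sum is nonnegative along
      divisors meeting \<open>U\<close> because \<open>\<phi>\<close> is a section there, and along
      the others by the choice of \<open>N\<close>.\<close>
    have "\<phi> \<otimes>\<^bsub>FF\<^esub> inv\<^bsub>FF\<^esub> ?\<omega> \<in> sec (- lam ?\<mu>) (points \<V>)"
    proof (rule secI[OF nonzero_mult[OF \<phi>nz i\<omega>] points_nonempty])
      fix Q assume Q: "Q \<in> prime_divisors \<V>"
      have "div_of \<V> \<phi> Q + Poly_Mapping.lookup D Q + Poly_Mapping.lookup N Q \<ge> 0"
      proof (cases "Q \<inter> U = {}")
        case True
        then show ?thesis using Q by (simp add: lookN n_def)
      next
        case False
        then show ?thesis using Q \<phi> by (auto simp: lookN sec_iff)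
      qed
      then show "div_of \<V> (\<phi> \<otimes>\<^bsub>FF\<^esub> inv\<^bsub>FF\<^esub> ?\<omega>) Q + Poly_Mapping.lookup (- lam ?\<mu>) Q \<ge> 0"
        using div_mult[OF \<phi>nz i\<omega>, of Q] div_inv[OF \<omega>, of Q] div\<omega>[of Q]
        by (simp add: lookup_minus lookup_add)
    qed
    then have z: "\<phi> \<otimes>\<^bsub>FF\<^esub> inv\<^bsub>FF\<^esub> ?\<omega> \<in> add_span FF (cox_terms L \<chi> G (- lam ?\<mu>))"
      using Gspan[OF C.K_minus[OF lamL[OF \<mu>T]]] by blast
    have GF: "snd ` G \<subseteq> carrier FF" using G nonzeroD(1) by force
    have TR: "triple_terms T D \<subseteq> carrier FF"
      by (rule triple_terms_carrier[OF Tnz])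
    \<comment> \<open>Multiplying back: a Cox term of degree \<open>- lam ?\<mu>\<close> contains a
      monomial of \<open>L\<close>-degree \<open>- lam ?\<mu> + E\<close>. Together with
      \<open>?\<mu>\<close> the \<open>L\<close>-degree is the principal divisor \<open>E\<close>,
      and \<open>\<chi> E\<close> is the factor required in \<open>triple_terms\<close>.\<close>
    have "(\<phi> \<otimes>\<^bsub>FF\<^esub> inv\<^bsub>FF\<^esub> ?\<omega>) \<otimes>\<^bsub>FF\<^esub> ?\<omega> \<in> add_span FF (triple_terms T D)"
    proof (rule F.add_span_mult_right[OF cox_terms_carrier[OF cd GF] nonzeroD(1)[OF \<omega>] _ TR z])
      fix t assume "t \<in> cox_terms L \<chi> G (- lam ?\<mu>)"
      then obtain c E \<nu> where t: "t = const_rational \<V> c \<otimes>\<^bsub>FF\<^esub> (\<chi> E \<otimes>\<^bsub>FF\<^esub> F.mprod (image_mset snd \<nu>))"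
        "set_mset \<nu> \<subseteq> G" "E \<in> principal_part \<V> L" "sum_mset (image_mset fst \<nu>) = - lam ?\<mu> + E"
        unfolding cox_terms_def[OF cd] by blast
      let ?\<nu> = "image_mset (\<lambda>(D, f). (D, 0 :: 'a divisor, f)) \<nu>"
      have \<nu>: "image_mset fst ?\<nu> = image_mset fst \<nu>" "image_mset (\<lambda>t. snd (snd t)) ?\<nu> = image_mset snd \<nu>"
        by (simp_all add: multiset.map_comp comp_def split_beta)
      have "image_mset (\<lambda>t. fst (snd t)) ?\<nu> = image_mset (\<lambda>_. 0) \<nu>"
        by (simp add: multiset.map_comp comp_def split_beta)
      then have d0: "del ?\<nu> = 0" by simp
      have \<nu>T: "set_mset ?\<nu> \<subseteq> T" using t(2) unfolding T_def by auto
      have lE: "lam (?\<nu> + ?\<mu>) = E" unfolding image_mset_union sum_mset.union \<nu>(1) t(4) by simp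
      have cl: "\<chi> E \<in> carrier FF" "val ?\<nu> \<in> carrier FF" "?\<omega> \<in> carrier FF" "const_rational \<V> c \<in> carrier FF"
        using C.\<chi>_closed[OF t(3)] nonzeroD(1)[OF val_nonzero[OF Tnz \<nu>T]] nonzeroD(1)[OF \<omega>] const_carrier by auto
      have "t \<otimes>\<^bsub>FF\<^esub> ?\<omega> = const_rational \<V> c \<otimes>\<^bsub>FF\<^esub> (\<chi> E \<otimes>\<^bsub>FF\<^esub> (val ?\<nu> \<otimes>\<^bsub>FF\<^esub> ?\<omega>))"
        unfolding t(1) \<nu>(2)[symmetric] using cl by (simp only: F.m_assoc F.m_closed)
      also have "\<dots> = const_rational \<V> c \<otimes>\<^bsub>FF\<^esub> (\<chi> (lam (?\<nu> + ?\<mu>)) \<otimes>\<^bsub>FF\<^esub> val (?\<nu> + ?\<mu>))"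
        unfolding lE using val_union[of T ?\<nu> ?\<mu>] Tnz \<nu>T \<mu>T by metis
      also have "\<dots> \<in> triple_terms T D"
        unfolding triple_terms_def
      proof (intro CollectI exI conjI)
        show "set_mset (?\<nu> + ?\<mu>) \<subseteq> T" using \<nu>T \<mu>T by auto
        show "lam (?\<nu> + ?\<mu>) \<in> principal_part \<V> L" unfolding lE by (rule t(3))
        show "del (?\<nu> + ?\<mu>) = D" using d0 \<mu>D by simp
      qed (rule refl)
      finally show "t \<otimes>\<^bsub>FF\<^esub> ?\<omega> \<in> add_span FF (triple_terms T D)" by (rule F.add_span_incl[OF TR])
    qed
    then show "\<phi> \<in> add_span FF (triple_terms T D)"
      using F.mult_inv_cancel(1)[OF nonzeroD[OF \<omega>] nonzeroD(1)[OF \<phi>nz]] by simp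
  qed
qed

end

text \<open>Over the empty set the algebra is the zero ring, whose unit differs from that of
  \<open>big K\<close>; it is therefore not one of the subrings treated above.\<close>

lemma divisorial_algebra_empty_fin_gen:
  "fin_gen_algebra (divisorial_algebra \<V> K {}) (divisorial_const \<V> K {})"
proof -
  let ?R = "divisorial_algebra \<V> K {}"
  define z where "z = (\<lambda>D\<in>K. \<zero>\<^bsub>FF\<^esub>)"
  have hz: "single FF K D \<zero>\<^bsub>FF\<^esub> = z" for D by (auto simp: single_def z_def)
  have car: "carrier ?R = {z}"
    unfolding divisorial_carrier graded_sections_def z_def
    by (auto simp: sec_iff group_algebra_def PiE_iff intro!: extensionalityI)
  have "\<one>\<^bsub>?R\<^esub> = z" "\<zero>\<^bsub>?R\<^esub> = z"
    by (simp_all add: divisorial_algebra_def Let_def homogeneous_single hz)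
  moreover have "z \<oplus>\<^bsub>?R\<^esub> z = z" "z \<otimes>\<^bsub>?R\<^esub> z = z"
    unfolding z_def by (auto simp: divisorial_algebra_def Let_def intro!: restrict_ext)
  ultimately have ops: "\<one>\<^bsub>?R\<^esub> = z" "\<zero>\<^bsub>?R\<^esub> = z" "z \<oplus>\<^bsub>?R\<^esub> z = z" "z \<otimes>\<^bsub>?R\<^esub> z = z" by auto
  have minus: "\<ominus>\<^bsub>?R\<^esub> z = z"
    unfolding a_inv_def m_inv_def by (rule the_equality) (use car ops in auto)
  have const: "divisorial_const \<V> K {} c = z" for c by (simp add: divisorial_const_def homogeneous_single hz)
  have "s = z" if "s \<in> generate_ring ?R (range (divisorial_const \<V> K {}) \<union> {})" for s
    using that by induction (auto simp: ops minus const)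
  moreover have "z \<in> generate_ring ?R (range (divisorial_const \<V> K {}) \<union> {})"
    using generate_ring.one[of ?R] ops(1) by metis
  ultimately have "generate_ring ?R (range (divisorial_const \<V> K {}) \<union> {}) = carrier ?R" unfolding car by blast
  then show ?thesis unfolding fin_gen_algebra_def by (intro exI[of _ "{}"]) auto
qed

end

theorem theorem1p2:
  fixes \<V> :: "('a, 'k::{alg_closed_field, field_char_0}) function_space"
    and K :: "'a divisor set" and U :: "'a set"
  assumes "normal_variety \<V>" and "has_fin_gen_cox_ring \<V>"
    and "subgroup K (WDiv \<V>)" and "fin_gen_subgroup (WDiv \<V>) K"
    and "openin (top_of \<V>) U"
  shows "fin_gen_algebra (divisorial_algebra \<V> K U) (divisorial_const \<V> K U)"
proof -
  interpret normal_variety \<V> by fact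
  obtain L \<chi> where cd: "cox_data \<V> L \<chi>" "fin_gen_algebra (cox_ring \<V> L \<chi>) (cox_const \<V> L \<chi>)"
    using assms(2) unfolding has_fin_gen_cox_ring_def by blast
  show ?thesis
  proof (cases "U = {}")
    case True
    then show ?thesis using divisorial_algebra_empty_fin_gen by simp
  next
    case False
    then show ?thesis using divisorial_algebra_fin_gen[OF cd assms(3-5)] by blast
  qed
qed

end
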